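(* For any $N$-tuple of spins $\boldsymbol{\bar\jmath}=(j_1,\dots,j_N)$, any $v_i\in\mathbb C^*$ ($1\le i\le N$), any $j\in\frac12\mathbb N_+$, any $\bar\varepsilon_\pm\in\mathbb C$ and $k_\pm\in\mathbb C^*$, assuming $\bar k_\pm=0$, we have $$\big[\tilde{\boldsymbol t}^{j,\boldsymbol{\bar\jmath}}(u),\ \bar\varepsilon_+\mathcal W_0^{(N)}+\bar\varepsilon_-\mathcal W_1^{(N)}\big]=0.$$
   Context: **Conventions.** $q\in\mathbb C^*$ is not a root of unity, spins lie in $\frac12\mathbb N_+$, $[n]_q=\frac{q^n-q^{-n}}{q-q^{-1}}$, $c(u)=u-u^{-1}$, $X_1=X\otimes\mathbb I$, $X_2=\mathbb I\otimes X$. Boundary parameters: $k_\pm\in\mathbb C^*$, $\varepsilon_\pm,\bar\varepsilon_\pm,\bar k_\pm\in\mathbb C$. **Fusion.** $B_{j,j'}=\sqrt{[j+j']_q[j-j'+1]_q}$; spin-$j$ matrices $(S_+)_{mn}=B_{j,j+1-m}\delta_{m,n-1}$, $(S_-)_{mn}=B_{j,j+1-n}\delta_{m-1,n}$, $(S_3)_{mn}=2(j+1-n)\delta_{mn}$. $\mathcal E^{(j)}:\mathbb C^{2j+1}\to\mathbb C^2\otimes\mathbb C^{2j}$ has nonzero entries $\mathcal E_{1,1}=1$, $\mathcal E_{1+n,1+n}=\prod_{p=0}^{n-1}\frac{B_{j-1/2,j-p-1/2}}{B_{j,j-p}}$ ($1\le n\le2j-1$), $\mathcal E_{2j+m,1+m}=[m]_q\mathcal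 E_{m,m}/B_{j,j+1-m}$ ($1\le m\le2j$). $\mathcal F^{(j)}:\mathbb C^2\otimes\mathbb C^{2j}\to\mathbb C^{2j+1}$ has nonzero entries $\mathcal F_{1,1}=1$, $\mathcal F_{n,n+2j-1}=\frac{\mathcal E_{n+2j-1,n}}{\mathcal E_{n,n}^2+\mathcal E_{n+2j-1,n}^2}$, $\mathcal F_{n,n}=\frac{1-\mathcal F_{n,n+2j-1}\mathcal E_{n+2j-1,n}}{\mathcal E_{n,n}}$ ($2\le n\le2j$), $\mathcal F_{2j+1,4j}=\mathcal E_{4j,2j+1}^{-1}$. **R-matrices.** $R^{(\frac12,0)}=\mathbb I_2$, $R^{(0,j)}=\mathbb I$, $R^{(\frac12,j)}(u)=\prod_{k=0}^{2j-2}c(uq^{j-\frac12-k})\Big((q-q^{-1})(\sigma_+\otimes S_-+\sigma_-\otimes S_+)+uq^{\frac12(\mathbb I+\sigma_z\otimes S_3)}-u^{-1}q^{-\frac12(\mathbb I+\sigma_z\otimes S_3)}\Big)$, $R^{(j_1,j_2)}(u)=\mathcal F^{(j_1)}_{\langle12\rangle}R_{13}^{(\frac12,j_2)}(uq^{-j_1+\frac12})R_{23}^{(j_1-\frac12,j_2)}(uq^{\frac12})\mathcal E^{(j_1)}_{\langle12\rangle}$; normalized: $\tilde R^{(j_1,j_2)}(u)=\Big(\prod_{k=0}^{2j_1-1}\prod_{\ell=0}^{2j_2-1}c(uq^{j_1+j_2-k-\ell})\Big)^{-1}R^{(j_1,j_2)}(u)$. **K-matrices.** $K^{(0)}=1$,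 $K^{(\frac12)}(u)=\begin{pmatrix}u\varepsilon_++u^{-1}\varepsilon_-&k_+c(u^2)/(q-q^{-1})\\k_-c(u^2)/(q-q^{-1})&u\varepsilon_-+u^{-1}\varepsilon_+\end{pmatrix}$, $K^{(j)}(u)=\mathcal F^{(j)}K_1^{(\frac12)}(uq^{-j+\frac12})R^{(\frac12,j-\frac12)}(u^2q^{-j+1})K_2^{(j-\frac12)}(uq^{\frac12})\mathcal E^{(j)}$; $\tilde K^{(j)}(u)=\Big(\prod_{\ell=0}^{2j-2}c(u^2q^{1-\ell})\Big)^{-1}K^{(j)}(u)$; $\tilde K^{+(j)}(u)=\big(\tilde K^{(j)}(u^{-1}q^{-1})\big)^t$ with $\varepsilon_\pm\to\bar\varepsilon_\mp$, $k_\pm\to-\bar k_\mp$. **Normalized transfer matrix.** $\tilde{\boldsymbol t}^{j,\boldsymbol{\bar\jmath}}(u)=\mathrm{tr}_{\mathbb C^{2j+1}}\big(\tilde K_a^{+(j)}(u)\tilde R_{Na}^{(j_N,j)}(uv_N)\cdots\tilde R_{1a}^{(j_1,j)}(uv_1)\tilde K_a^{(j)}(u)\tilde R_{1a}^{(j_1,j)}(uv_1^{-1})\cdots\tilde R_{Na}^{(j_N,j)}(uv_N^{-1})\big)$, trace over the auxiliary space $a$; it acts on $\mathbb C^{2j_N+1}\otimes\dots\otimes\mathbb C^{2j_1+1}$. **The two operators.** $\mathcal W_0^{(0)}=\varepsilon_+$, $\mathcal W_1^{(0)}=\varepsilon_-$ and, with $S_\pm,S_3$ of spin $j_N$ on the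 first factor, $\mathcal W_0^{(N)}=\big(k_+v_Nq^{\frac12}S_+q^{\frac12S_3}+k_-v_N^{-1}q^{-\frac12}S_-q^{\frac12S_3}\big)\otimes\mathbb I^{(N-1)}+q^{S_3}\otimes\mathcal W_0^{(N-1)}$, $\mathcal W_1^{(N)}=\big(k_+v_N^{-1}q^{-\frac12}S_+q^{-\frac12S_3}+k_-v_Nq^{\frac12}S_-q^{-\frac12S_3}\big)\otimes\mathbb I^{(N-1)}+q^{-S_3}\otimes\mathcal W_1^{(N-1)}$. *)

theory Defs
  imports Complex_Main "Jordan_Normal_Form.Matrix"
begin

text \<open>
  Half-integers are doubled: a spin \<open>j\<close> is given by the natural number \<open>J = 2 j\<close>, so that the
  spin-\<open>j\<close> space is \<open>\<complex>\<^bsup>J+1\<^esup>\<close>.  All half-integer powers of \<open>q\<close> are powers of a fixed square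
  root \<open>h\<close> of \<open>q\<close>: \<open>q\<^bsup>n/2\<^esup> = h powi n\<close>.  The definitions take \<open>h\<close> as their argument and
  \<open>q\<close> is \<open>h\<^sup>2\<close>.
\<close>

section \<open>Tensor products and traces\<close>

definition kron :: "'a::times mat \<Rightarrow> 'a mat \<Rightarrow> 'a mat" (infixr "\<otimes>\<^sub>m" 73) where
  "A \<otimes>\<^sub>m B = mat (dim_row A * dim_row B) (dim_col A * dim_col B)
     (\<lambda>(i, k). A $$ (i div dim_row B, k div dim_col B) * B $$ (i mod dim_row B, k mod dim_col B))"

text \<open>
  The standard basis of \<open>\<complex>\<^bsup>ds!0\<^esup> \<otimes> \<dots> \<otimes> \<complex>\<^bsup>ds!(n-1)\<^esup>\<close> is ordered as in the Kronecker product, i.e. the index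
  is the mixed-radix number whose digits (most significant first) are the indices in the factors.
\<close>

definition digit :: "nat list \<Rightarrow> nat \<Rightarrow> nat \<Rightarrow> nat" where
  "digit ds p r = (r div prod_list (drop (Suc p) ds)) mod (ds ! p)"

text \<open>
  The operator on \<open>\<complex>\<^bsup>ds!0\<^esup> \<otimes> \<dots> \<otimes> \<complex>\<^bsup>ds!(n-1)\<^esup>\<close> acting as \<open>A\<close> on the factors number \<open>p\<close> and \<open>p'\<close>
  (first tensor leg of \<open>A\<close> on \<open>p\<close>, second on \<open>p'\<close>; factors are counted from \<open>0\<close>) and as the
  identity on the others.
\<close>

definition on_legs :: "nat list \<Rightarrow> nat \<Rightarrow> nat \<Rightarrow> 'a::zero mat \<Rightarrow> 'a mat" where
  "on_legs ds p p' A = mat (prod_list ds) (prod_list ds)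
     (\<lambda>(r, s). if \<forall>k<length ds. k \<noteq> p \<and> k \<noteq> p' \<longrightarrow> digit ds k r = digit ds k s
        then A $$ (digit ds p r * ds ! p' + digit ds p' r, digit ds p s * ds ! p' + digit ds p' s)
        else 0)"

text \<open>Partial trace over the last tensor factor, which has dimension \<open>d\<close>.\<close>

definition ptrace_last :: "nat \<Rightarrow> 'a::comm_monoid_add mat \<Rightarrow> 'a mat" where
  "ptrace_last d A = mat (dim_row A div d) (dim_col A div d)
     (\<lambda>(r, s). \<Sum>k<d. A $$ (r * d + k, s * d + k))"

text \<open>Matrix given by a formula in the indices counted from \<open>1\<close>.\<close>

definition mat1 :: "nat \<Rightarrow> nat \<Rightarrow> (nat \<Rightarrow> nat \<Rightarrow> 'a) \<Rightarrow> 'a mat" where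
  "mat1 nr nc f = mat nr nc (\<lambda>(i, k). f (i + 1) (k + 1))"

text \<open>\<open>q\<^bsup>D/2\<^esup>\<close> for a diagonal integer matrix \<open>D\<close>.\<close>

definition qhalf :: "complex \<Rightarrow> int mat \<Rightarrow> complex mat" where
  "qhalf h D = mat_diag (dim_row D) (\<lambda>i. h powi (D $$ (i, i)))"

section \<open>Spin representations and fusion\<close>

definition c_fun :: "complex \<Rightarrow> complex" where
  "c_fun u = u - inverse u"

definition qnum :: "complex \<Rightarrow> int \<Rightarrow> complex" where
  "qnum h n = (h powi (2 * n) - h powi (- 2 * n)) / (h powi 2 - h powi (- 2))"

text \<open>\<open>B\<^bsub>j,j'\<^esub>\<close> with \<open>J = 2 j\<close>, \<open>J' = 2 j'\<close>; it is only used for \<open>J + J'\<close> even.\<close>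

definition B_coef :: "complex \<Rightarrow> int \<Rightarrow> int \<Rightarrow> complex" where
  "B_coef h J J' = csqrt (qnum h ((J + J') div 2) * qnum h ((J - J') div 2 + 1))"

definition S_plus :: "complex \<Rightarrow> nat \<Rightarrow> complex mat" where
  "S_plus h J = mat1 (J + 1) (J + 1)
     (\<lambda>m n. if m + 1 = n then B_coef h (int J) (int J + 2 - 2 * int m) else 0)"

definition S_minus :: "complex \<Rightarrow> nat \<Rightarrow> complex mat" where
  "S_minus h J = mat1 (J + 1) (J + 1)
     (\<lambda>m n. if m = n + 1 then B_coef h (int J) (int J + 2 - 2 * int n) else 0)"

definition S_3 :: "nat \<Rightarrow> int mat" where
  "S_3 J = mat1 (J + 1) (J + 1) (\<lambda>m n. if m = n then int J + 2 - 2 * int n else 0)"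

definition sigma_plus :: "complex mat" where
  "sigma_plus = mat_of_rows_list 2 [[0, 1], [0, 0]]"

definition sigma_minus :: "complex mat" where
  "sigma_minus = mat_of_rows_list 2 [[0, 0], [1, 0]]"

definition sigma_z :: "int mat" where
  "sigma_z = mat_of_rows_list 2 [[1, 0], [0, - 1]]"

text \<open>
  The entry \<open>\<E>\<^bsub>1+n,1+n\<^esub>\<close> (\<open>0 \<le> n \<le> J - 1\<close>); the empty product is \<open>\<E>\<^bsub>1,1\<^esub> = 1\<close>.
\<close>

definition E_diag :: "complex \<Rightarrow> nat \<Rightarrow> nat \<Rightarrow> complex" where
  "E_diag h J n = (\<Prod>p<n. B_coef h (int J - 1) (int J - 2 * int p - 1) / B_coef h (int J) (int J - 2 * int p))"

text \<open>
  Entries of \<open>\<E>\<close> and \<open>\<F>\<close>, indices counted from \<open>1\<close>.  The second case of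
  \<open>E_entry\<close> is \<open>\<E>\<^bsub>J+m,1+m\<^esub>\<close> with \<open>m = r - J\<close>.
\<close>

definition E_entry :: "complex \<Rightarrow> nat \<Rightarrow> nat \<Rightarrow> nat \<Rightarrow> complex" where
  "E_entry h J r s =
     (if 1 \<le> r \<and> r \<le> J \<and> s = r then E_diag h J (r - 1)
      else if J < r \<and> r \<le> 2 * J \<and> s = r - J + 1 then
        qnum h (int (r - J)) * E_diag h J (r - J - 1) / B_coef h (int J) (int J + 2 - 2 * int (r - J))
      else 0)"

definition E_mat :: "complex \<Rightarrow> nat \<Rightarrow> complex mat" where
  "E_mat h J = mat1 (2 * J) (J + 1) (E_entry h J)"

definition F_off :: "complex \<Rightarrow> nat \<Rightarrow> nat \<Rightarrow> complex" where
  "F_off h J n = E_entry h J (n + J - 1) n / ((E_entry h J n n)\<^sup>2 + (E_entry h J (n + J - 1) n)\<^sup>2)"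

definition F_entry :: "complex \<Rightarrow> nat \<Rightarrow> nat \<Rightarrow> nat \<Rightarrow> complex" where
  "F_entry h J n s =
     (if n = 1 \<and> s = 1 then 1
      else if 2 \<le> n \<and> n \<le> J \<and> s = n + J - 1 then F_off h J n
      else if 2 \<le> n \<and> n \<le> J \<and> s = n then
        (1 - F_off h J n * E_entry h J (n + J - 1) n) / E_entry h J n n
      else if n = J + 1 \<and> s = 2 * J then inverse (E_entry h J (2 * J) (J + 1))
      else 0)"

definition F_mat :: "complex \<Rightarrow> nat \<Rightarrow> complex mat" where
  "F_mat h J = mat1 (J + 1) (2 * J) (F_entry h J)"

section \<open>R-matrices\<close>

definition R_half :: "complex \<Rightarrow> nat \<Rightarrow> complex \<Rightarrow> complex mat" where
  "R_half h J u =
     (if J = 0 then 1\<^sub>m 2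
      else (\<Prod>k<J - 1. c_fun (u * h powi (int J - 1 - 2 * int k))) \<cdot>\<^sub>m
        ((h powi 2 - h powi (- 2)) \<cdot>\<^sub>m (sigma_plus \<otimes>\<^sub>m S_minus h J + sigma_minus \<otimes>\<^sub>m S_plus h J)
         + u \<cdot>\<^sub>m qhalf h (1\<^sub>m (2 * (J + 1)) + sigma_z \<otimes>\<^sub>m S_3 J)
         - inverse u \<cdot>\<^sub>m qhalf h (- (1\<^sub>m (2 * (J + 1)) + sigma_z \<otimes>\<^sub>m S_3 J))))"

text \<open>
  \<open>R_mat h J1 J2 u\<close> is \<open>R\<^bsup>(j1,j2)\<^esup>(u)\<close>.  In the recursive case \<open>J1 = n + 2\<close>, and the intermediate
  operators act on \<open>\<complex>\<^sup>2 \<otimes> \<complex>\<^bsup>J1\<^esup> \<otimes> \<complex>\<^bsup>J2+1\<^esup>\<close>.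
\<close>

fun R_mat :: "complex \<Rightarrow> nat \<Rightarrow> nat \<Rightarrow> complex \<Rightarrow> complex mat" where
  "R_mat h 0 J2 u = 1\<^sub>m (J2 + 1)"
| "R_mat h (Suc 0) J2 u = R_half h J2 u"
| "R_mat h (Suc (Suc n)) J2 u =
     (F_mat h (n + 2) \<otimes>\<^sub>m 1\<^sub>m (J2 + 1))
     * on_legs [2, n + 2, J2 + 1] 0 2 (R_half h J2 (u * h powi (1 - int (n + 2))))
     * (1\<^sub>m 2 \<otimes>\<^sub>m R_mat h (Suc n) J2 (u * h))
     * (E_mat h (n + 2) \<otimes>\<^sub>m 1\<^sub>m (J2 + 1))"

text \<open>
  The normalized matrices are rational functions of the spectral parameter.  They carry their
  mathematical meaning where the normalizing product does not vanish; at its zeros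
  the convention \<open>inverse 0 = 0\<close> applies.
\<close>

definition R_norm :: "complex \<Rightarrow> nat \<Rightarrow> nat \<Rightarrow> complex \<Rightarrow> complex mat" where
  "R_norm h J1 J2 u =
     inverse (\<Prod>k<J1. \<Prod>l<J2. c_fun (u * h powi (int J1 + int J2 - 2 * int k - 2 * int l)))
     \<cdot>\<^sub>m R_mat h J1 J2 u"

section \<open>K-matrices\<close>

text \<open>The arguments after \<open>h\<close> are \<open>\<epsilon>\<^sub>+, \<epsilon>\<^sub>-, k\<^sub>+, k\<^sub>-\<close>, the doubled spin and \<open>u\<close>.\<close>

definition K_half ::
  "complex \<Rightarrow> complex \<Rightarrow> complex \<Rightarrow> complex \<Rightarrow> complex \<Rightarrow> complex \<Rightarrow> complex mat" where
  "K_half h ep em kp km u = mat_of_rows_list 2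
     [[u * ep + inverse u * em, kp * c_fun (u\<^sup>2) / (h powi 2 - h powi (- 2))],
      [km * c_fun (u\<^sup>2) / (h powi 2 - h powi (- 2)), u * em + inverse u * ep]]"

fun K_mat ::
  "complex \<Rightarrow> complex \<Rightarrow> complex \<Rightarrow> complex \<Rightarrow> complex \<Rightarrow> nat \<Rightarrow> complex \<Rightarrow> complex mat" where
  "K_mat h ep em kp km 0 u = 1\<^sub>m 1"
| "K_mat h ep em kp km (Suc 0) u = K_half h ep em kp km u"
| "K_mat h ep em kp km (Suc (Suc n)) u =
     F_mat h (n + 2)
     * (K_half h ep em kp km (u * h powi (1 - int (n + 2))) \<otimes>\<^sub>m 1\<^sub>m (n + 2))
     * R_mat h 1 (n + 1) (u\<^sup>2 * h powi (2 - int (n + 2)))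
     * (1\<^sub>m 2 \<otimes>\<^sub>m K_mat h ep em kp km (Suc n) (u * h))
     * E_mat h (n + 2)"

definition K_norm ::
  "complex \<Rightarrow> complex \<Rightarrow> complex \<Rightarrow> complex \<Rightarrow> complex \<Rightarrow> nat \<Rightarrow> complex \<Rightarrow> complex mat" where
  "K_norm h ep em kp km J u =
     inverse (\<Prod>l<J - 1. c_fun (u\<^sup>2 * h powi (2 - 2 * int l))) \<cdot>\<^sub>m K_mat h ep em kp km J u"

text \<open>Here the parameters are the barred ones \<open>\<epsilon>\<^sub>+, \<epsilon>\<^sub>-, k\<^sub>+, k\<^sub>-\<close>, in this order.\<close>

definition K_plus_norm ::
  "complex \<Rightarrow> complex \<Rightarrow> complex \<Rightarrow> complex \<Rightarrow> complex \<Rightarrow> nat \<Rightarrow> complex \<Rightarrow> complex mat" where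
  "K_plus_norm h bep bem bkp bkm J u =
     transpose_mat (K_norm h bem bep (- bkm) (- bkp) J (inverse u * h powi (- 2)))"

section \<open>Transfer matrix\<close>

text \<open>
  \<open>Js i\<close> and \<open>v i\<close> (\<open>1 \<le> i \<le> N\<close>) are the doubled spins and inhomogeneities.  The quantum space is
  \<open>V\<^sub>N \<otimes> \<dots> \<otimes> V\<^sub>1\<close>; the auxiliary space \<open>a\<close> is appended as the last factor, so that \<open>V\<^sub>i\<close> is the
  factor number \<open>N - i\<close> and \<open>a\<close> the factor number \<open>N\<close>.
\<close>

definition qdim :: "nat \<Rightarrow> (nat \<Rightarrow> nat) \<Rightarrow> nat" where
  "qdim N Js = (\<Prod>i\<in>{1..N}. Js i + 1)"

definition R_site ::
  "complex \<Rightarrow> nat \<Rightarrow> (nat \<Rightarrow> nat) \<Rightarrow> nat \<Rightarrow> complex \<Rightarrow> nat \<Rightarrow> complex mat" where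
  "R_site h N Js J w i =
     on_legs (map (\<lambda>l. Js l + 1) (rev [1..<N + 1]) @ [J + 1]) (N - i) N (R_norm h (Js i) J w)"

definition mat_prod :: "nat \<Rightarrow> complex mat list \<Rightarrow> complex mat" where
  "mat_prod n As = foldr (*) As (1\<^sub>m n)"

definition t_norm ::
  "complex \<Rightarrow> complex \<Rightarrow> complex \<Rightarrow> complex \<Rightarrow> complex \<Rightarrow> complex \<Rightarrow> complex \<Rightarrow> complex \<Rightarrow> complex
   \<Rightarrow> nat \<Rightarrow> (nat \<Rightarrow> nat) \<Rightarrow> (nat \<Rightarrow> complex) \<Rightarrow> nat \<Rightarrow> complex \<Rightarrow> complex mat" where
  "t_norm h ep em kp km bep bem bkp bkm N Js v J u =
     ptrace_last (J + 1)
       ((1\<^sub>m (qdim N Js) \<otimes>\<^sub>m K_plus_norm h bep bem bkp bkm J u)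
        * mat_prod (qdim N Js * (J + 1))
            (map (\<lambda>i. R_site h N Js J (u * v i) i) (rev [1..<N + 1]))
        * (1\<^sub>m (qdim N Js) \<otimes>\<^sub>m K_norm h ep em kp km J u)
        * mat_prod (qdim N Js * (J + 1))
            (map (\<lambda>i. R_site h N Js J (u * inverse (v i)) i) [1..<N + 1]))"

section \<open>The two operators\<close>

fun W0 ::
  "complex \<Rightarrow> complex \<Rightarrow> complex \<Rightarrow> complex \<Rightarrow> (nat \<Rightarrow> nat) \<Rightarrow> (nat \<Rightarrow> complex) \<Rightarrow> nat \<Rightarrow> complex mat"
where
  "W0 h ep kp km Js v 0 = ep \<cdot>\<^sub>m 1\<^sub>m 1"
| "W0 h ep kp km Js v (Suc n) =
     (let J = Js (Suc n); w = v (Suc n) in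
       ((kp * w * h) \<cdot>\<^sub>m (S_plus h J * qhalf h (S_3 J))
        + (km * inverse w * inverse h) \<cdot>\<^sub>m (S_minus h J * qhalf h (S_3 J))) \<otimes>\<^sub>m 1\<^sub>m (qdim n Js)
       + qhalf h (2 \<cdot>\<^sub>m S_3 J) \<otimes>\<^sub>m W0 h ep kp km Js v n)"

fun W1 ::
  "complex \<Rightarrow> complex \<Rightarrow> complex \<Rightarrow> complex \<Rightarrow> (nat \<Rightarrow> nat) \<Rightarrow> (nat \<Rightarrow> complex) \<Rightarrow> nat \<Rightarrow> complex mat"
where
  "W1 h em kp km Js v 0 = em \<cdot>\<^sub>m 1\<^sub>m 1"
| "W1 h em kp km Js v (Suc n) =
     (let J = Js (Suc n); w = v (Suc n) in
       ((kp * inverse w * inverse h) \<cdot>\<^sub>m (S_plus h J * qhalf h (- S_3 J))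
        + (km * w * h) \<cdot>\<^sub>m (S_minus h J * qhalf h (- S_3 J))) \<otimes>\<^sub>m 1\<^sub>m (qdim n Js)
       + qhalf h (- (2 \<cdot>\<^sub>m S_3 J)) \<otimes>\<^sub>m W1 h em kp km Js v n)"

end

theory Submission
  imports Defs "HOL-Computational_Algebra.Polynomial"
begin

text \<open>
  The operators \<open>W\<^sub>0\<close> and \<open>W\<^sub>1\<close> represent two generators of a coideal subalgebra: extending the chain by
  one site, or by the auxiliary space, adds an off-diagonal operator on the new factor and
  multiplies the old part by the group-like element \<open>g = q\<^bsup>S\<^sub>3\<^esup>\<close>.  The off-diagonal operator, called
  \<open>current\<close> and written \<open>x(u)\<close> here, depends on the spectral parameter \<open>u\<close> of the new factor.  The operator
  \<open>W\<^sub>1\<close> is obtained from \<open>W\<^sub>0\<close> by inverting \<open>h\<close> and the spectral parameters (\<open>W1_eq\<close>), which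
  changes the R-matrix with a spin-\<open>1/2\<close> factor by a sign only and the K-matrix of spin \<open>1/2\<close> not at all
  once \<open>\<epsilon>\<^sub>+\<close> and \<open>\<epsilon>\<^sub>-\<close> are exchanged (\<open>R_core_inverse\<close>, \<open>K_half_inverse\<close>).  So every relation for
  the first generator yields one for the second.

  Two relations carry the proof.  The R-matrix exchanges the coproduct
  \<open>x(u a) \<otimes> 1 + g \<otimes> x(a)\<close> with the opposite coproduct (\<open>exchange_R_mat\<close>), and the K-matrix
  satisfies \<open>K(u) (x(u) + \<epsilon>\<^sub>+ g) = (x(u\<^sup>-\<^sup>1) + \<epsilon>\<^sub>+ g) K(u)\<close> (\<open>reflect_K_mat\<close>).  By induction on the
  number of sites, the product \<open>S\<close> of all factors of the transfer matrix except \<open>K\<^sup>+\<close> satisfies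
  \<open>S (1 \<otimes> x(u) + W\<^sub>0 \<otimes> g) = (1 \<otimes> x(u\<^sup>-\<^sup>1) + W\<^sub>0 \<otimes> g) S\<close> (\<open>intertwines_dress\<close>).  For vanishing
  off-diagonal parameters the matrix \<open>D = K\<^sup>+\<close> is diagonal, so it commutes with \<open>g\<close>, and cyclicity of the
  trace gives
  \<open>[t, W\<^sub>0] = tr\<^sub>a ((D g\<^sup>-\<^sup>1 x(u\<^sup>-\<^sup>1) - x(u) D g\<^sup>-\<^sup>1) S)\<close> (\<open>ptrace_last_commutator\<close>).  Neither
  this bracket nor the corresponding one for \<open>W\<^sub>1\<close> needs to vanish, but their combination with
  the coefficients of the theorem does (\<open>boundary_condition\<close>): entry by entry this is a
  two-term recursion for the diagonal of \<open>D\<close>.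

  For spin \<open>1/2\<close> both relations are direct computations.  For higher spin they descend from products of
  matrices of lower spin along the fusion map \<open>E\<close>, which is an intertwiner with left inverse \<open>F\<close>
  (\<open>intertwines_E_mat_coproduct\<close>, \<open>F_mat_E_mat\<close>), provided that these products preserve the image
  of \<open>E\<close>, i.e. that \<open>M(u) = (1 - E F) R\<^sub>1\<^sub>3 R\<^sub>2\<^sub>3 E\<close> and \<open>M(u) = (1 - E F) K\<^sub>1 R K\<^sub>2 E\<close> vanish.  Both
  depend on \<open>u\<close> as Laurent polynomials and intertwine the generators.  The first kills the top vector for
  reasons of weight, and for all but finitely many \<open>u\<close> the lowering operators of the two
  generators generate everything from it (\<open>exchange_fused\<close>).  For the second, weights are not preserved;
  but its leading coefficient in \<open>u\<close> intertwines the irreducible spin-\<open>J/2\<close> representation, which has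
  \<open>J + 1\<close> levels, with operators on only \<open>J - 1\<close> levels, so there is no leading coefficient
  (\<open>reflect_fused\<close>).

  This argument needs nonzero off-diagonal parameters, whereas the recursion for \<open>D\<close> concerns vanishing
  ones.  It is the first-order term of the reflection relations at small off-diagonal
  parameters (\<open>K_mat_zero_recursion\<close>).
\<close>

section \<open>Kronecker products and intertwiners\<close>

lemma sum_lessThan_mult:
  fixes f :: "nat \<Rightarrow> 'a::comm_monoid_add"
  shows "(\<Sum>s<a * b. f s) = (\<Sum>i<a. \<Sum>k<b. f (i * b + k))"
proof -
  have "(\<Sum>s<a * b. f s) = (\<Sum>i<a. sum f {i * b..<i * b + b})"
    by (rule sum.nat_group[symmetric])
  also have "\<dots> = (\<Sum>i<a. \<Sum>k<b. f (i * b + k))"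
  proof (rule sum.cong[OF refl])
    fix i
    show "sum f {i * b..<i * b + b} = (\<Sum>k<b. f (i * b + k))"
      using sum.shift_bounds_nat_ivl[of f 0 "i * b" b]
      by (simp add: add.commute lessThan_atLeast0)
  qed
  finally show ?thesis .
qed

lemma kron_index_less:
  fixes i k a b :: nat
  assumes "i < a" "k < b"
  shows "i * b + k < a * b"
proof -
  have "i * b + k < i * b + b" using assms by simp
  also have "\<dots> = Suc i * b" by simp
  also have "\<dots> \<le> a * b" using assms by (intro mult_le_mono1) simp
  finally show ?thesis .
qed

lemma dim_kron[simp]:
  "dim_row (A \<otimes>\<^sub>m B) = dim_row A * dim_row B"
  "dim_col (A \<otimes>\<^sub>m B) = dim_col A * dim_col B"
  by (auto simp: kron_def)

lemma kron_carrier[intro]: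
  assumes "A \<in> carrier_mat a b" "B \<in> carrier_mat c d"
  shows "A \<otimes>\<^sub>m B \<in> carrier_mat (a * c) (b * d)"
  using assms by auto

lemma index_kron:
  assumes "i < dim_row A" "k < dim_row B" "j < dim_col A" "l < dim_col B"
  shows "(A \<otimes>\<^sub>m B) $$ (i * dim_row B + k, j * dim_col B + l) = A $$ (i, j) * B $$ (k, l)"
  using assms by (auto simp: kron_def kron_index_less)

lemma index_kron':
  assumes "i < dim_row A * dim_row B" "j < dim_col A * dim_col B"
  shows "(A \<otimes>\<^sub>m B) $$ (i, j) =
    A $$ (i div dim_row B, j div dim_col B) * B $$ (i mod dim_row B, j mod dim_col B)"
  using assms by (auto simp: kron_def)

lemma div_mod_less:
  fixes i a b :: nat
  assumes "i < a * b"
  shows "i div b < a" "i mod b < b"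
proof -
  have "b > 0" using assms by (cases b) auto
  then show "i div b < a" "i mod b < b"
    using assms by (auto simp: div_less_iff_less_mult)
qed

lemma kron_mult:
  fixes A B C D :: "'a::comm_semiring_0 mat"
  assumes "dim_col A = dim_row C" "dim_col B = dim_row D"
  shows "(A \<otimes>\<^sub>m B) * (C \<otimes>\<^sub>m D) = (A * C) \<otimes>\<^sub>m (B * D)"
proof (rule eq_matI)
  fix i j
  assume "i < dim_row ((A * C) \<otimes>\<^sub>m (B * D))" "j < dim_col ((A * C) \<otimes>\<^sub>m (B * D))"
  then have ij: "i < dim_row A * dim_row B" "j < dim_col C * dim_col D" by auto
  note lt = div_mod_less[OF ij(1)] div_mod_less[OF ij(2)]
  have "((A \<otimes>\<^sub>m B) * (C \<otimes>\<^sub>m D)) $$ (i, j)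
      = (\<Sum>s<dim_row C * dim_row D. (A \<otimes>\<^sub>m B) $$ (i, s) * (C \<otimes>\<^sub>m D) $$ (s, j))"
    using ij assms by (simp add: scalar_prod_def lessThan_atLeast0)
  also have "\<dots> = (\<Sum>s<dim_row C. \<Sum>t<dim_row D.
      (A $$ (i div dim_row B, s) * C $$ (s, j div dim_col D)) *
      (B $$ (i mod dim_row B, t) * D $$ (t, j mod dim_col D)))"
    unfolding sum_lessThan_mult
  proof (intro sum.cong refl)
    fix s t assume "s \<in> {..<dim_row C}" "t \<in> {..<dim_row D}"
    then have st: "s < dim_row C" "t < dim_row D" by auto
    have st': "(s * dim_row D + t) div dim_row D = s" "(s * dim_row D + t) mod dim_row D = t"
      using st by auto
    have "(A \<otimes>\<^sub>m B) $$ (i, s * dim_row D + t)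
        = A $$ (i div dim_row B, s) * B $$ (i mod dim_row B, t)"
      using ij st st' kron_index_less[OF st] assms by (subst index_kron') auto
    moreover have "(C \<otimes>\<^sub>m D) $$ (s * dim_row D + t, j)
        = C $$ (s, j div dim_col D) * D $$ (t, j mod dim_col D)"
      using ij st st' kron_index_less[OF st] by (subst index_kron') auto
    ultimately show "(A \<otimes>\<^sub>m B) $$ (i, s * dim_row D + t) * (C \<otimes>\<^sub>m D) $$ (s * dim_row D + t, j)
      = (A $$ (i div dim_row B, s) * C $$ (s, j div dim_col D)) *
        (B $$ (i mod dim_row B, t) * D $$ (t, j mod dim_col D))"
      by (simp only: mult_ac)
  qed
  also have "\<dots> = ((A * C) \<otimes>\<^sub>m (B * D)) $$ (i, j)"
    using ij lt assms
    by (simp add: index_kron' scalar_prod_def lessThan_atLeast0 sum_product)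
  finally show "((A \<otimes>\<^sub>m B) * (C \<otimes>\<^sub>m D)) $$ (i, j) = ((A * C) \<otimes>\<^sub>m (B * D)) $$ (i, j)" .
qed auto

lemma div_mod_mult:
  fixes i b c :: nat
  shows "i div (b * c) = i div c div b" "i mod (b * c) div c = i div c mod b"
    "i mod (b * c) mod c = i mod c"
proof -
  show "i div (b * c) = i div c div b" by (metis div_mult2_eq mult.commute)
  show "i mod (b * c) mod c = i mod c" by (simp add: mod_mod_cancel)
  show "i mod (b * c) div c = i div c mod b"
  proof (cases "c = 0")
    case False
    have "i mod (b * c) = c * (i div c mod b) + i mod c"
      by (metis mod_mult2_eq mult.commute)
    then show ?thesis using False by simp
  qed simp
qed

lemma kron_assoc:
  fixes A B C :: "'a::semigroup_mult mat"
  shows "(A \<otimes>\<^sub>m B) \<otimes>\<^sub>m C = A \<otimes>\<^sub>m (B \<otimes>\<^sub>m C)"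
proof (rule eq_matI)
  fix i j
  assume "i < dim_row (A \<otimes>\<^sub>m (B \<otimes>\<^sub>m C))" "j < dim_col (A \<otimes>\<^sub>m (B \<otimes>\<^sub>m C))"
  then have ij': "i < dim_row A * (dim_row B * dim_row C)" "j < dim_col A * (dim_col B * dim_col C)"
    by auto
  then have ij: "i < (dim_row A * dim_row B) * dim_row C" "j < (dim_col A * dim_col B) * dim_col C"
    by (simp_all only: mult.assoc)
  note lt = div_mod_less[OF ij(1)] div_mod_less[OF ij(2)]
  note lt' = div_mod_less[OF ij'(1)] div_mod_less[OF ij'(2)]
  have "((A \<otimes>\<^sub>m B) \<otimes>\<^sub>m C) $$ (i, j)
      = (A \<otimes>\<^sub>m B) $$ (i div dim_row C, j div dim_col C) * C $$ (i mod dim_row C, j mod dim_col C)"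
    using ij by (subst index_kron') auto
  also have "(A \<otimes>\<^sub>m B) $$ (i div dim_row C, j div dim_col C)
      = A $$ (i div dim_row C div dim_row B, j div dim_col C div dim_col B)
        * B $$ (i div dim_row C mod dim_row B, j div dim_col C mod dim_col B)"
    using lt by (subst index_kron') auto
  also have "\<dots> * C $$ (i mod dim_row C, j mod dim_col C) = (A \<otimes>\<^sub>m (B \<otimes>\<^sub>m C)) $$ (i, j)"
    using ij' lt' by (simp add: index_kron' div_mod_mult mult.assoc)
  finally show "((A \<otimes>\<^sub>m B) \<otimes>\<^sub>m C) $$ (i, j) = (A \<otimes>\<^sub>m (B \<otimes>\<^sub>m C)) $$ (i, j)" .
qed (auto simp: mult.assoc)

lemma kron_add_left:
  fixes A B C :: "'a::semiring mat"
  assumes "dim_row A = dim_row B" "dim_col A = dim_col B"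
  shows "(A + B) \<otimes>\<^sub>m C = A \<otimes>\<^sub>m C + B \<otimes>\<^sub>m C"
  using assms by (intro eq_matI) (auto simp: index_kron' div_mod_less distrib_right)

lemma kron_add_right:
  fixes A B C :: "'a::semiring mat"
  assumes "dim_row A = dim_row B" "dim_col A = dim_col B"
  shows "C \<otimes>\<^sub>m (A + B) = C \<otimes>\<^sub>m A + C \<otimes>\<^sub>m B"
  using assms by (intro eq_matI) (auto simp: index_kron' div_mod_less distrib_left)

lemma kron_smult_left:
  fixes A B :: "'a::semigroup_mult mat"
  shows "(c \<cdot>\<^sub>m A) \<otimes>\<^sub>m B = c \<cdot>\<^sub>m (A \<otimes>\<^sub>m B)"
  by (intro eq_matI) (auto simp: index_kron' div_mod_less mult.assoc)

lemma kron_smult_right: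
  fixes A B :: "'a::comm_semiring_0 mat"
  shows "A \<otimes>\<^sub>m (c \<cdot>\<^sub>m B) = c \<cdot>\<^sub>m (A \<otimes>\<^sub>m B)"
  by (intro eq_matI) (auto simp: index_kron' div_mod_less ac_simps)

lemma kron_one[simp]: "1\<^sub>m a \<otimes>\<^sub>m 1\<^sub>m b = (1\<^sub>m (a * b) :: 'a::semiring_1 mat)"
proof (rule eq_matI)
  fix i j assume "i < dim_row (1\<^sub>m (a * b) :: 'a mat)" "j < dim_col (1\<^sub>m (a * b) :: 'a mat)"
  then have ij: "i < a * b" "j < a * b" by auto
  have "i = j \<longleftrightarrow> i div b = j div b \<and> i mod b = j mod b" by (metis div_mult_mod_eq)
  then show "(1\<^sub>m a \<otimes>\<^sub>m 1\<^sub>m b) $$ (i, j) = (1\<^sub>m (a * b) :: 'a mat) $$ (i, j)"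
    using ij div_mod_less[OF ij(1)] div_mod_less[OF ij(2)] by (auto simp: index_kron')
qed auto

lemma kron_one_dim_left[simp]: "1\<^sub>m (Suc 0) \<otimes>\<^sub>m A = (A :: 'a::semiring_1 mat)"
  by (rule eq_matI) (auto simp: index_kron')

text \<open>
  \<open>A\<close> intertwines the square matrices \<open>X\<close> (source) and \<open>Y\<close> (target).  As the dimensions of \<open>X\<close>
  and \<open>Y\<close> are part of the relation, it can be composed without dimension side conditions.
\<close>

definition intertwines :: "'a::semiring_0 mat \<Rightarrow> 'a mat \<Rightarrow> 'a mat \<Rightarrow> bool" where
  "intertwines A X Y \<longleftrightarrow> X \<in> carrier_mat (dim_col A) (dim_col A)
     \<and> Y \<in> carrier_mat (dim_row A) (dim_row A) \<and> A * X = Y * A"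

lemma intertwinesI:
  assumes "A \<in> carrier_mat m n" "X \<in> carrier_mat n n" "Y \<in> carrier_mat m m" "A * X = Y * A"
  shows "intertwines A X Y"
  using assms by (auto simp: intertwines_def)

lemma intertwinesD:
  assumes "intertwines A X Y"
  shows "A * X = Y * A" "X \<in> carrier_mat (dim_col A) (dim_col A)"
    "Y \<in> carrier_mat (dim_row A) (dim_row A)"
  using assms by (auto simp: intertwines_def)

lemma intertwines_comp:
  fixes A B :: "'a::semiring_0 mat"
  assumes "intertwines A X Y" "intertwines B Y Z"
  shows "intertwines (B * A) X Z"
proof -
  note a = intertwinesD[OF assms(1)] and b = intertwinesD[OF assms(2)]
  have d: "dim_col B = dim_row A" using a(3) b(2) by auto
  have A: "A \<in> carrier_mat (dim_row A) (dim_col A)"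
    and B: "B \<in> carrier_mat (dim_row B) (dim_row A)" using d by auto
  have "(B * A) * X = B * (Y * A)" using assoc_mult_mat[OF B A a(2)] a(1) by simp
  also have "\<dots> = (B * Y) * A" using assoc_mult_mat[OF B a(3) A] by simp
  also have "\<dots> = Z * (B * A)" using assoc_mult_mat[OF b(3) B A] b(1) by simp
  finally show ?thesis using a b d by (auto simp: intertwines_def)
qed

lemma intertwines_add:
  fixes A :: "'a::semiring_0 mat"
  assumes "intertwines A X Y" "intertwines A X' Y'"
  shows "intertwines A (X + X') (Y + Y')"
proof -
  note a = intertwinesD[OF assms(1)] and b = intertwinesD[OF assms(2)]
  have A: "A \<in> carrier_mat (dim_row A) (dim_col A)" by auto
  show ?thesis
    using a b mult_add_distrib_mat[OF A a(2) b(2)] add_mult_distrib_mat[OF a(3) b(3) A]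
    by (auto simp: intertwines_def)
qed

lemma intertwines_smult:
  fixes A :: "'a::comm_semiring_0 mat"
  assumes "intertwines A X Y"
  shows "intertwines A (c \<cdot>\<^sub>m X) (c \<cdot>\<^sub>m Y)"
proof -
  note a = intertwinesD[OF assms(1)]
  have A: "A \<in> carrier_mat (dim_row A) (dim_col A)" by auto
  show ?thesis
    using a mult_smult_distrib[OF A a(2)] mult_smult_assoc_mat[OF a(3) A]
    by (auto simp: intertwines_def)
qed

lemma intertwines_smult_left:
  fixes A :: "'a::comm_semiring_0 mat"
  assumes "intertwines A X Y"
  shows "intertwines (c \<cdot>\<^sub>m A) X Y"
proof -
  note a = intertwinesD[OF assms(1)]
  have A: "A \<in> carrier_mat (dim_row A) (dim_col A)" by auto
  show ?thesis
    using a mult_smult_assoc_mat[OF A a(2)] mult_smult_distrib[OF a(3) A]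
    by (auto simp: intertwines_def)
qed

lemma intertwines_kron:
  fixes A B :: "'a::comm_semiring_0 mat"
  assumes "intertwines A X Y" "intertwines B X' Y'"
  shows "intertwines (A \<otimes>\<^sub>m B) (X \<otimes>\<^sub>m X') (Y \<otimes>\<^sub>m Y')"
  using intertwinesD[OF assms(1)] intertwinesD[OF assms(2)]
  by (auto simp: intertwines_def kron_mult)

lemma intertwines_one_left:
  fixes X :: "'a::semiring_1 mat"
  assumes "X \<in> carrier_mat n n"
  shows "intertwines (1\<^sub>m n) X X"
  using assms by (auto simp: intertwines_def)

lemma intertwines_one_right:
  fixes A :: "'a::semiring_1 mat"
  assumes "A \<in> carrier_mat m n"
  shows "intertwines A (1\<^sub>m n) (1\<^sub>m m)"
  using assms by (auto simp: intertwines_def)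

section \<open>Spin representations\<close>

text \<open>The matrix entry of \<open>S_plus\<close> between the \<open>p\<close>-th and the \<open>(p+1)\<close>-st basis vector, counted from \<open>0\<close>.\<close>

definition ladder :: "complex \<Rightarrow> nat \<Rightarrow> nat \<Rightarrow> complex" where
  "ladder h J p = B_coef h (int J) (int J - 2 * int p)"

text \<open>The group-like element \<open>q\<^bsup>S\<^sub>3\<^esup>\<close> in the representation of doubled spin \<open>J\<close>.\<close>

definition cartan :: "complex \<Rightarrow> nat \<Rightarrow> complex mat" where
  "cartan h J = qhalf h (2 \<cdot>\<^sub>m S_3 J)"

text \<open>
  The non-diagonal part of the generator \<open>W\<^sub>0\<close> in the evaluation representation of doubled spin
  \<open>J\<close> with spectral parameter \<open>a\<close>.  The generator \<open>W\<^sub>1\<close> is obtained by replacing \<open>h\<close> and \<open>a\<close> by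
  their inverses.
\<close>

definition current :: "complex \<Rightarrow> complex \<Rightarrow> complex \<Rightarrow> nat \<Rightarrow> complex \<Rightarrow> complex mat" where
  "current h kp km J a =
     (kp * a * h) \<cdot>\<^sub>m (S_plus h J * qhalf h (S_3 J))
     + (km * inverse a * inverse h) \<cdot>\<^sub>m (S_minus h J * qhalf h (S_3 J))"

lemma qnum_eq:
  assumes "h \<noteq> 0" "p \<le> J"
  shows "qnum h (int J - int p) = (h ^ (2 * J) / h ^ (2 * p) - h ^ (2 * p) / h ^ (2 * J)) / (h\<^sup>2 - inverse (h\<^sup>2))"
    "qnum h (int p) = (h ^ (2 * p) - inverse (h ^ (2 * p))) / (h\<^sup>2 - inverse (h\<^sup>2))"
proof -
  have "h powi (2 * (int J - int p)) = h ^ (2 * J) / h ^ (2 * p)"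
    using power_int_diff[of h "int (2 * J)" "int (2 * p)"] assms
    by (simp only: power_int_of_nat) (simp add: right_diff_distrib)
  moreover have "h powi (2 * (int p - int J)) = h ^ (2 * p) / h ^ (2 * J)"
    using power_int_diff[of h "int (2 * p)" "int (2 * J)"] assms
    by (simp only: power_int_of_nat) (simp add: right_diff_distrib)
  moreover have "h powi (- 2) = inverse (h\<^sup>2)" "h powi 2 = h\<^sup>2" by (simp_all add: power_int_minus)
  ultimately show "qnum h (int J - int p) = (h ^ (2 * J) / h ^ (2 * p) - h ^ (2 * p) / h ^ (2 * J)) / (h\<^sup>2 - inverse (h\<^sup>2))"
    by (simp add: qnum_def algebra_simps)
  have "h powi (2 * int p) = h ^ (2 * p)"
    using power_int_of_nat[of h "2 * p"] by simp
  then show "qnum h (int p) = (h ^ (2 * p) - inverse (h ^ (2 * p))) / (h\<^sup>2 - inverse (h\<^sup>2))"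
    using \<open>h powi (- 2) = inverse (h\<^sup>2)\<close> \<open>h powi 2 = h\<^sup>2\<close>
    by (simp add: qnum_def power_int_minus)
qed

lemma ladder_sq: "(ladder h J p)\<^sup>2 = qnum h (int J - int p) * qnum h (int p + 1)"
proof -
  have "(int J + (int J - 2 * int p)) div 2 = int J - int p" by presburger
  moreover have "(int J - (int J - 2 * int p)) div 2 + 1 = int p + 1" by presburger
  ultimately show ?thesis unfolding ladder_def B_coef_def by (simp add: power2_csqrt)
qed

lemma ladder_sq_eq:
  assumes "h \<noteq> 0" "p \<le> J"
  shows "ladder h J p * ladder h J p =
    (((h ^ J)\<^sup>2 / (h ^ p)\<^sup>2 - (h ^ p)\<^sup>2 / (h ^ J)\<^sup>2) / (h\<^sup>2 - inverse (h\<^sup>2)))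
    * ((h\<^sup>2 * (h ^ p)\<^sup>2 - inverse (h\<^sup>2 * (h ^ p)\<^sup>2)) / (h\<^sup>2 - inverse (h\<^sup>2)))"
proof -
  have "qnum h (int p + 1) = qnum h (int (Suc p))" by (simp add: add.commute)
  also have "\<dots> = (h ^ (2 * Suc p) - inverse (h ^ (2 * Suc p))) / (h\<^sup>2 - inverse (h\<^sup>2))"
    by (rule qnum_eq(2)[of h "Suc p" "Suc p"]) (use assms in auto)
  finally have "qnum h (int p + 1) = (h ^ (2 * Suc p) - inverse (h ^ (2 * Suc p))) / (h\<^sup>2 - inverse (h\<^sup>2))" .
  then show ?thesis
    using ladder_sq[of h J p] qnum_eq(1)[OF assms]
    by (simp add: power2_eq_square power_mult mult_ac power_mult_distrib flip: power_mult power_add)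
      (simp add: mult_ac power2_eq_square mult_2 mult_2_right power_add)
qed

lemma powi_weight:
  fixes h :: complex
  assumes "h \<noteq> 0"
  shows "h powi (int J - 2 * int i) = h ^ J / (h ^ i)\<^sup>2"
    "h powi (2 * int J - 4 * int i) = (h ^ J / (h ^ i)\<^sup>2)\<^sup>2"
proof -
  have "h powi (int J - 2 * int i) = h ^ J / h ^ (2 * i)"
    using power_int_diff[of h "int J" "int (2 * i)"] assms
    by (simp only: power_int_of_nat) simp
  then show *: "h powi (int J - 2 * int i) = h ^ J / (h ^ i)\<^sup>2"
    by (simp add: power_mult mult.commute flip: power_mult)
  have "h powi (2 * int J - 4 * int i) = h powi ((int J - 2 * int i) * 2)"
    by (simp add: algebra_simps)
  also have "\<dots> = (h powi (int J - 2 * int i)) powi 2" by (rule power_int_mult)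
  finally show "h powi (2 * int J - 4 * int i) = (h ^ J / (h ^ i)\<^sup>2)\<^sup>2" by (simp add: *)
qed

lemma carrier_spin[simp]:
  "S_plus h J \<in> carrier_mat (Suc J) (Suc J)" "S_minus h J \<in> carrier_mat (Suc J) (Suc J)"
  "S_3 J \<in> carrier_mat (Suc J) (Suc J)"
  "qhalf h (S_3 J) \<in> carrier_mat (Suc J) (Suc J)"
  "cartan h J \<in> carrier_mat (Suc J) (Suc J)"
  "current h kp km J a \<in> carrier_mat (Suc J) (Suc J)"
  by (auto simp: S_plus_def S_minus_def S_3_def mat1_def qhalf_def mat_diag_def cartan_def current_def)

lemma dim_spin[simp]:
  "dim_row (S_plus h J) = Suc J" "dim_col (S_plus h J) = Suc J"
  "dim_row (S_minus h J) = Suc J" "dim_col (S_minus h J) = Suc J"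
  "dim_row (S_3 J) = Suc J" "dim_col (S_3 J) = Suc J"
  "dim_row (qhalf h (S_3 J)) = Suc J" "dim_col (qhalf h (S_3 J)) = Suc J"
  "dim_row (cartan h J) = Suc J" "dim_col (cartan h J) = Suc J"
  "dim_row (current h kp km J a) = Suc J" "dim_col (current h kp km J a) = Suc J"
  by (auto simp: S_plus_def S_minus_def S_3_def mat1_def qhalf_def mat_diag_def cartan_def current_def)

lemma index_S_plus:
  assumes "i \<le> J" "j \<le> J"
  shows "S_plus h J $$ (i, j) = (if j = Suc i then ladder h J i else 0)"
  using assms by (auto simp: S_plus_def mat1_def ladder_def)

lemma index_S_minus:
  assumes "i \<le> J" "j \<le> J"
  shows "S_minus h J $$ (i, j) = (if i = Suc j then ladder h J j else 0)"
  using assms by (auto simp: S_minus_def mat1_def ladder_def)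

lemma index_qhalf_S_3:
  assumes "i \<le> J" "j \<le> J"
  shows "qhalf h (S_3 J) $$ (i, j) = (if i = j then h powi (int J - 2 * int i) else 0)"
  using assms by (auto simp: qhalf_def mat_diag_def S_3_def mat1_def)

lemma index_cartan:
  assumes "i \<le> J" "j \<le> J"
  shows "cartan h J $$ (i, j) = (if i = j then h powi (2 * int J - 4 * int i) else 0)"
  using assms by (auto simp: cartan_def qhalf_def mat_diag_def S_3_def mat1_def)

lemma index_mult_diag_right:
  assumes "D \<in> carrier_mat n n" "\<And>i j. i < n \<Longrightarrow> j < n \<Longrightarrow> i \<noteq> j \<Longrightarrow> D $$ (i, j) = (0::complex)"
    "dim_col A = n" "i < dim_row A" "j < n"
  shows "(A * D) $$ (i, j) = A $$ (i, j) * D $$ (j, j)"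
proof -
  have "(A * D) $$ (i, j) = (\<Sum>s<n. A $$ (i, s) * D $$ (s, j))"
    using assms by (simp add: scalar_prod_def lessThan_atLeast0)
  also have "\<dots> = (\<Sum>s<n. if s = j then A $$ (i, j) * D $$ (j, j) else 0)"
    using assms by (intro sum.cong) auto
  finally show ?thesis using assms by simp
qed

lemma index_mult_diag_left:
  assumes "D \<in> carrier_mat n n" "\<And>i j. i < n \<Longrightarrow> j < n \<Longrightarrow> i \<noteq> j \<Longrightarrow> D $$ (i, j) = (0::complex)"
    "dim_row A = n" "i < n" "j < dim_col A"
  shows "(D * A) $$ (i, j) = D $$ (i, i) * A $$ (i, j)"
proof -
  have "(D * A) $$ (i, j) = (\<Sum>s<n. D $$ (i, s) * A $$ (s, j))"
    using assms by (simp add: scalar_prod_def lessThan_atLeast0)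
  also have "\<dots> = (\<Sum>s<n. if s = i then D $$ (i, i) * A $$ (i, j) else 0)"
    using assms by (intro sum.cong) auto
  finally show ?thesis using assms by simp
qed

lemma index_current:
  assumes "i \<le> J" "j \<le> J"
  shows "current h kp km J a $$ (i, j) =
    (if j = Suc i then kp * a * h * ladder h J i * h powi (int J - 2 * int j)
     else if i = Suc j then km * inverse a * inverse h * ladder h J j * h powi (int J - 2 * int j)
     else 0)"
proof -
  have "(S_plus h J * qhalf h (S_3 J)) $$ (i, j) = S_plus h J $$ (i, j) * qhalf h (S_3 J) $$ (j, j)"
    "(S_minus h J * qhalf h (S_3 J)) $$ (i, j) = S_minus h J $$ (i, j) * qhalf h (S_3 J) $$ (j, j)"
    by (rule index_mult_diag_right[where n = "Suc J"]; use assms in \<open>simp add: index_qhalf_S_3\<close>)+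
  then show ?thesis
    using assms by (auto simp: current_def index_S_plus index_S_minus index_qhalf_S_3)
qed

lemma index_mult_S_plus_left:
  assumes "dim_row A = Suc J" "i \<le> J" "j < dim_col A"
  shows "(S_plus h J * A) $$ (i, j) = (if i < J then ladder h J i * A $$ (Suc i, j) else 0)"
proof -
  have "(S_plus h J * A) $$ (i, j) = (\<Sum>s<Suc J. S_plus h J $$ (i, s) * A $$ (s, j))"
    using assms by (simp add: scalar_prod_def lessThan_atLeast0 del: sum.lessThan_Suc)
  also have "\<dots> = (\<Sum>s<Suc J. if s = Suc i then ladder h J i * A $$ (Suc i, j) else 0)"
    using assms by (intro sum.cong) (auto simp: index_S_plus)
  finally show ?thesis using assms by (simp del: sum.lessThan_Suc)
qed

lemma index_mult_S_plus_right:
  assumes "dim_col A = Suc J" "i < dim_row A" "j \<le> J"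
  shows "(A * S_plus h J) $$ (i, j) = (if 0 < j then A $$ (i, j - 1) * ladder h J (j - 1) else 0)"
proof -
  have "(A * S_plus h J) $$ (i, j) = (\<Sum>s<Suc J. A $$ (i, s) * S_plus h J $$ (s, j))"
    using assms by (simp add: scalar_prod_def lessThan_atLeast0 del: sum.lessThan_Suc)
  also have "\<dots> = (\<Sum>s<Suc J. if s = j - 1 then (if 0 < j then A $$ (i, j - 1) * ladder h J (j - 1) else 0) else 0)"
    using assms by (intro sum.cong) (auto simp: index_S_plus)
  finally show ?thesis using assms by (simp del: sum.lessThan_Suc)
qed

lemma index_mult_S_minus_left:
  assumes "dim_row A = Suc J" "i \<le> J" "j < dim_col A"
  shows "(S_minus h J * A) $$ (i, j) = (if 0 < i then ladder h J (i - 1) * A $$ (i - 1, j) else 0)"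
proof -
  have "(S_minus h J * A) $$ (i, j) = (\<Sum>s<Suc J. S_minus h J $$ (i, s) * A $$ (s, j))"
    using assms by (simp add: scalar_prod_def lessThan_atLeast0 del: sum.lessThan_Suc)
  also have "\<dots> = (\<Sum>s<Suc J. if s = i - 1 then (if 0 < i then ladder h J (i - 1) * A $$ (i - 1, j) else 0) else 0)"
    using assms by (intro sum.cong) (auto simp: index_S_minus)
  finally show ?thesis using assms by (simp del: sum.lessThan_Suc)
qed

lemma index_mult_S_minus_right:
  assumes "dim_col A = Suc J" "i < dim_row A" "j \<le> J"
  shows "(A * S_minus h J) $$ (i, j) = (if j < J then A $$ (i, Suc j) * ladder h J j else 0)"
proof -
  have "(A * S_minus h J) $$ (i, j) = (\<Sum>s<Suc J. A $$ (i, s) * S_minus h J $$ (s, j))"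
    using assms by (simp add: scalar_prod_def lessThan_atLeast0 del: sum.lessThan_Suc)
  also have "\<dots> = (\<Sum>s<Suc J. if s = Suc j then A $$ (i, Suc j) * ladder h J j else 0)"
    using assms by (intro sum.cong) (auto simp: index_S_minus)
  finally show ?thesis using assms by (simp del: sum.lessThan_Suc)
qed

lemma kron_two:
  fixes M A :: "'a::comm_semiring_1 mat"
  assumes "M \<in> carrier_mat 2 2"
  shows "M \<otimes>\<^sub>m A = four_block_mat (M $$ (0, 0) \<cdot>\<^sub>m A) (M $$ (0, 1) \<cdot>\<^sub>m A)
    (M $$ (1, 0) \<cdot>\<^sub>m A) (M $$ (1, 1) \<cdot>\<^sub>m A)"
proof (rule eq_matI)
  fix i j
  assume "i < dim_row (four_block_mat (M $$ (0, 0) \<cdot>\<^sub>m A) (M $$ (0, 1) \<cdot>\<^sub>m A)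
      (M $$ (1, 0) \<cdot>\<^sub>m A) (M $$ (1, 1) \<cdot>\<^sub>m A))"
    "j < dim_col (four_block_mat (M $$ (0, 0) \<cdot>\<^sub>m A) (M $$ (0, 1) \<cdot>\<^sub>m A)
      (M $$ (1, 0) \<cdot>\<^sub>m A) (M $$ (1, 1) \<cdot>\<^sub>m A))"
  then have ij: "i < dim_row A + dim_row A" "j < dim_col A + dim_col A" by auto
  have *: "k div d = (if k < d then 0 else 1) \<and> k mod d = (if k < d then k else k - d)"
    if "k < d + d" for k d :: nat
  proof (cases "k < d")
    case False
    then have "k = d + (k - d)" "k - d < d" using that by auto
    then show ?thesis
      by (metis False Nat.add_0_right add_eq_if div_add_self1 div_less mod_add_self1 mod_less
          not_less_zero One_nat_def)
  qed auto
  show "(M \<otimes>\<^sub>m A) $$ (i, j) = four_block_mat (M $$ (0, 0) \<cdot>\<^sub>m A) (M $$ (0, 1) \<cdot>\<^sub>m A)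
      (M $$ (1, 0) \<cdot>\<^sub>m A) (M $$ (1, 1) \<cdot>\<^sub>m A) $$ (i, j)"
    using ij *[OF ij(1)] *[OF ij(2)] assms by (auto simp: index_kron')
qed (use assms in auto)

section \<open>The R-matrix with one factor of spin 1/2\<close>

lemma index_smult_mult:
  fixes A B :: "'a::comm_semiring_0 mat"
  assumes "dim_col A = dim_row B" "i < dim_row A" "j < dim_col B"
  shows "((c \<cdot>\<^sub>m A) * B) $$ (i, j) = c * (A * B) $$ (i, j)"
    "(A * (c \<cdot>\<^sub>m B)) $$ (i, j) = c * (A * B) $$ (i, j)"
  using assms by (auto simp: scalar_prod_def sum_distrib_left mult_ac)

text \<open>
  The diagonal blocks of \<open>R_half\<close> with respect to its two-dimensional factor, up to the scalar
  prefactor: the upper one for \<open>s = 1\<close> and the lower one for \<open>s = -1\<close>.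
\<close>

definition R_diag :: "complex \<Rightarrow> nat \<Rightarrow> int \<Rightarrow> complex \<Rightarrow> complex mat" where
  "R_diag h J s u = mat (Suc J) (Suc J) (\<lambda>(i, j). if i = j then
     u * h powi (1 + s * (int J - 2 * int i)) - inverse u * h powi (- (1 + s * (int J - 2 * int i))) else 0)"

lemma R_diag_carrier[simp]:
  "R_diag h J s u \<in> carrier_mat (Suc J) (Suc J)" "dim_row (R_diag h J s u) = Suc J"
  "dim_col (R_diag h J s u) = Suc J"
  by (auto simp: R_diag_def)

lemma index_R_diag:
  assumes "h \<noteq> 0" "i \<le> J" "j \<le> J"
  shows "R_diag h J 1 u $$ (i, j) = (if i = j then u * h * (h ^ J / (h ^ i)\<^sup>2)
       - inverse u * inverse h * ((h ^ i)\<^sup>2 / h ^ J) else 0)"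
    "R_diag h J (-1) u $$ (i, j) = (if i = j then u * h * ((h ^ i)\<^sup>2 / h ^ J)
       - inverse u * inverse h * (h ^ J / (h ^ i)\<^sup>2) else 0)"
proof -
  have w: "h powi (1 + (int J - 2 * int i)) = h * (h ^ J / (h ^ i)\<^sup>2)"
    using assms powi_weight(1)[OF assms(1), of J i] by (simp add: power_int_add)
  have w': "h powi (1 - (int J - 2 * int i)) = h * ((h ^ i)\<^sup>2 / h ^ J)"
    using assms powi_weight(1)[OF assms(1), of J i] by (simp add: power_int_diff)
  have m: "h powi (- (1 + (int J - 2 * int i))) = inverse (h * (h ^ J / (h ^ i)\<^sup>2))"
    "h powi (- (1 - (int J - 2 * int i))) = inverse (h * ((h ^ i)\<^sup>2 / h ^ J))"
    by (simp_all only: power_int_minus w w')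
  show "R_diag h J 1 u $$ (i, j) = (if i = j then u * h * (h ^ J / (h ^ i)\<^sup>2)
       - inverse u * inverse h * ((h ^ i)\<^sup>2 / h ^ J) else 0)"
  proof (cases "i = j")
    case True
    then have *: "R_diag h J 1 u $$ (i, j) = u * h powi (1 + (int J - 2 * int i))
        - inverse u * h powi (- (1 + (int J - 2 * int i)))"
      using assms unfolding R_diag_def by (simp only: index_mat mult_1_left split le_imp_less_Suc simp_thms if_True)
    show ?thesis using True unfolding * w m(1) by (simp add: inverse_eq_divide mult.assoc)
  qed (use assms in \<open>simp add: R_diag_def\<close>)
  show "R_diag h J (-1) u $$ (i, j) = (if i = j then u * h * ((h ^ i)\<^sup>2 / h ^ J)
       - inverse u * inverse h * (h ^ J / (h ^ i)\<^sup>2) else 0)"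
  proof (cases "i = j")
    case True
    then have *: "R_diag h J (-1) u $$ (i, j) = u * h powi (1 + (-1) * (int J - 2 * int i))
        - inverse u * h powi (- (1 + (-1) * (int J - 2 * int i)))"
      using assms unfolding R_diag_def by (simp only: index_mat split le_imp_less_Suc simp_thms if_True)
    have **: "1 + (-1) * (int J - 2 * int i) = 1 - (int J - 2 * int i)" by simp
    show ?thesis using True unfolding * ** w' m(2) by (simp add: inverse_eq_divide mult.assoc)
  qed (use assms in \<open>simp add: R_diag_def\<close>)
qed

text \<open>
  The matrix factor of \<open>R_half\<close>, without the scalar prefactor, in block form.
\<close>

definition R_core :: "complex \<Rightarrow> nat \<Rightarrow> complex \<Rightarrow> complex mat" where
  "R_core h J u = four_block_mat (R_diag h J 1 u) ((h powi 2 - h powi (- 2)) \<cdot>\<^sub>m S_minus h J)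
     ((h powi 2 - h powi (- 2)) \<cdot>\<^sub>m S_plus h J) (R_diag h J (- 1) u)"

lemma R_half_eq:
  assumes "J \<noteq> 0"
  shows "R_half h J u =
    (\<Prod>k<J - 1. c_fun (u * h powi (int J - 1 - 2 * int k))) \<cdot>\<^sub>m R_core h J u"
proof -
  have sigma: "sigma_plus \<in> carrier_mat 2 2" "sigma_minus \<in> carrier_mat 2 2" "sigma_z \<in> carrier_mat 2 2"
    by (auto simp: sigma_plus_def sigma_minus_def sigma_z_def mat_of_rows_list_def)
  have s: "sigma_plus $$ (0,0) = 0" "sigma_plus $$ (0,Suc 0) = 1" "sigma_plus $$ (Suc 0,0) = 0" "sigma_plus $$ (Suc 0,Suc 0) = 0"
    "sigma_minus $$ (0,0) = 0" "sigma_minus $$ (0,Suc 0) = 0" "sigma_minus $$ (Suc 0,0) = 1" "sigma_minus $$ (Suc 0,Suc 0) = 0"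
    "sigma_z $$ (0,0) = 1" "sigma_z $$ (0,Suc 0) = 0" "sigma_z $$ (Suc 0,0) = 0" "sigma_z $$ (Suc 0,Suc 0) = -1"
    by (auto simp: sigma_plus_def sigma_minus_def sigma_z_def mat_of_rows_list_def)
  have "(h powi 2 - h powi (- 2)) \<cdot>\<^sub>m (sigma_plus \<otimes>\<^sub>m S_minus h J + sigma_minus \<otimes>\<^sub>m S_plus h J)
         + u \<cdot>\<^sub>m qhalf h (1\<^sub>m (2 * (J + 1)) + sigma_z \<otimes>\<^sub>m S_3 J)
         - inverse u \<cdot>\<^sub>m qhalf h (- (1\<^sub>m (2 * (J + 1)) + sigma_z \<otimes>\<^sub>m S_3 J)) = R_core h J u" (is "?L = _")
  proof (rule eq_matI)
    fix i j assume "i < dim_row (R_core h J u)" "j < dim_col (R_core h J u)"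
    then have ij: "i < Suc J + Suc J" "j < Suc J + Suc J" by (auto simp: R_core_def)
    have S3: "S_3 J $$ (k, k) = int J - 2 * int k" if "k \<le> J" for k
      using that by (auto simp: S_3_def mat1_def)
    show "?L $$ (i, j) = R_core h J u $$ (i, j)"
      using ij unfolding kron_two[OF sigma(1)] kron_two[OF sigma(2)] kron_two[OF sigma(3)]
      by (auto simp: R_core_def s qhalf_def mat_diag_def S3 R_diag_def)
  qed (auto simp: R_core_def qhalf_def mat_diag_def sigma_plus_def sigma_minus_def sigma_z_def mat_of_rows_list_def)
  then show ?thesis using assms by (simp add: R_half_def)
qed

text \<open>
  The condition is imposed on the square root \<open>h\<close> of \<open>q\<close>, for which it is equivalent to the one for
  \<open>q\<close>; \<open>0\<close> is excluded as well.
\<close>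

definition not_root_of_unity :: "complex \<Rightarrow> bool" where
  "not_root_of_unity h \<longleftrightarrow> h \<noteq> 0 \<and> (\<forall>n>0. h ^ n \<noteq> 1)"

lemma not_root_of_unity_nonzero: "not_root_of_unity h \<Longrightarrow> h \<noteq> 0"
  by (simp add: not_root_of_unity_def)

lemma not_root_of_unity_inverse: "not_root_of_unity h \<Longrightarrow> not_root_of_unity (inverse h)"
  by (auto simp: not_root_of_unity_def power_inverse)

lemma not_root_of_unity_powi:
  assumes "not_root_of_unity h" "n \<noteq> 0"
  shows "h powi n \<noteq> 1"
  using assms by (cases n rule: int_cases2) (auto simp: not_root_of_unity_def power_int_minus)

lemma not_root_of_unity_powi_inj:
  assumes "not_root_of_unity h"
  shows "h powi m = h powi n \<longleftrightarrow> m = n"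
proof
  assume "h powi m = h powi n"
  then have "h powi (m - n) = 1"
    using not_root_of_unity_nonzero[OF assms] by (simp add: power_int_diff)
  then show "m = n" using not_root_of_unity_powi[OF assms, of "m - n"] by auto
qed simp

lemma qnum_nonzero:
  assumes "not_root_of_unity h" "n \<noteq> 0"
  shows "qnum h n \<noteq> 0"
  using assms not_root_of_unity_powi_inj[of h "2 * n" "- 2 * n"]
    not_root_of_unity_powi_inj[of h 2 "- 2"] by (simp add: qnum_def)

lemma not_root_of_unity_denominator:
  assumes "not_root_of_unity h"
  shows "h\<^sup>2 - inverse (h\<^sup>2) \<noteq> 0" "h powi 2 - h powi (- 2) \<noteq> 0"
  using not_root_of_unity_powi_inj[OF assms, of 2 "- 2"] by (auto simp: power_int_minus)

lemma current_one:
  assumes "not_root_of_unity h"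
  shows "current h kp km 1 a $$ (0, 0) = 0" "current h kp km 1 a $$ (0, 1) = kp * a"
    "current h kp km 1 a $$ (1, 0) = km * inverse a" "current h kp km 1 a $$ (1, 1) = 0"
    "cartan h 1 $$ (0, 0) = h\<^sup>2" "cartan h 1 $$ (0, 1) = 0" "cartan h 1 $$ (1, 0) = 0"
    "cartan h 1 $$ (1, 1) = inverse (h\<^sup>2)"
proof -
  have l: "ladder h (Suc 0) 0 = 1"
    using not_root_of_unity_denominator[OF assms]
    by (auto simp: ladder_def B_coef_def qnum_def power_int_minus)
  show "current h kp km 1 a $$ (0, 0) = 0" "current h kp km 1 a $$ (0, 1) = kp * a"
    "current h kp km 1 a $$ (1, 0) = km * inverse a" "current h kp km 1 a $$ (1, 1) = 0"
    "cartan h 1 $$ (0, 0) = h\<^sup>2" "cartan h 1 $$ (0, 1) = 0" "cartan h 1 $$ (1, 0) = 0"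
    "cartan h 1 $$ (1, 1) = inverse (h\<^sup>2)"
    using not_root_of_unity_nonzero[OF assms]
    by (auto simp: index_current index_cartan l power_int_minus)
qed

text \<open>
  The values of the coproduct and of the opposite coproduct of \<open>current\<close>, and of the group-like
  element, on the tensor product of the spin-\<open>1/2\<close> space with another one, in block form.
\<close>

lemma coproduct_half:
  assumes "not_root_of_unity h" "A \<in> carrier_mat n n"
  shows "current h kp km 1 b \<otimes>\<^sub>m 1\<^sub>m n + cartan h 1 \<otimes>\<^sub>m A
      = four_block_mat (h\<^sup>2 \<cdot>\<^sub>m A) ((kp * b) \<cdot>\<^sub>m 1\<^sub>m n) ((km * inverse b) \<cdot>\<^sub>m 1\<^sub>m n) (inverse (h\<^sup>2) \<cdot>\<^sub>m A)"
    "B \<in> carrier_mat n n \<Longrightarrow> 1\<^sub>m 2 \<otimes>\<^sub>m A + current h kp km 1 b \<otimes>\<^sub>m B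
      = four_block_mat A ((kp * b) \<cdot>\<^sub>m B) ((km * inverse b) \<cdot>\<^sub>m B) A"
    "cartan h 1 \<otimes>\<^sub>m A = four_block_mat (h\<^sup>2 \<cdot>\<^sub>m A) (0\<^sub>m n n) (0\<^sub>m n n) (inverse (h\<^sup>2) \<cdot>\<^sub>m A)"
proof -
  have c: "current h kp km 1 b \<in> carrier_mat 2 2" "cartan h 1 \<in> carrier_mat 2 2"
    "1\<^sub>m 2 \<in> carrier_mat 2 2"
    using carrier_spin(5,6)[of _ 1] by (auto simp: numeral_2_eq_2)
  note k = current_one[OF assms(1), unfolded One_nat_def]
  show "current h kp km 1 b \<otimes>\<^sub>m 1\<^sub>m n + cartan h 1 \<otimes>\<^sub>m A
      = four_block_mat (h\<^sup>2 \<cdot>\<^sub>m A) ((kp * b) \<cdot>\<^sub>m 1\<^sub>m n) ((km * inverse b) \<cdot>\<^sub>m 1\<^sub>m n) (inverse (h\<^sup>2) \<cdot>\<^sub>m A)"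
    unfolding kron_two[OF c(1)] kron_two[OF c(2)]
    by (rule eq_matI) (use assms(2) in \<open>auto simp: k\<close>)
  show "1\<^sub>m 2 \<otimes>\<^sub>m A + current h kp km 1 b \<otimes>\<^sub>m B
      = four_block_mat A ((kp * b) \<cdot>\<^sub>m B) ((km * inverse b) \<cdot>\<^sub>m B) A" if "B \<in> carrier_mat n n"
    unfolding kron_two[OF c(1)] kron_two[OF c(3)]
    by (rule eq_matI) (use assms(2) that in \<open>auto simp: k\<close>)
  show "cartan h 1 \<otimes>\<^sub>m A = four_block_mat (h\<^sup>2 \<cdot>\<^sub>m A) (0\<^sub>m n n) (0\<^sub>m n n) (inverse (h\<^sup>2) \<cdot>\<^sub>m A)"
    unfolding kron_two[OF c(2)]
    by (rule eq_matI) (use assms(2) in \<open>auto simp: k\<close>)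
qed

lemma index_current_power:
  assumes "h \<noteq> 0" "i \<le> J" "j \<le> J"
  shows "current h kp km J a $$ (i, j) =
    (if j = Suc i then kp * a * h * ladder h J i * (h ^ J / (h ^ j)\<^sup>2)
     else if i = Suc j then km * inverse a * inverse h * ladder h J j * (h ^ J / (h ^ j)\<^sup>2)
     else 0)"
  by (simp only: index_current[OF assms(2,3)] powi_weight[OF assms(1)])

lemma index_cartan_power:
  assumes "h \<noteq> 0" "i \<le> J" "j \<le> J"
  shows "cartan h J $$ (i, j) = (if i = j then (h ^ J / (h ^ i)\<^sup>2)\<^sup>2 else 0)"
  by (simp only: index_cartan[OF assms(2,3)] powi_weight[OF assms(1)])

text \<open>
  The relation \<open>[S\<^sub>+, S\<^sub>-] = [S\<^sub>3]\<^sub>q\<close>, entry by entry.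
\<close>

lemma ladder_commutator:
  assumes "not_root_of_unity h" "i \<le> J"
  shows "(if i < J then ladder h J i * ladder h J i else 0)
      - (if 0 < i then ladder h J (i - 1) * ladder h J (i - 1) else 0)
      = ((h ^ J)\<^sup>2 / (h ^ i) ^ 4 - (h ^ i) ^ 4 / (h ^ J)\<^sup>2) / (h\<^sup>2 - inverse (h\<^sup>2))"
proof -
  have h0: "h \<noteq> 0" by (rule not_root_of_unity_nonzero[OF assms(1)])
  note d0 = not_root_of_unity_denominator(1)[OF assms(1)]
  define S where "S = h\<^sup>2 - inverse (h\<^sup>2)"
  have S0: "S \<noteq> 0" using d0 by (simp add: S_def)
  have sq: "ladder h J p * ladder h J p =
    (((h ^ J)\<^sup>2 / (h ^ p)\<^sup>2 - (h ^ p)\<^sup>2 / (h ^ J)\<^sup>2)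
    * (h\<^sup>2 * (h ^ p)\<^sup>2 - inverse (h\<^sup>2 * (h ^ p)\<^sup>2))) / S\<^sup>2" if "p \<le> J" for p
    using ladder_sq_eq[OF h0 that] by (simp add: S_def power2_eq_square)
  have 1: "(if i < J then ladder h J i * ladder h J i else 0) = ladder h J i * ladder h J i"
    using sq[of J] assms(2) h0 by (cases "i = J") (auto simp: power2_eq_square)
  have 2: "(if 0 < i then ladder h J (i - 1) * ladder h J (i - 1) else 0) =
    (((h ^ J)\<^sup>2 * h\<^sup>2 / (h ^ i)\<^sup>2 - (h ^ i)\<^sup>2 / ((h ^ J)\<^sup>2 * h\<^sup>2))
      * ((h ^ i)\<^sup>2 - inverse ((h ^ i)\<^sup>2))) / S\<^sup>2"
  proof (cases i)
    case (Suc k)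
    then show ?thesis using sq[of k] assms(2) h0 by (simp add: field_simps power2_eq_square)
  qed simp
  have "((h ^ J)\<^sup>2 / (h ^ i)\<^sup>2 - (h ^ i)\<^sup>2 / (h ^ J)\<^sup>2) * (h\<^sup>2 * (h ^ i)\<^sup>2 - inverse (h\<^sup>2 * (h ^ i)\<^sup>2))
    - ((h ^ J)\<^sup>2 * h\<^sup>2 / (h ^ i)\<^sup>2 - (h ^ i)\<^sup>2 / ((h ^ J)\<^sup>2 * h\<^sup>2)) * ((h ^ i)\<^sup>2 - inverse ((h ^ i)\<^sup>2))
    = ((h ^ J)\<^sup>2 / (h ^ i) ^ 4 - (h ^ i) ^ 4 / (h ^ J)\<^sup>2) * S"
    unfolding S_def using h0 by (simp add: field_simps power2_eq_square power4_eq_xxxx)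
  then show ?thesis
    using S0 by (subst 1, subst 2, subst sq[OF assms(2)])
      (simp add: S_def[symmetric] diff_divide_distrib[symmetric], simp add: power2_eq_square)
qed

text \<open>
  The four blocks of the relation \<open>intertwines_R_core_coproduct\<close> below.  The commutator of the ladder
  operators enters in the two off-diagonal blocks.
\<close>

lemma R_core_blocks_coproduct:
  fixes h u a b kp km :: complex and J :: nat
  assumes "not_root_of_unity h" "a \<noteq> 0" "b \<noteq> 0" "u \<noteq> 0" "b = u * a"
  defines "x \<equiv> current h kp km J a" and "g \<equiv> cartan h J" and "d \<equiv> h powi 2 - h powi (- 2)"
  shows "R_diag h J 1 u * (h\<^sup>2 \<cdot>\<^sub>m x) + (d \<cdot>\<^sub>m S_minus h J) * ((km * inverse b) \<cdot>\<^sub>m 1\<^sub>m (Suc J)) = x * R_diag h J 1 u + ((kp * b) \<cdot>\<^sub>m g) * (d \<cdot>\<^sub>m S_plus h J)"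
    "R_diag h J 1 u * ((kp * b) \<cdot>\<^sub>m 1\<^sub>m (Suc J)) + (d \<cdot>\<^sub>m S_minus h J) * (inverse (h\<^sup>2) \<cdot>\<^sub>m x) = x * (d \<cdot>\<^sub>m S_minus h J) + ((kp * b) \<cdot>\<^sub>m g) * R_diag h J (-1) u"
    "(d \<cdot>\<^sub>m S_plus h J) * (h\<^sup>2 \<cdot>\<^sub>m x) + R_diag h J (-1) u * ((km * inverse b) \<cdot>\<^sub>m 1\<^sub>m (Suc J)) = ((km * inverse b) \<cdot>\<^sub>m g) * R_diag h J 1 u + x * (d \<cdot>\<^sub>m S_plus h J)"
    "(d \<cdot>\<^sub>m S_plus h J) * ((kp * b) \<cdot>\<^sub>m 1\<^sub>m (Suc J)) + R_diag h J (-1) u * (inverse (h\<^sup>2) \<cdot>\<^sub>m x) = ((km * inverse b) \<cdot>\<^sub>m g) * (d \<cdot>\<^sub>m S_minus h J) + x * R_diag h J (-1) u"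
proof -
  have h0: "h \<noteq> 0" by (rule not_root_of_unity_nonzero[OF assms(1)])
  have dd: "d = h\<^sup>2 - inverse (h\<^sup>2)" by (simp add: d_def power_int_minus)
  note d0 = not_root_of_unity_denominator[OF assms(1), folded d_def]
  note idx = index_mult_diag_left[where n = "Suc J"] index_mult_diag_right[where n = "Suc J"]
    index_smult_mult index_mult_S_plus_left index_mult_S_plus_right
    index_mult_S_minus_left index_mult_S_minus_right index_S_plus index_S_minus
    index_current_power[OF h0] index_cartan_power[OF h0]
    index_R_diag[OF h0]
  have comm: "(if 0 < i then ladder h J (i - 1) * ladder h J (i - 1) else 0)
      = (if i < J then ladder h J i * ladder h J i else 0)
        - ((h ^ J)\<^sup>2 / (h ^ i) ^ 4 - (h ^ i) ^ 4 / (h ^ J)\<^sup>2) / d" if "i \<le> J" for i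
    using ladder_commutator[OF assms(1) that] by (simp add: dd algebra_simps)
  show "R_diag h J 1 u * (h\<^sup>2 \<cdot>\<^sub>m x) + (d \<cdot>\<^sub>m S_minus h J) * ((km * inverse b) \<cdot>\<^sub>m 1\<^sub>m (Suc J)) = x * R_diag h J 1 u + ((kp * b) \<cdot>\<^sub>m g) * (d \<cdot>\<^sub>m S_plus h J)" (is "?L = ?R")
  proof (rule eq_matI)
    fix i j assume "i < dim_row ?R" "j < dim_col ?R"
    then have ij: "i \<le> J" "j \<le> J" by (auto simp: g_def x_def)
    consider "j = Suc i" | "i = Suc j" | "j \<noteq> Suc i" "i \<noteq> Suc j" by blast
    then show "?L $$ (i, j) = ?R $$ (i, j)"
    proof cases
      case 1
      then show ?thesis using ij h0 assms(2-5) d0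
        by (simp add: idx g_def x_def del: index_mult_mat(1)) (simp add: dd field_simps power2_eq_square)
    next
      case 2
      then show ?thesis using ij h0 assms(2-5) d0
        by (simp add: idx g_def x_def del: index_mult_mat(1)) (simp add: dd field_simps power2_eq_square)
    next
      case 3
      then show ?thesis using ij by (simp add: idx g_def x_def del: index_mult_mat(1))
    qed
  qed (auto simp: g_def x_def)
  show "R_diag h J 1 u * ((kp * b) \<cdot>\<^sub>m 1\<^sub>m (Suc J)) + (d \<cdot>\<^sub>m S_minus h J) * (inverse (h\<^sup>2) \<cdot>\<^sub>m x) = x * (d \<cdot>\<^sub>m S_minus h J) + ((kp * b) \<cdot>\<^sub>m g) * R_diag h J (-1) u" (is "?L = ?R")
  proof (rule eq_matI)
    fix i j assume "i < dim_row ?R" "j < dim_col ?R"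
    then have ij: "i \<le> J" "j \<le> J" by (auto simp: g_def x_def)
    consider "i = j" | "i = Suc (Suc j)" | "i \<noteq> j" "\<not> (i = Suc (Suc j))" by blast
    then show "?L $$ (i, j) = ?R $$ (i, j)"
    proof cases
      case 1
      have "?L $$ (i, j) = (u * h * (h ^ J / (h ^ i)\<^sup>2) - inverse u * inverse h * ((h ^ i)\<^sup>2 / h ^ J)) * (kp * b) + d * inverse (h\<^sup>2) * (kp * a * h * (h ^ J / (h ^ i)\<^sup>2)) * (if 0 < i then ladder h J (i - 1) * ladder h J (i - 1) else 0)"
        using ij h0 1 by (auto simp add: idx g_def x_def simp del: index_mult_mat(1))
      also have "\<dots> = kp * a * h * (h ^ J / (h * h ^ i)\<^sup>2) * d * (if i < J then ladder h J i * ladder h J i else 0) + kp * b * (h ^ J / (h ^ i)\<^sup>2)\<^sup>2 * (u * h * ((h ^ i)\<^sup>2 / h ^ J) - inverse u * inverse h * (h ^ J / (h ^ i)\<^sup>2))"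
        unfolding comm[OF ij(1)] using h0 assms(2-5) d0(2)
        by (simp add: field_simps power2_eq_square power4_eq_xxxx)
      also have "\<dots> = ?R $$ (i, j)"
        using ij h0 1 by (auto simp add: idx g_def x_def simp del: index_mult_mat(1))
      finally show ?thesis .
    next
      case 2
      then show ?thesis using ij h0 assms(2-5) d0
        by (simp add: idx g_def x_def del: index_mult_mat(1)) (simp add: dd field_simps power2_eq_square)
    next
      case 3
      then show ?thesis using ij by (auto simp add: idx g_def x_def simp del: index_mult_mat(1))
    qed
  qed (auto simp: g_def x_def)
  show "(d \<cdot>\<^sub>m S_plus h J) * (h\<^sup>2 \<cdot>\<^sub>m x) + R_diag h J (-1) u * ((km * inverse b) \<cdot>\<^sub>m 1\<^sub>m (Suc J)) = ((km * inverse b) \<cdot>\<^sub>m g) * R_diag h J 1 u + x * (d \<cdot>\<^sub>m S_plus h J)" (is "?L = ?R")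
  proof (rule eq_matI)
    fix i j assume "i < dim_row ?R" "j < dim_col ?R"
    then have ij: "i \<le> J" "j \<le> J" by (auto simp: g_def x_def)
    consider "i = j" | "j = Suc (Suc i)" | "i \<noteq> j" "\<not> (j = Suc (Suc i))" by blast
    then show "?L $$ (i, j) = ?R $$ (i, j)"
    proof cases
      case 1
      have "?L $$ (i, j) = d * h\<^sup>2 * (km * inverse a * inverse h * (h ^ J / (h ^ i)\<^sup>2)) * (if i < J then ladder h J i * ladder h J i else 0) + (u * h * ((h ^ i)\<^sup>2 / h ^ J) - inverse u * inverse h * (h ^ J / (h ^ i)\<^sup>2)) * (km * inverse b)"
        using ij h0 1 by (auto simp add: idx g_def x_def simp del: index_mult_mat(1))
      also have "\<dots> = km * inverse b * (h ^ J / (h ^ i)\<^sup>2)\<^sup>2 * (u * h * (h ^ J / (h ^ i)\<^sup>2) - inverse u * inverse h * ((h ^ i)\<^sup>2 / h ^ J)) + km * inverse a * inverse h * (h ^ J * h\<^sup>2 / (h ^ i)\<^sup>2) * d * (if 0 < i then ladder h J (i - 1) * ladder h J (i - 1) else 0)"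
        unfolding comm[OF ij(1)] using h0 assms(2-5) d0(2)
        by (simp add: field_simps power2_eq_square power4_eq_xxxx)
      also have "\<dots> = ?R $$ (i, j)"
        using ij h0 1 by (cases i) (auto simp add: idx g_def x_def field_simps power2_eq_square simp del: index_mult_mat(1))
      finally show ?thesis .
    next
      case 2
      then show ?thesis using ij h0 assms(2-5) d0
        by (simp add: idx g_def x_def del: index_mult_mat(1)) (simp add: dd field_simps power2_eq_square)
    next
      case 3
      then show ?thesis using ij by (auto simp add: idx g_def x_def simp del: index_mult_mat(1))
    qed
  qed (auto simp: g_def x_def)
  show "(d \<cdot>\<^sub>m S_plus h J) * ((kp * b) \<cdot>\<^sub>m 1\<^sub>m (Suc J)) + R_diag h J (-1) u * (inverse (h\<^sup>2) \<cdot>\<^sub>m x) = ((km * inverse b) \<cdot>\<^sub>m g) * (d \<cdot>\<^sub>m S_minus h J) + x * R_diag h J (-1) u" (is "?L = ?R")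
  proof (rule eq_matI)
    fix i j assume "i < dim_row ?R" "j < dim_col ?R"
    then have ij: "i \<le> J" "j \<le> J" by (auto simp: g_def x_def)
    consider "j = Suc i" | "i = Suc j" | "j \<noteq> Suc i" "i \<noteq> Suc j" by blast
    then show "?L $$ (i, j) = ?R $$ (i, j)"
    proof cases
      case 1
      then show ?thesis using ij h0 assms(2-5) d0
        by (simp add: idx g_def x_def del: index_mult_mat(1)) (simp add: dd field_simps power2_eq_square)
    next
      case 2
      then show ?thesis using ij h0 assms(2-5) d0
        by (simp add: idx g_def x_def del: index_mult_mat(1)) (simp add: dd field_simps power2_eq_square)
    next
      case 3
      then show ?thesis using ij by (simp add: idx g_def x_def del: index_mult_mat(1))
    qed
  qed (auto simp: g_def x_def)
qed

lemma intertwines_four_block: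
  fixes A0 A1 A2 A3 :: "'a::semiring_0 mat"
  assumes "A0 \<in> carrier_mat n n" "A1 \<in> carrier_mat n n" "A2 \<in> carrier_mat n n" "A3 \<in> carrier_mat n n"
    "X0 \<in> carrier_mat n n" "X1 \<in> carrier_mat n n" "X2 \<in> carrier_mat n n" "X3 \<in> carrier_mat n n"
    "Y0 \<in> carrier_mat n n" "Y1 \<in> carrier_mat n n" "Y2 \<in> carrier_mat n n" "Y3 \<in> carrier_mat n n"
    "A0 * X0 + A1 * X2 = Y0 * A0 + Y1 * A2" "A0 * X1 + A1 * X3 = Y0 * A1 + Y1 * A3"
    "A2 * X0 + A3 * X2 = Y2 * A0 + Y3 * A2" "A2 * X1 + A3 * X3 = Y2 * A1 + Y3 * A3"
  shows "intertwines (four_block_mat A0 A1 A2 A3) (four_block_mat X0 X1 X2 X3)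
    (four_block_mat Y0 Y1 Y2 Y3)"
  by (rule intertwinesI[of _ "n + n" "n + n"])
    (use assms in \<open>auto simp: mult_four_block_mat[OF assms(1-8)] mult_four_block_mat[OF assms(9-12) assms(1-4)]\<close>)

lemma intertwines_R_core_coproduct:
  assumes "not_root_of_unity h" "a \<noteq> 0" "u \<noteq> 0" "b = u * a"
  shows "intertwines (R_core h J u)
    (current h kp km 1 b \<otimes>\<^sub>m 1\<^sub>m (Suc J) + cartan h 1 \<otimes>\<^sub>m current h kp km J a)
    (1\<^sub>m 2 \<otimes>\<^sub>m current h kp km J a + current h kp km 1 b \<otimes>\<^sub>m cartan h J)"
proof -
  have "b \<noteq> 0" using assms by simp
  note e = R_core_blocks_coproduct[OF assms(1,2) this assms(3,4)]
  show ?thesis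
    unfolding coproduct_half(1)[OF assms(1) carrier_spin(6)]
      coproduct_half(2)[OF assms(1) carrier_spin(6) carrier_spin(5)] R_core_def
    by (rule intertwines_four_block[where n = "Suc J"]) (rule e | simp)+
qed

lemma intertwines_transpose:
  fixes A :: "'a::comm_semiring_0 mat"
  assumes "intertwines A X Y"
  shows "intertwines (transpose_mat A) (transpose_mat Y) (transpose_mat X)"
proof -
  note a = intertwinesD[OF assms]
  have A: "A \<in> carrier_mat (dim_row A) (dim_col A)" by auto
  have "transpose_mat A * transpose_mat Y = transpose_mat X * transpose_mat A"
    unfolding transpose_mult[OF a(3) A, symmetric] transpose_mult[OF A a(2), symmetric] a(1) ..
  then show ?thesis using a by (auto simp: intertwines_def)
qed

lemma transpose_kron: "transpose_mat (A \<otimes>\<^sub>m B) = transpose_mat A \<otimes>\<^sub>m transpose_mat B"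
  by (rule eq_matI) (auto simp: index_kron' div_mod_less)

lemma transpose_plus:
  assumes "dim_row A = dim_row B" "dim_col A = dim_col B"
  shows "transpose_mat (A + B) = transpose_mat A + transpose_mat B"
  by (rule eq_matI) (use assms in auto)

lemma transpose_current:
  assumes "h \<noteq> 0"
  shows "transpose_mat (current h kp km J a) = current h km kp J (inverse a)"
  by (rule eq_matI) (use assms in \<open>auto simp: index_current_power field_simps power2_eq_square\<close>)

lemma transpose_cartan: "transpose_mat (cartan h J) = cartan h J"
  by (rule eq_matI) (auto simp: index_cartan)

lemma transpose_R_core: "transpose_mat (R_core h J u) = R_core h J u"
  by (rule eq_matI) (auto simp: R_core_def R_diag_def index_S_plus index_S_minus)

text \<open>
  The relation for the opposite coproduct is the transpose of the one for the coproduct: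
  transposition fixes \<open>R_core\<close> and exchanges \<open>kp\<close> with \<open>km\<close> and each parameter with its inverse.
\<close>

lemma intertwines_R_core_opposite:
  assumes "not_root_of_unity h" "b \<noteq> 0" "u \<noteq> 0" "a = u * b"
  shows "intertwines (R_core h J u)
    (1\<^sub>m 2 \<otimes>\<^sub>m current h kp km J a + current h kp km 1 b \<otimes>\<^sub>m cartan h J)
    (current h kp km 1 b \<otimes>\<^sub>m 1\<^sub>m (Suc J) + cartan h 1 \<otimes>\<^sub>m current h kp km J a)"
proof -
  have h0: "h \<noteq> 0" by (rule not_root_of_unity_nonzero[OF assms(1)])
  have "inverse a \<noteq> 0" "inverse b = u * inverse a" using assms by simp_all
  from intertwines_transpose[OF intertwines_R_core_coproduct[OF assms(1) this(1) assms(3) this(2), of J km kp]]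
  show ?thesis
    by (simp add: transpose_R_core transpose_kron transpose_plus transpose_current[OF h0] transpose_cartan numeral_2_eq_2)
qed

lemma intertwines_R_core_cartan:
  assumes "not_root_of_unity h"
  shows "intertwines (R_core h J u) (cartan h 1 \<otimes>\<^sub>m cartan h J) (cartan h 1 \<otimes>\<^sub>m cartan h J)"
proof -
  have h0: "h \<noteq> 0" by (rule not_root_of_unity_nonzero[OF assms(1)])
  let ?d = "h powi 2 - h powi (- 2)" let ?g = "cartan h J"
  note idx = index_mult_diag_left[where n = "Suc J"] index_mult_diag_right[where n = "Suc J"]
    index_smult_mult index_S_plus index_S_minus index_cartan_power[OF h0] index_R_diag[OF h0]
  have "R_diag h J 1 u * (h\<^sup>2 \<cdot>\<^sub>m ?g) = (h\<^sup>2 \<cdot>\<^sub>m ?g) * R_diag h J 1 u"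
    "R_diag h J (-1) u * (inverse (h\<^sup>2) \<cdot>\<^sub>m ?g) = (inverse (h\<^sup>2) \<cdot>\<^sub>m ?g) * R_diag h J (-1) u"
    by (rule eq_matI; simp add: idx del: index_mult_mat(1))+
  moreover have "(?d \<cdot>\<^sub>m S_minus h J) * (inverse (h\<^sup>2) \<cdot>\<^sub>m ?g) = (h\<^sup>2 \<cdot>\<^sub>m ?g) * (?d \<cdot>\<^sub>m S_minus h J)"
    "(?d \<cdot>\<^sub>m S_plus h J) * (h\<^sup>2 \<cdot>\<^sub>m ?g) = (inverse (h\<^sup>2) \<cdot>\<^sub>m ?g) * (?d \<cdot>\<^sub>m S_plus h J)"
    by (rule eq_matI; use h0 in \<open>simp add: idx power2_eq_square field_simps del: index_mult_mat(1)\<close>)+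
  ultimately show ?thesis
    unfolding coproduct_half(3)[OF assms(1) carrier_spin(5)] R_core_def
    by (intro intertwines_four_block[where n = "Suc J"]) (simp_all add: carrier_matI)
qed

lemma intertwines_R_half:
  assumes "not_root_of_unity h" "J \<noteq> 0"
  shows "a \<noteq> 0 \<Longrightarrow> u \<noteq> 0 \<Longrightarrow> b = u * a \<Longrightarrow> intertwines (R_half h J u)
    (current h kp km 1 b \<otimes>\<^sub>m 1\<^sub>m (Suc J) + cartan h 1 \<otimes>\<^sub>m current h kp km J a)
    (1\<^sub>m 2 \<otimes>\<^sub>m current h kp km J a + current h kp km 1 b \<otimes>\<^sub>m cartan h J)"
    "b \<noteq> 0 \<Longrightarrow> u \<noteq> 0 \<Longrightarrow> a = u * b \<Longrightarrow> intertwines (R_half h J u)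
    (1\<^sub>m 2 \<otimes>\<^sub>m current h kp km J a + current h kp km 1 b \<otimes>\<^sub>m cartan h J)
    (current h kp km 1 b \<otimes>\<^sub>m 1\<^sub>m (Suc J) + cartan h 1 \<otimes>\<^sub>m current h kp km J a)"
    "intertwines (R_half h J u) (cartan h 1 \<otimes>\<^sub>m cartan h J) (cartan h 1 \<otimes>\<^sub>m cartan h J)"
  unfolding R_half_eq[OF assms(2)]
  by (rule intertwines_smult_left, rule intertwines_R_core_coproduct[OF assms(1)], assumption+)
    (rule intertwines_smult_left, rule intertwines_R_core_opposite[OF assms(1)], assumption+,
     rule intertwines_smult_left, rule intertwines_R_core_cartan[OF assms(1)])

section \<open>Operators on the two outer factors of a tensor product\<close>

text \<open>
  For \<open>X\<close> on \<open>\<complex>\<^bsup>d\<^esup> \<otimes> \<complex>\<^bsup>e\<^esup>\<close> and \<open>C\<close> on a middle factor, \<open>sandwich d e C X\<close> acts as \<open>X\<close> on the two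
  outer factors and as \<open>C\<close> on the middle one.
\<close>

definition sandwich :: "nat \<Rightarrow> nat \<Rightarrow> 'a::times mat \<Rightarrow> 'a mat \<Rightarrow> 'a mat" where
  "sandwich d e C X = mat (d * dim_row C * e) (d * dim_col C * e) (\<lambda>(r, s).
     X $$ (r div e div dim_row C * e + r mod e, s div e div dim_col C * e + s mod e)
     * C $$ (r div e mod dim_row C, s div e mod dim_col C))"

lemma dim_sandwich[simp]:
  "dim_row (sandwich d e C X) = d * dim_row C * e" "dim_col (sandwich d e C X) = d * dim_col C * e"
  by (auto simp: sandwich_def)

lemma sandwich_index_less:
  fixes d D e r :: nat
  assumes "r < d * D * e"
  shows "r div e div D < d" "r div e mod D < D" "r mod e < e"
    "r div e div D * e + r mod e < d * e"
proof -
  note * = div_mod_less[OF assms]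
  show "r div e div D < d" "r div e mod D < D" "r mod e < e"
    using div_mod_less[OF *(1)] *(2) by auto
  then show "r div e div D * e + r mod e < d * e" by (intro kron_index_less)
qed

lemma sandwich_mult:
  fixes C C' X X' :: "'a::comm_semiring_0 mat"
  assumes "dim_col C = dim_row C'" "X \<in> carrier_mat (d * e) (d * e)" "X' \<in> carrier_mat (d * e) (d * e)"
  shows "sandwich d e C X * sandwich d e C' X' = sandwich d e (C * C') (X * X')"
proof (rule eq_matI)
  fix r s assume "r < dim_row (sandwich d e (C * C') (X * X'))"
    "s < dim_col (sandwich d e (C * C') (X * X'))"
  then have rs: "r < d * dim_row C * e" "s < d * dim_col C' * e" by auto
  let ?D = "dim_row C'"
  let ?r = "r div e div dim_row C * e + r mod e" and ?s = "s div e div dim_col C' * e + s mod e"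
  let ?k = "r div e mod dim_row C" and ?m = "s div e mod dim_col C'"
  note lr = sandwich_index_less[OF rs(1)] and ls = sandwich_index_less[OF rs(2)]
  have "(sandwich d e C X * sandwich d e C' X') $$ (r, s)
      = (\<Sum>t<(d * ?D) * e. sandwich d e C X $$ (r, t) * sandwich d e C' X' $$ (t, s))"
    using rs assms by (simp add: scalar_prod_def lessThan_atLeast0)
  also have "\<dots> = (\<Sum>i<d. \<Sum>k<?D. \<Sum>l<e.
      sandwich d e C X $$ (r, (i * ?D + k) * e + l) * sandwich d e C' X' $$ ((i * ?D + k) * e + l, s))"
    by (simp only: sum_lessThan_mult)
  also have "\<dots> = (\<Sum>i<d. \<Sum>k<?D. \<Sum>l<e.
      (X $$ (?r, i * e + l) * X' $$ (i * e + l, ?s)) * (C $$ (?k, k) * C' $$ (k, ?m)))"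
  proof (intro sum.cong refl)
    fix i k l assume "i \<in> {..<d}" "k \<in> {..<?D}" "l \<in> {..<e}"
    then have *: "i < d" "k < ?D" "l < e" by auto
    have t: "(i * ?D + k) * e + l < d * ?D * e"
      using * by (intro kron_index_less)
    have "((i * ?D + k) * e + l) div e = i * ?D + k" "((i * ?D + k) * e + l) mod e = l"
      "(i * ?D + k) div ?D = i" "(i * ?D + k) mod ?D = k"
      using * by auto
    then have "sandwich d e C X $$ (r, (i * ?D + k) * e + l) = X $$ (?r, i * e + l) * C $$ (?k, k)"
      "sandwich d e C' X' $$ ((i * ?D + k) * e + l, s) = X' $$ (i * e + l, ?s) * C' $$ (k, ?m)"
      using rs t assms(1) by (simp_all add: sandwich_def)
    then show "sandwich d e C X $$ (r, (i * ?D + k) * e + l) * sandwich d e C' X' $$ ((i * ?D + k) * e + l, s)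
      = (X $$ (?r, i * e + l) * X' $$ (i * e + l, ?s)) * (C $$ (?k, k) * C' $$ (k, ?m))"
      by (simp only: mult_ac)
  qed
  also have "\<dots> = (\<Sum>i<d. \<Sum>l<e. \<Sum>k<?D.
      (X $$ (?r, i * e + l) * X' $$ (i * e + l, ?s)) * (C $$ (?k, k) * C' $$ (k, ?m)))"
    by (intro sum.cong refl sum.swap)
  also have "\<dots> = (\<Sum>t<d * e. X $$ (?r, t) * X' $$ (t, ?s)) * (\<Sum>k<?D. C $$ (?k, k) * C' $$ (k, ?m))"
    by (simp only: sum_lessThan_mult sum_distrib_right) (simp only: sum_distrib_left)
  also have "\<dots> = sandwich d e (C * C') (X * X') $$ (r, s)"
  proof -
    have "(X * X') $$ (?r, ?s) = (\<Sum>t<d * e. X $$ (?r, t) * X' $$ (t, ?s))"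
      using lr ls assms by (simp add: scalar_prod_def lessThan_atLeast0)
    moreover have "(C * C') $$ (?k, ?m) = (\<Sum>k<?D. C $$ (?k, k) * C' $$ (k, ?m))"
      using lr ls assms by (simp add: scalar_prod_def lessThan_atLeast0)
    ultimately show ?thesis using rs by (simp add: sandwich_def)
  qed
  finally show "(sandwich d e C X * sandwich d e C' X') $$ (r, s)
    = sandwich d e (C * C') (X * X') $$ (r, s)" .
qed (use assms in auto)

lemma sandwich_add:
  fixes C X X' :: "'a::semiring mat"
  assumes "X \<in> carrier_mat (d * e) (d * e)" "X' \<in> carrier_mat (d * e) (d * e)"
  shows "sandwich d e C (X + X') = sandwich d e C X + sandwich d e C X'"
proof (rule eq_matI)
  fix r s assume "r < dim_row (sandwich d e C X + sandwich d e C X')"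
    "s < dim_col (sandwich d e C X + sandwich d e C X')"
  then have rs: "r < d * dim_row C * e" "s < d * dim_col C * e" by auto
  show "sandwich d e C (X + X') $$ (r, s) = (sandwich d e C X + sandwich d e C X') $$ (r, s)"
    using rs sandwich_index_less[OF rs(1)] sandwich_index_less[OF rs(2)] assms
    by (simp add: sandwich_def distrib_right)
qed auto

lemma sandwich_kron:
  fixes A B C :: "'a::comm_semiring_0 mat"
  assumes "A \<in> carrier_mat d d" "B \<in> carrier_mat e e"
  shows "sandwich d e C (A \<otimes>\<^sub>m B) = A \<otimes>\<^sub>m (C \<otimes>\<^sub>m B)"
proof (rule eq_matI)
  fix r s assume "r < dim_row (A \<otimes>\<^sub>m (C \<otimes>\<^sub>m B))" "s < dim_col (A \<otimes>\<^sub>m (C \<otimes>\<^sub>m B))"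
  then have rs': "r < d * (dim_row C * e)" "s < d * (dim_col C * e)" using assms by auto
  then have rs: "r < d * dim_row C * e" "s < d * dim_col C * e" by (simp_all only: mult.assoc)
  note lt = sandwich_index_less[OF rs(1)] sandwich_index_less[OF rs(2)]
  have "sandwich d e C (A \<otimes>\<^sub>m B) $$ (r, s) =
      (A $$ (r div e div dim_row C, s div e div dim_col C) * B $$ (r mod e, s mod e))
      * C $$ (r div e mod dim_row C, s div e mod dim_col C)"
    using rs lt assms by (simp add: sandwich_def index_kron')
  also have "\<dots> = A $$ (r div e div dim_row C, s div e div dim_col C)
      * (C $$ (r div e mod dim_row C, s div e mod dim_col C) * B $$ (r mod e, s mod e))"
    by (simp only: mult_ac)
  also have "\<dots> = (A \<otimes>\<^sub>m (C \<otimes>\<^sub>m B)) $$ (r, s)"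
    using rs' lt assms by (simp add: index_kron' div_mod_mult div_mod_less)
  finally show "sandwich d e C (A \<otimes>\<^sub>m B) $$ (r, s) = (A \<otimes>\<^sub>m (C \<otimes>\<^sub>m B)) $$ (r, s)" .
qed (use assms in auto)

lemma intertwines_sandwich:
  fixes A C X Y :: "'a::comm_semiring_1 mat"
  assumes "intertwines A X Y" "A \<in> carrier_mat (d * e) (d * e)" "C \<in> carrier_mat D D"
  shows "intertwines (sandwich d e (1\<^sub>m D) A) (sandwich d e C X) (sandwich d e C Y)"
proof (rule intertwinesI[of _ "d * D * e" "d * D * e"])
  note a = intertwinesD[OF assms(1)]
  have c: "X \<in> carrier_mat (d * e) (d * e)" "Y \<in> carrier_mat (d * e) (d * e)" using a assms(2) by auto
  show "sandwich d e (1\<^sub>m D) A * sandwich d e C X = sandwich d e C Y * sandwich d e (1\<^sub>m D) A"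
    using assms a c by (simp add: sandwich_mult)
qed (use assms(3) in \<open>auto intro!: carrier_matI\<close>)

lemma digit_Cons:
  "digit (d # ds) 0 x = x div prod_list ds mod d"
  "digit (d # ds) (Suc p) x = digit ds p x"
  by (simp_all add: digit_def)

lemma digits_eq_iff:
  "(\<forall>p<length ds. digit ds p x = digit ds p y) \<longleftrightarrow> x mod prod_list ds = y mod prod_list ds"
proof (induction ds)
  case (Cons d ds)
  have "(\<forall>p<length (d # ds). digit (d # ds) p x = digit (d # ds) p y) \<longleftrightarrow>
      x div prod_list ds mod d = y div prod_list ds mod d \<and> x mod prod_list ds = y mod prod_list ds"
    by (simp add: All_less_Suc2 digit_Cons Cons.IH)
  also have "\<dots> \<longleftrightarrow> x mod (d * prod_list ds) = y mod (d * prod_list ds)"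
    by (metis div_mod_mult(2,3) div_mult_mod_eq)
  finally show ?case by simp
qed simp

lemma digit_mod_prod_list:
  assumes "p < length ds"
  shows "digit ds p (x mod prod_list ds) = digit ds p x"
  using digits_eq_iff[of ds "x mod prod_list ds" x] assms by simp

lemma on_legs_Cons:
  fixes A :: "'a::semiring_1 mat"
  assumes "p < length ds" "p' < length ds"
  shows "on_legs (d # ds) (Suc p) (Suc p') A = 1\<^sub>m d \<otimes>\<^sub>m on_legs ds p p' A"
proof (rule eq_matI)
  fix r s assume "r < dim_row (1\<^sub>m d \<otimes>\<^sub>m on_legs ds p p' A)" "s < dim_col (1\<^sub>m d \<otimes>\<^sub>m on_legs ds p p' A)"
  then have rs: "r < d * prod_list ds" "s < d * prod_list ds" by (auto simp: on_legs_def)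
  note lt = div_mod_less[OF rs(1)] div_mod_less[OF rs(2)]
  let ?P = "prod_list ds"
  have "(\<forall>k<length (d # ds). k \<noteq> Suc p \<and> k \<noteq> Suc p' \<longrightarrow> digit (d # ds) k r = digit (d # ds) k s)
    \<longleftrightarrow> r div ?P = s div ?P \<and> (\<forall>k<length ds. k \<noteq> p \<and> k \<noteq> p' \<longrightarrow> digit ds k (r mod ?P) = digit ds k (s mod ?P))"
    using lt by (simp add: All_less_Suc2 digit_Cons digit_mod_prod_list)
  moreover have "on_legs (d # ds) (Suc p) (Suc p') A $$ (r, s) =
      (if \<forall>k<length (d # ds). k \<noteq> Suc p \<and> k \<noteq> Suc p' \<longrightarrow> digit (d # ds) k r = digit (d # ds) k s
       then A $$ (digit ds p r * ds ! p' + digit ds p' r, digit ds p s * ds ! p' + digit ds p' s) else 0)"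
    using rs unfolding on_legs_def by (subst index_mat) (simp_all only: prod_list.Cons split digit_Cons nth_Cons_Suc)
  moreover have "(1\<^sub>m d \<otimes>\<^sub>m on_legs ds p p' A) $$ (r, s) =
      (if r div ?P = s div ?P \<and> (\<forall>k<length ds. k \<noteq> p \<and> k \<noteq> p' \<longrightarrow> digit ds k (r mod ?P) = digit ds k (s mod ?P))
       then A $$ (digit ds p r * ds ! p' + digit ds p' r, digit ds p s * ds ! p' + digit ds p' s) else 0)"
    using rs lt assms by (simp add: on_legs_def index_kron' digit_mod_prod_list) blast
  ultimately show "on_legs (d # ds) (Suc p) (Suc p') A $$ (r, s) = (1\<^sub>m d \<otimes>\<^sub>m on_legs ds p p' A) $$ (r, s)"
    by (simp only:)
qed (auto simp: on_legs_def)

lemma on_legs_outer: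
  fixes A :: "'a::semiring_1 mat"
  shows "on_legs (d # ds @ [e]) 0 (Suc (length ds)) A = sandwich d e (1\<^sub>m (prod_list ds)) A"
proof (rule eq_matI)
  fix r s assume "r < dim_row (sandwich d e (1\<^sub>m (prod_list ds)) A)"
    "s < dim_col (sandwich d e (1\<^sub>m (prod_list ds)) A)"
  then have rs: "r < d * prod_list ds * e" "s < d * prod_list ds * e" by auto
  note lt = sandwich_index_less[OF rs(1)] sandwich_index_less[OF rs(2)]
  have dm: "digit (ds @ [e]) k x = digit ds k (x div e)" if "k < length ds" for k x
    using that by (simp add: digit_def nth_append div_mod_mult)
  have dl: "digit (d # ds @ [e]) (Suc (length ds)) x = x mod e" for x
    by (simp add: digit_def)
  have df: "digit (d # ds @ [e]) 0 x = x div e div prod_list ds" if "x < d * prod_list ds * e" for x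
    using that sandwich_index_less(1)[OF that] by (simp add: digit_def div_mod_mult)
  have inner: "(\<forall>k<Suc (Suc n). k \<noteq> 0 \<and> k \<noteq> Suc n \<longrightarrow> P k) \<longleftrightarrow> (\<forall>k<n. P (Suc k))" for n and P :: "nat \<Rightarrow> bool"
  proof (intro iffI allI impI)
    fix k assume "\<forall>k<Suc (Suc n). k \<noteq> 0 \<and> k \<noteq> Suc n \<longrightarrow> P k" "k < n"
    then show "P (Suc k)" by simp
  next
    fix k assume *: "\<forall>k<n. P (Suc k)" "k < Suc (Suc n)" "k \<noteq> 0 \<and> k \<noteq> Suc n"
    then show "P k" by (cases k) auto
  qed
  have "(\<forall>k<length (d # ds @ [e]). k \<noteq> 0 \<and> k \<noteq> Suc (length ds) \<longrightarrow>
      digit (d # ds @ [e]) k r = digit (d # ds @ [e]) k s)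
    \<longleftrightarrow> (\<forall>k<length ds. digit (ds @ [e]) k r = digit (ds @ [e]) k s)"
    using inner[of "length ds" "\<lambda>k. digit (d # ds @ [e]) k r = digit (d # ds @ [e]) k s"]
    by (simp add: digit_Cons)
  also have "\<dots> \<longleftrightarrow> (\<forall>k<length ds. digit ds k (r div e) = digit ds k (s div e))"
    by (simp add: dm)
  also have "\<dots> \<longleftrightarrow> r div e mod prod_list ds = s div e mod prod_list ds"
    by (rule digits_eq_iff)
  finally have cond: "(\<forall>k<length (d # ds @ [e]). k \<noteq> 0 \<and> k \<noteq> Suc (length ds) \<longrightarrow>
      digit (d # ds @ [e]) k r = digit (d # ds @ [e]) k s)
    \<longleftrightarrow> r div e mod prod_list ds = s div e mod prod_list ds" .
  have "prod_list (d # ds @ [e]) = d * prod_list ds * e" "(d # ds @ [e]) ! Suc (length ds) = e"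
    by simp_all
  then have "on_legs (d # ds @ [e]) 0 (Suc (length ds)) A $$ (r, s) =
      (if r div e mod prod_list ds = s div e mod prod_list ds
       then A $$ (r div e div prod_list ds * e + r mod e, s div e div prod_list ds * e + s mod e) else 0)"
    using rs unfolding on_legs_def by (subst index_mat) (simp_all only: split cond dl df)
  then show "on_legs (d # ds @ [e]) 0 (Suc (length ds)) A $$ (r, s)
      = sandwich d e (1\<^sub>m (prod_list ds)) A $$ (r, s)"
    using rs lt by (simp add: sandwich_def)
qed (auto simp: on_legs_def)

section \<open>The fusion maps\<close>

text \<open>
  The fusion maps identify the spin-\<open>J/2\<close> space with the symmetric part of
  \<open>\<complex>\<^sup>2 \<otimes> \<complex>\<^bsup>J\<^esup>\<close>.  They preserve the following grading: \<open>level J r\<close> is the number of lowering steps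
  from the top vector to the \<open>r\<close>-th basis vector of \<open>\<complex>\<^sup>2 \<otimes> \<complex>\<^bsup>J\<^esup>\<close>.
\<close>

definition level :: "nat \<Rightarrow> nat \<Rightarrow> nat" where
  "level J r = (if r < J then r else Suc r - J)"

text \<open>The only nonzero entry of \<open>E_mat\<close> in row \<open>J + m\<close>, which lies in column \<open>m + 1\<close>.\<close>

definition E_off :: "complex \<Rightarrow> nat \<Rightarrow> nat \<Rightarrow> complex" where
  "E_off h J m = qnum h (int m + 1) * E_diag h J m / ladder h J m"

lemma dim_E_F[simp]:
  "dim_row (E_mat h J) = 2 * J" "dim_col (E_mat h J) = Suc J"
  "dim_row (F_mat h J) = Suc J" "dim_col (F_mat h J) = 2 * J"
  "E_mat h J \<in> carrier_mat (2 * J) (Suc J)" "F_mat h J \<in> carrier_mat (Suc J) (2 * J)"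
  by (auto simp: E_mat_def F_mat_def mat1_def)

lemma index_E_mat:
  assumes "r < 2 * J" "c \<le> J"
  shows "E_mat h J $$ (r, c) =
    (if c = level J r then if r < J then E_diag h J r else E_off h J (r - J) else 0)"
proof -
  have "int J + 2 - 2 * int (Suc r - J) = int J - 2 * int (r - J)" if "\<not> r < J"
    using that by (simp add: algebra_simps of_nat_diff)
  moreover have "int (Suc r - J) = int (r - J) + 1" "Suc r - J - 1 = r - J" if "\<not> r < J"
    using that by (simp_all add: of_nat_diff Suc_diff_le)
  moreover have "E_mat h J $$ (r, c) = E_entry h J (Suc r) (Suc c)"
    using assms by (simp add: E_mat_def mat1_def)
  ultimately show ?thesis
    using assms by (simp add: E_entry_def level_def E_off_def ladder_def del: of_nat_diff)
qed

lemma index_mult_E_mat: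
  assumes "dim_col M = 2 * J" "i < dim_row M" "c \<le> J"
  shows "(M * E_mat h J) $$ (i, c) = (if c < J then M $$ (i, c) * E_diag h J c else 0)
     + (if 0 < c then M $$ (i, J + c - 1) * E_off h J (c - 1) else 0)"
proof -
  have "(M * E_mat h J) $$ (i, c) = (\<Sum>r<J + J. M $$ (i, r) * E_mat h J $$ (r, c))"
    using assms by (simp add: scalar_prod_def lessThan_atLeast0 mult_2)
  also have "\<dots> = (\<Sum>r<J. M $$ (i, r) * E_mat h J $$ (r, c)) + (\<Sum>r<J. M $$ (i, J + r) * E_mat h J $$ (J + r, c))"
  proof -
    have "(\<Sum>r<J + J. f r) = (\<Sum>r<J. f r) + (\<Sum>r<J. f (J + r))" for f :: "nat \<Rightarrow> complex"
      using sum.atLeastLessThan_concat[of 0 J "J + J" f] sum.shift_bounds_nat_ivl[of f 0 J J]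
      by (simp add: lessThan_atLeast0 add.commute)
    then show ?thesis .
  qed
  also have "(\<Sum>r<J. M $$ (i, r) * E_mat h J $$ (r, c)) = (\<Sum>r<J. if r = c then M $$ (i, c) * E_diag h J c else 0)"
    using assms by (intro sum.cong) (auto simp: index_E_mat level_def)
  also have "(\<Sum>r<J. M $$ (i, J + r) * E_mat h J $$ (J + r, c))
      = (\<Sum>r<J. if r = c - 1 then (if 0 < c then M $$ (i, J + c - 1) * E_off h J (c - 1) else 0) else 0)"
    using assms by (intro sum.cong) (auto simp: index_E_mat level_def)
  finally show ?thesis using assms by (auto simp: sum.delta)
qed

lemma index_E_mat_mult:
  assumes "dim_row M = Suc J" "r < 2 * J" "c < dim_col M"
  shows "(E_mat h J * M) $$ (r, c) =
    (if r < J then E_diag h J r else E_off h J (r - J)) * M $$ (level J r, c)"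
proof -
  have l: "level J r \<le> J" using assms by (auto simp: level_def)
  have "(E_mat h J * M) $$ (r, c) = (\<Sum>s<Suc J. E_mat h J $$ (r, s) * M $$ (s, c))"
    using assms by (simp add: scalar_prod_def lessThan_atLeast0 del: sum.lessThan_Suc)
  also have "\<dots> = (\<Sum>s<Suc J. if s = level J r then (if r < J then E_diag h J r else E_off h J (r - J)) * M $$ (level J r, c) else 0)"
    using assms by (intro sum.cong) (auto simp: index_E_mat)
  finally show ?thesis using l by (simp del: sum.lessThan_Suc)
qed

lemma ladder_nonzero:
  assumes "not_root_of_unity h" "p < J"
  shows "ladder h J p \<noteq> 0"
proof
  assume "ladder h J p = 0"
  then have "qnum h (int J - int p) * qnum h (int p + 1) = 0" using ladder_sq[of h J p] by simp
  then show False
    using qnum_nonzero[OF assms(1), of "int J - int p"] qnum_nonzero[OF assms(1), of "int p + 1"] assms(2)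
    by auto
qed

lemma ladder_last: "ladder h J J = 0"
  using ladder_sq[of h J J] by (simp add: qnum_def)

lemma E_diag_Suc:
  assumes "not_root_of_unity h" "n < J"
  shows "E_diag h J (Suc n) * ladder h J n = E_diag h J n * ladder h (J - 1) n"
proof -
  have "E_diag h J (Suc n) = E_diag h J n * (ladder h (J - 1) n / ladder h J n)"
    using assms(2) by (simp add: E_diag_def ladder_def of_nat_diff algebra_simps)
  then show ?thesis using ladder_nonzero[OF assms] by simp
qed

lemma E_diag_nonzero:
  assumes "not_root_of_unity h" "n < J"
  shows "E_diag h J n \<noteq> 0"
  using assms(2)
proof (induction n)
  case (Suc n)
  then show ?case
    using E_diag_Suc[OF assms(1), of n J] ladder_nonzero[OF assms(1), of n "J - 1"] by auto
qed (simp add: E_diag_def)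

lemma E_off_ladder:
  assumes "not_root_of_unity h" "m < J"
  shows "E_off h J m * ladder h J m = qnum h (int m + 1) * E_diag h J m"
  using ladder_nonzero[OF assms] by (simp add: E_off_def)

lemma E_off_ladder':
  assumes "not_root_of_unity h" "Suc m < J"
  shows "E_off h J m * ladder h (J - 1) m = qnum h (int m + 1) * E_diag h J (Suc m)"
proof -
  have "E_off h J m * ladder h (J - 1) m * ladder h J m
      = qnum h (int m + 1) * (E_diag h J m * ladder h (J - 1) m)"
    using E_off_ladder[OF assms(1), of m J] assms(2) by simp
  also have "\<dots> = qnum h (int m + 1) * E_diag h J (Suc m) * ladder h J m"
    using E_diag_Suc[OF assms(1), of m J] assms(2) by simp
  finally show ?thesis using ladder_nonzero[OF assms(1), of m J] assms(2) by simp
qed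

lemma E_off_nonzero:
  assumes "not_root_of_unity h" "m < J"
  shows "E_off h J m \<noteq> 0"
  using E_off_ladder[OF assms] E_diag_nonzero[OF assms] qnum_nonzero[OF assms(1), of "int m + 1"] by auto

text \<open>
  A tridiagonal matrix with vanishing diagonal on the spin-\<open>J/2\<close> space and a block
  matrix on \<open>\<complex>\<^sup>2 \<otimes> \<complex>\<^bsup>J\<^esup>\<close> with the corresponding pattern are intertwined by \<open>E_mat\<close> as soon as four
  families of scalar identities hold.
\<close>

lemma intertwines_E_mat:
  fixes xu xl au al du dl b c :: "nat \<Rightarrow> complex"
  assumes q: "not_root_of_unity h" and "J \<ge> 2"
    and x: "X \<in> carrier_mat (Suc J) (Suc J)"
      "\<And>i j. i \<le> J \<Longrightarrow> j \<le> J \<Longrightarrow> X $$ (i, j) =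
        (if j = Suc i then xu i * ladder h J i else if i = Suc j then xl j * ladder h J j else 0)"
    and A: "A \<in> carrier_mat J J"
      "\<And>i j. i < J \<Longrightarrow> j < J \<Longrightarrow> A $$ (i, j) =
        (if j = Suc i then au i * ladder h (J - 1) i else if i = Suc j then al j * ladder h (J - 1) j else 0)"
    and B: "B \<in> carrier_mat J J" "\<And>i j. i < J \<Longrightarrow> j < J \<Longrightarrow> B $$ (i, j) = (if i = j then b i else 0)"
    and C: "C \<in> carrier_mat J J" "\<And>i j. i < J \<Longrightarrow> j < J \<Longrightarrow> C $$ (i, j) = (if i = j then c i else 0)"
    and D: "D \<in> carrier_mat J J"
      "\<And>i j. i < J \<Longrightarrow> j < J \<Longrightarrow> D $$ (i, j) =
        (if j = Suc i then du i * ladder h (J - 1) i else if i = Suc j then dl j * ladder h (J - 1) j else 0)"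
    and e1: "\<And>i. i < J \<Longrightarrow> xu i * qnum h (int J - int i) = au i * qnum h (int (J - 1) - int i) + b i"
    and e2: "\<And>i. Suc i < J \<Longrightarrow> xl i = al i"
    and e3: "\<And>i. Suc i < J \<Longrightarrow> xu (Suc i) = du i"
    and e4: "\<And>i. i < J \<Longrightarrow> xl i * qnum h (int i + 1) = c i + (if 0 < i then dl (i - 1) * qnum h (int i) else 0)"
  shows "intertwines (E_mat h J) X (four_block_mat A B C D)"
proof (rule intertwinesI[of _ "2 * J" "Suc J"])
  let ?Y = "four_block_mat A B C D" and ?l = "ladder h J" and ?l' = "ladder h (J - 1)"
    and ?e = "E_diag h J" and ?o = "E_off h J"
  show "E_mat h J * X = ?Y * E_mat h J"
  proof (rule eq_matI)
    fix r k assume "r < dim_row (?Y * E_mat h J)" "k < dim_col (?Y * E_mat h J)"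
    then have r: "r < 2 * J" and k: "k \<le> J" using A D by auto
    have XE: "(E_mat h J * X) $$ (r, k) = (if r < J then ?e r else ?o (r - J)) * X $$ (level J r, k)"
      using r k x(1) by (intro index_E_mat_mult) auto
    have YE: "(?Y * E_mat h J) $$ (r, k) = (if k < J then ?Y $$ (r, k) * ?e k else 0)
       + (if 0 < k then ?Y $$ (r, J + k - 1) * ?o (k - 1) else 0)"
      using r k A(1) D(1) by (intro index_mult_E_mat) auto
    have dims: "dim_row A = J" "dim_col A = J" "dim_row D = J" "dim_col D = J"
      using A(1) D(1) by auto
    note idx = dims x(2) A(2) B(2) C(2) D(2) level_def
    show "(E_mat h J * X) $$ (r, k) = (?Y * E_mat h J) $$ (r, k)"
    proof (cases "r < J")
      case True
      consider "k = Suc r" | "r = Suc k" | "k \<noteq> Suc r" "r \<noteq> Suc k" by blast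
      then show ?thesis
      proof cases
        case 1
        have b: "?l r * ?l r = qnum h (int J - int r) * qnum h (int r + 1)"
          "?l' r * ?l' r = qnum h (int (J - 1) - int r) * qnum h (int r + 1)"
          using ladder_sq[of h J r] ladder_sq[of h "J - 1" r] by (simp_all add: power2_eq_square)
        have "?l r * (?e r * (xu r * ?l r)) = xu r * qnum h (int J - int r) * (qnum h (int r + 1) * ?e r)"
          using b(1) by (simp add: mult_ac)
        also have "\<dots> = au r * (?l' r * ?l' r) * ?e r + b r * (qnum h (int r + 1) * ?e r)"
          unfolding e1[OF True] b(2) by (simp add: algebra_simps)
        also have "\<dots> = au r * ?l' r * (?e (Suc r) * ?l r) + b r * (?o r * ?l r)"
          unfolding E_diag_Suc[OF q True] E_off_ladder[OF q True] by (simp add: mult_ac)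
        also have "\<dots> = ?l r * (au r * ?l' r * ?e (Suc r) + b r * ?o r)" by (simp add: algebra_simps)
        finally have *: "?e r * (xu r * ?l r) = au r * ?l' r * ?e (Suc r) + b r * ?o r"
          using ladder_nonzero[OF q True] by simp
        have "Suc r < J \<or> Suc r = J" using True by auto
        then show ?thesis
        proof
          assume "Suc r < J"
          then show ?thesis unfolding XE YE using 1 True r k * \<open>J \<ge> 2\<close> by (simp add: idx del: index_mult_mat(1))
        next
          assume J: "Suc r = J"
          then have "?l' r = 0" using ladder_last[of h "J - 1"] by auto
          moreover have "J + k - 1 = J + r" "k - 1 = r" using 1 by simp_all
          ultimately show ?thesis unfolding XE YE using 1 True r k * J \<open>J \<ge> 2\<close> by (simp add: idx del: index_mult_mat(1))
        qed
      next
        case 2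
        then have "?e r * (xl k * ?l k) = al k * ?l' k * ?e k"
          using True E_diag_Suc[OF q, of k J] e2[of k] by (simp add: mult_ac)
        then show ?thesis unfolding XE YE using 2 True r k \<open>J \<ge> 2\<close> by (simp add: idx del: index_mult_mat(1))
      next
        case 3
        then show ?thesis unfolding XE YE using True r k \<open>J \<ge> 2\<close> by (auto simp add: idx simp del: index_mult_mat(1))
      qed
    next
      case False
      then obtain i where i: "r = J + i" "i < J" using r by (metis add_less_cancel_left le_Suc_ex mult_2 not_less)
      consider "k = Suc (Suc i)" | "k = i" | "k \<noteq> Suc (Suc i)" "k \<noteq> i" by blast
      then show ?thesis
      proof cases
        case 1
        then have i': "Suc i < J" using k i by simp
        have b: "?l (Suc i) * ?l (Suc i) = qnum h (int (J - 1) - int i) * qnum h (int (Suc i) + 1)"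
          "?l' i * ?l' i = qnum h (int (J - 1) - int i) * qnum h (int i + 1)"
        proof -
          have "int J - int (Suc i) = int (J - 1) - int i" using i' by simp
          then show "?l (Suc i) * ?l (Suc i) = qnum h (int (J - 1) - int i) * qnum h (int (Suc i) + 1)"
            using ladder_sq[of h J "Suc i"] by (simp only: power2_eq_square)
          show "?l' i * ?l' i = qnum h (int (J - 1) - int i) * qnum h (int i + 1)"
            using ladder_sq[of h "J - 1" i] by (simp only: power2_eq_square)
        qed
        have "?o i * (?l (Suc i) * ?l (Suc i)) * ?l' i
            = (?o i * ?l' i) * (qnum h (int (J - 1) - int i) * qnum h (int (Suc i) + 1))"
          unfolding b(1) by (simp only: mult_ac)
        also have "\<dots> = (?l' i * ?l' i) * (qnum h (int (Suc i) + 1) * ?e (Suc i))"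
          unfolding E_off_ladder'[OF q i'] b(2) by (simp add: mult_ac)
        also have "\<dots> = ?l' i * ?o (Suc i) * (?l (Suc i) * ?l' i)"
          unfolding E_off_ladder[OF q i', symmetric] by (simp only: mult_ac)
        finally have "(?o i * ?l (Suc i)) * (?l (Suc i) * ?l' i) = (?l' i * ?o (Suc i)) * (?l (Suc i) * ?l' i)"
          by (simp only: mult_ac)
        moreover have "?l (Suc i) * ?l' i \<noteq> 0"
          using ladder_nonzero[OF q i'] ladder_nonzero[OF q, of i "J - 1"] i' by simp
        ultimately have "?o i * ?l (Suc i) = ?l' i * ?o (Suc i)"
          by (metis mult_right_cancel)
        then have "?o i * (xu (Suc i) * ?l (Suc i)) = du i * ?l' i * ?o (Suc i)"
          using e3[OF i'] by (simp add: mult_ac)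
        then show ?thesis unfolding XE YE using 1 i i' r k \<open>J \<ge> 2\<close> by (simp add: idx del: index_mult_mat(1))
      next
        case 2
        have "?o i * (xl i * ?l i) = xl i * qnum h (int i + 1) * ?e i"
          using E_off_ladder[OF q i(2)] by (simp add: mult_ac)
        also have "\<dots> = c i * ?e i + (if 0 < i then dl (i - 1) * ?l' (i - 1) * ?o (i - 1) else 0)"
          unfolding e4[OF i(2)] using E_off_ladder'[OF q, of "i - 1" J] i(2)
          by (auto simp: algebra_simps of_nat_diff)
        finally show ?thesis unfolding XE YE using 2 i r k \<open>J \<ge> 2\<close> by (cases i) (simp_all add: idx del: index_mult_mat(1))
      next
        case 3
        then show ?thesis unfolding XE YE using i r k \<open>J \<ge> 2\<close> by (auto simp add: idx simp del: index_mult_mat(1))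
      qed
    qed
  qed (use x A D in auto)
qed (use x A D in \<open>auto simp: mult_2\<close>)

lemma F_entry_support:
  assumes "J \<ge> 1" "n \<le> J" "s < 2 * J" "n \<noteq> level J s"
  shows "F_mat h J $$ (n, s) = 0"
  using assms by (auto simp: F_mat_def mat1_def F_entry_def level_def split: if_splits)

lemma index_F_mat:
  assumes "not_root_of_unity h" "J \<ge> 2"
  shows "F_mat h J $$ (0, 0) = 1" "F_mat h J $$ (J, 2 * J - 1) * E_off h J (J - 1) = 1"
    "0 < n \<Longrightarrow> n < J \<Longrightarrow> F_mat h J $$ (n, n) * E_diag h J n + F_mat h J $$ (n, J + n - 1) * E_off h J (n - 1) = 1"
proof -
  have E: "E_entry h J (Suc r) (Suc c) = E_mat h J $$ (r, c)" if "r < 2 * J" "c \<le> J" for r c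
    using that by (simp add: E_mat_def mat1_def)
  show "F_mat h J $$ (0, 0) = 1" using assms by (simp add: F_mat_def mat1_def F_entry_def)
  have "F_mat h J $$ (J, 2 * J - 1) = inverse (E_entry h J (2 * J) (J + 1))"
    using assms by (simp add: F_mat_def mat1_def F_entry_def)
  also have "E_entry h J (2 * J) (J + 1) = E_off h J (J - 1)"
    using E[of "2 * J - 1" J] assms by (simp add: index_E_mat level_def)
  finally show "F_mat h J $$ (J, 2 * J - 1) * E_off h J (J - 1) = 1"
    using E_off_nonzero[OF assms(1), of "J - 1" J] assms(2) by simp
  assume n: "0 < n" "n < J"
  have 1: "F_mat h J $$ (n, n) = (1 - F_off h J (Suc n) * E_entry h J (n + J) (Suc n)) / E_entry h J (Suc n) (Suc n)"
    "F_mat h J $$ (n, J + n - 1) = F_off h J (Suc n)"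
    using n assms by (simp_all add: F_mat_def mat1_def F_entry_def add.commute)
  have 2: "E_entry h J (n + J) (Suc n) = E_off h J (n - 1)" "E_entry h J (Suc n) (Suc n) = E_diag h J n"
    using E[of "n + J - 1" n] E[of n n] n by (simp_all add: index_E_mat level_def)
  show "F_mat h J $$ (n, n) * E_diag h J n + F_mat h J $$ (n, J + n - 1) * E_off h J (n - 1) = 1"
    unfolding 1 2 using E_diag_nonzero[OF assms(1) n(2)] by simp
qed

lemma F_mat_E_mat:
  assumes "not_root_of_unity h" "J \<ge> 2"
  shows "F_mat h J * E_mat h J = 1\<^sub>m (Suc J)"
proof (rule eq_matI)
  fix n c assume "n < dim_row (1\<^sub>m (Suc J) :: complex mat)" "c < dim_col (1\<^sub>m (Suc J) :: complex mat)"
  then have nc: "n \<le> J" "c \<le> J" by auto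
  have eq: "(F_mat h J * E_mat h J) $$ (n, c) = (if c < J then F_mat h J $$ (n, c) * E_diag h J c else 0)
     + (if 0 < c then F_mat h J $$ (n, J + c - 1) * E_off h J (c - 1) else 0)"
    using nc by (intro index_mult_E_mat) auto
  note F = index_F_mat[OF assms]
  show "(F_mat h J * E_mat h J) $$ (n, c) = 1\<^sub>m (Suc J) $$ (n, c)"
  proof (cases "n = c")
    case True
    consider "n = 0" | "n = J" | "0 < n" "n < J" using nc by force
    then show ?thesis
    proof cases
      case 1 then show ?thesis using True eq F(1) assms(2) by (simp add: E_diag_def)
    next
      case 2
      have "J + J - 1 = 2 * J - 1" by simp
      then show ?thesis using 2 True eq F(2) assms(2) by simp
    next
      case 3 then show ?thesis using True eq F(3)[of n] by simp
    qed
  next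
    case False
    then show ?thesis using nc eq assms(2) by (auto simp: F_entry_support level_def)
  qed
qed (use assms in auto)

text \<open>
  The projection whose kernel is the symmetric part of \<open>\<complex>\<^sup>2 \<otimes> \<complex>\<^bsup>J\<^esup>\<close>, i.e. the image of \<open>E_mat\<close>.
\<close>

definition antisymmetrizer :: "complex \<Rightarrow> nat \<Rightarrow> complex mat" where
  "antisymmetrizer h J = 1\<^sub>m (2 * J) - E_mat h J * F_mat h J"

lemma antisymmetrizer_carrier[simp]:
  "antisymmetrizer h J \<in> carrier_mat (2 * J) (2 * J)" "dim_row (antisymmetrizer h J) = 2 * J" "dim_col (antisymmetrizer h J) = 2 * J"
  by (auto simp: antisymmetrizer_def)

lemma antisymmetrizer_E_mat:
  assumes "not_root_of_unity h" "J \<ge> 2"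
  shows "antisymmetrizer h J * E_mat h J = 0\<^sub>m (2 * J) (Suc J)"
proof -
  have "antisymmetrizer h J * E_mat h J = 1\<^sub>m (2 * J) * E_mat h J - (E_mat h J * F_mat h J) * E_mat h J"
    unfolding antisymmetrizer_def by (rule minus_mult_distrib_mat[of _ "2 * J" "2 * J"]) auto
  also have "(E_mat h J * F_mat h J) * E_mat h J = E_mat h J"
    using assoc_mult_mat[of "E_mat h J" "2 * J" "Suc J" "F_mat h J" "2 * J" "E_mat h J" "Suc J"]
      F_mat_E_mat[OF assms] by simp
  finally show ?thesis by simp
qed

lemma index_antisymmetrizer:
  assumes "not_root_of_unity h" "J \<ge> 2" "r < 2 * J" "s < 2 * J"
  shows "level J r \<noteq> level J s \<Longrightarrow> antisymmetrizer h J $$ (r, s) = 0"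
    "level J r = 0 \<Longrightarrow> antisymmetrizer h J $$ (r, s) = 0"
    "level J r = J \<Longrightarrow> antisymmetrizer h J $$ (r, s) = 0"
proof -
  have eq: "antisymmetrizer h J $$ (r, s) = (if r = s then 1 else 0)
      - (if r < J then E_diag h J r else E_off h J (r - J)) * F_mat h J $$ (level J r, s)"
    using assms index_E_mat_mult[of "F_mat h J" J r s h] by (simp add: antisymmetrizer_def del: index_mult_mat(1))
  have l: "level J r \<le> J" using assms(3) by (auto simp: level_def)
  show "antisymmetrizer h J $$ (r, s) = 0" if "level J r \<noteq> level J s"
    using that eq F_entry_support[of J "level J r" s h] assms l by auto
  note F = index_F_mat[OF assms(1,2)]
  show "antisymmetrizer h J $$ (r, s) = 0" if "level J r = 0"
  proof -
    have r: "r = 0" using that assms by (auto simp: level_def split: if_splits)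
    show ?thesis
    proof (cases "s = 0")
      case True
      then show ?thesis using eq r F(1) assms(2) by (simp add: level_def E_diag_def)
    next
      case False
      then have "level J s \<noteq> 0" using assms by (auto simp: level_def)
      then show ?thesis using eq r False F_entry_support[of J 0 s h] assms by (simp add: level_def)
    qed
  qed
  show "antisymmetrizer h J $$ (r, s) = 0" if "level J r = J"
  proof -
    have r: "r = 2 * J - 1" using that assms by (auto simp: level_def split: if_splits)
    then have r': "\<not> r < J" "r - J = J - 1" using assms(2) by auto
    show ?thesis
    proof (cases "s = 2 * J - 1")
      case True
      then show ?thesis using eq r r' F(2) that by (simp add: mult.commute)
    next
      case False
      then have "level J s \<noteq> J" using assms by (auto simp: level_def)
      then show ?thesis using eq r r' that False F_entry_support[of J J s h] assms by simp
    qed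
  qed
qed

lemma powi_nat:
  fixes h :: complex
  assumes "h \<noteq> 0"
  shows "h powi (1 - int (Suc n)) = inverse (h ^ n)" "h powi (int (Suc n) - 1) = h ^ n"
  using power_int_minus[of h "int n"] by (simp_all add: power_int_of_nat)

lemma qnum_eq':
  assumes "h \<noteq> 0" "p \<le> J"
  shows "qnum h (int J - int p) = ((h ^ J)\<^sup>2 / (h ^ p)\<^sup>2 - (h ^ p)\<^sup>2 / (h ^ J)\<^sup>2) / (h\<^sup>2 - inverse (h\<^sup>2))"
    "qnum h (int p) = ((h ^ p)\<^sup>2 - inverse ((h ^ p)\<^sup>2)) / (h\<^sup>2 - inverse (h\<^sup>2))"
    "qnum h (int p + 1) = ((h * h ^ p)\<^sup>2 - inverse ((h * h ^ p)\<^sup>2)) / (h\<^sup>2 - inverse (h\<^sup>2))"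
proof -
  have e: "h ^ (2 * m) = (h ^ m)\<^sup>2" for m by (simp add: power_mult mult.commute flip: power_mult)
  show "qnum h (int J - int p) = ((h ^ J)\<^sup>2 / (h ^ p)\<^sup>2 - (h ^ p)\<^sup>2 / (h ^ J)\<^sup>2) / (h\<^sup>2 - inverse (h\<^sup>2))"
    "qnum h (int p) = ((h ^ p)\<^sup>2 - inverse ((h ^ p)\<^sup>2)) / (h\<^sup>2 - inverse (h\<^sup>2))"
    using qnum_eq[OF assms] unfolding e by blast+
  have "int p + 1 = int (Suc p)" by simp
  then show "qnum h (int p + 1) = ((h * h ^ p)\<^sup>2 - inverse ((h * h ^ p)\<^sup>2)) / (h\<^sup>2 - inverse (h\<^sup>2))"
    using qnum_eq(2)[OF assms(1) le_refl, of "Suc p"] unfolding e power_Suc by (simp only:)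
qed

text \<open>
  The spin-\<open>(n+1)/2\<close> representation with parameter \<open>b\<close> is a submodule of the tensor product of those
  of spins \<open>1/2\<close> and \<open>n/2\<close>, for the coproduct as well as for the opposite coproduct, but with the
  parameters of the factors shifted in opposite directions.
\<close>

lemma intertwines_E_mat_coproduct:
  assumes q: "not_root_of_unity h" and n: "n \<ge> 1" and b: "b \<noteq> 0"
  shows "intertwines (E_mat h (Suc n)) (current h kp km (Suc n) b)
      (current h kp km 1 (b * h powi (1 - int (Suc n))) \<otimes>\<^sub>m 1\<^sub>m (Suc n)
        + cartan h 1 \<otimes>\<^sub>m current h kp km n (b * h))" (is ?coproduct)
    and "intertwines (E_mat h (Suc n)) (current h kp km (Suc n) b)
      (1\<^sub>m 2 \<otimes>\<^sub>m current h kp km n (b * inverse h)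
        + current h kp km 1 (b * h powi (int (Suc n) - 1)) \<otimes>\<^sub>m cartan h n)" (is ?opposite)
proof -
  have h0: "h \<noteq> 0" by (rule not_root_of_unity_nonzero[OF q])
  note d0 = not_root_of_unity_denominator(1)[OF q]
  define P where "P = h ^ n"
  have P0: "P \<noteq> 0" using h0 by (simp add: P_def)
  have hP: "h powi (- int n) = inverse P" by (simp add: P_def power_int_minus)
  let ?xu = "\<lambda>i. kp * b * h * (h * P / (h * h ^ i)\<^sup>2)"
  let ?xl = "\<lambda>i. km * inverse b * inverse h * (h * P / (h ^ i)\<^sup>2)"
  let ?yu = "\<lambda>a i. kp * a * h * (P / (h * h ^ i)\<^sup>2)"
  let ?yl = "\<lambda>a i. km * inverse a * inverse h * (P / (h ^ i)\<^sup>2)"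
  show ?coproduct unfolding coproduct_half(1)[OF q carrier_spin(6)]
  proof (rule intertwines_E_mat[OF q, where xu = ?xu and xl = ?xl
      and au = "\<lambda>i. h\<^sup>2 * ?yu (b * h) i" and al = "\<lambda>i. h\<^sup>2 * ?yl (b * h) i"
      and du = "\<lambda>i. inverse (h\<^sup>2) * ?yu (b * h) i" and dl = "\<lambda>i. inverse (h\<^sup>2) * ?yl (b * h) i"
      and b = "\<lambda>i. kp * (b * inverse P)" and c = "\<lambda>i. km * inverse (b * inverse P)"])
    show "?xu i * qnum h (int (Suc n) - int i)
        = h\<^sup>2 * ?yu (b * h) i * qnum h (int (Suc n - 1) - int i) + kp * (b * inverse P)"
      if "i < Suc n" for i
      using that h0 P0 d0 b qnum_eq'(1)[OF h0, of i n] qnum_eq'(1)[OF h0, of i "Suc n"]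
      by (simp add: P_def[symmetric]) (simp add: field_simps power2_eq_square)
    show "?xl i * qnum h (int i + 1) = km * inverse (b * inverse P)
        + (if 0 < i then inverse (h\<^sup>2) * ?yl (b * h) (i - 1) * qnum h (int i) else 0)" if "i < Suc n" for i
      using that h0 P0 d0 b qnum_eq'(2)[OF h0, of i n] qnum_eq'(3)[OF h0, of i n]
      by (cases i) (simp_all add: P_def[symmetric], simp_all add: field_simps power2_eq_square)
  qed (use h0 b n in \<open>simp_all add: index_current_power[OF h0] powi_nat[OF h0] hP P_def[symmetric]
      field_simps power2_eq_square\<close>)
  show ?opposite unfolding coproduct_half(2)[OF q carrier_spin(6) carrier_spin(5)]
  proof (rule intertwines_E_mat[OF q, where xu = ?xu and xl = ?xl
      and au = "?yu (b * inverse h)" and al = "?yl (b * inverse h)"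
      and du = "?yu (b * inverse h)" and dl = "?yl (b * inverse h)"
      and b = "\<lambda>i. kp * (b * P) * (P / (h ^ i)\<^sup>2)\<^sup>2" and c = "\<lambda>i. km * inverse (b * P) * (P / (h ^ i)\<^sup>2)\<^sup>2"])
    show "?xu i * qnum h (int (Suc n) - int i)
        = ?yu (b * inverse h) i * qnum h (int (Suc n - 1) - int i) + kp * (b * P) * (P / (h ^ i)\<^sup>2)\<^sup>2"
      if "i < Suc n" for i
      using that h0 P0 d0 b qnum_eq'(1)[OF h0, of i n] qnum_eq'(1)[OF h0, of i "Suc n"]
      by (simp add: P_def[symmetric]) (simp add: field_simps power2_eq_square)
    show "?xl i * qnum h (int i + 1) = km * inverse (b * P) * (P / (h ^ i)\<^sup>2)\<^sup>2
        + (if 0 < i then ?yl (b * inverse h) (i - 1) * qnum h (int i) else 0)" if "i < Suc n" for i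
      using that h0 P0 d0 b qnum_eq'(2)[OF h0, of i n] qnum_eq'(3)[OF h0, of i n]
      by (cases i) (simp_all add: P_def[symmetric], simp_all add: field_simps power2_eq_square)
  qed (use h0 b n in \<open>simp_all add: index_current_power[OF h0] index_cartan_power[OF h0] powi_nat[OF h0] hP P_def[symmetric]
      field_simps power2_eq_square\<close>)
qed

lemma index_cartan_kron:
  assumes "not_root_of_unity h" "r < 2 * Suc n" "s < 2 * Suc n"
  shows "(cartan h 1 \<otimes>\<^sub>m cartan h n) $$ (r, s) =
    (if r = s then h powi (2 * int (Suc n) - 4 * int (level (Suc n) r)) else 0)"
proof -
  have h0: "h \<noteq> 0" by (rule not_root_of_unity_nonzero[OF assms(1)])
  have 1: "h\<^sup>2 * h powi (2 * int n - 4 * int r) = h powi (2 * int (Suc n) - 4 * int r)"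
    using power_int_add[of h 2 "2 * int n - 4 * int r"] h0 by (simp add: algebra_simps)
  have "inverse (h\<^sup>2) * h powi (2 * int n - 4 * int (r - Suc n)) = h powi (2 * int (Suc n) - 4 * int (Suc r - Suc n))"
    if "\<not> r < Suc n"
  proof -
    have e: "2 * int (Suc n) - 4 * int (Suc r - Suc n) = - 2 + (2 * int n - 4 * int (r - Suc n))"
      using that by (simp add: of_nat_diff algebra_simps)
    have "h powi (2 * int (Suc n) - 4 * int (Suc r - Suc n))
        = h powi (- 2) * h powi (2 * int n - 4 * int (r - Suc n))"
      unfolding e by (rule power_int_add) (use h0 in simp)
    then show ?thesis by (simp only:) (simp add: power_int_minus)
  qed
  then show ?thesis
    using 1 assms(2,3) unfolding coproduct_half(3)[OF assms(1) carrier_spin(5)]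
    by (auto simp: index_cartan level_def)
qed

lemma intertwines_E_mat_cartan:
  assumes "not_root_of_unity h" "n \<ge> 1"
  shows "intertwines (E_mat h (Suc n)) (cartan h (Suc n)) (cartan h 1 \<otimes>\<^sub>m cartan h n)"
proof (rule intertwinesI[of _ "2 * Suc n" "Suc (Suc n)"])
  let ?G = "cartan h 1 \<otimes>\<^sub>m cartan h n"
  show G: "?G \<in> carrier_mat (2 * Suc n) (2 * Suc n)" by auto
  show "E_mat h (Suc n) * cartan h (Suc n) = ?G * E_mat h (Suc n)"
  proof (rule eq_matI)
    fix r c assume "r < dim_row (?G * E_mat h (Suc n))" "c < dim_col (?G * E_mat h (Suc n))"
    then have rc: "r < 2 * Suc n" "c \<le> Suc n" by auto
    have "(E_mat h (Suc n) * cartan h (Suc n)) $$ (r, c)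
        = E_mat h (Suc n) $$ (r, c) * h powi (2 * int (Suc n) - 4 * int c)"
      using rc by (subst index_mult_diag_right[where n = "Suc (Suc n)"]) (auto simp: index_cartan)
    moreover have "(?G * E_mat h (Suc n)) $$ (r, c)
        = h powi (2 * int (Suc n) - 4 * int (level (Suc n) r)) * E_mat h (Suc n) $$ (r, c)"
      using rc G by (subst index_mult_diag_left[where n = "2 * Suc n"]) (auto simp: index_cartan_kron[OF assms(1), unfolded One_nat_def])
    ultimately show "(E_mat h (Suc n) * cartan h (Suc n)) $$ (r, c) = (?G * E_mat h (Suc n)) $$ (r, c)"
      using rc by (simp add: index_E_mat del: index_mult_mat(1))
  qed auto
qed auto

lemma intertwines_F_mat_cartan:
  assumes "not_root_of_unity h" "n \<ge> 1"
  shows "intertwines (F_mat h (Suc n)) (cartan h 1 \<otimes>\<^sub>m cartan h n) (cartan h (Suc n))"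
proof (rule intertwinesI[of _ "Suc (Suc n)" "2 * Suc n"])
  let ?G = "cartan h 1 \<otimes>\<^sub>m cartan h n"
  show G: "?G \<in> carrier_mat (2 * Suc n) (2 * Suc n)" by auto
  show "F_mat h (Suc n) * ?G = cartan h (Suc n) * F_mat h (Suc n)"
  proof (rule eq_matI)
    fix c r assume "c < dim_row (cartan h (Suc n) * F_mat h (Suc n))" "r < dim_col (cartan h (Suc n) * F_mat h (Suc n))"
    then have rc: "r < 2 * Suc n" "c \<le> Suc n" by auto
    have "(cartan h (Suc n) * F_mat h (Suc n)) $$ (c, r)
        = h powi (2 * int (Suc n) - 4 * int c) * F_mat h (Suc n) $$ (c, r)"
      using rc by (subst index_mult_diag_left[where n = "Suc (Suc n)"]) (auto simp: index_cartan)
    moreover have "(F_mat h (Suc n) * ?G) $$ (c, r)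
        = F_mat h (Suc n) $$ (c, r) * h powi (2 * int (Suc n) - 4 * int (level (Suc n) r))"
      using rc G by (subst index_mult_diag_right[where n = "2 * Suc n"]) (auto simp: index_cartan_kron[OF assms(1), unfolded One_nat_def])
    ultimately show "(F_mat h (Suc n) * ?G) $$ (c, r) = (cartan h (Suc n) * F_mat h (Suc n)) $$ (c, r)"
      using rc F_entry_support[of "Suc n" c r h] by (cases "c = level (Suc n) r") (simp_all del: index_mult_mat(1))
  qed auto
qed auto

section \<open>Laurent polynomial dependence on a parameter\<close>

text \<open>Laurent polynomial functions of a nonzero complex argument.\<close>

definition laurent :: "(complex \<Rightarrow> complex) \<Rightarrow> bool" where
  "laurent f \<longleftrightarrow> (\<exists>n p. \<forall>z. z \<noteq> 0 \<longrightarrow> f z * z ^ n = poly p z)"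

lemma laurent_const: "laurent (\<lambda>_. c)"
  unfolding laurent_def by (rule exI[of _ 0], rule exI[of _ "[:c:]"]) simp

lemma laurent_ident: "laurent (\<lambda>z. z)"
  unfolding laurent_def by (rule exI[of _ 0], rule exI[of _ "[:0, 1:]"]) simp

lemma laurent_inverse: "laurent (\<lambda>z. inverse z)"
  unfolding laurent_def by (rule exI[of _ 1], rule exI[of _ "[:1:]"]) simp

lemma laurent_add:
  assumes "laurent f" "laurent g"
  shows "laurent (\<lambda>z. f z + g z)"
proof -
  from assms obtain n p m r where *: "\<And>z. z \<noteq> 0 \<Longrightarrow> f z * z ^ n = poly p z"
    "\<And>z. z \<noteq> 0 \<Longrightarrow> g z * z ^ m = poly r z" unfolding laurent_def by metis
  have "(f z + g z) * z ^ (n + m) = poly (p * monom 1 m + r * monom 1 n) z" if "z \<noteq> 0" for z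
  proof -
    have "(f z + g z) * z ^ (n + m) = (f z * z ^ n) * z ^ m + (g z * z ^ m) * z ^ n"
      by (simp add: power_add algebra_simps)
    then show ?thesis using *[OF that] by (simp add: poly_monom)
  qed
  then show ?thesis unfolding laurent_def by blast
qed

lemma laurent_mult:
  assumes "laurent f" "laurent g"
  shows "laurent (\<lambda>z. f z * g z)"
proof -
  from assms obtain n p m r where *: "\<And>z. z \<noteq> 0 \<Longrightarrow> f z * z ^ n = poly p z"
    "\<And>z. z \<noteq> 0 \<Longrightarrow> g z * z ^ m = poly r z" unfolding laurent_def by metis
  have "(f z * g z) * z ^ (n + m) = poly (p * r) z" if "z \<noteq> 0" for z
  proof -
    have "(f z * g z) * z ^ (n + m) = (f z * z ^ n) * (g z * z ^ m)"
      by (simp add: power_add algebra_simps)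
    then show ?thesis using *[OF that] by simp
  qed
  then show ?thesis unfolding laurent_def by blast
qed

lemma laurent_diff:
  assumes "laurent f" "laurent g"
  shows "laurent (\<lambda>z. f z - g z)"
  using laurent_add[OF assms(1) laurent_mult[OF laurent_const[of "-1"] assms(2)]] by simp

lemma laurent_sum:
  assumes "\<And>i. i \<in> S \<Longrightarrow> laurent (f i)"
  shows "laurent (\<lambda>z. \<Sum>i\<in>S. f i z)"
  using assms by (induction S rule: infinite_finite_induct) (simp_all add: laurent_const laurent_add)

lemma laurent_prod:
  assumes "\<And>i. i \<in> S \<Longrightarrow> laurent (f i)"
  shows "laurent (\<lambda>z. \<Prod>i\<in>S. f i z)"
  using assms by (induction S rule: infinite_finite_induct) (simp_all add: laurent_const laurent_mult)

lemma laurent_eq_zero: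
  assumes "laurent f" "finite S" "\<And>z. z \<noteq> 0 \<Longrightarrow> z \<notin> S \<Longrightarrow> f z = 0" "z \<noteq> 0"
  shows "f z = 0"
proof -
  from assms(1) obtain n p where *: "\<And>z. z \<noteq> 0 \<Longrightarrow> f z * z ^ n = poly p z"
    unfolding laurent_def by metis
  have "p = 0"
  proof (rule ccontr)
    assume "p \<noteq> 0"
    then have "finite {z. poly p z = 0}" by (rule poly_roots_finite)
    then have "finite ({z. poly p z = 0} \<union> S \<union> {0})" using assms(2) by simp
    moreover have "z \<in> {z. poly p z = 0} \<union> S \<union> {0}" for z :: complex
      using *[of z] assms(3)[of z] by auto
    ultimately have "finite (UNIV :: complex set)" by (metis UNIV_eq_I)
    then show False using infinite_UNIV_char_0 by blast
  qed
  then show ?thesis using *[OF assms(4)] assms(4) by simp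
qed

text \<open>
  Matrices of a fixed size whose entries are Laurent polynomials in the parameter.
\<close>

definition laurent_mat :: "nat \<Rightarrow> nat \<Rightarrow> (complex \<Rightarrow> complex mat) \<Rightarrow> bool" where
  "laurent_mat m n A \<longleftrightarrow> (\<forall>z. A z \<in> carrier_mat m n) \<and> (\<forall>i<m. \<forall>j<n. laurent (\<lambda>z. A z $$ (i, j)))"

lemma laurent_matI:
  assumes "\<And>z. A z \<in> carrier_mat m n" "\<And>i j. i < m \<Longrightarrow> j < n \<Longrightarrow> laurent (\<lambda>z. A z $$ (i, j))"
  shows "laurent_mat m n A"
  using assms by (auto simp: laurent_mat_def)

lemma laurent_matD:
  assumes "laurent_mat m n A"
  shows "A z \<in> carrier_mat m n" "i < m \<Longrightarrow> j < n \<Longrightarrow> laurent (\<lambda>z. A z $$ (i, j))"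
  using assms by (auto simp: laurent_mat_def)

lemma laurent_mat_const:
  assumes "A \<in> carrier_mat m n"
  shows "laurent_mat m n (\<lambda>_. A)"
  using assms by (auto simp: laurent_mat_def laurent_const)

lemma laurent_mat_mult:
  assumes "laurent_mat m n A" "laurent_mat n k B"
  shows "laurent_mat m k (\<lambda>z. A z * B z)"
proof (rule laurent_matI)
  fix z show "A z * B z \<in> carrier_mat m k"
    using laurent_matD(1)[OF assms(1)] laurent_matD(1)[OF assms(2)] by (rule mult_carrier_mat)
next
  fix i j assume ij: "i < m" "j < k"
  have "(\<lambda>z. (A z * B z) $$ (i, j)) = (\<lambda>z. \<Sum>s<n. A z $$ (i, s) * B z $$ (s, j))"
    using ij by (auto simp: fun_eq_iff scalar_prod_def lessThan_atLeast0 carrier_matD[OF laurent_matD(1)[OF assms(1)]] carrier_matD[OF laurent_matD(1)[OF assms(2)]])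
  moreover have "laurent (\<lambda>z. \<Sum>s<n. A z $$ (i, s) * B z $$ (s, j))"
    by (rule laurent_sum, rule laurent_mult)
      (use ij laurent_matD(2)[OF assms(1)] laurent_matD(2)[OF assms(2)] in simp_all)
  ultimately show "laurent (\<lambda>z. (A z * B z) $$ (i, j))" by simp
qed

lemma laurent_mat_smult:
  assumes "laurent f" "laurent_mat m n A"
  shows "laurent_mat m n (\<lambda>z. f z \<cdot>\<^sub>m A z)"
proof (rule laurent_matI)
  fix i j assume ij: "i < m" "j < n"
  have "(\<lambda>z. (f z \<cdot>\<^sub>m A z) $$ (i, j)) = (\<lambda>z. f z * A z $$ (i, j))"
    using ij by (auto simp: fun_eq_iff carrier_matD[OF laurent_matD(1)[OF assms(2)]])
  then show "laurent (\<lambda>z. (f z \<cdot>\<^sub>m A z) $$ (i, j))"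
    using ij assms(1) laurent_matD(2)[OF assms(2)] by (simp add: laurent_mult)
qed (use assms in \<open>auto simp: laurent_mat_def\<close>)

lemma laurent_mat_kron:
  assumes "laurent_mat m n A" "laurent_mat k l B"
  shows "laurent_mat (m * k) (n * l) (\<lambda>z. A z \<otimes>\<^sub>m B z)"
proof (rule laurent_matI)
  fix z show "A z \<otimes>\<^sub>m B z \<in> carrier_mat (m * k) (n * l)" using assms by (auto simp: laurent_mat_def)
next
  fix i j assume ij: "i < m * k" "j < n * l"
  have "(\<lambda>z. (A z \<otimes>\<^sub>m B z) $$ (i, j)) = (\<lambda>z. A z $$ (i div k, j div l) * B z $$ (i mod k, j mod l))"
    using ij by (auto simp: fun_eq_iff index_kron' carrier_matD[OF laurent_matD(1)[OF assms(1)]] carrier_matD[OF laurent_matD(1)[OF assms(2)]])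
  then show "laurent (\<lambda>z. (A z \<otimes>\<^sub>m B z) $$ (i, j))"
    using div_mod_less[OF ij(1)] div_mod_less[OF ij(2)]
      laurent_matD(2)[OF assms(1)] laurent_matD(2)[OF assms(2)] by (simp add: laurent_mult)
qed

lemma laurent_mat_sandwich:
  assumes "laurent_mat (d * e) (d * e) A" "C \<in> carrier_mat D D"
  shows "laurent_mat (d * D * e) (d * D * e) (\<lambda>z. sandwich d e C (A z))"
proof (rule laurent_matI)
  fix z show "sandwich d e C (A z) \<in> carrier_mat (d * D * e) (d * D * e)"
    using assms(2) by (auto intro!: carrier_matI)
next
  fix i j assume ij: "i < d * D * e" "j < d * D * e"
  show "laurent (\<lambda>z. sandwich d e C (A z) $$ (i, j))"
    using ij sandwich_index_less[OF ij(1)] sandwich_index_less[OF ij(2)] assms(2)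
      laurent_matD(2)[OF assms(1)] by (simp add: sandwich_def laurent_mult laurent_const)
qed

lemma laurent_mat_four_block:
  assumes "laurent_mat n n A" "laurent_mat n n B" "laurent_mat n n C" "laurent_mat n n D"
  shows "laurent_mat (n + n) (n + n) (\<lambda>z. four_block_mat (A z) (B z) (C z) (D z))"
proof (rule laurent_matI)
  fix z show "four_block_mat (A z) (B z) (C z) (D z) \<in> carrier_mat (n + n) (n + n)"
    using assms by (auto simp: laurent_mat_def)
next
  fix i j assume ij: "i < n + n" "j < n + n"
  have "(\<lambda>z. four_block_mat (A z) (B z) (C z) (D z) $$ (i, j)) =
    (\<lambda>z. if i < n then if j < n then A z $$ (i, j) else B z $$ (i, j - n)
       else if j < n then C z $$ (i - n, j) else D z $$ (i - n, j - n))"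
    using ij by (auto simp: fun_eq_iff assms[THEN laurent_matD(1), THEN carrier_matD(1)]
        assms[THEN laurent_matD(1), THEN carrier_matD(2)])
  then show "laurent (\<lambda>z. four_block_mat (A z) (B z) (C z) (D z) $$ (i, j))"
    using ij assms[THEN laurent_matD(2), of "if i < n then i else i - n" "if j < n then j else j - n"] by (cases "i < n"; cases "j < n") simp_all
qed

lemma laurent_mat_exponent:
  assumes "laurent_mat m n A"
  shows "\<exists>N P. \<forall>i<m. \<forall>j<n. \<forall>z. z \<noteq> 0 \<longrightarrow> A z $$ (i, j) * z ^ N = poly (P i j) z"
proof -
  have "\<forall>i j. \<exists>N p. i < m \<and> j < n \<longrightarrow> (\<forall>z. z \<noteq> 0 \<longrightarrow> A z $$ (i, j) * z ^ N = poly p z)"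
    using laurent_matD(2)[OF assms] by (auto simp: laurent_def)
  then obtain N p where *: "\<And>i j z. i < m \<Longrightarrow> j < n \<Longrightarrow> z \<noteq> 0 \<Longrightarrow> A z $$ (i, j) * z ^ N i j = poly (p i j) z"
    by metis
  define L where "L = (\<Sum>i<m. \<Sum>j<n. N i j)"
  have L: "N i j \<le> L" if "i < m" "j < n" for i j
  proof -
    have "N i j \<le> (\<Sum>j<n. N i j)" using that by (intro member_le_sum) auto
    also have "\<dots> \<le> L" unfolding L_def using that by (intro member_le_sum) auto
    finally show ?thesis .
  qed
  have "A z $$ (i, j) * z ^ L = poly (p i j * monom 1 (L - N i j)) z"
    if "i < m" "j < n" "z \<noteq> 0" for i j z
  proof -
    have "z ^ L = z ^ N i j * z ^ (L - N i j)" using L[OF that(1,2)] by (simp flip: power_add)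
    then have "A z $$ (i, j) * z ^ L = (A z $$ (i, j) * z ^ N i j) * z ^ (L - N i j)" by simp
    then show ?thesis using *[OF that] by (simp add: poly_monom)
  qed
  then show ?thesis
    by (intro exI[of _ L] exI[of _ "\<lambda>i j. p i j * monom 1 (L - N i j)"]) simp
qed

lemma coeff_shift:
  fixes p :: "complex poly"
  shows "coeff (p * [:c, b, a:]) (Suc (Suc d)) = coeff p d * a + coeff p (Suc d) * b + coeff p (Suc (Suc d)) * c"
  by (simp add: algebra_simps)

text \<open>
  The coefficient matrix \<open>T\<close> of the highest power of \<open>z\<close> in a nonzero Laurent polynomial matrix \<open>M\<close>
  inherits every intertwining relation of \<open>M\<close> with the operators linear in \<open>z\<close> and \<open>z\<^sup>-\<^sup>1\<close>, with only
  the coefficients of \<open>z\<close> retained.  It is chosen before the relations, so that several of them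
  can be used for the same \<open>T\<close>.
\<close>

lemma laurent_mat_leading:
  assumes M: "laurent_mat m n M" and "i0 < m" "j0 < n" "z0 \<noteq> 0" "M z0 $$ (i0, j0) \<noteq> 0"
  obtains T where "T \<in> carrier_mat m n" "T \<noteq> 0\<^sub>m m n"
    "\<And>X X0 X' Y Y0 Y' :: complex mat. X \<in> carrier_mat n n \<Longrightarrow> X0 \<in> carrier_mat n n \<Longrightarrow> X' \<in> carrier_mat n n \<Longrightarrow>
      Y \<in> carrier_mat m m \<Longrightarrow> Y0 \<in> carrier_mat m m \<Longrightarrow> Y' \<in> carrier_mat m m \<Longrightarrow>
      (\<And>z. z \<noteq> 0 \<Longrightarrow> M z * (z \<cdot>\<^sub>m X + X0 + inverse z \<cdot>\<^sub>m X') = (z \<cdot>\<^sub>m Y + Y0 + inverse z \<cdot>\<^sub>m Y') * M z) \<Longrightarrow>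
      T * X = Y * T"
proof -
  obtain N P where P: "\<And>i j z. i < m \<Longrightarrow> j < n \<Longrightarrow> z \<noteq> 0 \<Longrightarrow> M z $$ (i, j) * z ^ N = poly (P i j) z"
    using laurent_mat_exponent[OF M] by blast
  define S where "S = {k. \<exists>i<m. \<exists>j<n. coeff (P i j) k \<noteq> 0}"
  have "S \<subseteq> (\<Union>i<m. \<Union>j<n. {..degree (P i j)})"
    by (auto simp: S_def dest: le_degree)
  then have fin: "finite S" by (rule finite_subset) auto
  have "poly (P i0 j0) z0 \<noteq> 0" using P[of i0 j0 z0] assms by auto
  then have "P i0 j0 \<noteq> 0" by auto
  then have "coeff (P i0 j0) (degree (P i0 j0)) \<noteq> 0" by simp
  then have "degree (P i0 j0) \<in> S" using assms(2,3) unfolding S_def by blast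
  then have "S \<noteq> {}" by blast
  define d where "d = Max S"
  have dS: "d \<in> S" using Max_in[OF fin \<open>S \<noteq> {}\<close>] by (simp add: d_def)
  have above: "coeff (P i j) k = 0" if "k > d" "i < m" "j < n" for i j k
    using that Max_ge[OF fin, of k] by (fastforce simp: S_def d_def)
  define T where "T = mat m n (\<lambda>(i, j). coeff (P i j) d)"
  show ?thesis
  proof (rule that[of T])
    show T: "T \<in> carrier_mat m n" by (simp add: T_def)
    show "T \<noteq> 0\<^sub>m m n"
    proof
      assume "T = 0\<^sub>m m n"
      moreover obtain i j where "i < m" "j < n" "coeff (P i j) d \<noteq> 0" using dS by (auto simp: S_def)
      ultimately show False by (auto simp: T_def dest!: arg_cong[where f = "\<lambda>A. A $$ (i, j)"])
    qed
    fix X X0 X' Y Y0 Y' :: "complex mat"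
    assume c: "X \<in> carrier_mat n n" "X0 \<in> carrier_mat n n" "X' \<in> carrier_mat n n"
      "Y \<in> carrier_mat m m" "Y0 \<in> carrier_mat m m" "Y' \<in> carrier_mat m m"
    assume eq: "\<And>z. z \<noteq> 0 \<Longrightarrow> M z * (z \<cdot>\<^sub>m X + X0 + inverse z \<cdot>\<^sub>m X')
      = (z \<cdot>\<^sub>m Y + Y0 + inverse z \<cdot>\<^sub>m Y') * M z"
    show "T * X = Y * T"
    proof (rule eq_matI)
      fix i j assume "i < dim_row (Y * T)" "j < dim_col (Y * T)"
      then have ij: "i < m" "j < n" using c T by auto
      \<comment> \<open>Multiplication by \<open>z\<close> turns the coefficients of the relation into quadratic polynomials.\<close>
      let ?px = "\<lambda>s. [:X' $$ (s, j), X0 $$ (s, j), X $$ (s, j):]"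
        and ?py = "\<lambda>s. [:Y' $$ (i, s), Y0 $$ (i, s), Y $$ (i, s):]"
      have shift: "z * (z * a + b + inverse z * c) = poly [:c, b, a:] z" if "z \<noteq> 0" for z a b c :: complex
        using that by (simp add: algebra_simps)
      have key: "poly (\<Sum>s<n. P i s * ?px s) z = poly (\<Sum>s<m. ?py s * P s j) z" if "z \<noteq> 0" for z
      proof -
        note Mc = laurent_matD(1)[OF M, of z]
        have "z * z ^ N * (M z * (z \<cdot>\<^sub>m X + X0 + inverse z \<cdot>\<^sub>m X')) $$ (i, j)
            = z * z ^ N * (\<Sum>s<n. M z $$ (i, s) * (z * X $$ (s, j) + X0 $$ (s, j) + inverse z * X' $$ (s, j)))"
          using Mc c ij by (simp add: scalar_prod_def lessThan_atLeast0)
        also have "\<dots> = (\<Sum>s<n. (M z $$ (i, s) * z ^ N) * (z * (z * X $$ (s, j) + X0 $$ (s, j) + inverse z * X' $$ (s, j))))"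
          by (simp only: sum_distrib_left mult_ac)
        also have "\<dots> = (\<Sum>s<n. poly (P i s) z * poly (?px s) z)"
          using ij that by (intro sum.cong refl) (simp only: P lessThan_iff shift[OF that] simp_thms)
        finally have l: "z * z ^ N * (M z * (z \<cdot>\<^sub>m X + X0 + inverse z \<cdot>\<^sub>m X')) $$ (i, j)
          = poly (\<Sum>s<n. P i s * ?px s) z" by (simp only: poly_sum poly_mult)
        have "z * z ^ N * ((z \<cdot>\<^sub>m Y + Y0 + inverse z \<cdot>\<^sub>m Y') * M z) $$ (i, j)
            = z * z ^ N * (\<Sum>s<m. (z * Y $$ (i, s) + Y0 $$ (i, s) + inverse z * Y' $$ (i, s)) * M z $$ (s, j))"
          using Mc c ij by (simp add: scalar_prod_def lessThan_atLeast0)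
        also have "\<dots> = (\<Sum>s<m. (z * (z * Y $$ (i, s) + Y0 $$ (i, s) + inverse z * Y' $$ (i, s))) * (M z $$ (s, j) * z ^ N))"
          by (simp only: sum_distrib_left mult_ac)
        also have "\<dots> = (\<Sum>s<m. poly (?py s) z * poly (P s j) z)"
          using ij that by (intro sum.cong refl) (simp only: P lessThan_iff shift[OF that] simp_thms)
        finally have r: "z * z ^ N * ((z \<cdot>\<^sub>m Y + Y0 + inverse z \<cdot>\<^sub>m Y') * M z) $$ (i, j)
          = poly (\<Sum>s<m. ?py s * P s j) z" by (simp only: poly_sum poly_mult)
        show ?thesis unfolding l[symmetric] r[symmetric] eq[OF that] ..
      qed
      have "(\<Sum>s<n. P i s * ?px s) = (\<Sum>s<m. ?py s * P s j)" (is "?l = ?r")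
      proof (rule ccontr)
        assume "?l \<noteq> ?r"
        then have "finite {z. poly (?l - ?r) z = 0}" by (intro poly_roots_finite) simp
        moreover have "UNIV \<subseteq> insert 0 {z. poly (?l - ?r) z = 0}" using key by auto
        ultimately have "finite (UNIV :: complex set)" by (meson finite.insertI finite_subset)
        then show False using infinite_UNIV_char_0 by blast
      qed
      \<comment> \<open>In degree \<open>d + 2\<close> only the coefficients of degree \<open>d\<close> of \<open>P\<close> contribute.\<close>
      then have "coeff ?l (Suc (Suc d)) = coeff ?r (Suc (Suc d))" by simp
      moreover have "coeff ?l (Suc (Suc d)) = (\<Sum>s<n. coeff (P i s) d * X $$ (s, j))"
        unfolding coeff_sum by (intro sum.cong refl) (use above ij in \<open>simp add: coeff_shift\<close>)
      moreover have "coeff ?r (Suc (Suc d)) = (\<Sum>s<m. Y $$ (i, s) * coeff (P s j) d)"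
        unfolding coeff_sum by (intro sum.cong refl) (use above ij in \<open>simp add: coeff_shift mult.commute[of "pCons _ _"]\<close>)
      ultimately show "(T * X) $$ (i, j) = (Y * T) $$ (i, j)"
        using ij c by (simp add: T_def scalar_prod_def lessThan_atLeast0)
    qed (use c T in auto)
  qed
qed

section \<open>Fused R-matrices\<close>

lemma mat_add_assoc:
  fixes A B C :: "'a::semigroup_add mat"
  assumes "dim_row B = dim_row C" "dim_col B = dim_col C"
  shows "A + (B + C) = (A + B) + C"
  by (rule eq_matI) (use assms in \<open>auto simp: add.assoc\<close>)

lemma intertwines_minus_left:
  fixes A B :: "'a::ring mat"
  assumes "intertwines A X Y" "intertwines B X Y"
  shows "intertwines (A - B) X Y"
proof -
  note a = intertwinesD[OF assms(1)] and b = intertwinesD[OF assms(2)]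
  have c: "A \<in> carrier_mat (dim_row B) (dim_col B)" "B \<in> carrier_mat (dim_row B) (dim_col B)"
    using carrier_matD[OF a(2)] carrier_matD[OF b(2)] carrier_matD[OF a(3)] carrier_matD[OF b(3)] by auto
  have "(A - B) * X = A * X - B * X" by (rule minus_mult_distrib_mat[OF c b(2)])
  also have "\<dots> = Y * (A - B)"
    unfolding mult_minus_distrib_mat[OF b(3) c] a(1) b(1) ..
  finally have "(A - B) * X = Y * (A - B)" .
  then show ?thesis using b by (simp add: intertwines_def)
qed

text \<open>An intertwiner into a larger space whose image lies in the image of \<open>E\<close> descends along \<open>E\<close>.\<close>

lemma intertwines_descend:
  fixes W E F :: "'a::semiring_1 mat"
  assumes "intertwines W s T" "intertwines E t T" "F * E = 1\<^sub>m (dim_col E)" "E * (F * W) = W"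
    "F \<in> carrier_mat (dim_col E) (dim_row E)"
  shows "intertwines (F * W) s t"
proof -
  note w = intertwinesD[OF assms(1)] and e = intertwinesD[OF assms(2)]
  define m where "m = dim_row E"
  define n where "n = dim_col E"
  define k where "k = dim_col W"
  have E: "E \<in> carrier_mat m n" by (auto simp: m_def n_def)
  have T: "T \<in> carrier_mat m m" using e by (simp add: m_def)
  have W: "W \<in> carrier_mat m k" using w(3) T by (auto simp: k_def)
  have t: "t \<in> carrier_mat n n" using e by (simp add: n_def)
  have s: "s \<in> carrier_mat k k" using w by (simp add: k_def)
  have F: "F \<in> carrier_mat n m" using assms(5) by (simp add: m_def n_def)
  have "(F * W) * s = F * (T * W)" using assoc_mult_mat[OF F W s] w(1) by simp
  also have "\<dots> = F * (T * (E * (F * W)))" using assms(4) by simp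
  also have "T * (E * (F * W)) = (E * t) * (F * W)"
    using assoc_mult_mat[OF T E, of "F * W" k] F W e(1) by simp
  also have "F * \<dots> = (F * (E * t)) * (F * W)"
    using assoc_mult_mat[of F n m "E * t" n "F * W" k] F W E t by simp
  also have "F * (E * t) = t" using assoc_mult_mat[OF F E t] assms(3) t by (simp add: n_def)
  finally show ?thesis using F W s t by (auto simp: intertwines_def)
qed

text \<open>
  For an operator \<open>X\<close> that preserves the image of \<open>E_mat\<close>, the antisymmetrizer \<open>P\<close> satisfies
  \<open>P X = P X P\<close>.
\<close>

lemma intertwines_antisymmetrizer:
  assumes "not_root_of_unity h" "J \<ge> 2" "intertwines (E_mat h J) x X"
  shows "intertwines (antisymmetrizer h J) X (antisymmetrizer h J * X)"
proof -
  note e = intertwinesD[OF assms(3)]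
  let ?P = "antisymmetrizer h J" and ?E = "E_mat h J" and ?F = "F_mat h J"
  have P: "?P \<in> carrier_mat (2 * J) (2 * J)" and E: "?E \<in> carrier_mat (2 * J) (Suc J)"
    and F: "?F \<in> carrier_mat (Suc J) (2 * J)" by simp_all
  have X: "X \<in> carrier_mat (2 * J) (2 * J)" and x: "x \<in> carrier_mat (Suc J) (Suc J)" using e by auto
  have PX: "?P * X \<in> carrier_mat (2 * J) (2 * J)" by (rule mult_carrier_mat[OF P X])
  have EF: "?E * ?F \<in> carrier_mat (2 * J) (2 * J)" by (rule mult_carrier_mat[OF E F])
  have "(?P * X) * (?E * ?F) = ((?P * X) * ?E) * ?F" by (rule assoc_mult_mat[OF PX E F, symmetric])
  also have "(?P * X) * ?E = ?P * (?E * x)" using assoc_mult_mat[OF P X E] e(1) by simp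
  also have "\<dots> = (?P * ?E) * x" by (rule assoc_mult_mat[OF P E x, symmetric])
  also have "\<dots> = 0\<^sub>m (2 * J) (Suc J)" using antisymmetrizer_E_mat[OF assms(1,2)] x by simp
  finally have 0: "(?P * X) * (?E * ?F) = 0\<^sub>m (2 * J) (2 * J)" using F by simp
  have "(?P * X) * ?P = (?P * X) * 1\<^sub>m (2 * J) - (?P * X) * (?E * ?F)"
    unfolding antisymmetrizer_def[of h J] using mult_minus_distrib_mat[OF _ one_carrier_mat EF] PX
    by (metis antisymmetrizer_def)
  also have "\<dots> = ?P * X" using 0 PX by (auto intro!: eq_matI)
  finally have e: "(?P * X) * ?P = ?P * X" .
  show ?thesis by (rule intertwinesI[OF P X PX]) (simp only: e)
qed

lemma intertwines_antisymmetrizer_cartan: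
  assumes "not_root_of_unity h" "n \<ge> 1"
  shows "intertwines (antisymmetrizer h (Suc n)) (cartan h 1 \<otimes>\<^sub>m cartan h n) (cartan h 1 \<otimes>\<^sub>m cartan h n)"
  unfolding antisymmetrizer_def
  by (rule intertwines_minus_left, rule intertwines_one_left,
      use carrier_spin(5)[of h 1] carrier_spin(5)[of h n] in \<open>fastforce simp: numeral_2_eq_2\<close>,
      rule intertwines_comp[OF intertwines_F_mat_cartan[OF assms] intertwines_E_mat_cartan[OF assms]])

lemma antisymmetrizer_plus: "antisymmetrizer h J + E_mat h J * F_mat h J = 1\<^sub>m (2 * J)"
  by (rule eq_matI) (auto simp: antisymmetrizer_def simp del: index_mult_mat(1))

text \<open>
  The exchange relations of an R-matrix on the spaces of doubled spins \<open>J1\<close> and \<open>J2\<close> at spectral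
  parameter \<open>u\<close>: it interchanges the coproduct and the opposite coproduct of the generator
  \<open>current\<close>, and it commutes with the coproduct of the group-like element.
\<close>

definition exchange :: "complex \<Rightarrow> nat \<Rightarrow> nat \<Rightarrow> complex \<Rightarrow> complex mat \<Rightarrow> bool" where
  "exchange h J1 J2 u R \<longleftrightarrow>
    (\<forall>kp km a b. a \<noteq> 0 \<longrightarrow> b = u * a \<longrightarrow> intertwines R
      (current h kp km J1 b \<otimes>\<^sub>m 1\<^sub>m (Suc J2) + cartan h J1 \<otimes>\<^sub>m current h kp km J2 a)
      (1\<^sub>m (Suc J1) \<otimes>\<^sub>m current h kp km J2 a + current h kp km J1 b \<otimes>\<^sub>m cartan h J2)) \<and>
    (\<forall>kp km a b. b \<noteq> 0 \<longrightarrow> a = u * b \<longrightarrow> intertwines R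
      (1\<^sub>m (Suc J1) \<otimes>\<^sub>m current h kp km J2 a + current h kp km J1 b \<otimes>\<^sub>m cartan h J2)
      (current h kp km J1 b \<otimes>\<^sub>m 1\<^sub>m (Suc J2) + cartan h J1 \<otimes>\<^sub>m current h kp km J2 a)) \<and>
    intertwines R (cartan h J1 \<otimes>\<^sub>m cartan h J2) (cartan h J1 \<otimes>\<^sub>m cartan h J2)"

lemma exchangeD:
  assumes "exchange h J1 J2 u R"
  shows "a \<noteq> 0 \<Longrightarrow> b = u * a \<Longrightarrow> intertwines R
      (current h kp km J1 b \<otimes>\<^sub>m 1\<^sub>m (Suc J2) + cartan h J1 \<otimes>\<^sub>m current h kp km J2 a)
      (1\<^sub>m (Suc J1) \<otimes>\<^sub>m current h kp km J2 a + current h kp km J1 b \<otimes>\<^sub>m cartan h J2)"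
    "b \<noteq> 0 \<Longrightarrow> a = u * b \<Longrightarrow> intertwines R
      (1\<^sub>m (Suc J1) \<otimes>\<^sub>m current h kp km J2 a + current h kp km J1 b \<otimes>\<^sub>m cartan h J2)
      (current h kp km J1 b \<otimes>\<^sub>m 1\<^sub>m (Suc J2) + cartan h J1 \<otimes>\<^sub>m current h kp km J2 a)"
    "intertwines R (cartan h J1 \<otimes>\<^sub>m cartan h J2) (cartan h J1 \<otimes>\<^sub>m cartan h J2)"
  using assms by (simp_all add: exchange_def)

lemma exchange_half:
  assumes "not_root_of_unity h" "J \<noteq> 0" "u \<noteq> 0"
  shows "exchange h 1 J u (R_half h J u)"
  using intertwines_R_half[OF assms(1,2)] assms(3) by (simp add: exchange_def numeral_2_eq_2)

text \<open>
  The operator \<open>R\<^sub>1\<^sub>3 R\<^sub>2\<^sub>3\<close> on \<open>\<complex>\<^sup>2 \<otimes> \<complex>\<^bsup>n+1\<^esup> \<otimes> \<complex>\<^bsup>J2+1\<^esup>\<close> satisfies exchange relations between the last factor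
  and the first two.
\<close>

lemma exchange_product:
  assumes A: "exchange h 1 J2 (u * h powi (1 - int (Suc n))) A" "A \<in> carrier_mat (2 * Suc J2) (2 * Suc J2)"
    and B: "exchange h n J2 (u * h) B" "B \<in> carrier_mat (Suc n * Suc J2) (Suc n * Suc J2)"
    and h0: "h \<noteq> 0"
  defines "Z \<equiv> sandwich 2 (Suc J2) (1\<^sub>m (Suc n)) A * (1\<^sub>m 2 \<otimes>\<^sub>m B)"
    and "X \<equiv> \<lambda>kp km b. current h kp km 1 (b * h powi (1 - int (Suc n))) \<otimes>\<^sub>m 1\<^sub>m (Suc n)
        + cartan h 1 \<otimes>\<^sub>m current h kp km n (b * h)"
    and "Y \<equiv> \<lambda>kp km b. 1\<^sub>m 2 \<otimes>\<^sub>m current h kp km n (b * inverse h)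
        + current h kp km 1 (b * h powi (int (Suc n) - 1)) \<otimes>\<^sub>m cartan h n"
    and "G \<equiv> cartan h 1 \<otimes>\<^sub>m cartan h n"
  shows "a \<noteq> 0 \<Longrightarrow> b = u * a \<Longrightarrow> intertwines Z
      (X kp km b \<otimes>\<^sub>m 1\<^sub>m (Suc J2) + G \<otimes>\<^sub>m current h kp km J2 a)
      (1\<^sub>m (2 * Suc n) \<otimes>\<^sub>m current h kp km J2 a + X kp km b \<otimes>\<^sub>m cartan h J2)"
    and "b \<noteq> 0 \<Longrightarrow> a = u * b \<Longrightarrow> intertwines Z
      (1\<^sub>m (2 * Suc n) \<otimes>\<^sub>m current h kp km J2 a + Y kp km b \<otimes>\<^sub>m cartan h J2)
      (Y kp km b \<otimes>\<^sub>m 1\<^sub>m (Suc J2) + G \<otimes>\<^sub>m current h kp km J2 a)"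
    and "intertwines Z (G \<otimes>\<^sub>m cartan h J2) (G \<otimes>\<^sub>m cartan h J2)"
proof -
  let ?S = "sandwich 2 (Suc J2)"
  let ?I2 = "1\<^sub>m 2 :: complex mat" and ?In = "1\<^sub>m (Suc n) :: complex mat" and ?I3 = "1\<^sub>m (Suc J2) :: complex mat"
  let ?g1 = "cartan h 1" and ?g2 = "cartan h n" and ?g3 = "cartan h J2"
  have Suc1: "Suc 1 = 2" by simp
  have g1: "?g1 \<in> carrier_mat 2 2" using carrier_spin(5)[of h 1] by (simp add: numeral_2_eq_2)
  have S: "?S C (P \<otimes>\<^sub>m Q) = P \<otimes>\<^sub>m (C \<otimes>\<^sub>m Q)"
    if "P \<in> carrier_mat 2 2" "Q \<in> carrier_mat (Suc J2) (Suc J2)" for P Q C :: "complex mat"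
    by (rule sandwich_kron[OF that])
  have S2: "?S C (P \<otimes>\<^sub>m Q + P' \<otimes>\<^sub>m Q') = P \<otimes>\<^sub>m (C \<otimes>\<^sub>m Q) + P' \<otimes>\<^sub>m (C \<otimes>\<^sub>m Q')"
    if "P \<in> carrier_mat 2 2" "Q \<in> carrier_mat (Suc J2) (Suc J2)"
      "P' \<in> carrier_mat 2 2" "Q' \<in> carrier_mat (Suc J2) (Suc J2)" for P Q P' Q' C :: "complex mat"
    using that by (subst sandwich_add) (auto simp: S)
  have iS: "intertwines (?S ?In A) (?S C P) (?S C Q)"
    if "intertwines A P Q" "C \<in> carrier_mat (Suc n) (Suc n)" for P Q C
    by (rule intertwines_sandwich[OF that(1) A(2) that(2)])
  note a = exchangeD[OF A(1), unfolded Suc1] and b = exchangeD[OF B(1)]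
  note one_I2 = intertwines_one_left[where n = 2]
  show "intertwines Z (G \<otimes>\<^sub>m ?g3) (G \<otimes>\<^sub>m ?g3)"
  proof -
    have "intertwines (?I2 \<otimes>\<^sub>m B) (?g1 \<otimes>\<^sub>m (?g2 \<otimes>\<^sub>m ?g3)) (?g1 \<otimes>\<^sub>m (?g2 \<otimes>\<^sub>m ?g3))"
      by (rule intertwines_kron[OF one_I2[OF g1] b(3)])
    moreover have "intertwines (?S ?In A) (?g1 \<otimes>\<^sub>m (?g2 \<otimes>\<^sub>m ?g3)) (?g1 \<otimes>\<^sub>m (?g2 \<otimes>\<^sub>m ?g3))"
      using iS[OF a(3) carrier_spin(5)] by (simp only: S[OF g1 carrier_spin(5)])
    ultimately show ?thesis unfolding Z_def G_def kron_assoc by (rule intertwines_comp)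
  qed
  show "intertwines Z (X kp km b \<otimes>\<^sub>m ?I3 + G \<otimes>\<^sub>m current h kp km J2 a)
      (1\<^sub>m (2 * Suc n) \<otimes>\<^sub>m current h kp km J2 a + X kp km b \<otimes>\<^sub>m ?g3)"
    if ab: "a \<noteq> 0" "b = u * a"
  proof -
    let ?x1 = "current h kp km 1 (b * h powi (1 - int (Suc n)))" and ?x2 = "current h kp km n (b * h)"
      and ?x3 = "current h kp km J2 a"
    have x1: "?x1 \<in> carrier_mat 2 2" using carrier_spin(6)[of h kp km 1] by (simp add: numeral_2_eq_2)
    have 1: "intertwines (?I2 \<otimes>\<^sub>m B) (?x1 \<otimes>\<^sub>m 1\<^sub>m (Suc n * Suc J2) + ?g1 \<otimes>\<^sub>m (?x2 \<otimes>\<^sub>m ?I3 + ?g2 \<otimes>\<^sub>m ?x3))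
        (?x1 \<otimes>\<^sub>m 1\<^sub>m (Suc n * Suc J2) + ?g1 \<otimes>\<^sub>m (?In \<otimes>\<^sub>m ?x3 + ?x2 \<otimes>\<^sub>m ?g3))"
      by (intro intertwines_add intertwines_kron one_I2 x1 g1 intertwines_one_right[OF B(2)] b(1))
        (use ab in \<open>simp_all add: mult_ac\<close>)
    have 2: "intertwines (?S ?In A) (?S ?In (?x1 \<otimes>\<^sub>m ?I3 + ?g1 \<otimes>\<^sub>m ?x3) + ?S ?x2 (?g1 \<otimes>\<^sub>m ?g3))
        (?S ?In (?I2 \<otimes>\<^sub>m ?x3 + ?x1 \<otimes>\<^sub>m ?g3) + ?S ?x2 (?g1 \<otimes>\<^sub>m ?g3))"
      by (intro intertwines_add iS a(1) a(3)) (use ab in \<open>simp_all add: mult_ac\<close>)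
    have "?x1 \<otimes>\<^sub>m 1\<^sub>m (Suc n * Suc J2) + ?g1 \<otimes>\<^sub>m (?In \<otimes>\<^sub>m ?x3 + ?x2 \<otimes>\<^sub>m ?g3)
        = ?S ?In (?x1 \<otimes>\<^sub>m ?I3 + ?g1 \<otimes>\<^sub>m ?x3) + ?S ?x2 (?g1 \<otimes>\<^sub>m ?g3)"
      using x1 g1 by (simp add: S S2 kron_add_right mat_add_assoc)
    moreover have "X kp km b \<otimes>\<^sub>m ?I3 + G \<otimes>\<^sub>m ?x3
        = ?x1 \<otimes>\<^sub>m 1\<^sub>m (Suc n * Suc J2) + ?g1 \<otimes>\<^sub>m (?x2 \<otimes>\<^sub>m ?I3 + ?g2 \<otimes>\<^sub>m ?x3)"
      using x1 g1 by (simp add: X_def G_def kron_add_left kron_add_right kron_assoc mat_add_assoc)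
    moreover have "1\<^sub>m (2 * Suc n) \<otimes>\<^sub>m ?x3 + X kp km b \<otimes>\<^sub>m ?g3
        = ?S ?In (?I2 \<otimes>\<^sub>m ?x3 + ?x1 \<otimes>\<^sub>m ?g3) + ?S ?x2 (?g1 \<otimes>\<^sub>m ?g3)"
      using x1 g1 unfolding kron_one[symmetric] X_def
      by (simp add: S S2 kron_add_left kron_add_right kron_assoc mat_add_assoc del: kron_one)
    ultimately show ?thesis using 1 2 unfolding Z_def by (simp only:) (rule intertwines_comp)
  qed
  show "intertwines Z (1\<^sub>m (2 * Suc n) \<otimes>\<^sub>m current h kp km J2 a + Y kp km b \<otimes>\<^sub>m ?g3)
      (Y kp km b \<otimes>\<^sub>m ?I3 + G \<otimes>\<^sub>m current h kp km J2 a)"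
    if ab: "b \<noteq> 0" "a = u * b"
  proof -
    let ?x1 = "current h kp km 1 (b * h powi (int (Suc n) - 1))" and ?x2 = "current h kp km n (b * inverse h)"
      and ?x3 = "current h kp km J2 a"
    have x1: "?x1 \<in> carrier_mat 2 2" using carrier_spin(6)[of h kp km 1] by (simp add: numeral_2_eq_2)
    have p: "h powi (1 - int (Suc n)) * h powi (int (Suc n) - 1) = 1"
      using power_int_add[of h "1 - int (Suc n)" "int (Suc n) - 1"] h0 by simp
    have 1: "intertwines (?I2 \<otimes>\<^sub>m B) (?I2 \<otimes>\<^sub>m (?In \<otimes>\<^sub>m ?x3 + ?x2 \<otimes>\<^sub>m ?g3) + ?x1 \<otimes>\<^sub>m (?g2 \<otimes>\<^sub>m ?g3))
        (?I2 \<otimes>\<^sub>m (?x2 \<otimes>\<^sub>m ?I3 + ?g2 \<otimes>\<^sub>m ?x3) + ?x1 \<otimes>\<^sub>m (?g2 \<otimes>\<^sub>m ?g3))"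
      by (intro intertwines_add intertwines_kron one_I2 x1 g1 b(2) b(3))
        (use ab h0 in \<open>simp_all add: mult_ac\<close>)
    have 2: "intertwines (?S ?In A) (?S ?x2 (?I2 \<otimes>\<^sub>m ?I3) + ?S ?g2 (?I2 \<otimes>\<^sub>m ?x3 + ?x1 \<otimes>\<^sub>m ?g3))
        (?S ?x2 (?I2 \<otimes>\<^sub>m ?I3) + ?S ?g2 (?x1 \<otimes>\<^sub>m ?I3 + ?g1 \<otimes>\<^sub>m ?x3))"
    proof (rule intertwines_add; rule iS)
      show "intertwines A (?I2 \<otimes>\<^sub>m ?I3) (?I2 \<otimes>\<^sub>m ?I3)"
        unfolding kron_one by (rule intertwines_one_right[OF A(2)])
      show "intertwines A (?I2 \<otimes>\<^sub>m ?x3 + ?x1 \<otimes>\<^sub>m ?g3) (?x1 \<otimes>\<^sub>m ?I3 + ?g1 \<otimes>\<^sub>m ?x3)"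
        by (rule a(2)) (use ab h0 p in \<open>simp_all add: mult_ac\<close>)
    qed simp_all
    have "?I2 \<otimes>\<^sub>m (?x2 \<otimes>\<^sub>m ?I3 + ?g2 \<otimes>\<^sub>m ?x3) + ?x1 \<otimes>\<^sub>m (?g2 \<otimes>\<^sub>m ?g3)
        = ?S ?x2 (?I2 \<otimes>\<^sub>m ?I3) + ?S ?g2 (?I2 \<otimes>\<^sub>m ?x3 + ?x1 \<otimes>\<^sub>m ?g3)"
      using x1 g1 by (simp add: S S2 kron_add_right mat_add_assoc del: kron_one)
    moreover have "1\<^sub>m (2 * Suc n) \<otimes>\<^sub>m ?x3 + Y kp km b \<otimes>\<^sub>m ?g3
        = ?I2 \<otimes>\<^sub>m (?In \<otimes>\<^sub>m ?x3 + ?x2 \<otimes>\<^sub>m ?g3) + ?x1 \<otimes>\<^sub>m (?g2 \<otimes>\<^sub>m ?g3)"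
      using x1 g1 unfolding kron_one[symmetric] Y_def
      by (simp add: kron_add_left kron_add_right kron_assoc mat_add_assoc del: kron_one)
    moreover have "Y kp km b \<otimes>\<^sub>m ?I3 + G \<otimes>\<^sub>m ?x3
        = ?S ?x2 (?I2 \<otimes>\<^sub>m ?I3) + ?S ?g2 (?x1 \<otimes>\<^sub>m ?I3 + ?g1 \<otimes>\<^sub>m ?x3)"
      using x1 g1 by (simp add: Y_def G_def S S2 kron_add_left kron_add_right kron_assoc mat_add_assoc del: kron_one)
    ultimately show ?thesis using 1 2 unfolding Z_def by (simp only:) (rule intertwines_comp)
  qed
qed

text \<open>
  Inverting \<open>h\<close> exchanges the roles of the two generators.  The ladder operators and the fusion maps
  do not change, as \<open>[n]\<^sub>q\<close> is invariant under \<open>q \<mapsto> q\<^sup>-\<^sup>1\<close>.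
\<close>

lemma qnum_inverse: "qnum (inverse h) n = qnum h n"
proof -
  have e: "inverse h powi m = h powi (- m)" for m by (simp add: power_int_inverse power_int_minus)
  have "qnum (inverse h) n = (h powi (- 2 * n) - h powi (2 * n)) / (h powi (- 2) - h powi 2)"
    unfolding qnum_def e by simp
  also have "\<dots> = (- (h powi (2 * n) - h powi (- 2 * n))) / (- (h powi 2 - h powi (- 2)))" by simp
  also have "\<dots> = qnum h n" unfolding qnum_def by (rule minus_divide_divide)
  finally show ?thesis .
qed

lemma B_coef_inverse: "B_coef (inverse h) J J' = B_coef h J J'"
  by (simp add: B_coef_def qnum_inverse)

lemma spin_inverse:
  "ladder (inverse h) J p = ladder h J p" "S_plus (inverse h) J = S_plus h J"
  "S_minus (inverse h) J = S_minus h J" "E_mat (inverse h) J = E_mat h J" "F_mat (inverse h) J = F_mat h J"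
  "antisymmetrizer (inverse h) J = antisymmetrizer h J"
proof -
  have E: "E_entry (inverse h) J = E_entry h J"
    by (intro ext) (simp add: E_entry_def E_diag_def B_coef_inverse qnum_inverse)
  show "E_mat (inverse h) J = E_mat h J" by (simp add: E_mat_def E)
  moreover show "F_mat (inverse h) J = F_mat h J"
  proof -
    have "F_off (inverse h) J n = F_off h J n" for n by (simp add: F_off_def E)
    then have "F_entry (inverse h) J = F_entry h J" by (intro ext) (simp add: F_entry_def E)
    then show ?thesis by (simp add: F_mat_def)
  qed
  ultimately show "antisymmetrizer (inverse h) J = antisymmetrizer h J" by (simp add: antisymmetrizer_def)
qed (simp_all add: ladder_def S_plus_def S_minus_def B_coef_inverse cong: if_cong)

lemma index_mult_sum:
  fixes A B :: "'a::semiring_0 mat"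
  assumes "A \<in> carrier_mat m n" "B \<in> carrier_mat n k" "i < m" "j < k"
  shows "(A * B) $$ (i, j) = (\<Sum>s<n. A $$ (i, s) * B $$ (s, j))"
  using assms by (simp add: scalar_prod_def lessThan_atLeast0)

text \<open>
  The action from the right of the lowering operator (\<open>kp = 0\<close>, \<open>km = 1\<close>) on a tensor product.
\<close>

lemma index_mult_lowering:
  fixes M :: "complex mat"
  assumes M: "dim_col M = Suc J * Suc J2" "i < dim_row M" and mk: "m \<le> J" "k \<le> J2"
  shows "(M * (current h 0 1 J b \<otimes>\<^sub>m 1\<^sub>m (Suc J2) + cartan h J \<otimes>\<^sub>m current h 0 1 J2 a)) $$ (i, m * Suc J2 + k) =
    (if m < J then M $$ (i, Suc m * Suc J2 + k) * ladder h J m else 0) * (inverse b * inverse h * h powi (int J - 2 * int m))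
    + (if k < J2 then M $$ (i, m * Suc J2 + Suc k) * ladder h J2 k else 0)
      * (h powi (2 * int J - 4 * int m) * (inverse a * inverse h * h powi (int J2 - 2 * int k)))"
  (is "(M * ?W) $$ _ = ?r1 * ?c1 + ?r2 * ?c2")
proof -
  let ?e = "Suc J2"
  have col: "m * ?e + k < Suc J * ?e" using mk by (intro kron_index_less) auto
  have W: "?W $$ (m' * ?e + k', m * ?e + k) =
     (if m' = Suc m then if k' = k then ladder h J m * ?c1 else 0 else 0)
     + (if m' = m then if k' = Suc k then ladder h J2 k * ?c2 else 0 else 0)"
    if "m' < Suc J" "k' < ?e" for m' k'
  proof -
    have "?W $$ (m' * ?e + k', m * ?e + k) = current h 0 1 J b $$ (m', m) * 1\<^sub>m ?e $$ (k', k)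
        + cartan h J $$ (m', m) * current h 0 1 J2 a $$ (k', k)"
      using that mk kron_index_less[OF that] col
        index_kron[of m' "current h 0 1 J b" k' "1\<^sub>m ?e" m k]
        index_kron[of m' "cartan h J" k' "current h 0 1 J2 a" m k] by simp
    then show ?thesis using that mk by (auto simp: index_current index_cartan)
  qed
  have "(M * ?W) $$ (i, m * ?e + k) = (\<Sum>s<Suc J * ?e. M $$ (i, s) * ?W $$ (s, m * ?e + k))"
    using M col by (simp add: scalar_prod_def lessThan_atLeast0)
  also have "\<dots> = (\<Sum>m'<Suc J. \<Sum>k'<?e.
      (if m' = Suc m then if k' = k then M $$ (i, Suc m * ?e + k) * ladder h J m * ?c1 else 0 else 0)
     + (if m' = m then if k' = Suc k then M $$ (i, m * ?e + Suc k) * ladder h J2 k * ?c2 else 0 else 0))"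
    unfolding sum_lessThan_mult
  proof (intro sum.cong refl)
    fix m' k' assume "m' \<in> {..<Suc J}" "k' \<in> {..<?e}"
    then show "M $$ (i, m' * ?e + k') * ?W $$ (m' * ?e + k', m * ?e + k) =
      (if m' = Suc m then if k' = k then M $$ (i, Suc m * ?e + k) * ladder h J m * ?c1 else 0 else 0)
     + (if m' = m then if k' = Suc k then M $$ (i, m * ?e + Suc k) * ladder h J2 k * ?c2 else 0 else 0)"
      using W[of m' k'] by (cases "m' = Suc m"; cases "k' = k") auto
  qed
  also have "\<dots> = (\<Sum>m'<Suc J. if m' = Suc m then (\<Sum>k'<?e. if k' = k then M $$ (i, Suc m * ?e + k) * ladder h J m * ?c1 else 0) else 0)
     + (\<Sum>m'<Suc J. if m' = m then (\<Sum>k'<?e. if k' = Suc k then M $$ (i, m * ?e + Suc k) * ladder h J2 k * ?c2 else 0) else 0)"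
    unfolding sum.distrib
    by (intro arg_cong2[where f = "(+)"] sum.cong refl) auto
  also have "\<dots> = ?r1 * ?c1 + ?r2 * ?c2"
    using mk by (simp del: sum.lessThan_Suc add: sum.delta)
  finally show ?thesis .
qed

text \<open>
  For generic spectral parameters the lowering operators of the two generators together generate the
  tensor product from its top vector, so that an intertwiner that kills the top vector vanishes.
\<close>

lemma intertwines_lowering_zero:
  fixes M :: "complex mat"
  assumes q: "not_root_of_unity h" and M: "M \<in> carrier_mat r (Suc J * Suc J2)"
    and 0: "intertwines M (current h 0 1 J b \<otimes>\<^sub>m 1\<^sub>m (Suc J2) + cartan h J \<otimes>\<^sub>m current h 0 1 J2 a) Y0"
    and 1: "intertwines M (current (inverse h) 0 1 J (inverse b) \<otimes>\<^sub>m 1\<^sub>m (Suc J2)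
        + cartan (inverse h) J \<otimes>\<^sub>m current (inverse h) 0 1 J2 (inverse a)) Y1"
    and ab: "a \<noteq> 0" "b \<noteq> 0"
    and generic: "\<And>l. l \<le> J + J2 \<Longrightarrow> a\<^sup>2 \<noteq> b\<^sup>2 * (h powi (int J + int J2 - 2 * int l))\<^sup>2"
    and top: "\<And>i. i < r \<Longrightarrow> M $$ (i, 0) = 0"
  shows "M = 0\<^sub>m r (Suc J * Suc J2)"
proof -
  have h0: "h \<noteq> 0" by (rule not_root_of_unity_nonzero[OF q])
  let ?e = "Suc J2"
  define Z where "Z m k \<longleftrightarrow> (\<forall>i<r. M $$ (i, m * ?e + k) = 0)" for m k
  have zero: "(Y * M) $$ (i, m * ?e + k) = 0" if "Z m k" "i < r" "m \<le> J" "k \<le> J2" "Y \<in> carrier_mat r r" for i m k Y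
  proof -
    have "m * ?e + k < Suc J * ?e" using that by (intro kron_index_less) auto
    then show ?thesis using that M by (simp add: scalar_prod_def Z_def)
  qed
  have step: "(m < J \<longrightarrow> M $$ (i, Suc m * ?e + k) = 0) \<and> (k < J2 \<longrightarrow> M $$ (i, m * ?e + Suc k) = 0)"
    if z: "Z m k" and i: "i < r" and mk: "m \<le> J" "k \<le> J2" for m k i
  proof -
    define v1 where "v1 = (if m < J then M $$ (i, Suc m * ?e + k) * ladder h J m else 0)"
    define v2 where "v2 = (if k < J2 then M $$ (i, m * ?e + Suc k) * ladder h J2 k else 0)"
    define s where "s = h powi (int J - 2 * int m)"
    define t where "t = h powi (int J2 - 2 * int k)"
    have st: "s \<noteq> 0" "t \<noteq> 0" using h0 by (auto simp: s_def t_def)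
    have g: "h powi (2 * int J - 4 * int m) = s\<^sup>2"
      by (simp add: s_def powi_weight[OF h0])
    have si: "inverse h powi (int J - 2 * int m) = inverse s" "inverse h powi (int J2 - 2 * int k) = inverse t"
      "inverse h powi (2 * int J - 4 * int m) = inverse (s\<^sup>2)"
      using g by (simp_all add: s_def t_def power_int_inverse)
    have dM: "dim_col M = Suc J * ?e" "i < dim_row M" using M i by auto
    note Y0 = intertwinesD[OF 0] and Y1 = intertwinesD[OF 1]
    have Yc: "Y0 \<in> carrier_mat r r" "Y1 \<in> carrier_mat r r" using Y0(3) Y1(3) M by auto
    \<comment> \<open>The two lowering operators give two linear equations for the two columns one level further
        down; genericity says that their determinant does not vanish.\<close>
    have E0: "v1 * (inverse b * inverse h * s) + v2 * (s\<^sup>2 * (inverse a * inverse h * t)) = 0"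
      using zero[OF z i mk Yc(1)] index_mult_lowering[OF dM mk, of h b a]
      unfolding Y0(1) v1_def v2_def s_def[symmetric] t_def[symmetric] g by simp
    have "v1 * a + v2 * (s * t * b) = (v1 * (inverse b * inverse h * s)
        + v2 * (s\<^sup>2 * (inverse a * inverse h * t))) * (b * h * a * inverse s)"
      using h0 ab st by (simp add: field_simps power2_eq_square)
    then have e0: "v1 * a + v2 * (s * t * b) = 0" unfolding E0 by simp
    have E1: "v1 * (b * h * inverse s) + v2 * (inverse (s\<^sup>2) * (a * h * inverse t)) = 0"
      using zero[OF z i mk Yc(2)] index_mult_lowering[OF dM mk, of "inverse h" "inverse b" "inverse a"]
      unfolding Y1(1) v1_def v2_def si spin_inverse by simp
    have "v1 * (b * s * t) + v2 * a = (v1 * (b * h * inverse s)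
        + v2 * (inverse (s\<^sup>2) * (a * h * inverse t))) * (s\<^sup>2 * t * inverse h)"
      using h0 ab st by (simp add: field_simps power2_eq_square)
    then have e1: "v1 * (b * s * t) + v2 * a = 0" unfolding E1 by simp
    have "v2 * (a\<^sup>2 - b\<^sup>2 * (s * t)\<^sup>2) = a * (v1 * (b * s * t) + v2 * a) - b * s * t * (v1 * a + v2 * (s * t * b))"
      by (simp add: algebra_simps power2_eq_square)
    also have "\<dots> = 0" by (simp add: e0 e1)
    finally have "v2 * (a\<^sup>2 - b\<^sup>2 * (s * t)\<^sup>2) = 0" .
    moreover have "s * t = h powi (int J + int J2 - 2 * int (m + k))"
      unfolding s_def t_def using h0 by (subst power_int_add[symmetric]) (simp_all add: algebra_simps)
    then have "a\<^sup>2 - b\<^sup>2 * (s * t)\<^sup>2 \<noteq> 0" using generic[of "m + k"] mk by simp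
    ultimately have v2: "v2 = 0" by simp
    with e0 ab have v1: "v1 = 0" by simp
    show ?thesis
      using v1 v2 ladder_nonzero[OF q, of m J] ladder_nonzero[OF q, of k J2]
      by (auto simp: v1_def v2_def)
  qed
  have "m \<le> J \<longrightarrow> k \<le> J2 \<longrightarrow> m + k = l \<longrightarrow> Z m k" for m k l
  proof (induction l arbitrary: m k)
    case 0
    then show ?case using top by (auto simp: Z_def)
  next
    case (Suc l)
    show ?case
    proof (intro impI)
      assume mk: "m \<le> J" "k \<le> J2" "m + k = Suc l"
      show "Z m k"
      proof (cases m)
        case (Suc m')
        then have "Z m' k" using Suc.IH[of m' k] mk by simp
        then show ?thesis using step[of m' k] Suc mk by (auto simp: Z_def)
      next
        case 0
        then obtain k' where k': "k = Suc k'" using mk by (cases k) auto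
        then have "Z m k'" using Suc.IH[of m k'] mk by simp
        then show ?thesis using step[of m k'] k' mk by (auto simp: Z_def)
      qed
    qed
  qed
  then have Zall: "Z m k" if "m \<le> J" "k \<le> J2" for m k using that by blast
  show ?thesis
  proof (rule eq_matI)
    fix i j assume "i < dim_row (0\<^sub>m r (Suc J * ?e) :: complex mat)" "j < dim_col (0\<^sub>m r (Suc J * ?e) :: complex mat)"
    then have ij: "i < r" "j < Suc J * ?e" by auto
    note lt = div_mod_less[OF ij(2)]
    have "M $$ (i, (j div ?e) * ?e + j mod ?e) = 0"
      using Zall[of "j div ?e" "j mod ?e"] lt ij by (simp add: Z_def del: mult_Suc_right)
    then show "M $$ (i, j) = 0\<^sub>m r (Suc J * ?e) $$ (i, j)" using ij by (simp del: mult_Suc_right)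
  qed (use M in auto)
qed

lemma intertwines_E_mat_tensor:
  fixes h b kp km :: complex and n J2 :: nat
  assumes q: "not_root_of_unity h" and n: "n \<ge> 1" and b: "b \<noteq> 0"
  defines "E \<equiv> E_mat h (Suc n) \<otimes>\<^sub>m 1\<^sub>m (Suc J2)"
    and "X \<equiv> current h kp km 1 (b * h powi (1 - int (Suc n))) \<otimes>\<^sub>m 1\<^sub>m (Suc n)
        + cartan h 1 \<otimes>\<^sub>m current h kp km n (b * h)"
    and "Y \<equiv> 1\<^sub>m 2 \<otimes>\<^sub>m current h kp km n (b * inverse h)
        + current h kp km 1 (b * h powi (int (Suc n) - 1)) \<otimes>\<^sub>m cartan h n"
    and "G \<equiv> cartan h 1 \<otimes>\<^sub>m cartan h n"
  shows "C \<in> carrier_mat (Suc J2) (Suc J2) \<Longrightarrow> D \<in> carrier_mat (Suc J2) (Suc J2) \<Longrightarrow>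
      intertwines E (current h kp km (Suc n) b \<otimes>\<^sub>m C + cartan h (Suc n) \<otimes>\<^sub>m D) (X \<otimes>\<^sub>m C + G \<otimes>\<^sub>m D)"
    "C \<in> carrier_mat (Suc J2) (Suc J2) \<Longrightarrow> D \<in> carrier_mat (Suc J2) (Suc J2) \<Longrightarrow>
      intertwines E (1\<^sub>m (Suc (Suc n)) \<otimes>\<^sub>m D + current h kp km (Suc n) b \<otimes>\<^sub>m C) (1\<^sub>m (2 * Suc n) \<otimes>\<^sub>m D + X \<otimes>\<^sub>m C)"
    "C \<in> carrier_mat (Suc J2) (Suc J2) \<Longrightarrow> D \<in> carrier_mat (Suc J2) (Suc J2) \<Longrightarrow>
      intertwines E (current h kp km (Suc n) b \<otimes>\<^sub>m C + cartan h (Suc n) \<otimes>\<^sub>m D) (Y \<otimes>\<^sub>m C + G \<otimes>\<^sub>m D)"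
    "C \<in> carrier_mat (Suc J2) (Suc J2) \<Longrightarrow> D \<in> carrier_mat (Suc J2) (Suc J2) \<Longrightarrow>
      intertwines E (1\<^sub>m (Suc (Suc n)) \<otimes>\<^sub>m D + current h kp km (Suc n) b \<otimes>\<^sub>m C) (1\<^sub>m (2 * Suc n) \<otimes>\<^sub>m D + Y \<otimes>\<^sub>m C)"
    "D \<in> carrier_mat (Suc J2) (Suc J2) \<Longrightarrow> intertwines E (cartan h (Suc n) \<otimes>\<^sub>m D) (G \<otimes>\<^sub>m D)"
proof -
  note e = intertwines_E_mat_coproduct[OF q n b, of kp km] intertwines_E_mat_cartan[OF q n]
    intertwines_one_right[OF dim_E_F(5), of h "Suc n"]
  show "C \<in> carrier_mat (Suc J2) (Suc J2) \<Longrightarrow> D \<in> carrier_mat (Suc J2) (Suc J2) \<Longrightarrow>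
      intertwines E (current h kp km (Suc n) b \<otimes>\<^sub>m C + cartan h (Suc n) \<otimes>\<^sub>m D) (X \<otimes>\<^sub>m C + G \<otimes>\<^sub>m D)"
    unfolding E_def X_def G_def by (rule intertwines_add; rule intertwines_kron) (rule e intertwines_one_left | assumption)+
  show "C \<in> carrier_mat (Suc J2) (Suc J2) \<Longrightarrow> D \<in> carrier_mat (Suc J2) (Suc J2) \<Longrightarrow>
      intertwines E (1\<^sub>m (Suc (Suc n)) \<otimes>\<^sub>m D + current h kp km (Suc n) b \<otimes>\<^sub>m C) (1\<^sub>m (2 * Suc n) \<otimes>\<^sub>m D + X \<otimes>\<^sub>m C)"
    unfolding E_def X_def G_def by (rule intertwines_add; rule intertwines_kron) (rule e intertwines_one_left | assumption)+
  show "C \<in> carrier_mat (Suc J2) (Suc J2) \<Longrightarrow> D \<in> carrier_mat (Suc J2) (Suc J2) \<Longrightarrow>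
      intertwines E (current h kp km (Suc n) b \<otimes>\<^sub>m C + cartan h (Suc n) \<otimes>\<^sub>m D) (Y \<otimes>\<^sub>m C + G \<otimes>\<^sub>m D)"
    unfolding E_def Y_def G_def by (rule intertwines_add; rule intertwines_kron) (rule e intertwines_one_left | assumption)+
  show "C \<in> carrier_mat (Suc J2) (Suc J2) \<Longrightarrow> D \<in> carrier_mat (Suc J2) (Suc J2) \<Longrightarrow>
      intertwines E (1\<^sub>m (Suc (Suc n)) \<otimes>\<^sub>m D + current h kp km (Suc n) b \<otimes>\<^sub>m C) (1\<^sub>m (2 * Suc n) \<otimes>\<^sub>m D + Y \<otimes>\<^sub>m C)"
    unfolding E_def Y_def G_def by (rule intertwines_add; rule intertwines_kron) (rule e intertwines_one_left | assumption)+
  show "D \<in> carrier_mat (Suc J2) (Suc J2) \<Longrightarrow> intertwines E (cartan h (Suc n) \<otimes>\<^sub>m D) (G \<otimes>\<^sub>m D)"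
    unfolding E_def G_def by (rule intertwines_kron) (rule e intertwines_one_left | assumption)+
qed

text \<open>
  If the image of \<open>R\<^sub>1\<^sub>3 R\<^sub>2\<^sub>3\<close> restricted to the symmetric part stays in the symmetric part, the
  exchange relations descend to the fused operator.
\<close>

lemma exchange_descend:
  assumes q: "not_root_of_unity h" and n: "n \<ge> 1" and u: "u \<noteq> 0"
    and A: "exchange h 1 J2 (u * h powi (1 - int (Suc n))) A" "A \<in> carrier_mat (2 * Suc J2) (2 * Suc J2)"
    and B: "exchange h n J2 (u * h) B" "B \<in> carrier_mat (Suc n * Suc J2) (Suc n * Suc J2)"
  defines "Z \<equiv> sandwich 2 (Suc J2) (1\<^sub>m (Suc n)) A * (1\<^sub>m 2 \<otimes>\<^sub>m B)"
    and "E \<equiv> E_mat h (Suc n) \<otimes>\<^sub>m 1\<^sub>m (Suc J2)" and "F \<equiv> F_mat h (Suc n) \<otimes>\<^sub>m 1\<^sub>m (Suc J2)"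
  assumes inv: "E * (F * (Z * E)) = Z * E"
  shows "exchange h (Suc n) J2 u (F * (Z * E))"
proof -
  have h0: "h \<noteq> 0" by (rule not_root_of_unity_nonzero[OF q])
  note z = exchange_product[OF A B h0, folded Z_def]
  have FE: "F * E = 1\<^sub>m (dim_col E)"
    using F_mat_E_mat[OF q, of "Suc n"] n by (simp add: E_def F_def kron_mult)
  have F: "F \<in> carrier_mat (dim_col E) (dim_row E)" by (auto simp: E_def F_def intro!: carrier_matI)
  note desc = intertwines_descend[OF _ _ FE inv F]
  note eo = intertwines_E_mat_tensor[OF q n, where ?J2.0 = J2, folded E_def]
  show ?thesis unfolding exchange_def
  proof (intro conjI allI impI)
    fix kp km a b :: complex
    assume ab: "a \<noteq> 0" "b = u * a"
    then have b: "b \<noteq> 0" using u by simp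
    show "intertwines (F * (Z * E))
        (current h kp km (Suc n) b \<otimes>\<^sub>m 1\<^sub>m (Suc J2) + cartan h (Suc n) \<otimes>\<^sub>m current h kp km J2 a)
        (1\<^sub>m (Suc (Suc n)) \<otimes>\<^sub>m current h kp km J2 a + current h kp km (Suc n) b \<otimes>\<^sub>m cartan h J2)"
      by (rule desc[OF intertwines_comp[OF eo(1)[OF b] z(1)[OF ab]] eo(2)[OF b]]) simp_all
  next
    fix kp km a b :: complex
    assume ab: "b \<noteq> 0" "a = u * b"
    show "intertwines (F * (Z * E))
        (1\<^sub>m (Suc (Suc n)) \<otimes>\<^sub>m current h kp km J2 a + current h kp km (Suc n) b \<otimes>\<^sub>m cartan h J2)
        (current h kp km (Suc n) b \<otimes>\<^sub>m 1\<^sub>m (Suc J2) + cartan h (Suc n) \<otimes>\<^sub>m current h kp km J2 a)"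
      by (rule desc[OF intertwines_comp[OF eo(4)[OF ab(1)] z(2)[OF ab]] eo(3)[OF ab(1)]]) simp_all
  next
    show "intertwines (F * (Z * E)) (cartan h (Suc n) \<otimes>\<^sub>m cartan h J2) (cartan h (Suc n) \<otimes>\<^sub>m cartan h J2)"
      by (rule desc[OF intertwines_comp[OF eo(5)[OF u] z(3)] eo(5)[OF u]]) simp_all
  qed
qed

lemma intertwines_antisymmetrizer_product:
  assumes q: "not_root_of_unity h" and n: "n \<ge> 1"
    and A: "exchange h 1 J2 (u * h powi (1 - int (Suc n))) A" "A \<in> carrier_mat (2 * Suc J2) (2 * Suc J2)"
    and B: "exchange h n J2 (u * h) B" "B \<in> carrier_mat (Suc n * Suc J2) (Suc n * Suc J2)"
  defines "Z \<equiv> sandwich 2 (Suc J2) (1\<^sub>m (Suc n)) A * (1\<^sub>m 2 \<otimes>\<^sub>m B)"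
    and "E \<equiv> E_mat h (Suc n) \<otimes>\<^sub>m 1\<^sub>m (Suc J2)" and "P \<equiv> antisymmetrizer h (Suc n) \<otimes>\<^sub>m 1\<^sub>m (Suc J2)"
    and "G \<equiv> cartan h 1 \<otimes>\<^sub>m cartan h n"
  shows "a \<noteq> 0 \<Longrightarrow> b \<noteq> 0 \<Longrightarrow> b = u * a \<Longrightarrow> \<exists>Y. intertwines (P * (Z * E))
      (current h kp km (Suc n) b \<otimes>\<^sub>m 1\<^sub>m (Suc J2) + cartan h (Suc n) \<otimes>\<^sub>m current h kp km J2 a) Y"
    and "intertwines (P * (Z * E)) (cartan h (Suc n) \<otimes>\<^sub>m cartan h J2) (G \<otimes>\<^sub>m cartan h J2)"
proof -
  have h0: "h \<noteq> 0" by (rule not_root_of_unity_nonzero[OF q])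
  note z = exchange_product[OF A B h0, folded Z_def]
  note eo = intertwines_E_mat_tensor[OF q n, where ?J2.0 = J2, folded E_def]
  show "\<exists>Y. intertwines (P * (Z * E))
      (current h kp km (Suc n) b \<otimes>\<^sub>m 1\<^sub>m (Suc J2) + cartan h (Suc n) \<otimes>\<^sub>m current h kp km J2 a) Y"
    if ab: "a \<noteq> 0" "b \<noteq> 0" "b = u * a"
  proof -
    let ?X = "current h kp km 1 (b * h powi (1 - int (Suc n))) \<otimes>\<^sub>m 1\<^sub>m (Suc n)
        + cartan h 1 \<otimes>\<^sub>m current h kp km n (b * h)"
    have PX: "intertwines P (1\<^sub>m (2 * Suc n) \<otimes>\<^sub>m current h kp km J2 a + ?X \<otimes>\<^sub>m cartan h J2)
       (1\<^sub>m (2 * Suc n) \<otimes>\<^sub>m current h kp km J2 a + (antisymmetrizer h (Suc n) * ?X) \<otimes>\<^sub>m cartan h J2)"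
      unfolding P_def
      by (intro intertwines_add intertwines_kron intertwines_one_left
          intertwines_one_right[OF antisymmetrizer_carrier(1)]
          intertwines_antisymmetrizer[OF q _ intertwines_E_mat_coproduct(1)[OF q n ab(2)]])
        (use n in simp_all)
    have "intertwines (P * (Z * E))
      (current h kp km (Suc n) b \<otimes>\<^sub>m 1\<^sub>m (Suc J2) + cartan h (Suc n) \<otimes>\<^sub>m current h kp km J2 a)
      (1\<^sub>m (2 * Suc n) \<otimes>\<^sub>m current h kp km J2 a + (antisymmetrizer h (Suc n) * ?X) \<otimes>\<^sub>m cartan h J2)"
      by (rule intertwines_comp[OF intertwines_comp[OF eo(1)[OF ab(2)] z(1)[OF ab(1,3)]] PX]) simp_all
    then show ?thesis by blast
  qed
  have PG: "intertwines P (G \<otimes>\<^sub>m cartan h J2) (G \<otimes>\<^sub>m cartan h J2)"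
    unfolding P_def G_def
    by (intro intertwines_kron intertwines_antisymmetrizer_cartan[OF q n] intertwines_one_left) simp_all
  show "intertwines (P * (Z * E)) (cartan h (Suc n) \<otimes>\<^sub>m cartan h J2) (G \<otimes>\<^sub>m cartan h J2)"
    by (rule intertwines_comp[OF intertwines_comp[OF eo(5)[OF zero_neq_one[symmetric]] z(3), folded G_def] PG]) simp
qed

text \<open>
  The operator \<open>M u\<close> below measures the failure of \<open>R\<^sub>1\<^sub>3 R\<^sub>2\<^sub>3\<close> to preserve the symmetric part.  It
  vanishes on the top vector by its weight, hence identically for generic \<open>u\<close>, hence for all
  \<open>u\<close> by its Laurent polynomial dependence on \<open>u\<close>.
\<close>

lemma exchange_fused:
  fixes A B :: "complex \<Rightarrow> complex mat"
  assumes q: "not_root_of_unity h" and n: "n \<ge> 1"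
    and LA: "laurent_mat (2 * Suc J2) (2 * Suc J2) A"
    and LB: "laurent_mat (Suc n * Suc J2) (Suc n * Suc J2) B"
    and A: "\<And>u. u \<noteq> 0 \<Longrightarrow> exchange h 1 J2 (u * h powi (1 - int (Suc n))) (A u)"
      "\<And>u. u \<noteq> 0 \<Longrightarrow> exchange (inverse h) 1 J2 (inverse u * inverse h powi (1 - int (Suc n))) (A u)"
    and B: "\<And>u. u \<noteq> 0 \<Longrightarrow> exchange h n J2 (u * h) (B u)"
      "\<And>u. u \<noteq> 0 \<Longrightarrow> exchange (inverse h) n J2 (inverse u * inverse h) (B u)"
    and u: "u \<noteq> 0"
  defines "Z \<equiv> \<lambda>u. sandwich 2 (Suc J2) (1\<^sub>m (Suc n)) (A u) * (1\<^sub>m 2 \<otimes>\<^sub>m B u)"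
    and "E \<equiv> E_mat h (Suc n) \<otimes>\<^sub>m 1\<^sub>m (Suc J2)" and "F \<equiv> F_mat h (Suc n) \<otimes>\<^sub>m 1\<^sub>m (Suc J2)"
  shows "exchange h (Suc n) J2 u (F * (Z u * E))"
    "exchange (inverse h) (Suc n) J2 (inverse u) (F * (Z u * E))"
proof -
  have h0: "h \<noteq> 0" by (rule not_root_of_unity_nonzero[OF q])
  note q' = not_root_of_unity_inverse[OF q]
  define P where "P = antisymmetrizer h (Suc n) \<otimes>\<^sub>m 1\<^sub>m (Suc J2)"
  define M where "M = (\<lambda>u. P * (Z u * E))"
  let ?r = "2 * Suc n * Suc J2" and ?c = "Suc (Suc n) * Suc J2"
  have Ac: "A u \<in> carrier_mat (2 * Suc J2) (2 * Suc J2)" and Bc: "B u \<in> carrier_mat (Suc n * Suc J2) (Suc n * Suc J2)" for u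
    using laurent_matD(1)[OF LA] laurent_matD(1)[OF LB] by auto
  have Pc: "P \<in> carrier_mat ?r ?r" unfolding P_def by (rule kron_carrier[OF antisymmetrizer_carrier(1) one_carrier_mat])
  have Ec: "E \<in> carrier_mat ?r ?c" unfolding E_def by (rule kron_carrier[OF dim_E_F(5) one_carrier_mat])
  have Fc: "F \<in> carrier_mat ?c ?r" unfolding F_def by (rule kron_carrier[OF dim_E_F(6) one_carrier_mat])
  have LZ: "laurent_mat ?r ?r Z"
  proof -
    have "laurent_mat (2 * (Suc n * Suc J2)) (2 * (Suc n * Suc J2)) (\<lambda>u. 1\<^sub>m 2 \<otimes>\<^sub>m B u)"
      by (rule laurent_mat_kron[OF laurent_mat_const LB]) simp
    then show ?thesis unfolding Z_def
      by (intro laurent_mat_mult[of _ ?r] laurent_mat_sandwich[OF LA]) (simp_all add: mult.assoc)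
  qed
  have LZE: "laurent_mat ?r ?c (\<lambda>u. Z u * E)"
    by (rule laurent_mat_mult[OF LZ laurent_mat_const[OF Ec]])
  have LM: "laurent_mat ?r ?c M"
    unfolding M_def by (rule laurent_mat_mult[OF laurent_mat_const[OF Pc] LZE])
  note Mc = laurent_matD(1)[OF LM]
  note p = intertwines_antisymmetrizer_product[OF q n A(1) Ac B(1) Bc, folded P_def E_def]
  note p' = intertwines_antisymmetrizer_product[OF q' n A(2) Ac B(2) Bc, unfolded spin_inverse,
      folded P_def E_def]
  \<comment> \<open>The rows of the antisymmetrizer at level \<open>0\<close> vanish; in the other rows the weight differs
      from that of the top vector.\<close>
  have top: "M z $$ (i, 0) = 0" if z: "z \<noteq> 0" and i: "i < ?r" for z i
  proof -
    have i': "i < (2 * Suc n) * Suc J2" using i by simp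
    note lt = div_mod_less[OF i']
    let ?r1 = "i div Suc J2" and ?r3 = "i mod Suc J2"
    show ?thesis
    proof (cases "level (Suc n) ?r1 = 0")
      case True
      have ZE: "Z z * E \<in> carrier_mat ?r ?c" by (rule laurent_matD(1)[OF LZE])
      have "P $$ (i, s) = 0" if "s < ?r" for s
      proof -
        have "s div Suc J2 < 2 * Suc n" using that by (intro div_mod_less(1)[of s _ "Suc J2"]) simp
        then have "antisymmetrizer h (Suc n) $$ (?r1, s div Suc J2) = 0"
          using index_antisymmetrizer(2)[OF q _ lt(1), of "s div Suc J2"] n True by simp
        then show ?thesis unfolding P_def using i' that by (subst index_kron') simp_all
      qed
      then show ?thesis
        unfolding M_def using i Pc ZE by (subst index_mult_mat) (auto simp: scalar_prod_def)
    next
      case False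
      let ?D = "cartan h (Suc n) \<otimes>\<^sub>m cartan h J2" and ?G = "cartan h 1 \<otimes>\<^sub>m cartan h n"
      have Gc: "?G \<in> carrier_mat (2 * Suc n) (2 * Suc n)" by auto
      have D: "?D \<in> carrier_mat ?c ?c" by (intro kron_carrier) simp_all
      have GD: "?G \<otimes>\<^sub>m cartan h J2 \<in> carrier_mat ?r ?r" by (intro kron_carrier Gc) simp_all
      have dD: "?D $$ (s, 0) = (if s = 0 then h powi (2 * int (Suc n)) * h powi (2 * int J2) else 0)" if "s < ?c" for s
      proof -
        have s: "s < Suc (Suc n) * Suc J2" using that by simp
        have "s = 0 \<longleftrightarrow> s div Suc J2 = 0 \<and> s mod Suc J2 = 0" by (metis div_mult_mod_eq add_0 mult_0 div_0 mod_0)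
        then show ?thesis
          using s div_mod_less[OF s] by (subst index_kron') (auto simp: index_cartan)
      qed
      have dG: "(?G \<otimes>\<^sub>m cartan h J2) $$ (i, s) = (if s = i then
          h powi (2 * int (Suc n) - 4 * int (level (Suc n) ?r1)) * h powi (2 * int J2 - 4 * int ?r3) else 0)"
        if s: "s < ?r" for s
      proof -
        have s': "s < (2 * Suc n) * Suc J2" using s by simp
        have "i = s \<longleftrightarrow> i div Suc J2 = s div Suc J2 \<and> i mod Suc J2 = s mod Suc J2" by (metis div_mult_mod_eq)
        moreover have "(?G \<otimes>\<^sub>m cartan h J2) $$ (i, s)
            = ?G $$ (i div Suc J2, s div Suc J2) * cartan h J2 $$ (i mod Suc J2, s mod Suc J2)"
          using i' s' index_kron'[of i ?G "cartan h J2" s]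
          by (simp only: dim_kron dim_spin numeral_2_eq_2 One_nat_def simp_thms)
        ultimately show ?thesis
          using lt div_mod_less[OF s'] index_cartan_kron[OF q lt(1) div_mod_less(1)[OF s']]
          by (auto simp: index_cartan)
      qed
      have "(M z * ?D) $$ (i, 0) = M z $$ (i, 0) * (h powi (2 * int (Suc n)) * h powi (2 * int J2))"
      proof -
        have "(M z * ?D) $$ (i, 0) = (\<Sum>s<?c. M z $$ (i, s) * ?D $$ (s, 0))"
          by (rule index_mult_sum[OF Mc D i]) simp
        also have "\<dots> = (\<Sum>s<?c. if s = 0 then M z $$ (i, 0) * (h powi (2 * int (Suc n)) * h powi (2 * int J2)) else 0)"
          by (intro sum.cong refl) (auto simp: dD)
        finally show ?thesis by (simp del: mult_Suc mult_Suc_right)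
      qed
      moreover have "((?G \<otimes>\<^sub>m cartan h J2) * M z) $$ (i, 0)
        = h powi (2 * int (Suc n) - 4 * int (level (Suc n) ?r1)) * h powi (2 * int J2 - 4 * int ?r3) * M z $$ (i, 0)"
      proof -
        have "((?G \<otimes>\<^sub>m cartan h J2) * M z) $$ (i, 0) = (\<Sum>s<?r. (?G \<otimes>\<^sub>m cartan h J2) $$ (i, s) * M z $$ (s, 0))"
          by (rule index_mult_sum[OF GD Mc i]) simp
        also have "\<dots> = (\<Sum>s<?r. if s = i then h powi (2 * int (Suc n) - 4 * int (level (Suc n) ?r1))
            * h powi (2 * int J2 - 4 * int ?r3) * M z $$ (i, 0) else 0)"
        proof (intro sum.cong refl)
          fix s assume "s \<in> {..<?r}"
          then have "s < ?r" by (simp only: lessThan_iff)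
          from dG[OF this] show "(?G \<otimes>\<^sub>m cartan h J2) $$ (i, s) * M z $$ (s, 0) =
            (if s = i then h powi (2 * int (Suc n) - 4 * int (level (Suc n) ?r1))
              * h powi (2 * int J2 - 4 * int ?r3) * M z $$ (i, 0) else 0)"
            by (cases "s = i") (simp_all only: mult_zero_left if_True if_False simp_thms)
        qed
        finally show ?thesis using i by (simp del: mult_Suc mult_Suc_right)
      qed
      moreover have "M z * ?D = (?G \<otimes>\<^sub>m cartan h J2) * M z"
        using intertwinesD(1)[OF p(2)[OF z z]] unfolding M_def Z_def .
      ultimately have "M z $$ (i, 0) * (h powi (2 * int (Suc n)) * h powi (2 * int J2))
          = h powi (2 * int (Suc n) - 4 * int (level (Suc n) ?r1)) * h powi (2 * int J2 - 4 * int ?r3) * M z $$ (i, 0)"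
        by (simp only:)
      then have "M z $$ (i, 0) * h powi (2 * int (Suc n) + 2 * int J2)
          = h powi ((2 * int (Suc n) - 4 * int (level (Suc n) ?r1)) + (2 * int J2 - 4 * int ?r3)) * M z $$ (i, 0)"
        by (simp only: power_int_add[OF disjI1[OF h0]])
      moreover have "2 * int (Suc n) + 2 * int J2 \<noteq> (2 * int (Suc n) - 4 * int (level (Suc n) ?r1)) + (2 * int J2 - 4 * int ?r3)"
        using False by simp
      ultimately show ?thesis
        using not_root_of_unity_powi_inj[OF q] by (metis mult.commute mult_cancel_left)
    qed
  qed
  \<comment> \<open>\<open>S\<close> is the set of the parameters that are not generic, with \<open>a = 1\<close> and \<open>b = z\<close>.\<close>
  define c where "c = (\<lambda>l. (h powi (int (Suc n) + int J2 - 2 * int l))\<^sup>2)"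
  define S where "S = (\<Union>l\<in>{..Suc n + J2}. {z. 1 = z\<^sup>2 * c l})"
  have finS: "finite S"
  proof -
    have "finite {z. 1 = z\<^sup>2 * c l}" for l
    proof -
      have "{z. 1 = z\<^sup>2 * c l} \<subseteq> {csqrt (inverse (c l)), - csqrt (inverse (c l))}"
      proof
        fix z assume "z \<in> {z. 1 = z\<^sup>2 * c l}"
        then have "z\<^sup>2 * c l = 1" by simp
        then have "z\<^sup>2 = inverse (c l)" by (metis inverse_unique mult.commute)
        then have "z\<^sup>2 = (csqrt (inverse (c l)))\<^sup>2" by simp
        then show "z \<in> {csqrt (inverse (c l)), - csqrt (inverse (c l))}" by (simp only: power2_eq_iff) simp
      qed
      then show ?thesis by (rule finite_subset) simp
    qed
    then show ?thesis by (simp add: S_def)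
  qed
  have gen: "M z = 0\<^sub>m ?r ?c" if z: "z \<noteq> 0" "z \<notin> S" for z
  proof -
    have "\<exists>Y. intertwines (M z) (current h 0 1 (Suc n) z \<otimes>\<^sub>m 1\<^sub>m (Suc J2) + cartan h (Suc n) \<otimes>\<^sub>m current h 0 1 J2 1) Y"
      unfolding M_def Z_def by (rule p(1)[OF z(1) z(1)]) (use z in simp_all)
    then obtain Y0 where Y0: "intertwines (M z) (current h 0 1 (Suc n) z \<otimes>\<^sub>m 1\<^sub>m (Suc J2)
        + cartan h (Suc n) \<otimes>\<^sub>m current h 0 1 J2 1) Y0" by blast
    have "\<exists>Y. intertwines (M z) (current (inverse h) 0 1 (Suc n) (inverse z) \<otimes>\<^sub>m 1\<^sub>m (Suc J2)
        + cartan (inverse h) (Suc n) \<otimes>\<^sub>m current (inverse h) 0 1 J2 (inverse 1)) Y"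
      unfolding M_def Z_def by (rule p'(1)[OF z(1) z(1)]) (use z in simp_all)
    then obtain Y1 where Y1: "intertwines (M z) (current (inverse h) 0 1 (Suc n) (inverse z) \<otimes>\<^sub>m 1\<^sub>m (Suc J2)
        + cartan (inverse h) (Suc n) \<otimes>\<^sub>m current (inverse h) 0 1 J2 (inverse 1)) Y1" by blast
    show ?thesis
      by (rule intertwines_lowering_zero[OF q Mc Y0 Y1 _ z(1) _ top[OF z(1)]])
        (use z(2) in \<open>auto simp: S_def c_def\<close>)
  qed
  have M0: "M u = 0\<^sub>m ?r ?c"
  proof (rule eq_matI)
    fix i j assume ij: "i < dim_row (0\<^sub>m ?r ?c :: complex mat)" "j < dim_col (0\<^sub>m ?r ?c :: complex mat)"
    have "M u $$ (i, j) = 0"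
      by (rule laurent_eq_zero[OF _ finS _ u]) (use ij gen laurent_matD(2)[OF LM] in auto)
    then show "M u $$ (i, j) = 0\<^sub>m ?r ?c $$ (i, j)" using ij by simp
  qed (use Mc[of u] in auto)
  have ZE: "Z u * E \<in> carrier_mat ?r ?c" by (rule laurent_matD(1)[OF LZE])
  have inv: "E * (F * (Z u * E)) = Z u * E"
  proof -
    have EF: "E * F = (E_mat h (Suc n) * F_mat h (Suc n)) \<otimes>\<^sub>m 1\<^sub>m (Suc J2)"
      unfolding E_def F_def by (subst kron_mult) auto
    have "P + E * F = 1\<^sub>m ?r"
      unfolding P_def EF by (subst kron_add_left[symmetric]) (auto simp: antisymmetrizer_plus)
    then have "Z u * E = (P + E * F) * (Z u * E)"
      by (simp only: left_mult_one_mat[OF ZE])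
    also have "\<dots> = P * (Z u * E) + (E * F) * (Z u * E)"
      by (rule add_mult_distrib_mat[OF Pc mult_carrier_mat[OF Ec Fc] ZE])
    also have "\<dots> = (E * F) * (Z u * E)"
      using M0 mult_carrier_mat[OF mult_carrier_mat[OF Ec Fc] ZE] unfolding M_def by simp
    also have "\<dots> = E * (F * (Z u * E))" by (rule assoc_mult_mat[OF Ec Fc ZE])
    finally show ?thesis ..
  qed
  show "exchange h (Suc n) J2 u (F * (Z u * E))"
    using exchange_descend[OF q n u A(1)[OF u] Ac B(1)[OF u] Bc] inv
    unfolding E_def F_def Z_def by simp
  show "exchange (inverse h) (Suc n) J2 (inverse u) (F * (Z u * E))"
    using exchange_descend[OF q' n _ A(2)[OF u] Ac B(2)[OF u] Bc] inv u
    unfolding E_def F_def Z_def spin_inverse by simp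
qed

lemma exchange_smult:
  assumes "exchange h J1 J2 u R"
  shows "exchange h J1 J2 u (c \<cdot>\<^sub>m R)"
  using assms unfolding exchange_def by (simp add: intertwines_smult_left)

lemma R_core_inverse: "R_core (inverse h) J (inverse u) = (-1) \<cdot>\<^sub>m R_core h J u"
proof -
  have d: "inverse h powi 2 - inverse h powi (- 2) = - (h powi 2 - h powi (- 2))"
    by (simp add: power_int_minus power_inverse)
  have "R_diag (inverse h) J s (inverse u) = (-1) \<cdot>\<^sub>m R_diag h J s u" for s
  proof -
    have e: "inverse h powi k = h powi (- k)" for k by (simp add: power_int_inverse power_int_minus)
    show ?thesis by (rule eq_matI) (auto simp: R_diag_def e algebra_simps)
  qed
  then show ?thesis
    unfolding R_core_def spin_inverse d by (intro eq_matI) (auto simp: algebra_simps)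
qed

lemma exchange_half_inverse:
  assumes q: "not_root_of_unity h" and J: "J \<noteq> 0" and u: "u \<noteq> 0"
  shows "exchange (inverse h) 1 J (inverse u) (R_half h J u)"
proof -
  let ?p = "\<lambda>h u. \<Prod>k<J - 1. c_fun (u * h powi (int J - 1 - 2 * int k))"
  have "c_fun (inverse u * inverse h powi k) = - c_fun (u * h powi k)" for k
    by (simp add: c_fun_def power_int_inverse)
  then have p: "?p (inverse h) (inverse u) = (-1) ^ (J - 1) * ?p h u"
    by (simp add: prod.distrib[symmetric] flip: prod_constant)
      (simp add: prod_uminus)
  have "R_half (inverse h) J (inverse u) = ((-1) ^ J) \<cdot>\<^sub>m R_half h J u"
    using J unfolding R_half_eq[OF J] R_core_inverse p by (cases J) auto
  then have "R_half h J u = ((-1) ^ J) \<cdot>\<^sub>m R_half (inverse h) J (inverse u)"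
    by (auto intro!: eq_matI simp: power_mult_distrib[symmetric])
  then show ?thesis
    using exchange_smult[OF exchange_half[OF not_root_of_unity_inverse[OF q] J, of "inverse u"]] u by simp
qed

lemma laurent_R_half:
  assumes "laurent f" "laurent (\<lambda>z. inverse (f z))"
  shows "laurent_mat (2 * Suc J) (2 * Suc J) (\<lambda>z. R_half h J (f z))"
proof (cases "J = 0")
  case True
  then have "(\<lambda>z. R_half h J (f z)) = (\<lambda>z. 1\<^sub>m 2)" by (auto simp: R_half_def)
  then show ?thesis using True by (simp add: laurent_mat_const)
next
  case False
  have d: "laurent_mat (Suc J) (Suc J) (\<lambda>z. R_diag h J s (f z))" for s
  proof (rule laurent_matI)
    fix i j assume ij: "i < Suc J" "j < Suc J"
    have "(\<lambda>z. R_diag h J s (f z) $$ (i, j)) = (\<lambda>z. if i = j then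
      f z * h powi (1 + s * (int J - 2 * int i)) - inverse (f z) * h powi (- (1 + s * (int J - 2 * int i))) else 0)"
      using ij by (auto simp: R_diag_def)
    moreover have "laurent (\<lambda>z. f z * h powi (1 + s * (int J - 2 * int i)) - inverse (f z) * h powi (- (1 + s * (int J - 2 * int i))))"
      by (intro laurent_diff laurent_mult laurent_const assms)
    ultimately show "laurent (\<lambda>z. R_diag h J s (f z) $$ (i, j))"
      by (cases "i = j") (simp_all add: laurent_const)
  qed simp
  have "laurent_mat (2 * Suc J) (2 * Suc J) (\<lambda>z. R_core h J (f z))"
    unfolding R_core_def mult_2
    by (intro laurent_mat_four_block d laurent_mat_const smult_carrier_mat carrier_spin)
  moreover have "laurent (\<lambda>z. \<Prod>k<J - 1. c_fun (f z * h powi (int J - 1 - 2 * int k)))"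
    unfolding c_fun_def inverse_mult_distrib
    by (intro laurent_prod laurent_diff laurent_mult laurent_const assms)
  ultimately show ?thesis unfolding R_half_eq[OF False] by (intro laurent_mat_smult)
qed

lemma on_legs_three:
  fixes A :: "'a::semiring_1 mat"
  shows "on_legs [d, D, e] 0 2 A = sandwich d e (1\<^sub>m D) A"
  using on_legs_outer[of d "[D]" e A] by (simp add: numeral_2_eq_2)

lemma R_mat_fused:
  "R_mat h (Suc (Suc n)) J2 u = (F_mat h (Suc (Suc n)) \<otimes>\<^sub>m 1\<^sub>m (Suc J2))
     * (sandwich 2 (Suc J2) (1\<^sub>m (Suc (Suc n))) (R_half h J2 (u * h powi (1 - int (Suc (Suc n)))))
        * (1\<^sub>m 2 \<otimes>\<^sub>m R_mat h (Suc n) J2 (u * h)) * (E_mat h (Suc (Suc n)) \<otimes>\<^sub>m 1\<^sub>m (Suc J2)))"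
  if "R_mat h (Suc n) J2 (u * h) \<in> carrier_mat (Suc (Suc n) * Suc J2) (Suc (Suc n) * Suc J2)"
proof -
  let ?J = "Suc (Suc n)" and ?e = "Suc J2"
  let ?F = "F_mat h ?J \<otimes>\<^sub>m 1\<^sub>m ?e" and ?E = "E_mat h ?J \<otimes>\<^sub>m 1\<^sub>m ?e"
    and ?S = "sandwich 2 ?e (1\<^sub>m ?J) (R_half h J2 (u * h powi (1 - int ?J)))"
    and ?B = "1\<^sub>m 2 \<otimes>\<^sub>m R_mat h (Suc n) J2 (u * h)"
  have F: "?F \<in> carrier_mat (Suc ?J * ?e) (2 * ?J * ?e)" by (rule kron_carrier[OF dim_E_F(6) one_carrier_mat])
  have E: "?E \<in> carrier_mat (2 * ?J * ?e) (Suc ?J * ?e)" by (rule kron_carrier[OF dim_E_F(5) one_carrier_mat])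
  have S: "?S \<in> carrier_mat (2 * ?J * ?e) (2 * ?J * ?e)" by (rule carrier_matI) simp_all
  have B: "?B \<in> carrier_mat (2 * ?J * ?e) (2 * ?J * ?e)"
    using kron_carrier[OF one_carrier_mat[of 2] that] by (simp only: mult.assoc)
  have "R_mat h ?J J2 u = ?F * ?S * ?B * ?E"
    unfolding on_legs_three[symmetric] by simp
  also have "?F * ?S * ?B = ?F * (?S * ?B)" by (rule assoc_mult_mat[OF F S B])
  also have "?F * (?S * ?B) * ?E = ?F * (?S * ?B * ?E)"
    by (rule assoc_mult_mat[OF F mult_carrier_mat[OF S B] E])
  finally show ?thesis .
qed

lemma laurent_R_mat:
  assumes "laurent f" "laurent (\<lambda>z. inverse (f z))"
  shows "laurent_mat (Suc J1 * Suc J2) (Suc J1 * Suc J2) (\<lambda>z. R_mat h J1 J2 (f z))"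
  using assms
proof (induction J1 arbitrary: f rule: induct_nat_012)
  case 0
  then show ?case by (simp add: laurent_mat_const)
next
  case 1
  show ?case using laurent_R_half[OF 1, of J2 h] unfolding R_mat.simps numeral_2_eq_2 .
next
  case (ge2 n)
  let ?e = "Suc J2" and ?J = "Suc (Suc n)"
  have f: "laurent (\<lambda>z. f z * h powi k)" "laurent (\<lambda>z. inverse (f z * h powi k))"
    "laurent (\<lambda>z. f z * h)" "laurent (\<lambda>z. inverse (f z * h))" for k
    unfolding inverse_mult_distrib using ge2(3,4) by (auto intro!: laurent_mult laurent_const)
  have IH: "laurent_mat (?J * ?e) (?J * ?e) (\<lambda>z. R_mat h (Suc n) J2 (f z * h))"
    by (rule ge2(2)[OF f(3,4)])
  have S: "laurent_mat (2 * ?J * ?e) (2 * ?J * ?e)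
      (\<lambda>z. sandwich 2 ?e (1\<^sub>m ?J) (R_half h J2 (f z * h powi (1 - int ?J))))"
    by (rule laurent_mat_sandwich[OF laurent_R_half[OF f(1,2)] one_carrier_mat])
  have B: "laurent_mat (2 * ?J * ?e) (2 * ?J * ?e) (\<lambda>z. 1\<^sub>m 2 \<otimes>\<^sub>m R_mat h (Suc n) J2 (f z * h))"
    using laurent_mat_kron[OF laurent_mat_const[OF one_carrier_mat, of 2] IH] by (simp only: mult.assoc)
  have F: "laurent_mat (Suc ?J * ?e) (2 * ?J * ?e) (\<lambda>z. F_mat h ?J \<otimes>\<^sub>m 1\<^sub>m ?e)"
    by (rule laurent_mat_const[OF kron_carrier[OF dim_E_F(6) one_carrier_mat]])
  have E: "laurent_mat (2 * ?J * ?e) (Suc ?J * ?e) (\<lambda>z. E_mat h ?J \<otimes>\<^sub>m 1\<^sub>m ?e)"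
    by (rule laurent_mat_const[OF kron_carrier[OF dim_E_F(5) one_carrier_mat]])
  show ?case
    unfolding R_mat_fused[OF laurent_matD(1)[OF IH]]
    by (rule laurent_mat_mult[OF F laurent_mat_mult[OF laurent_mat_mult[OF S B] E]])
qed

lemma exchange_R_mat:
  assumes q: "not_root_of_unity h" and J2: "J2 \<noteq> 0" and "u \<noteq> 0"
  shows "exchange h (Suc n) J2 u (R_mat h (Suc n) J2 u)"
    "exchange (inverse h) (Suc n) J2 (inverse u) (R_mat h (Suc n) J2 u)"
proof -
  have h0: "h \<noteq> 0" by (rule not_root_of_unity_nonzero[OF q])
  have "exchange h (Suc n) J2 u (R_mat h (Suc n) J2 u) \<and>
    exchange (inverse h) (Suc n) J2 (inverse u) (R_mat h (Suc n) J2 u)"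
    using \<open>u \<noteq> 0\<close>
  proof (induction n arbitrary: u)
    case 0
    then show ?case
      using exchange_half[OF q J2] exchange_half_inverse[OF q J2] by simp
  next
    case (Suc n)
    define A where "A = (\<lambda>z. R_half h J2 (z * h powi (1 - int (Suc (Suc n)))))"
    define B where "B = (\<lambda>z. R_mat h (Suc n) J2 (z * h))"
    have i: "inverse z * inverse h powi k = inverse (z * h powi k)" "inverse z * inverse h = inverse (z * h)" for z k
      by (simp_all add: power_int_inverse)
    have LA: "laurent_mat (2 * Suc J2) (2 * Suc J2) A"
      unfolding A_def by (rule laurent_R_half)
        (unfold inverse_mult_distrib, (intro laurent_mult laurent_ident laurent_inverse laurent_const)+)
    have LB: "laurent_mat (Suc (Suc n) * Suc J2) (Suc (Suc n) * Suc J2) B"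
      unfolding B_def by (rule laurent_R_mat)
        (unfold inverse_mult_distrib, (intro laurent_mult laurent_ident laurent_inverse laurent_const)+)
    have A: "exchange h 1 J2 (z * h powi (1 - int (Suc (Suc n)))) (A z)"
      "exchange (inverse h) 1 J2 (inverse z * inverse h powi (1 - int (Suc (Suc n)))) (A z)" if "z \<noteq> 0" for z
    proof -
      have z: "z * h powi (1 - int (Suc (Suc n))) \<noteq> 0" using that h0 by simp
      show "exchange h 1 J2 (z * h powi (1 - int (Suc (Suc n)))) (A z)"
        "exchange (inverse h) 1 J2 (inverse z * inverse h powi (1 - int (Suc (Suc n)))) (A z)"
        unfolding A_def i by (rule exchange_half[OF q J2 z], rule exchange_half_inverse[OF q J2 z])
    qed
    have B: "exchange h (Suc n) J2 (z * h) (B z)"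
      "exchange (inverse h) (Suc n) J2 (inverse z * inverse h) (B z)" if "z \<noteq> 0" for z
    proof -
      have z: "z * h \<noteq> 0" using that h0 by simp
      show "exchange h (Suc n) J2 (z * h) (B z)" "exchange (inverse h) (Suc n) J2 (inverse z * inverse h) (B z)"
        unfolding B_def i using Suc.IH[OF z] by blast+
    qed
    have "1 \<le> Suc n" by simp
    from exchange_fused[OF q this LA LB A B Suc.prems] show ?case
      unfolding R_mat_fused[OF laurent_matD(1)[OF LB, unfolded B_def]] A_def B_def by blast
  qed
  then show "exchange h (Suc n) J2 u (R_mat h (Suc n) J2 u)"
    "exchange (inverse h) (Suc n) J2 (inverse u) (R_mat h (Suc n) J2 u)" by blast+
qed

section \<open>Fused K-matrices\<close>

text \<open>
  The reflection relation: a K-matrix at spectral parameter \<open>u\<close> intertwines the representations with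
  parameters \<open>u\<close> and \<open>u\<^sup>-\<^sup>1\<close> of a generator of the coideal subalgebra.  The relation for the other
  generator is obtained by inverting \<open>h\<close> and \<open>u\<close>.
\<close>

definition reflect :: "complex \<Rightarrow> complex \<Rightarrow> complex \<Rightarrow> complex \<Rightarrow> nat \<Rightarrow> complex \<Rightarrow> complex mat \<Rightarrow> bool" where
  "reflect h ep kp km J u K \<longleftrightarrow> intertwines K
     (current h kp km J u + ep \<cdot>\<^sub>m cartan h J) (current h kp km J (inverse u) + ep \<cdot>\<^sub>m cartan h J)"

lemma K_half_carrier[simp]:
  "K_half h ep em kp km u \<in> carrier_mat 2 2"
  "dim_row (K_half h ep em kp km u) = 2" "dim_col (K_half h ep em kp km u) = 2"
  by (auto simp: K_half_def mat_of_rows_list_def)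

lemma index_K_half:
  "K_half h ep em kp km u $$ (0, 0) = u * ep + inverse u * em"
  "K_half h ep em kp km u $$ (0, Suc 0) = kp * c_fun (u\<^sup>2) / (h powi 2 - h powi (- 2))"
  "K_half h ep em kp km u $$ (Suc 0, 0) = km * c_fun (u\<^sup>2) / (h powi 2 - h powi (- 2))"
  "K_half h ep em kp km u $$ (Suc 0, Suc 0) = u * em + inverse u * ep"
  by (auto simp: K_half_def mat_of_rows_list_def)

lemma K_half_inverse:
  "K_half (inverse h) em ep kp km (inverse u) = K_half h ep em kp km u"
proof -
  have d: "inverse h powi 2 - inverse h powi (- 2) = - (h powi 2 - h powi (- 2))"
    by (simp add: power_int_minus power_inverse)
  have c: "c_fun ((inverse u)\<^sup>2) = - c_fun (u\<^sup>2)" by (simp add: c_fun_def power_inverse)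
  have m: "a * - x / - y = a * x / y" for a x y :: complex by simp
  show ?thesis
    unfolding K_half_def d c m inverse_inverse_eq by (simp add: add.commute)
qed

lemma reflect_half:
  assumes q: "not_root_of_unity h" and u: "u \<noteq> 0"
  shows "reflect h ep kp km 1 u (K_half h ep em kp km u)"
  unfolding reflect_def
proof (rule intertwinesI[of _ 2 2])
  let ?K = "K_half h ep em kp km u"
  let ?X = "\<lambda>u. current h kp km 1 u + ep \<cdot>\<^sub>m cartan h 1"
  have h0: "h \<noteq> 0" by (rule not_root_of_unity_nonzero[OF q])
  define d where "d = h powi 2 - h powi (- 2)"
  have d0: "d \<noteq> 0" using not_root_of_unity_denominator(2)[OF q] by (simp add: d_def)
  have dd: "d = h\<^sup>2 - inverse (h\<^sup>2)" by (simp add: d_def power_int_minus)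
  show Xc: "?X u \<in> carrier_mat 2 2" "?X (inverse u) \<in> carrier_mat 2 2" for u
    by (auto intro!: carrier_matI)
  note one = current_one[OF q, unfolded One_nat_def]
  note K = index_K_half[of h ep em kp km u, folded d_def]
  have c: "c_fun (u\<^sup>2) = u\<^sup>2 - inverse (u\<^sup>2)" by (simp add: c_fun_def)
  show "?K * ?X u = ?X (inverse u) * ?K"
  proof (rule eq_matI)
    fix i j assume "i < dim_row (?X (inverse u) * ?K)" "j < dim_col (?X (inverse u) * ?K)"
    then have "i < 2" "j < 2" by auto
    have s: "(A * B) $$ (i, j) = A $$ (i, 0) * B $$ (0, j) + A $$ (i, Suc 0) * B $$ (Suc 0, j)"
      if "A \<in> carrier_mat 2 2" "B \<in> carrier_mat 2 2" for A B :: "complex mat"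
      using index_mult_sum[OF that \<open>i < 2\<close> \<open>j < 2\<close>] by (simp add: numeral_2_eq_2)
    from \<open>i < 2\<close> \<open>j < 2\<close> have "i = 0 \<or> i = Suc 0" "j = 0 \<or> j = Suc 0" by auto
    then show "(?K * ?X u) $$ (i, j) = (?X (inverse u) * ?K) $$ (i, j)"
      unfolding s[OF K_half_carrier(1) Xc(1)] s[OF Xc(2) K_half_carrier(1)]
      using h0 u d0
      by (elim disjE) (simp_all add: one K c,
          simp_all add: dd field_simps power2_eq_square)
  qed auto
qed simp

lemma reflect_half_inverse:
  assumes q: "not_root_of_unity h" and u: "u \<noteq> 0"
  shows "reflect (inverse h) em kp km 1 (inverse u) (K_half h ep em kp km u)"
  using reflect_half[OF not_root_of_unity_inverse[OF q], of "inverse u" em kp km ep] u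
  by (simp add: K_half_inverse)

text \<open>
  The operator \<open>K\<^sub>1 R K\<^sub>2\<close> on \<open>\<complex>\<^sup>2 \<otimes> \<complex>\<^bsup>n+1\<^esup>\<close> turns the coproduct at \<open>u\<close> into the opposite coproduct at
  \<open>u\<^sup>-\<^sup>1\<close>, each with the shifts of the parameters for which \<open>E_mat\<close> is an intertwiner.
\<close>

lemma reflect_product:
  assumes K1: "reflect h ep kp km 1 (u * h powi (1 - int (Suc n))) K1" "K1 \<in> carrier_mat 2 2"
    and K2: "reflect h ep kp km n (u * h) K2" "K2 \<in> carrier_mat (Suc n) (Suc n)"
    and R: "exchange h 1 n (u\<^sup>2 * h powi (2 - int (Suc n))) R"
    and h0: "h \<noteq> 0" and u: "u \<noteq> 0"
  defines "Z \<equiv> (K1 \<otimes>\<^sub>m 1\<^sub>m (Suc n)) * R * (1\<^sub>m 2 \<otimes>\<^sub>m K2)"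
    and "X \<equiv> \<lambda>b. current h kp km 1 (b * h powi (1 - int (Suc n))) \<otimes>\<^sub>m 1\<^sub>m (Suc n)
        + cartan h 1 \<otimes>\<^sub>m current h kp km n (b * h)"
    and "Y \<equiv> \<lambda>b. 1\<^sub>m 2 \<otimes>\<^sub>m current h kp km n (b * inverse h)
        + current h kp km 1 (b * h powi (int (Suc n) - 1)) \<otimes>\<^sub>m cartan h n"
    and "G \<equiv> cartan h 1 \<otimes>\<^sub>m cartan h n"
  assumes Rc: "R \<in> carrier_mat (2 * Suc n) (2 * Suc n)"
  shows "intertwines Z (X u + ep \<cdot>\<^sub>m G) (Y (inverse u) + ep \<cdot>\<^sub>m G)"
proof -
  let ?u1 = "u * h powi (1 - int (Suc n))" and ?u2 = "u * h"
  let ?I2 = "1\<^sub>m 2 :: complex mat" and ?In = "1\<^sub>m (Suc n) :: complex mat"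
  let ?g1 = "cartan h 1" and ?g2 = "cartan h n" and ?x1 = "current h kp km 1" and ?x2 = "current h kp km n"
  have g1: "?g1 \<in> carrier_mat 2 2" and x1: "?x1 a \<in> carrier_mat 2 2" for a
    using carrier_spin(5)[of h 1] carrier_spin(6)[of h kp km 1 a] by (auto simp: numeral_2_eq_2)
  have Suc1: "Suc 1 = 2" by simp
  note r = exchangeD[OF R, unfolded Suc1]
  have p: "inverse (h powi (1 - int (Suc n))) = h powi (int (Suc n) - 1)"
    by (simp flip: power_int_minus)
  have 1: "intertwines (?I2 \<otimes>\<^sub>m K2) (?x1 ?u1 \<otimes>\<^sub>m ?In + ?g1 \<otimes>\<^sub>m (?x2 ?u2 + ep \<cdot>\<^sub>m ?g2))
     (?x1 ?u1 \<otimes>\<^sub>m ?In + ?g1 \<otimes>\<^sub>m (?x2 (inverse ?u2) + ep \<cdot>\<^sub>m ?g2))"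
    by (intro intertwines_add[of _ "?x1 ?u1 \<otimes>\<^sub>m ?In" "?x1 ?u1 \<otimes>\<^sub>m ?In"] intertwines_kron
        intertwines_one_left x1 g1 intertwines_one_right[OF K2(2)] K2(1)[unfolded reflect_def])
  have 2: "intertwines R ((?x1 ?u1 \<otimes>\<^sub>m ?In + ?g1 \<otimes>\<^sub>m ?x2 (inverse ?u2)) + ep \<cdot>\<^sub>m (?g1 \<otimes>\<^sub>m ?g2))
     ((?I2 \<otimes>\<^sub>m ?x2 (inverse ?u2) + ?x1 ?u1 \<otimes>\<^sub>m ?g2) + ep \<cdot>\<^sub>m (?g1 \<otimes>\<^sub>m ?g2))"
  proof (rule intertwines_add[OF r(1) intertwines_smult[OF r(3)]])
    have "h powi (2 - int (Suc n)) * inverse h = h powi (1 - int (Suc n))"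
      using power_int_diff[of h "2 - int (Suc n)" 1] h0 by (simp add: divide_inverse)
    then show "u * h powi (1 - int (Suc n)) = u\<^sup>2 * h powi (2 - int (Suc n)) * inverse (u * h)"
      using u h0 by (simp add: power2_eq_square field_simps)
  qed (use u h0 in simp)
  have 3: "intertwines (K1 \<otimes>\<^sub>m ?In) (?I2 \<otimes>\<^sub>m ?x2 (inverse ?u2) + (?x1 ?u1 + ep \<cdot>\<^sub>m ?g1) \<otimes>\<^sub>m ?g2)
     (?I2 \<otimes>\<^sub>m ?x2 (inverse ?u2) + (?x1 (inverse ?u1) + ep \<cdot>\<^sub>m ?g1) \<otimes>\<^sub>m ?g2)"
    by (intro intertwines_add[of _ "?I2 \<otimes>\<^sub>m ?x2 (inverse ?u2)" "?I2 \<otimes>\<^sub>m ?x2 (inverse ?u2)"] intertwines_kron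
        intertwines_one_left carrier_spin intertwines_one_right[OF K1(2)] K1(1)[unfolded reflect_def])
  have "?x1 ?u1 \<otimes>\<^sub>m ?In + ?g1 \<otimes>\<^sub>m (?x2 ?u2 + ep \<cdot>\<^sub>m ?g2) = X u + ep \<cdot>\<^sub>m G"
    by (simp add: X_def G_def kron_add_right kron_smult_right mat_add_assoc)
  moreover have "?x1 ?u1 \<otimes>\<^sub>m ?In + ?g1 \<otimes>\<^sub>m (?x2 (inverse ?u2) + ep \<cdot>\<^sub>m ?g2)
      = (?x1 ?u1 \<otimes>\<^sub>m ?In + ?g1 \<otimes>\<^sub>m ?x2 (inverse ?u2)) + ep \<cdot>\<^sub>m (?g1 \<otimes>\<^sub>m ?g2)"
    by (simp add: kron_add_right kron_smult_right mat_add_assoc)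
  moreover have "?I2 \<otimes>\<^sub>m ?x2 (inverse ?u2) + (?x1 ?u1 + ep \<cdot>\<^sub>m ?g1) \<otimes>\<^sub>m ?g2
      = (?I2 \<otimes>\<^sub>m ?x2 (inverse ?u2) + ?x1 ?u1 \<otimes>\<^sub>m ?g2) + ep \<cdot>\<^sub>m (?g1 \<otimes>\<^sub>m ?g2)"
    by (simp add: kron_add_left kron_smult_left mat_add_assoc)
  moreover have "?I2 \<otimes>\<^sub>m ?x2 (inverse ?u2) + (?x1 (inverse ?u1) + ep \<cdot>\<^sub>m ?g1) \<otimes>\<^sub>m ?g2
      = Y (inverse u) + ep \<cdot>\<^sub>m G"
    unfolding inverse_mult_distrib p
    by (simp add: Y_def G_def kron_add_left kron_smult_left mat_add_assoc)
  ultimately have "intertwines ((K1 \<otimes>\<^sub>m ?In) * (R * (?I2 \<otimes>\<^sub>m K2))) (X u + ep \<cdot>\<^sub>m G) (Y (inverse u) + ep \<cdot>\<^sub>m G)"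
    using intertwines_comp[OF intertwines_comp[OF 1, of R] 3] 2 by simp
  moreover have "(K1 \<otimes>\<^sub>m ?In) * (R * (?I2 \<otimes>\<^sub>m K2)) = Z"
    unfolding Z_def using assoc_mult_mat[OF kron_carrier[OF K1(2) one_carrier_mat] Rc kron_carrier[OF one_carrier_mat K2(2)]] ..
  ultimately show ?thesis by simp
qed

lemma reflect_descend:
  assumes q: "not_root_of_unity h" and n: "n \<ge> 1" and u: "u \<noteq> 0"
    and K1: "reflect h ep kp km 1 (u * h powi (1 - int (Suc n))) K1" "K1 \<in> carrier_mat 2 2"
    and K2: "reflect h ep kp km n (u * h) K2" "K2 \<in> carrier_mat (Suc n) (Suc n)"
    and R: "exchange h 1 n (u\<^sup>2 * h powi (2 - int (Suc n))) R" "R \<in> carrier_mat (2 * Suc n) (2 * Suc n)"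
  defines "Z \<equiv> (K1 \<otimes>\<^sub>m 1\<^sub>m (Suc n)) * R * (1\<^sub>m 2 \<otimes>\<^sub>m K2)"
    and "E \<equiv> E_mat h (Suc n)" and "F \<equiv> F_mat h (Suc n)" and "P \<equiv> antisymmetrizer h (Suc n)"
    and "Y \<equiv> \<lambda>b. 1\<^sub>m 2 \<otimes>\<^sub>m current h kp km n (b * inverse h)
        + current h kp km 1 (b * h powi (int (Suc n) - 1)) \<otimes>\<^sub>m cartan h n"
    and "G \<equiv> cartan h 1 \<otimes>\<^sub>m cartan h n"
  shows "E * (F * (Z * E)) = Z * E \<Longrightarrow> reflect h ep kp km (Suc n) u (F * (Z * E))"
    "intertwines (P * (Z * E)) (current h kp km (Suc n) u + ep \<cdot>\<^sub>m cartan h (Suc n))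
      (P * Y (inverse u) + ep \<cdot>\<^sub>m G)"
proof -
  have h0: "h \<noteq> 0" by (rule not_root_of_unity_nonzero[OF q])
  have u': "inverse u \<noteq> 0" using u by simp
  note z = reflect_product[OF K1 K2 R(1) h0 u R(2), folded Z_def]
  have E1: "intertwines E (current h kp km (Suc n) u + ep \<cdot>\<^sub>m cartan h (Suc n))
      ((current h kp km 1 (u * h powi (1 - int (Suc n))) \<otimes>\<^sub>m 1\<^sub>m (Suc n)
        + cartan h 1 \<otimes>\<^sub>m current h kp km n (u * h)) + ep \<cdot>\<^sub>m G)"
    unfolding E_def G_def
    by (rule intertwines_add[OF intertwines_E_mat_coproduct(1)[OF q n u] intertwines_smult[OF intertwines_E_mat_cartan[OF q n]]])
  have E2: "intertwines E (current h kp km (Suc n) (inverse u) + ep \<cdot>\<^sub>m cartan h (Suc n)) (Y (inverse u) + ep \<cdot>\<^sub>m G)"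
    unfolding E_def G_def Y_def
    by (rule intertwines_add[OF intertwines_E_mat_coproduct(2)[OF q n u'] intertwines_smult[OF intertwines_E_mat_cartan[OF q n]]])
  have ZE: "intertwines (Z * E) (current h kp km (Suc n) u + ep \<cdot>\<^sub>m cartan h (Suc n)) (Y (inverse u) + ep \<cdot>\<^sub>m G)"
    unfolding Y_def G_def by (rule intertwines_comp[OF E1[unfolded G_def] z])
  show "reflect h ep kp km (Suc n) u (F * (Z * E))" if "E * (F * (Z * E)) = Z * E"
    unfolding reflect_def
  proof (rule intertwines_descend[OF ZE E2 _ that])
    show "F * E = 1\<^sub>m (dim_col E)" using F_mat_E_mat[OF q, of "Suc n"] n by (simp add: E_def F_def)
    show "F \<in> carrier_mat (dim_col E) (dim_row E)"
      unfolding E_def F_def dim_E_F(1,2) by (rule dim_E_F(6))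
  qed
  have "intertwines P (Y (inverse u)) (P * Y (inverse u))"
    unfolding P_def Y_def
    by (rule intertwines_antisymmetrizer[OF q _ intertwines_E_mat_coproduct(2)[OF q n u']]) (use n in simp)
  then have "intertwines P (Y (inverse u) + ep \<cdot>\<^sub>m G) (P * Y (inverse u) + ep \<cdot>\<^sub>m G)"
    using intertwines_add intertwines_smult[OF intertwines_antisymmetrizer_cartan[OF q n]]
    unfolding P_def G_def by blast
  then show "intertwines (P * (Z * E)) (current h kp km (Suc n) u + ep \<cdot>\<^sub>m cartan h (Suc n))
      (P * Y (inverse u) + ep \<cdot>\<^sub>m G)"
    by (rule intertwines_comp[OF ZE])
qed

lemma current_split:
  assumes "z \<noteq> 0"
  shows "current h kp km J (c * z) = z \<cdot>\<^sub>m current h kp 0 J c + inverse z \<cdot>\<^sub>m current h 0 km J c"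
    "current h kp km J (inverse z * c) = z \<cdot>\<^sub>m current h 0 km J c + inverse z \<cdot>\<^sub>m current h kp 0 J c"
  by (rule eq_matI; auto simp: index_current)+

lemma coproduct_opposite_level:
  assumes q: "not_root_of_unity h" and rs: "r < 2 * Suc n" "s < 2 * Suc n"
    and nz: "(1\<^sub>m 2 \<otimes>\<^sub>m current h kp 0 n a + current h kp 0 1 b \<otimes>\<^sub>m cartan h n) $$ (r, s) \<noteq> 0"
  shows "level (Suc n) s = Suc (level (Suc n) r)"
  using nz rs unfolding coproduct_half(2)[OF q carrier_spin(6) carrier_spin(5)]
  by (auto simp: level_def index_current index_cartan split: if_splits)

text \<open>
  With \<open>J = n + 1\<close>, let \<open>T\<close> intertwine the lowering and the raising operator of the spin-\<open>J/2\<close>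
  representation with \<open>N\<close> and \<open>N'\<close>, where \<open>N\<close> shifts the level by one.  If the image of \<open>T\<close> only
  involves the \<open>J - 1\<close> middle levels, then \<open>T = 0\<close>: the column \<open>c\<close> of \<open>T\<close> involves no level above
  \<open>n - c\<close>, so the last columns vanish, and the raising operator recovers the others from them.
\<close>

lemma graded_intertwiner_zero:
  assumes q: "not_root_of_unity h" and n: "n \<ge> 1" and k: "kp \<noteq> 0" "km \<noteq> 0"
    and T: "T \<in> carrier_mat (2 * Suc n) (Suc (Suc n))"
    and lev: "\<And>r c. r < 2 * Suc n \<Longrightarrow> c < Suc (Suc n) \<Longrightarrow> T $$ (r, c) \<noteq> 0 \<Longrightarrow>
      0 < level (Suc n) r \<and> level (Suc n) r < Suc n"
    and N: "N \<in> carrier_mat (2 * Suc n) (2 * Suc n)"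
      "\<And>r s. r < 2 * Suc n \<Longrightarrow> s < 2 * Suc n \<Longrightarrow> N $$ (r, s) \<noteq> 0 \<Longrightarrow> level (Suc n) s = Suc (level (Suc n) r)"
    and lower: "T * current (inverse h) 0 km (Suc n) 1 = N * T"
    and raise: "T * current h kp 0 (Suc n) 1 = N' * T" "N' \<in> carrier_mat (2 * Suc n) (2 * Suc n)"
  shows "T = 0\<^sub>m (2 * Suc n) (Suc (Suc n))"
proof -
  let ?J = "Suc n"
  have h0: "h \<noteq> 0" by (rule not_root_of_unity_nonzero[OF q])
  have low: "\<exists>x. x \<noteq> 0 \<and> (\<forall>r<2 * ?J. (N * T) $$ (r, c) = T $$ (r, Suc c) * x)" if c: "c \<le> n" for c
  proof -
    let ?x = "current (inverse h) 0 km ?J 1 $$ (Suc c, c)"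
    have "?x \<noteq> 0"
      using c k h0 ladder_nonzero[OF q, of c ?J] by (simp add: index_current spin_inverse)
    moreover have "(N * T) $$ (r, c) = T $$ (r, Suc c) * ?x" if r: "r < 2 * ?J" for r
    proof -
      have "(N * T) $$ (r, c) = (\<Sum>s<Suc ?J. T $$ (r, s) * current (inverse h) 0 km ?J 1 $$ (s, c))"
        unfolding lower[symmetric] by (rule index_mult_sum[OF T carrier_spin(6) r]) (use c in simp)
      also have "\<dots> = (\<Sum>s<Suc ?J. if s = Suc c then T $$ (r, Suc c) * ?x else 0)"
        using c by (intro sum.cong refl) (auto simp: index_current)
      finally show ?thesis using c by (simp del: sum.lessThan_Suc)
    qed
    ultimately show ?thesis by blast
  qed
  have rai: "\<exists>x. x \<noteq> 0 \<and> (\<forall>r<2 * ?J. (N' * T) $$ (r, Suc c) = T $$ (r, c) * x)" if c: "c \<le> n" for c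
  proof -
    let ?x = "current h kp 0 ?J 1 $$ (c, Suc c)"
    have "?x \<noteq> 0"
      using c k h0 ladder_nonzero[OF q, of c ?J] by (simp add: index_current)
    moreover have "(N' * T) $$ (r, Suc c) = T $$ (r, c) * ?x" if r: "r < 2 * ?J" for r
    proof -
      have "(N' * T) $$ (r, Suc c) = (\<Sum>s<Suc ?J. T $$ (r, s) * current h kp 0 ?J 1 $$ (s, Suc c))"
        unfolding raise(1)[symmetric] by (rule index_mult_sum[OF T carrier_spin(6) r]) (use c in simp)
      also have "\<dots> = (\<Sum>s<Suc ?J. if s = c then T $$ (r, c) * ?x else 0)"
        using c by (intro sum.cong refl) (auto simp: index_current)
      finally show ?thesis using c by (simp del: sum.lessThan_Suc)
    qed
    ultimately show ?thesis by blast
  qed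
  have bound: "level ?J r + c \<le> n" if "c \<le> ?J" "r < 2 * ?J" "T $$ (r, c) \<noteq> 0" for r c
    using that
  proof (induction c arbitrary: r)
    case 0
    then show ?case using lev[of r 0] by simp
  next
    case (Suc c)
    obtain x where x: "x \<noteq> 0" "\<And>r. r < 2 * ?J \<Longrightarrow> (N * T) $$ (r, c) = T $$ (r, Suc c) * x"
      using low[of c] Suc.prems by auto
    have "(N * T) $$ (r, c) \<noteq> 0" using x Suc.prems by simp
    moreover have "(N * T) $$ (r, c) = (\<Sum>s<2 * ?J. N $$ (r, s) * T $$ (s, c))"
      by (rule index_mult_sum[OF N(1) T]) (use Suc.prems in simp_all)
    ultimately obtain s where s: "s < 2 * ?J" "N $$ (r, s) * T $$ (s, c) \<noteq> 0"
      by (metis (no_types, lifting) lessThan_iff sum.neutral)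
    then have "level ?J s = Suc (level ?J r)" using N(2)[of r s] Suc.prems by simp
    moreover have "level ?J s + c \<le> n" using Suc.IH[of s] Suc.prems s by simp
    ultimately show ?case by simp
  qed
  have zero: "T $$ (r, c) = 0" if "n \<le> c" "c \<le> ?J" "r < 2 * ?J" for r c
    using bound[of c r] lev[of r c] that by fastforce
  have down: "T $$ (r, n - d) = 0" if "r < 2 * ?J" for r d
    using that
  proof (induction d arbitrary: r)
    case 0
    then show ?case using zero[of n r] by simp
  next
    case (Suc d)
    show ?case
    proof (cases "d < n")
      case True
      then have e: "Suc (n - Suc d) = n - d" by simp
      obtain x where x: "x \<noteq> 0" "\<And>r. r < 2 * ?J \<Longrightarrow> (N' * T) $$ (r, n - d) = T $$ (r, n - Suc d) * x"
        using rai[of "n - Suc d"] e by auto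
      have "(N' * T) $$ (r, n - d) = (\<Sum>s<2 * ?J. N' $$ (r, s) * T $$ (s, n - d))"
        by (rule index_mult_sum[OF raise(2) T]) (use Suc.prems in simp_all)
      also have "\<dots> = 0" by (intro sum.neutral ballI) (simp add: Suc.IH)
      finally show ?thesis using x Suc.prems by simp
    next
      case False
      then show ?thesis using Suc.IH[OF Suc.prems] by simp
    qed
  qed
  show ?thesis
  proof (rule eq_matI)
    fix r c assume "r < dim_row (0\<^sub>m (2 * ?J) (Suc ?J) :: complex mat)" "c < dim_col (0\<^sub>m (2 * ?J) (Suc ?J) :: complex mat)"
    then have rc: "r < 2 * ?J" "c \<le> ?J" by auto
    have "T $$ (r, c) = 0"
      using zero[of c r] down[of r "n - c"] rc by (cases "n \<le> c") auto
    then show "T $$ (r, c) = 0\<^sub>m (2 * ?J) (Suc ?J) $$ (r, c)" using rc by simp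
  qed (use T in auto)
qed

lemma mat_split_sum:
  fixes A B C D :: "complex mat"
  assumes "A \<in> carrier_mat m n" "B \<in> carrier_mat m n" "C \<in> carrier_mat m n" "D \<in> carrier_mat m n"
  shows "(z \<cdot>\<^sub>m A + w \<cdot>\<^sub>m B) + (z \<cdot>\<^sub>m C + w \<cdot>\<^sub>m D) = z \<cdot>\<^sub>m (A + C) + w \<cdot>\<^sub>m (B + D)"
  by (rule eq_matI) (use assms in \<open>auto simp: algebra_simps\<close>)

text \<open>
  The operator \<open>M u\<close> below measures the failure of \<open>K\<^sub>1 R K\<^sub>2\<close> to preserve the symmetric part.  Its
  coefficient of the highest power of \<open>u\<close> intertwines the raising and lowering operators and maps
  into the middle levels, hence vanishes.  Here both off-diagonal parameters have to be nonzero.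
\<close>

lemma reflect_fused:
  fixes K1 K2 R :: "complex \<Rightarrow> complex mat"
  assumes q: "not_root_of_unity h" and n: "n \<ge> 1" and k: "kp \<noteq> 0" "km \<noteq> 0"
    and L: "laurent_mat 2 2 K1" "laurent_mat (Suc n) (Suc n) K2" "laurent_mat (2 * Suc n) (2 * Suc n) R"
    and K1: "\<And>u. u \<noteq> 0 \<Longrightarrow> reflect h ep kp km 1 (u * h powi (1 - int (Suc n))) (K1 u)"
      "\<And>u. u \<noteq> 0 \<Longrightarrow> reflect (inverse h) em kp km 1 (inverse u * inverse h powi (1 - int (Suc n))) (K1 u)"
    and K2: "\<And>u. u \<noteq> 0 \<Longrightarrow> reflect h ep kp km n (u * h) (K2 u)"
      "\<And>u. u \<noteq> 0 \<Longrightarrow> reflect (inverse h) em kp km n (inverse u * inverse h) (K2 u)"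
    and R: "\<And>u. u \<noteq> 0 \<Longrightarrow> exchange h 1 n (u\<^sup>2 * h powi (2 - int (Suc n))) (R u)"
      "\<And>u. u \<noteq> 0 \<Longrightarrow> exchange (inverse h) 1 n ((inverse u)\<^sup>2 * inverse h powi (2 - int (Suc n))) (R u)"
    and u: "u \<noteq> 0"
  defines "Z \<equiv> \<lambda>u. (K1 u \<otimes>\<^sub>m 1\<^sub>m (Suc n)) * R u * (1\<^sub>m 2 \<otimes>\<^sub>m K2 u)"
    and "E \<equiv> E_mat h (Suc n)" and "F \<equiv> F_mat h (Suc n)"
  shows "reflect h ep kp km (Suc n) u (F * (Z u * E))"
    "reflect (inverse h) em kp km (Suc n) (inverse u) (F * (Z u * E))"
proof -
  let ?J = "Suc n"
  note q' = not_root_of_unity_inverse[OF q]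
  define P where "P = antisymmetrizer h ?J"
  define M where "M = (\<lambda>u. P * (Z u * E))"
  have Pc: "P \<in> carrier_mat (2 * ?J) (2 * ?J)" unfolding P_def by (rule antisymmetrizer_carrier)
  have Ec: "E \<in> carrier_mat (2 * ?J) (Suc ?J)" unfolding E_def by (rule dim_E_F)
  have Fc: "F \<in> carrier_mat (Suc ?J) (2 * ?J)" unfolding F_def by (rule dim_E_F)
  have LZ: "laurent_mat (2 * ?J) (2 * ?J) Z"
    unfolding Z_def
    by (rule laurent_mat_mult[OF laurent_mat_mult[OF laurent_mat_kron[OF L(1) laurent_mat_const[OF one_carrier_mat]] L(3)]
          laurent_mat_kron[OF laurent_mat_const[OF one_carrier_mat] L(2)]])
  have LZE: "laurent_mat (2 * ?J) (Suc ?J) (\<lambda>u. Z u * E)"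
    by (rule laurent_mat_mult[OF LZ laurent_mat_const[OF Ec]])
  have LM: "laurent_mat (2 * ?J) (Suc ?J) M"
    unfolding M_def by (rule laurent_mat_mult[OF laurent_mat_const[OF Pc] LZE])
  note c = L[THEN laurent_matD(1)]
  note ZE = laurent_matD(1)[OF LZE] and Mc = laurent_matD(1)[OF LM]
  define W where "W = (\<lambda>h kp km. 1\<^sub>m 2 \<otimes>\<^sub>m current h kp km n (inverse h)
        + current h kp km 1 (h powi (int ?J - 1)) \<otimes>\<^sub>m cartan h n)"
  define G where "G = (\<lambda>h. cartan h 1 \<otimes>\<^sub>m cartan h n)"
  have Gc: "G h \<in> carrier_mat (2 * ?J) (2 * ?J)" for h
    using kron_carrier[OF carrier_spin(5)[of h 1] carrier_spin(5)[of h n]] by (simp only: G_def numeral_2_eq_2 One_nat_def)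
  have cc: "1\<^sub>m 2 \<otimes>\<^sub>m current h kp km n a \<in> carrier_mat (2 * ?J) (2 * ?J)"
    "current h kp km 1 b \<otimes>\<^sub>m cartan h n \<in> carrier_mat (2 * ?J) (2 * ?J)" for h kp km a b
    using kron_carrier[OF one_carrier_mat carrier_spin(6)[of h kp km n a], of 2]
      kron_carrier[OF carrier_spin(6)[of h kp km 1 b] carrier_spin(5)[of h n]]
    by (simp_all only: numeral_2_eq_2 One_nat_def)
  have Wc: "W h kp km \<in> carrier_mat (2 * ?J) (2 * ?J)" for h kp km
    unfolding W_def by (rule add_carrier_mat[OF cc(2)])
  have kd: "C \<otimes>\<^sub>m (z \<cdot>\<^sub>m current h kp km n a + w \<cdot>\<^sub>m current h kp' km' n a)
      = z \<cdot>\<^sub>m (C \<otimes>\<^sub>m current h kp km n a) + w \<cdot>\<^sub>m (C \<otimes>\<^sub>m current h kp' km' n a)"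
    "(z \<cdot>\<^sub>m current h kp km 1 a + w \<cdot>\<^sub>m current h kp' km' 1 a) \<otimes>\<^sub>m C
      = z \<cdot>\<^sub>m (current h kp km 1 a \<otimes>\<^sub>m C) + w \<cdot>\<^sub>m (current h kp' km' 1 a \<otimes>\<^sub>m C)" for C z w h kp km kp' km' a
    by (simp_all add: kron_add_left kron_add_right kron_smult_left kron_smult_right)
  have split: "1\<^sub>m 2 \<otimes>\<^sub>m current h kp km n (inverse z * inverse h)
        + current h kp km 1 (inverse z * h powi (int ?J - 1)) \<otimes>\<^sub>m cartan h n
      = z \<cdot>\<^sub>m W h 0 km + inverse z \<cdot>\<^sub>m W h kp 0"
    "1\<^sub>m 2 \<otimes>\<^sub>m current h kp km n (z * inverse h)
        + current h kp km 1 (z * h powi (int ?J - 1)) \<otimes>\<^sub>m cartan h n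
      = z \<cdot>\<^sub>m W h kp 0 + inverse z \<cdot>\<^sub>m W h 0 km" if "z \<noteq> 0" for z h
    unfolding W_def mult.commute[of z] current_split[OF that]
    by (simp_all only: kd mat_split_sum[OF cc(1) cc(1) cc(2) cc(2)])
  have PW: "P * (z \<cdot>\<^sub>m A + w \<cdot>\<^sub>m B) + e \<cdot>\<^sub>m H = z \<cdot>\<^sub>m (P * A) + e \<cdot>\<^sub>m H + w \<cdot>\<^sub>m (P * B)"
    if "A \<in> carrier_mat (2 * ?J) (2 * ?J)" "B \<in> carrier_mat (2 * ?J) (2 * ?J)" "H \<in> carrier_mat (2 * ?J) (2 * ?J)"
    for A B H z w e
  proof -
    have "P * (z \<cdot>\<^sub>m A + w \<cdot>\<^sub>m B) = z \<cdot>\<^sub>m (P * A) + w \<cdot>\<^sub>m (P * B)"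
      using mult_add_distrib_mat[OF Pc, of "z \<cdot>\<^sub>m A" "2 * ?J" "w \<cdot>\<^sub>m B"] mult_smult_distrib[OF Pc that(1)]
        mult_smult_distrib[OF Pc that(2)] that by simp
    then show ?thesis using that Pc by (intro eq_matI) auto
  qed
  have XS: "(z \<cdot>\<^sub>m A + w \<cdot>\<^sub>m B) + e \<cdot>\<^sub>m H = z \<cdot>\<^sub>m A + e \<cdot>\<^sub>m H + w \<cdot>\<^sub>m B"
    if "A \<in> carrier_mat m m" "B \<in> carrier_mat m m" "H \<in> carrier_mat m m" for A B H :: "complex mat" and z w e m
    by (rule eq_matI) (use that in auto)
  have eq: "M z * (z \<cdot>\<^sub>m current h kp 0 ?J 1 + ep \<cdot>\<^sub>m cartan h ?J + inverse z \<cdot>\<^sub>m current h 0 km ?J 1)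
      = (z \<cdot>\<^sub>m (P * W h 0 km) + ep \<cdot>\<^sub>m G h + inverse z \<cdot>\<^sub>m (P * W h kp 0)) * M z" if z: "z \<noteq> 0" for z
  proof -
    have "M z * (current h kp km ?J (1 * z) + ep \<cdot>\<^sub>m cartan h ?J)
      = (P * (z \<cdot>\<^sub>m W h 0 km + inverse z \<cdot>\<^sub>m W h kp 0) + ep \<cdot>\<^sub>m G h) * M z"
      using intertwinesD(1)[OF reflect_descend(2)[OF q n z K1(1)[OF z] c(1) K2(1)[OF z] c(2) R(1)[OF z] c(3)]]
      unfolding split[OF z] by (simp only: M_def P_def Z_def E_def G_def mult_1_left)
    then show ?thesis
      unfolding current_split[OF z] PW[OF Wc Wc Gc] XS[OF carrier_spin(6) carrier_spin(6) carrier_spin(5)] .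
  qed
  have eq': "M z * (z \<cdot>\<^sub>m current (inverse h) 0 km ?J 1 + em \<cdot>\<^sub>m cartan (inverse h) ?J + inverse z \<cdot>\<^sub>m current (inverse h) kp 0 ?J 1)
      = (z \<cdot>\<^sub>m (P * W (inverse h) kp 0) + em \<cdot>\<^sub>m G (inverse h) + inverse z \<cdot>\<^sub>m (P * W (inverse h) 0 km)) * M z"
    if z: "z \<noteq> 0" for z
  proof -
    have z': "inverse z \<noteq> 0" using z by simp
    have "M z * (current (inverse h) kp km ?J (inverse z * 1) + em \<cdot>\<^sub>m cartan (inverse h) ?J)
      = (P * (z \<cdot>\<^sub>m W (inverse h) kp 0 + inverse z \<cdot>\<^sub>m W (inverse h) 0 km) + em \<cdot>\<^sub>m G (inverse h)) * M z"
      using intertwinesD(1)[OF reflect_descend(2)[OF q' n z' K1(2)[OF z] c(1) K2(2)[OF z] c(2) R(2)[OF z] c(3)]]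
      unfolding inverse_inverse_eq[of z] split[OF z] spin_inverse
      by (simp only: M_def P_def Z_def E_def G_def mult_1_right)
    then show ?thesis
      unfolding current_split[OF z] PW[OF Wc Wc Gc] XS[OF carrier_spin(6) carrier_spin(6) carrier_spin(5)] .
  qed
  have PP: "P * P = P"
  proof -
    have "P * (E * F) = (P * E) * F" by (rule assoc_mult_mat[OF Pc Ec Fc, symmetric])
    also have "P * E = 0\<^sub>m (2 * ?J) (Suc ?J)"
      unfolding P_def E_def by (rule antisymmetrizer_E_mat[OF q]) (use n in simp)
    also have "0\<^sub>m (2 * ?J) (Suc ?J) * F = 0\<^sub>m (2 * ?J) (2 * ?J)" by (rule left_mult_zero_mat[OF Fc])
    finally have 0: "P * (E * F) = 0\<^sub>m (2 * ?J) (2 * ?J)" .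
    have "P * P + P * (E * F) = P * (P + E * F)"
      by (rule mult_add_distrib_mat[OF Pc Pc mult_carrier_mat[OF Ec Fc], symmetric])
    also have "P + E * F = 1\<^sub>m (2 * ?J)" unfolding P_def E_def F_def by (rule antisymmetrizer_plus)
    also have "P * 1\<^sub>m (2 * ?J) = P" by (rule right_mult_one_mat[OF Pc])
    finally show ?thesis unfolding 0 right_add_zero_mat[OF mult_carrier_mat[OF Pc Pc]] .
  qed
  have PM: "P * M z = M z" for z
    unfolding M_def using assoc_mult_mat[OF Pc Pc ZE[of z]] PP by simp
  have M0: "M u = 0\<^sub>m (2 * ?J) (Suc ?J)"
  proof (rule ccontr)
    assume "M u \<noteq> 0\<^sub>m (2 * ?J) (Suc ?J)"
    then obtain i j where ij: "i < 2 * ?J" "j < Suc ?J" "M u $$ (i, j) \<noteq> 0"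
      using Mc[of u] by (metis (no_types, lifting) carrier_matD eq_matI index_zero_mat)
    obtain T where T: "T \<in> carrier_mat (2 * ?J) (Suc ?J)" "T \<noteq> 0\<^sub>m (2 * ?J) (Suc ?J)"
      "\<And>X X0 X' Y Y0 Y' :: complex mat. X \<in> carrier_mat (Suc ?J) (Suc ?J) \<Longrightarrow> X0 \<in> carrier_mat (Suc ?J) (Suc ?J) \<Longrightarrow>
        X' \<in> carrier_mat (Suc ?J) (Suc ?J) \<Longrightarrow> Y \<in> carrier_mat (2 * ?J) (2 * ?J) \<Longrightarrow>
        Y0 \<in> carrier_mat (2 * ?J) (2 * ?J) \<Longrightarrow> Y' \<in> carrier_mat (2 * ?J) (2 * ?J) \<Longrightarrow>
        (\<And>z. z \<noteq> 0 \<Longrightarrow> M z * (z \<cdot>\<^sub>m X + X0 + inverse z \<cdot>\<^sub>m X') = (z \<cdot>\<^sub>m Y + Y0 + inverse z \<cdot>\<^sub>m Y') * M z) \<Longrightarrow>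
        T * X = Y * T"
      using laurent_mat_leading[OF LM ij(1,2) u ij(3)] by blast
    have sc: "e \<cdot>\<^sub>m cartan h ?J \<in> carrier_mat (Suc ?J) (Suc ?J)" "e \<cdot>\<^sub>m G h \<in> carrier_mat (2 * ?J) (2 * ?J)" for e h
      by (rule smult_carrier_mat[OF carrier_spin(5)], rule smult_carrier_mat[OF Gc])
    note PWc = mult_carrier_mat[OF Pc Wc]
    have raise: "T * current h kp 0 ?J 1 = (P * W h 0 km) * T"
      by (rule T(3)[OF carrier_spin(6) sc(1) carrier_spin(6) PWc sc(2) PWc eq])
    have lower: "T * current (inverse h) 0 km ?J 1 = (P * W (inverse h) kp 0) * T"
      by (rule T(3)[OF carrier_spin(6) sc(1) carrier_spin(6) PWc sc(2) PWc eq'])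
    have PT: "P * T = T"
    proof -
      have "T * 1\<^sub>m (Suc ?J) = P * T"
      proof (rule T(3)[OF one_carrier_mat zero_carrier_mat zero_carrier_mat Pc zero_carrier_mat zero_carrier_mat])
        fix z :: complex
        have "z \<cdot>\<^sub>m 1\<^sub>m (Suc ?J) + 0\<^sub>m (Suc ?J) (Suc ?J) + inverse z \<cdot>\<^sub>m 0\<^sub>m (Suc ?J) (Suc ?J) = z \<cdot>\<^sub>m 1\<^sub>m (Suc ?J)"
          by (rule eq_matI) auto
        moreover have "z \<cdot>\<^sub>m P + 0\<^sub>m (2 * ?J) (2 * ?J) + inverse z \<cdot>\<^sub>m 0\<^sub>m (2 * ?J) (2 * ?J) = z \<cdot>\<^sub>m P"
          by (rule eq_matI) (use Pc in auto)
        ultimately show "M z * (z \<cdot>\<^sub>m 1\<^sub>m (Suc ?J) + 0\<^sub>m (Suc ?J) (Suc ?J) + inverse z \<cdot>\<^sub>m 0\<^sub>m (Suc ?J) (Suc ?J))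
          = (z \<cdot>\<^sub>m P + 0\<^sub>m (2 * ?J) (2 * ?J) + inverse z \<cdot>\<^sub>m 0\<^sub>m (2 * ?J) (2 * ?J)) * M z"
          using mult_smult_distrib[OF Mc[of z] one_carrier_mat] mult_smult_assoc_mat[OF Pc Mc[of z]]
            right_mult_one_mat[OF Mc[of z]] PM[of z] by simp
      qed
      then show ?thesis using right_mult_one_mat[OF T(1)] by simp
    qed
    have "n + 1 \<ge> 2" using n by simp
    then have J2: "?J \<ge> 2" by simp
    have "T = 0\<^sub>m (2 * ?J) (Suc ?J)"
    proof (rule graded_intertwiner_zero[OF q n k T(1) _ _ _ lower raise])
      show "0 < level ?J r \<and> level ?J r < ?J" if rc: "r < 2 * ?J" "c < Suc ?J" "T $$ (r, c) \<noteq> 0" for r c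
      proof -
        have "T $$ (r, c) = (\<Sum>s<2 * ?J. P $$ (r, s) * T $$ (s, c))"
          using index_mult_sum[OF Pc T(1) rc(1,2)] PT by simp
        then obtain s where "s < 2 * ?J" "P $$ (r, s) \<noteq> 0"
          using rc(3) by (metis (no_types, lifting) lessThan_iff mult_zero_left sum.neutral)
        then have "level ?J r \<noteq> 0" "level ?J r \<noteq> ?J"
          using index_antisymmetrizer(2,3)[OF q J2 rc(1)] unfolding P_def by blast+
        moreover have "level ?J r \<le> ?J" using rc(1) by (auto simp: level_def)
        ultimately show ?thesis by simp
      qed
      show "level ?J s = Suc (level ?J r)"
        if rs: "r < 2 * ?J" "s < 2 * ?J" and nz: "(P * W (inverse h) kp 0) $$ (r, s) \<noteq> 0" for r s
      proof -
        have "(P * W (inverse h) kp 0) $$ (r, s) = (\<Sum>t<2 * ?J. P $$ (r, t) * W (inverse h) kp 0 $$ (t, s))"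
          by (rule index_mult_sum[OF Pc Wc rs])
        then obtain t where t: "t < 2 * ?J" "P $$ (r, t) \<noteq> 0" "W (inverse h) kp 0 $$ (t, s) \<noteq> 0"
          using nz by (metis (no_types, lifting) lessThan_iff mult_zero_left mult_zero_right sum.neutral)
        have "level ?J r = level ?J t"
          using index_antisymmetrizer(1)[OF q J2 rs(1) t(1)] t(2) unfolding P_def by blast
        then show ?thesis
          using coproduct_opposite_level[OF q' t(1) rs(2)] t(3) unfolding W_def by simp
      qed
    qed (rule PWc)+
    then show False using T(2) by simp
  qed
  have inv: "E * (F * (Z u * E)) = Z u * E"
  proof -
    have "Z u * E = (P + E * F) * (Z u * E)"
      unfolding P_def E_def F_def antisymmetrizer_plus using left_mult_one_mat[OF ZE[of u]] by (simp only: E_def)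
    also have "\<dots> = P * (Z u * E) + (E * F) * (Z u * E)"
      by (rule add_mult_distrib_mat[OF Pc mult_carrier_mat[OF Ec Fc] ZE])
    also have "\<dots> = (E * F) * (Z u * E)"
      using M0 left_add_zero_mat[OF mult_carrier_mat[OF mult_carrier_mat[OF Ec Fc] ZE[of u]]] unfolding M_def by simp
    also have "\<dots> = E * (F * (Z u * E))" by (rule assoc_mult_mat[OF Ec Fc ZE])
    finally show ?thesis ..
  qed
  show "reflect h ep kp km ?J u (F * (Z u * E))"
    using reflect_descend(1)[OF q n u K1(1)[OF u] c(1) K2(1)[OF u] c(2) R(1)[OF u] c(3)] inv
    unfolding E_def F_def Z_def by simp
  show "reflect (inverse h) em kp km ?J (inverse u) (F * (Z u * E))"
    using reflect_descend(1)[OF q' n _ K1(2)[OF u] c(1) K2(2)[OF u] c(2) R(2)[OF u] c(3)] inv u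
    unfolding E_def F_def Z_def spin_inverse by simp
qed

lemma laurent_K_half:
  assumes "laurent kp" "laurent km" "laurent f" "laurent (\<lambda>z. inverse (f z))"
  shows "laurent_mat 2 2 (\<lambda>z. K_half h ep em (kp z) (km z) (f z))"
proof (rule laurent_matI)
  fix i j assume "i < (2::nat)" "j < (2::nat)"
  then have "i = 0 \<or> i = Suc 0" "j = 0 \<or> j = Suc 0" by auto
  then show "laurent (\<lambda>z. K_half h ep em (kp z) (km z) (f z) $$ (i, j))"
    by (elim disjE) (simp_all only: index_K_half c_fun_def power2_eq_square inverse_mult_distrib divide_inverse,
      (intro laurent_add laurent_mult laurent_diff laurent_const assms)+)
qed simp

lemma K_mat_fused:
  assumes c: "K_mat h ep em kp km (Suc n) (u * h) \<in> carrier_mat (Suc (Suc n)) (Suc (Suc n))"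
    "R_half h (Suc n) (u\<^sup>2 * h powi (2 - int (Suc (Suc n)))) \<in> carrier_mat (2 * Suc (Suc n)) (2 * Suc (Suc n))"
  shows "K_mat h ep em kp km (Suc (Suc n)) u = F_mat h (Suc (Suc n))
     * ((K_half h ep em kp km (u * h powi (1 - int (Suc (Suc n)))) \<otimes>\<^sub>m 1\<^sub>m (Suc (Suc n)))
        * R_half h (Suc n) (u\<^sup>2 * h powi (2 - int (Suc (Suc n))))
        * (1\<^sub>m 2 \<otimes>\<^sub>m K_mat h ep em kp km (Suc n) (u * h)) * E_mat h (Suc (Suc n)))"
proof -
  let ?J = "Suc (Suc n)"
  let ?K = "K_half h ep em kp km (u * h powi (1 - int ?J)) \<otimes>\<^sub>m 1\<^sub>m ?J"
    and ?R = "R_half h (Suc n) (u\<^sup>2 * h powi (2 - int ?J))"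
    and ?B = "1\<^sub>m 2 \<otimes>\<^sub>m K_mat h ep em kp km (Suc n) (u * h)"
  have F: "F_mat h ?J \<in> carrier_mat (Suc ?J) (2 * ?J)" and E: "E_mat h ?J \<in> carrier_mat (2 * ?J) (Suc ?J)"
    by (rule dim_E_F)+
  have K: "?K \<in> carrier_mat (2 * ?J) (2 * ?J)" by (rule kron_carrier[OF K_half_carrier(1) one_carrier_mat])
  have B: "?B \<in> carrier_mat (2 * ?J) (2 * ?J)" by (rule kron_carrier[OF one_carrier_mat c(1)])
  have KR: "?K * ?R \<in> carrier_mat (2 * ?J) (2 * ?J)" by (rule mult_carrier_mat[OF K c(2)])
  have "K_mat h ep em kp km ?J u = F_mat h ?J * ?K * ?R * ?B * E_mat h ?J"
    by simp
  also have "F_mat h ?J * ?K * ?R = F_mat h ?J * (?K * ?R)" by (rule assoc_mult_mat[OF F K c(2)])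
  also have "\<dots> * ?B = F_mat h ?J * (?K * ?R * ?B)" by (rule assoc_mult_mat[OF F KR B])
  also have "\<dots> * E_mat h ?J = F_mat h ?J * (?K * ?R * ?B * E_mat h ?J)"
    by (rule assoc_mult_mat[OF F mult_carrier_mat[OF KR B] E])
  finally show ?thesis .
qed

lemma R_half_carrier: "R_half h J u \<in> carrier_mat (2 * Suc J) (2 * Suc J)"
  by (rule laurent_matD(1)[OF laurent_R_half[where f = "\<lambda>_. u"]]) (rule laurent_const)+

lemma laurent_K_mat:
  assumes "laurent kp" "laurent km" "laurent f" "laurent (\<lambda>z. inverse (f z))"
  shows "laurent_mat (Suc J) (Suc J) (\<lambda>z. K_mat h ep em (kp z) (km z) J (f z))"
  using assms(3,4)
proof (induction J arbitrary: f rule: induct_nat_012)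
  case 0
  show ?case by (simp add: laurent_mat_const)
next
  case 1
  show ?case using laurent_K_half[OF assms(1,2) 1] unfolding K_mat.simps numeral_2_eq_2 .
next
  case (ge2 n)
  let ?J = "Suc (Suc n)"
  have f: "laurent (\<lambda>z. f z * h powi k)" "laurent (\<lambda>z. inverse (f z * h powi k))"
    "laurent (\<lambda>z. (f z)\<^sup>2 * h powi k)" "laurent (\<lambda>z. inverse ((f z)\<^sup>2 * h powi k))"
    "laurent (\<lambda>z. f z * h)" "laurent (\<lambda>z. inverse (f z * h))" for k
    unfolding inverse_mult_distrib power2_eq_square using ge2(3,4) by (auto intro!: laurent_mult laurent_const)
  have IH: "laurent_mat ?J ?J (\<lambda>z. K_mat h ep em (kp z) (km z) (Suc n) (f z * h))"
    by (rule ge2(2)[OF f(5,6)])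
  show ?case
    unfolding K_mat_fused[OF laurent_matD(1)[OF IH] R_half_carrier]
    by (rule laurent_mat_mult[OF laurent_mat_const[OF dim_E_F(6)] laurent_mat_mult[OF laurent_mat_mult[OF laurent_mat_mult[OF
          laurent_mat_kron[OF laurent_K_half[OF assms(1,2) f(1,2)] laurent_mat_const[OF one_carrier_mat]]
          laurent_R_half[OF f(3,4)]] laurent_mat_kron[OF laurent_mat_const[OF one_carrier_mat] IH]]
          laurent_mat_const[OF dim_E_F(5)]]])
qed

lemma K_mat_carrier: "K_mat h ep em kp km J u \<in> carrier_mat (Suc J) (Suc J)"
  by (rule laurent_matD(1)[OF laurent_K_mat[where f = "\<lambda>_. u" and kp = "\<lambda>_. kp" and km = "\<lambda>_. km"]])
    (rule laurent_const)+

lemma reflect_K_mat: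
  assumes q: "not_root_of_unity h" and k: "kp \<noteq> 0" "km \<noteq> 0" and "u \<noteq> 0"
  shows "reflect h ep kp km (Suc n) u (K_mat h ep em kp km (Suc n) u)"
    "reflect (inverse h) em kp km (Suc n) (inverse u) (K_mat h ep em kp km (Suc n) u)"
proof -
  have h0: "h \<noteq> 0" by (rule not_root_of_unity_nonzero[OF q])
  have "reflect h ep kp km (Suc n) u (K_mat h ep em kp km (Suc n) u) \<and>
    reflect (inverse h) em kp km (Suc n) (inverse u) (K_mat h ep em kp km (Suc n) u)"
    using \<open>u \<noteq> 0\<close>
  proof (induction n arbitrary: u)
    case 0
    then show ?case using reflect_half[OF q] reflect_half_inverse[OF q] by simp
  next
    case (Suc n)
    let ?J = "Suc (Suc n)"
    define K1 where "K1 = (\<lambda>z. K_half h ep em kp km (z * h powi (1 - int ?J)))"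
    define K2 where "K2 = (\<lambda>z. K_mat h ep em kp km (Suc n) (z * h))"
    define R where "R = (\<lambda>z. R_half h (Suc n) (z\<^sup>2 * h powi (2 - int ?J)))"
    have i: "inverse z * inverse h powi k = inverse (z * h powi k)" "inverse z * inverse h = inverse (z * h)"
      "(inverse z)\<^sup>2 * inverse h powi k = inverse (z\<^sup>2 * h powi k)" for z k
      by (simp_all add: power_int_inverse power_inverse)
    have l: "laurent (\<lambda>z. z * c)" "laurent (\<lambda>z. inverse (z * c))"
      "laurent (\<lambda>z. z\<^sup>2 * c)" "laurent (\<lambda>z. inverse (z\<^sup>2 * c))" for c
      unfolding inverse_mult_distrib power2_eq_square
      by (intro laurent_mult laurent_ident laurent_inverse laurent_const)+
    have L: "laurent_mat 2 2 K1" "laurent_mat ?J ?J K2" "laurent_mat (2 * ?J) (2 * ?J) R"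
      unfolding K1_def K2_def R_def
      by (rule laurent_K_half[OF laurent_const laurent_const l(1,2)]
          laurent_K_mat[OF laurent_const laurent_const l(1,2)] laurent_R_half[OF l(3,4)])+
    have nz: "z * h powi k \<noteq> 0" "z\<^sup>2 * h powi k \<noteq> 0" "z * h \<noteq> 0" if "z \<noteq> 0" for z k
      using that h0 by simp_all
    have K1: "reflect h ep kp km 1 (z * h powi (1 - int ?J)) (K1 z)"
      "reflect (inverse h) em kp km 1 (inverse z * inverse h powi (1 - int ?J)) (K1 z)" if "z \<noteq> 0" for z
      unfolding K1_def i by (rule reflect_half[OF q nz(1)[OF that]], rule reflect_half_inverse[OF q nz(1)[OF that]])
    have K2: "reflect h ep kp km (Suc n) (z * h) (K2 z)"
      "reflect (inverse h) em kp km (Suc n) (inverse z * inverse h) (K2 z)" if "z \<noteq> 0" for z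
      unfolding K2_def i using Suc.IH[OF nz(3)[OF that]] by blast+
    have R: "exchange h 1 (Suc n) (z\<^sup>2 * h powi (2 - int ?J)) (R z)"
      "exchange (inverse h) 1 (Suc n) ((inverse z)\<^sup>2 * inverse h powi (2 - int ?J)) (R z)" if "z \<noteq> 0" for z
      unfolding R_def i
      by (rule exchange_half[OF q _ nz(2)[OF that]], simp, rule exchange_half_inverse[OF q _ nz(2)[OF that]], simp)
    have "1 \<le> Suc n" by simp
    from reflect_fused[OF q this k L K1 K2 R Suc.prems] show ?case
      unfolding K_mat_fused[OF K_mat_carrier R_half_carrier] K1_def K2_def R_def by blast
  qed
  then show "reflect h ep kp km (Suc n) u (K_mat h ep em kp km (Suc n) u)"
    "reflect (inverse h) em kp km (Suc n) (inverse u) (K_mat h ep em kp km (Suc n) u)" by blast+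
qed

section \<open>The diagonal K-matrix of the auxiliary space\<close>

lemma intertwines_K_mat_zero_cartan:
  assumes q: "not_root_of_unity h"
  shows "intertwines (K_mat h ep em 0 0 (Suc n) u) (cartan h (Suc n)) (cartan h (Suc n))"
proof -
  have half: "intertwines (K_half h ep em 0 0 w) (cartan h 1) (cartan h 1)" for w
  proof (rule intertwinesI[of _ 2 2])
    show g: "cartan h 1 \<in> carrier_mat 2 2" by (rule carrier_matI) simp_all
    show "K_half h ep em 0 0 w * cartan h 1 = cartan h 1 * K_half h ep em 0 0 w"
    proof (rule eq_matI)
      fix i j assume "i < dim_row (cartan h 1 * K_half h ep em 0 0 w)" "j < dim_col (cartan h 1 * K_half h ep em 0 0 w)"
      then have ij: "i < 2" "j < 2" by auto
      then have d: "i = 0 \<or> i = Suc 0" "j = 0 \<or> j = Suc 0" by auto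
      show "(K_half h ep em 0 0 w * cartan h 1) $$ (i, j) = (cartan h 1 * K_half h ep em 0 0 w) $$ (i, j)"
        unfolding index_mult_sum[OF K_half_carrier(1) g ij] index_mult_sum[OF g K_half_carrier(1) ij]
        using d by (elim disjE) (simp_all add: numeral_2_eq_2 index_K_half index_cartan)
    qed auto
  qed (rule K_half_carrier(1), rule carrier_matI, simp_all)
  show ?thesis
  proof (induction n arbitrary: u)
    case 0
    then show ?case using half by simp
  next
    case (Suc n)
    let ?J = "Suc (Suc n)"
    have n: "1 \<le> Suc n" by simp
    have R: "intertwines (R_half h (Suc n) w) (cartan h 1 \<otimes>\<^sub>m cartan h (Suc n)) (cartan h 1 \<otimes>\<^sub>m cartan h (Suc n))" for w
      by (rule intertwines_R_half(3)[OF q]) simp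
    have g1: "cartan h 1 \<in> carrier_mat 2 2" by (rule carrier_matI) simp_all
    have "intertwines ((K_half h ep em 0 0 (u * h powi (1 - int ?J)) \<otimes>\<^sub>m 1\<^sub>m ?J)
        * R_half h (Suc n) (u\<^sup>2 * h powi (2 - int ?J)) * (1\<^sub>m 2 \<otimes>\<^sub>m K_mat h ep em 0 0 (Suc n) (u * h)) * E_mat h ?J)
      (cartan h ?J) (cartan h 1 \<otimes>\<^sub>m cartan h (Suc n))"
      by (rule intertwines_comp[OF intertwines_E_mat_cartan[OF q n]
            intertwines_comp[OF intertwines_kron[OF intertwines_one_left[OF g1] Suc.IH]
              intertwines_comp[OF R intertwines_kron[OF half intertwines_one_left[OF carrier_spin(5)]]]]])
    then show ?case
      unfolding K_mat_fused[OF K_mat_carrier R_half_carrier]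
      by (rule intertwines_comp[OF _ intertwines_F_mat_cartan[OF q n]])
  qed
qed

lemma index_K_mat_zero:
  assumes q: "not_root_of_unity h" and "i \<le> Suc n" "j \<le> Suc n" "i \<noteq> j"
  shows "K_mat h ep em 0 0 (Suc n) u $$ (i, j) = 0"
proof -
  let ?K = "K_mat h ep em 0 0 (Suc n) u" and ?g = "cartan h (Suc n)"
  have K: "?K \<in> carrier_mat (Suc (Suc n)) (Suc (Suc n))" by (rule K_mat_carrier)
  have "(?K * ?g) $$ (i, j) = ?K $$ (i, j) * ?g $$ (j, j)"
    by (rule index_mult_diag_right[where n = "Suc (Suc n)"]) (use assms K in \<open>auto simp: index_cartan\<close>)
  moreover have "(?g * ?K) $$ (i, j) = ?g $$ (i, i) * ?K $$ (i, j)"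
    by (rule index_mult_diag_left[where n = "Suc (Suc n)"]) (use assms K in \<open>auto simp: index_cartan\<close>)
  ultimately have "?K $$ (i, j) * ?g $$ (j, j) = ?g $$ (i, i) * ?K $$ (i, j)"
    using intertwinesD(1)[OF intertwines_K_mat_zero_cartan[OF q, of ep em n u]] by metis
  moreover have "?g $$ (i, i) \<noteq> ?g $$ (j, j)"
    using assms not_root_of_unity_powi_inj[OF q] by (simp add: index_cartan del: of_nat_Suc)
  ultimately show ?thesis by (metis mult.commute mult_cancel_left)
qed

lemma current_scale: "current h (c * kp) (c * km) J a = c \<cdot>\<^sub>m current h kp km J a"
  by (rule eq_matI) (auto simp: index_current)

text \<open>
  The recursion for the diagonal entries is the first-order term, in the off-diagonal parameters, of
  the reflection relation.
\<close>

lemma K_mat_zero_recursion: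
  fixes h ep em u :: complex and i J :: nat
  assumes q: "not_root_of_unity h" and u: "u \<noteq> 0" and i: "i < J"
  defines "H \<equiv> h powi (int J - 2 * int i)" and "\<kappa> \<equiv> \<lambda>i. K_mat h ep em 0 0 J u $$ (i, i)"
  shows "em * h * inverse H * (\<kappa> i * u - \<kappa> (Suc i) * inverse u)
    + ep * H * inverse h * (\<kappa> i * inverse u - \<kappa> (Suc i) * u) = 0"
proof -
  have h0: "h \<noteq> 0" by (rule not_root_of_unity_nonzero[OF q])
  have h4: "1 - h ^ 4 \<noteq> 0"
    using not_root_of_unity_powi_inj[OF q, of 4 0] by simp
  have H: "H = h ^ J / (h ^ i)\<^sup>2" unfolding H_def by (rule powi_weight(1)[OF h0])
  have H0: "H \<noteq> 0" using h0 by (simp add: H_def)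
  obtain n where J: "J = Suc n" using i by (cases J) auto
  \<comment> \<open>The reflection relation holds for the off-diagonal parameters \<open>z - 1\<close> with \<open>z \<noteq> 1\<close>; \<open>z\<close>
      instead of \<open>z - 1\<close> is the variable because Laurent polynomials may have a pole at \<open>0\<close>.\<close>
  define K where "K = (\<lambda>z. K_mat h ep em (z - 1) (z - 1) J u)"
  have Kc: "K z \<in> carrier_mat (Suc J) (Suc J)" for z unfolding K_def by (rule K_mat_carrier)
  have LK: "laurent_mat (Suc J) (Suc J) K"
    unfolding K_def by (intro laurent_K_mat laurent_diff laurent_ident laurent_const)
  define f where "f = (\<lambda>h u z. (K z * current h 1 1 J u) $$ (i, Suc i)
      - (current h 1 1 J (inverse u) * K z) $$ (i, Suc i))"
  have Lf: "laurent (f h u)" for h u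
    unfolding f_def using i
    by (intro laurent_diff laurent_matD(2)[OF laurent_mat_mult[OF LK laurent_mat_const[OF carrier_spin(6)]]]
        laurent_matD(2)[OF laurent_mat_mult[OF laurent_mat_const[OF carrier_spin(6)] LK]]) simp_all
  have f: "(z - 1) * f h u z = e * (cartan h J $$ (i, i) - cartan h J $$ (Suc i, Suc i)) * K z $$ (i, Suc i)"
    if "reflect h e (z - 1) (z - 1) J u (K z)" for h u z e
  proof -
    have c: "current h (z - 1) (z - 1) J a = (z - 1) \<cdot>\<^sub>m current h 1 1 J a" for a
      using current_scale[of h "z - 1" 1 1] by simp
    let ?x = "\<lambda>a. current h 1 1 J a" and ?g = "cartan h J"
    have "(K z * ((z - 1) \<cdot>\<^sub>m ?x u + e \<cdot>\<^sub>m ?g)) = ((z - 1) \<cdot>\<^sub>m ?x (inverse u) + e \<cdot>\<^sub>m ?g) * K z"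
      using intertwinesD(1)[OF that[unfolded reflect_def c]] .
    moreover have "K z * ((z - 1) \<cdot>\<^sub>m ?x u + e \<cdot>\<^sub>m ?g) = (z - 1) \<cdot>\<^sub>m (K z * ?x u) + e \<cdot>\<^sub>m (K z * ?g)"
      using mult_add_distrib_mat[OF Kc smult_carrier_mat[OF carrier_spin(6)] smult_carrier_mat[OF carrier_spin(5)]]
        mult_smult_distrib[OF Kc carrier_spin(6)] mult_smult_distrib[OF Kc carrier_spin(5)] by simp
    moreover have "((z - 1) \<cdot>\<^sub>m ?x (inverse u) + e \<cdot>\<^sub>m ?g) * K z = (z - 1) \<cdot>\<^sub>m (?x (inverse u) * K z) + e \<cdot>\<^sub>m (?g * K z)"
      using add_mult_distrib_mat[OF smult_carrier_mat[OF carrier_spin(6)] smult_carrier_mat[OF carrier_spin(5)] Kc]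
        mult_smult_assoc_mat[OF carrier_spin(6) Kc] mult_smult_assoc_mat[OF carrier_spin(5) Kc] by simp
    ultimately have "((z - 1) \<cdot>\<^sub>m (K z * ?x u) + e \<cdot>\<^sub>m (K z * ?g)) $$ (i, Suc i)
        = ((z - 1) \<cdot>\<^sub>m (?x (inverse u) * K z) + e \<cdot>\<^sub>m (?g * K z)) $$ (i, Suc i)" by simp
    then have "(z - 1) * (K z * ?x u) $$ (i, Suc i) + e * (K z * ?g) $$ (i, Suc i)
        = (z - 1) * (?x (inverse u) * K z) $$ (i, Suc i) + e * (?g * K z) $$ (i, Suc i)"
      using i Kc[of z] by (simp del: index_mult_mat(1))
    moreover have "(K z * ?g) $$ (i, Suc i) = K z $$ (i, Suc i) * ?g $$ (Suc i, Suc i)"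
      by (rule index_mult_diag_right[where n = "Suc J"]) (use i Kc[of z] in \<open>auto simp: index_cartan\<close>)
    moreover have "(?g * K z) $$ (i, Suc i) = ?g $$ (i, i) * K z $$ (i, Suc i)"
      by (rule index_mult_diag_left[where n = "Suc J"]) (use i Kc[of z] in \<open>auto simp: index_cartan\<close>)
    ultimately show ?thesis unfolding f_def by (simp add: algebra_simps)
  qed
  have g: "cartan h J $$ (i, i) = H\<^sup>2" "cartan h J $$ (Suc i, Suc i) = H\<^sup>2 * inverse (h ^ 4)"
    "cartan (inverse h) J $$ (i, i) = inverse (H\<^sup>2)" "cartan (inverse h) J $$ (Suc i, Suc i) = h ^ 4 * inverse (H\<^sup>2)"
    using i h0 by (simp_all add: index_cartan_power H power_inverse field_simps power2_eq_square power4_eq_xxxx)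
  \<comment> \<open>The combination of the relations of the two generators from which the unknown off-diagonal
      entry of \<open>K z\<close> drops out.\<close>
  define g0 where "g0 = ep * (H\<^sup>2 - H\<^sup>2 * inverse (h ^ 4))"
  define g1 where "g1 = em * (inverse (H\<^sup>2) - h ^ 4 * inverse (H\<^sup>2))"
  define \<Phi> where "\<Phi> = (\<lambda>z. g1 * f h u z - g0 * f (inverse h) (inverse u) z)"
  have "\<Phi> 1 = 0"
  proof (rule laurent_eq_zero[where f = \<Phi> and z = 1 and S = "{1}"])
    show "laurent \<Phi>" unfolding \<Phi>_def by (intro laurent_diff laurent_mult laurent_const Lf)
    fix z :: complex assume z: "z \<noteq> 0" "z \<notin> {1}"
    then have z1: "z - 1 \<noteq> 0" by simp
    have r: "reflect h ep (z - 1) (z - 1) J u (K z)" "reflect (inverse h) em (z - 1) (z - 1) J (inverse u) (K z)"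
      unfolding K_def J by (rule reflect_K_mat[OF q z1 z1 u])+
    have "(z - 1) * f h u z = g0 * K z $$ (i, Suc i)"
      using f[OF r(1)] unfolding g g0_def .
    moreover have "(z - 1) * f (inverse h) (inverse u) z = g1 * K z $$ (i, Suc i)"
      using f[OF r(2)] unfolding g g1_def .
    moreover have "(z - 1) * \<Phi> z = g1 * ((z - 1) * f h u z) - g0 * ((z - 1) * f (inverse h) (inverse u) z)"
      unfolding \<Phi>_def by (simp add: algebra_simps)
    ultimately have "(z - 1) * \<Phi> z = 0" by simp
    then show "\<Phi> z = 0" using z1 by simp
  qed simp_all
  have f1: "f h u 1 = \<kappa> i * current h 1 1 J u $$ (i, Suc i) - current h 1 1 J (inverse u) $$ (i, Suc i) * \<kappa> (Suc i)" for h u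
  proof -
    have off: "K 1 $$ (k, l) = 0" if "k < Suc J" "l < Suc J" "k \<noteq> l" for k l
      using that index_K_mat_zero[OF q, of k n l] unfolding K_def J by simp
    have "(K 1 * current h 1 1 J u) $$ (i, Suc i) = K 1 $$ (i, i) * current h 1 1 J u $$ (i, Suc i)"
      by (rule index_mult_diag_left[OF Kc off]) (use i in simp_all)
    moreover have "(current h 1 1 J (inverse u) * K 1) $$ (i, Suc i)
        = current h 1 1 J (inverse u) $$ (i, Suc i) * K 1 $$ (Suc i, Suc i)"
      by (rule index_mult_diag_right[OF Kc off]) (use i in simp_all)
    ultimately show ?thesis unfolding f_def \<kappa>_def K_def by simp
  qed
  define \<beta> where "\<beta> = ladder h J i"
  have \<beta>: "\<beta> \<noteq> 0" unfolding \<beta>_def by (rule ladder_nonzero[OF q i])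
  have x: "current h 1 1 J a $$ (i, Suc i) = a * inverse h * H * \<beta>"
    "current (inverse h) 1 1 J a $$ (i, Suc i) = a * h * inverse H * \<beta>" for a
    using i h0 by (simp_all add: index_current_power spin_inverse \<beta>_def[symmetric],
      simp_all add: H power_inverse field_simps power2_eq_square)
  have "\<Phi> 1 = (1 - h ^ 4) * \<beta> * inverse (h\<^sup>2) * (em * h * inverse H * (\<kappa> i * u - \<kappa> (Suc i) * inverse u)
    + ep * H * inverse h * (\<kappa> i * inverse u - \<kappa> (Suc i) * u))"
    unfolding \<Phi>_def f1 x g0_def g1_def inverse_inverse_eq
    using h0 H0 u by (simp add: field_simps power2_eq_square power4_eq_xxxx)
  then show ?thesis using \<open>\<Phi> 1 = 0\<close> h4 \<beta> h0 by simp
qed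

section \<open>Dressing\<close>

lemma qdim_Suc: "qdim (Suc N) Js = Suc (Js (Suc N)) * qdim N Js"
  by (simp add: qdim_def)

lemma prod_list_dims: "prod_list (map (\<lambda>l. Js l + 1) (rev [1..<N + 1])) = qdim N Js"
  by (induction N) (simp_all add: qdim_Suc qdim_def)

lemma R_site_Suc:
  assumes "1 \<le> i" "i \<le> N"
  shows "R_site h (Suc N) Js J w i = 1\<^sub>m (Suc (Js (Suc N))) \<otimes>\<^sub>m R_site h N Js J w i"
proof -
  let ?ds = "map (\<lambda>l. Js l + 1) (rev [1..<N + 1]) @ [J + 1]"
  have "on_legs (Suc (Js (Suc N)) # ?ds) (Suc (N - i)) (Suc N) (R_norm h (Js i) J w)
      = 1\<^sub>m (Suc (Js (Suc N))) \<otimes>\<^sub>m on_legs ?ds (N - i) N (R_norm h (Js i) J w)"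
    by (rule on_legs_Cons) (use assms in auto)
  then show ?thesis using assms by (simp add: R_site_def Suc_diff_le)
qed

lemma R_site_last:
  "R_site h (Suc N) Js J w (Suc N)
    = sandwich (Suc (Js (Suc N))) (Suc J) (1\<^sub>m (qdim N Js)) (R_norm h (Js (Suc N)) J w)"
proof -
  let ?ds = "map (\<lambda>l. Js l + 1) (rev [1..<N + 1])"
  have l: "map (\<lambda>l. Js l + 1) (rev [1..<Suc N + 1]) @ [J + 1] = Suc (Js (Suc N)) # ?ds @ [Suc J]" by simp
  have len: "length ?ds = N" by simp
  show ?thesis
    using on_legs_outer[of "Suc (Js (Suc N))" ?ds "Suc J" "R_norm h (Js (Suc N)) J w"]
    unfolding R_site_def l len prod_list_dims diff_self_eq_0 .
qed

lemma R_site_carrier: "R_site h N Js J w i \<in> carrier_mat (qdim N Js * Suc J) (qdim N Js * Suc J)"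
  by (auto simp: R_site_def on_legs_def prod_list_dims[simplified] intro!: carrier_matI)

lemma sites_carrier:
  "A \<in> set (map (\<lambda>i. R_site h N Js J (c i) i) xs) \<Longrightarrow> A \<in> carrier_mat (qdim N Js * Suc J) (qdim N Js * Suc J)"
  by (auto simp only: set_map image_iff R_site_carrier)

lemma mat_prod_carrier:
  assumes "\<And>A. A \<in> set As \<Longrightarrow> A \<in> carrier_mat n n"
  shows "mat_prod n As \<in> carrier_mat n n"
  using assms by (induction As) (auto simp: mat_prod_def intro!: mult_carrier_mat)

lemma mat_prod_Cons: "mat_prod n (A # As) = A * mat_prod n As"
  by (simp add: mat_prod_def)

lemma mat_prod_snoc:
  assumes "\<And>A. A \<in> set As \<Longrightarrow> A \<in> carrier_mat n n" "B \<in> carrier_mat n n"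
  shows "mat_prod n (As @ [B]) = mat_prod n As * B"
  using assms(1)
proof (induction As)
  case Nil
  then show ?case using assms(2) by (simp add: mat_prod_def)
next
  case (Cons A As)
  have "mat_prod n ((A # As) @ [B]) = A * (mat_prod n As * B)"
    using Cons by (simp add: mat_prod_Cons)
  also have "\<dots> = (A * mat_prod n As) * B"
    by (rule assoc_mult_mat[symmetric]) (use Cons.prems assms(2) in \<open>auto intro!: mat_prod_carrier\<close>)
  finally show ?case by (simp add: mat_prod_Cons)
qed

lemma mat_prod_kron:
  assumes "\<And>A. A \<in> set As \<Longrightarrow> A \<in> carrier_mat n n"
  shows "mat_prod (d * n) (map (\<lambda>A. 1\<^sub>m d \<otimes>\<^sub>m A) As) = 1\<^sub>m d \<otimes>\<^sub>m mat_prod n As"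
  using assms
proof (induction As)
  case Nil
  then show ?case by (simp add: mat_prod_def)
next
  case (Cons A As)
  then have "(1\<^sub>m d \<otimes>\<^sub>m A) * (1\<^sub>m d \<otimes>\<^sub>m mat_prod n As) = 1\<^sub>m d \<otimes>\<^sub>m (A * mat_prod n As)"
    using mat_prod_carrier[of As n] by (subst kron_mult) auto
  then show ?case using Cons by (simp add: mat_prod_Cons)
qed

text \<open>
  The K-matrix \<open>K\<close> of the auxiliary space dressed with the R-matrices of the first \<open>N\<close> sites:
  \<open>Rp\<close> stands to its left and \<open>Rm\<close> to its right.  Each site is added as a new first tensor factor.
\<close>

fun dress :: "(nat \<Rightarrow> nat) \<Rightarrow> nat \<Rightarrow> (nat \<Rightarrow> complex mat) \<Rightarrow> (nat \<Rightarrow> complex mat) \<Rightarrow> complex mat \<Rightarrow> nat \<Rightarrow> complex mat"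
where
  "dress Js J Rp Rm K 0 = K"
| "dress Js J Rp Rm K (Suc N) =
     sandwich (Suc (Js (Suc N))) (Suc J) (1\<^sub>m (qdim N Js)) (Rp (Suc N))
     * (1\<^sub>m (Suc (Js (Suc N))) \<otimes>\<^sub>m dress Js J Rp Rm K N)
     * sandwich (Suc (Js (Suc N))) (Suc J) (1\<^sub>m (qdim N Js)) (Rm (Suc N))"

lemma dress_carrier:
  assumes "K \<in> carrier_mat (Suc J) (Suc J)"
  shows "dress Js J Rp Rm K N \<in> carrier_mat (qdim N Js * Suc J) (qdim N Js * Suc J)"
proof (cases N)
  case 0
  then show ?thesis using assms by (simp add: qdim_def)
next
  case (Suc N)
  show ?thesis unfolding Suc by (rule carrier_matI) (simp_all add: qdim_Suc mult.assoc)
qed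

lemma dress_eq:
  assumes K: "K \<in> carrier_mat (Suc J) (Suc J)"
  shows "mat_prod (qdim N Js * Suc J) (map (\<lambda>i. R_site h N Js J (a i) i) (rev [1..<N + 1]))
      * (1\<^sub>m (qdim N Js) \<otimes>\<^sub>m K)
      * mat_prod (qdim N Js * Suc J) (map (\<lambda>i. R_site h N Js J (b i) i) [1..<N + 1])
    = dress Js J (\<lambda>i. R_norm h (Js i) J (a i)) (\<lambda>i. R_norm h (Js i) J (b i)) K N"
proof (induction N)
  case 0
  then show ?case using K by (simp add: mat_prod_def qdim_def)
next
  case (Suc N)
  let ?d = "Suc (Js (Suc N))" and ?n = "qdim N Js * Suc J"
  let ?P = "mat_prod ?n (map (\<lambda>i. R_site h N Js J (a i) i) (rev [1..<N + 1]))"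
    and ?Q = "mat_prod ?n (map (\<lambda>i. R_site h N Js J (b i) i) [1..<N + 1])"
    and ?K = "1\<^sub>m (qdim N Js) \<otimes>\<^sub>m K"
  let ?A = "sandwich ?d (Suc J) (1\<^sub>m (qdim N Js)) (R_norm h (Js (Suc N)) J (a (Suc N)))"
    and ?B = "sandwich ?d (Suc J) (1\<^sub>m (qdim N Js)) (R_norm h (Js (Suc N)) J (b (Suc N)))"
  have n: "qdim (Suc N) Js * Suc J = ?d * ?n" by (simp only: qdim_Suc mult.assoc)
  have site: "map (\<lambda>i. R_site h (Suc N) Js J (c i) i) xs
      = map (\<lambda>A. 1\<^sub>m ?d \<otimes>\<^sub>m A) (map (\<lambda>i. R_site h N Js J (c i) i) xs)"
    if "set xs \<subseteq> {1..N}" for xs c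
    using that by (auto intro!: R_site_Suc)
  have A: "?A \<in> carrier_mat (?d * ?n) (?d * ?n)" and B: "?B \<in> carrier_mat (?d * ?n) (?d * ?n)"
    by (auto intro!: carrier_matI simp: algebra_simps)
  have P: "?P \<in> carrier_mat ?n ?n" and Q: "?Q \<in> carrier_mat ?n ?n"
    by (rule mat_prod_carrier, erule sites_carrier)+
  have Kc: "?K \<in> carrier_mat ?n ?n" by (rule kron_carrier[OF one_carrier_mat K])
  have Pc: "1\<^sub>m ?d \<otimes>\<^sub>m ?P \<in> carrier_mat (?d * ?n) (?d * ?n)"
    and Qc: "1\<^sub>m ?d \<otimes>\<^sub>m ?Q \<in> carrier_mat (?d * ?n) (?d * ?n)"
    and KC: "1\<^sub>m ?d \<otimes>\<^sub>m ?K \<in> carrier_mat (?d * ?n) (?d * ?n)"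
    by (rule kron_carrier[OF one_carrier_mat P] kron_carrier[OF one_carrier_mat Q] kron_carrier[OF one_carrier_mat Kc])+
  have 1: "mat_prod (qdim (Suc N) Js * Suc J) (map (\<lambda>i. R_site h (Suc N) Js J (a i) i) (rev [1..<Suc N + 1]))
      = ?A * (1\<^sub>m ?d \<otimes>\<^sub>m ?P)"
  proof -
    have "map (\<lambda>i. R_site h (Suc N) Js J (a i) i) (rev [1..<Suc N + 1])
        = ?A # map (\<lambda>i. R_site h (Suc N) Js J (a i) i) (rev [1..<N + 1])"
      by (simp add: R_site_last)
    also have "\<dots> = ?A # map (\<lambda>A. 1\<^sub>m ?d \<otimes>\<^sub>m A) (map (\<lambda>i. R_site h N Js J (a i) i) (rev [1..<N + 1]))"
      by (subst site) auto
    finally show ?thesis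
      unfolding n by (simp only: mat_prod_Cons) (subst mat_prod_kron, erule sites_carrier, rule refl)
  qed
  have 2: "mat_prod (qdim (Suc N) Js * Suc J) (map (\<lambda>i. R_site h (Suc N) Js J (b i) i) [1..<Suc N + 1])
      = (1\<^sub>m ?d \<otimes>\<^sub>m ?Q) * ?B"
  proof -
    have "map (\<lambda>i. R_site h (Suc N) Js J (b i) i) [1..<Suc N + 1]
        = map (\<lambda>i. R_site h (Suc N) Js J (b i) i) [1..<N + 1] @ [?B]"
      by (simp add: R_site_last)
    also have "\<dots> = map (\<lambda>A. 1\<^sub>m ?d \<otimes>\<^sub>m A) (map (\<lambda>i. R_site h N Js J (b i) i) [1..<N + 1]) @ [?B]"
      by (subst site) auto
    finally have l: "map (\<lambda>i. R_site h (Suc N) Js J (b i) i) [1..<Suc N + 1]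
        = map (\<lambda>A. 1\<^sub>m ?d \<otimes>\<^sub>m A) (map (\<lambda>i. R_site h N Js J (b i) i) [1..<N + 1]) @ [?B]" .
    have c: "C \<in> carrier_mat (?d * ?n) (?d * ?n)"
      if C: "C \<in> set (map (\<lambda>A. 1\<^sub>m ?d \<otimes>\<^sub>m A) (map (\<lambda>i. R_site h N Js J (b i) i) [1..<N + 1]))" for C
    proof -
      from C obtain A where A: "A \<in> set (map (\<lambda>i. R_site h N Js J (b i) i) [1..<N + 1])" "C = 1\<^sub>m ?d \<otimes>\<^sub>m A"
        unfolding set_map[of "\<lambda>A. 1\<^sub>m ?d \<otimes>\<^sub>m A"] by (rule imageE)
      show ?thesis unfolding A(2) by (rule kron_carrier[OF one_carrier_mat sites_carrier[OF A(1)]])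
    qed
    have "mat_prod (qdim (Suc N) Js * Suc J) (map (\<lambda>i. R_site h (Suc N) Js J (b i) i) [1..<Suc N + 1])
      = mat_prod (?d * ?n) (map (\<lambda>A. 1\<^sub>m ?d \<otimes>\<^sub>m A) (map (\<lambda>i. R_site h N Js J (b i) i) [1..<N + 1])) * ?B"
      unfolding n l by (rule mat_prod_snoc[OF c B])
    moreover have "mat_prod (?d * ?n) (map (\<lambda>A. 1\<^sub>m ?d \<otimes>\<^sub>m A) (map (\<lambda>i. R_site h N Js J (b i) i) [1..<N + 1]))
        = 1\<^sub>m ?d \<otimes>\<^sub>m ?Q"
      by (rule mat_prod_kron) (erule sites_carrier)
    ultimately show ?thesis by (simp only:)
  qed
  have 3: "1\<^sub>m (qdim (Suc N) Js) \<otimes>\<^sub>m K = 1\<^sub>m ?d \<otimes>\<^sub>m ?K"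
    unfolding qdim_Suc kron_one[symmetric] by (rule kron_assoc)
  have "?A * (1\<^sub>m ?d \<otimes>\<^sub>m ?P) * (1\<^sub>m ?d \<otimes>\<^sub>m ?K) * ((1\<^sub>m ?d \<otimes>\<^sub>m ?Q) * ?B)
      = ?A * ((1\<^sub>m ?d \<otimes>\<^sub>m ?P) * (1\<^sub>m ?d \<otimes>\<^sub>m ?K) * (1\<^sub>m ?d \<otimes>\<^sub>m ?Q)) * ?B"
    using assoc_mult_mat[OF A Pc KC] assoc_mult_mat[OF A mult_carrier_mat[OF Pc KC] Qc]
      assoc_mult_mat[OF mult_carrier_mat[OF A mult_carrier_mat[OF Pc KC]] Qc B] by (simp only:)
  also have "(1\<^sub>m ?d \<otimes>\<^sub>m ?P) * (1\<^sub>m ?d \<otimes>\<^sub>m ?K) * (1\<^sub>m ?d \<otimes>\<^sub>m ?Q) = 1\<^sub>m ?d \<otimes>\<^sub>m (?P * ?K * ?Q)"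
  proof -
    have k: "(1\<^sub>m ?d \<otimes>\<^sub>m C) * (1\<^sub>m ?d \<otimes>\<^sub>m C') = 1\<^sub>m ?d \<otimes>\<^sub>m (C * C')"
      if "C \<in> carrier_mat ?n ?n" "C' \<in> carrier_mat ?n ?n" for C C' :: "complex mat"
      by (subst kron_mult) (use that in auto)
    show ?thesis unfolding k[OF P Kc] k[OF mult_carrier_mat[OF P Kc] Q] ..
  qed
  finally show ?case unfolding 1 2 3 Suc.IH by simp
qed

lemma W0_Suc:
  "W0 h ep kp km Js v (Suc n) = current h kp km (Js (Suc n)) (v (Suc n)) \<otimes>\<^sub>m 1\<^sub>m (qdim n Js)
    + cartan h (Js (Suc n)) \<otimes>\<^sub>m W0 h ep kp km Js v n"
  by (simp add: Let_def current_def cartan_def)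

lemma W0_carrier: "W0 h ep kp km Js v N \<in> carrier_mat (qdim N Js) (qdim N Js)"
proof (induction N)
  case 0
  then show ?case by (simp add: qdim_def)
next
  case (Suc N)
  show ?case unfolding W0_Suc qdim_Suc
    by (rule add_carrier_mat[OF kron_carrier[OF carrier_spin(5) Suc]])
qed

lemma W1_eq: "W1 h em kp km Js v N = W0 (inverse h) em kp km Js (\<lambda>i. inverse (v i)) N"
proof (induction N)
  case (Suc N)
  have e: "qhalf (inverse h) D = qhalf h (- D)" if "D \<in> carrier_mat m m" for D m
    using that by (intro eq_matI) (auto simp: qhalf_def mat_diag_def power_int_inverse power_int_minus)
  have "qhalf (inverse h) (S_3 J) = qhalf h (- S_3 J)" "qhalf (inverse h) (2 \<cdot>\<^sub>m S_3 J) = qhalf h (- (2 \<cdot>\<^sub>m S_3 J))" for J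
    by (rule e[OF carrier_spin(3)], rule e[OF smult_carrier_mat[OF carrier_spin(3)]])
  then show ?case by (simp add: Let_def Suc.IH spin_inverse)
qed simp

text \<open>The dressed K-matrix satisfies the reflection relation for the operators on the whole chain.\<close>

lemma intertwines_dress:
  assumes K: "reflect h ep kp km J u K" "K \<in> carrier_mat (Suc J) (Suc J)" and u: "u \<noteq> 0"
    and v: "\<And>i. 1 \<le> i \<Longrightarrow> i \<le> N \<Longrightarrow> v i \<noteq> 0"
    and Rp: "\<And>i. 1 \<le> i \<Longrightarrow> i \<le> N \<Longrightarrow> exchange h (Js i) J (u * v i) (Rp i)"
      "\<And>i. Rp i \<in> carrier_mat (Suc (Js i) * Suc J) (Suc (Js i) * Suc J)"
    and Rm: "\<And>i. 1 \<le> i \<Longrightarrow> i \<le> N \<Longrightarrow> exchange h (Js i) J (u * inverse (v i)) (Rm i)"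
      "\<And>i. Rm i \<in> carrier_mat (Suc (Js i) * Suc J) (Suc (Js i) * Suc J)"
  shows "intertwines (dress Js J Rp Rm K N)
    (1\<^sub>m (qdim N Js) \<otimes>\<^sub>m current h kp km J u + W0 h ep kp km Js v N \<otimes>\<^sub>m cartan h J)
    (1\<^sub>m (qdim N Js) \<otimes>\<^sub>m current h kp km J (inverse u) + W0 h ep kp km Js v N \<otimes>\<^sub>m cartan h J)"
  using v Rp(1) Rm(1)
proof (induction N)
  case 0
  have "1\<^sub>m (qdim 0 Js) \<otimes>\<^sub>m A = A" "W0 h ep kp km Js v 0 \<otimes>\<^sub>m A = ep \<cdot>\<^sub>m A" for A
    by (simp_all add: qdim_def kron_smult_left)
  then show ?case using K(1) by (simp add: reflect_def)
next
  case (Suc N)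
  let ?j = "Js (Suc N)" and ?Q = "qdim N Js" and ?v = "v (Suc N)" and ?W = "W0 h ep kp km Js v N"
  let ?d = "Suc ?j" and ?e = "Suc J"
  let ?S = "sandwich ?d ?e"
  let ?x = "current h kp km ?j ?v" and ?g = "cartan h ?j" and ?y = "\<lambda>u. current h kp km J u" and ?k = "cartan h J"
  note Wc = W0_carrier[of h ep kp km Js v N]
  have dW: "dim_row ?W = ?Q" "dim_col ?W = ?Q" using Wc by auto
  have S: "?S C (P \<otimes>\<^sub>m Q) = P \<otimes>\<^sub>m (C \<otimes>\<^sub>m Q)"
    if "P \<in> carrier_mat ?d ?d" "Q \<in> carrier_mat ?e ?e" for P Q C :: "complex mat"
    by (rule sandwich_kron[OF that])
  have S2: "?S C (P \<otimes>\<^sub>m Q + P' \<otimes>\<^sub>m Q') = P \<otimes>\<^sub>m (C \<otimes>\<^sub>m Q) + P' \<otimes>\<^sub>m (C \<otimes>\<^sub>m Q')"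
    if "P \<in> carrier_mat ?d ?d" "Q \<in> carrier_mat ?e ?e"
      "P' \<in> carrier_mat ?d ?d" "Q' \<in> carrier_mat ?e ?e" for P Q P' Q' C :: "complex mat"
    using that kron_carrier[OF that(1,2)] kron_carrier[OF that(3,4)] by (subst sandwich_add) (auto simp: S)
  have i: "intertwines (?S (1\<^sub>m ?Q) A) (?S (1\<^sub>m ?Q) X + ?S ?W (?g \<otimes>\<^sub>m ?k)) (?S (1\<^sub>m ?Q) Y + ?S ?W (?g \<otimes>\<^sub>m ?k))"
    if "intertwines A X Y" "intertwines A (?g \<otimes>\<^sub>m ?k) (?g \<otimes>\<^sub>m ?k)" "A \<in> carrier_mat (?d * ?e) (?d * ?e)" for A X Y
    by (rule intertwines_add[OF intertwines_sandwich[OF that(1,3) one_carrier_mat] intertwines_sandwich[OF that(2,3) Wc]])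
  have v0: "?v \<noteq> 0" using Suc.prems(1) by simp
  note rm = exchangeD[OF Suc.prems(3)[of "Suc N"]] and rp = exchangeD[OF Suc.prems(2)[of "Suc N"]]
  have 1: "intertwines (?S (1\<^sub>m ?Q) (Rm (Suc N)))
      (?S (1\<^sub>m ?Q) (1\<^sub>m ?d \<otimes>\<^sub>m ?y u + ?x \<otimes>\<^sub>m ?k) + ?S ?W (?g \<otimes>\<^sub>m ?k))
      (?S (1\<^sub>m ?Q) (?x \<otimes>\<^sub>m 1\<^sub>m ?e + ?g \<otimes>\<^sub>m ?y u) + ?S ?W (?g \<otimes>\<^sub>m ?k))"
    by (rule i[OF rm(2) rm(3) Rm(2)]) (use v0 in simp_all)
  have 3: "intertwines (?S (1\<^sub>m ?Q) (Rp (Suc N)))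
      (?S (1\<^sub>m ?Q) (?x \<otimes>\<^sub>m 1\<^sub>m ?e + ?g \<otimes>\<^sub>m ?y (inverse u)) + ?S ?W (?g \<otimes>\<^sub>m ?k))
      (?S (1\<^sub>m ?Q) (1\<^sub>m ?d \<otimes>\<^sub>m ?y (inverse u) + ?x \<otimes>\<^sub>m ?k) + ?S ?W (?g \<otimes>\<^sub>m ?k))"
    by (rule i[OF rp(1) rp(3) Rp(2)]) (use u in simp_all)
  have IH: "intertwines (dress Js J Rp Rm K N) (1\<^sub>m ?Q \<otimes>\<^sub>m ?y u + ?W \<otimes>\<^sub>m ?k) (1\<^sub>m ?Q \<otimes>\<^sub>m ?y (inverse u) + ?W \<otimes>\<^sub>m ?k)"
    by (rule Suc.IH) (use Suc.prems in auto)
  have 2: "intertwines (1\<^sub>m ?d \<otimes>\<^sub>m dress Js J Rp Rm K N)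
      (?x \<otimes>\<^sub>m 1\<^sub>m (?Q * ?e) + ?g \<otimes>\<^sub>m (1\<^sub>m ?Q \<otimes>\<^sub>m ?y u + ?W \<otimes>\<^sub>m ?k))
      (?x \<otimes>\<^sub>m 1\<^sub>m (?Q * ?e) + ?g \<otimes>\<^sub>m (1\<^sub>m ?Q \<otimes>\<^sub>m ?y (inverse u) + ?W \<otimes>\<^sub>m ?k))"
    by (rule intertwines_add[OF
          intertwines_kron[OF intertwines_one_left[OF carrier_spin(6)] intertwines_one_right[OF dress_carrier[OF K(2)]]]
          intertwines_kron[OF intertwines_one_left[OF carrier_spin(5)] IH]])
  have m: "?S (1\<^sub>m ?Q) (?x \<otimes>\<^sub>m 1\<^sub>m ?e + ?g \<otimes>\<^sub>m ?y w) + ?S ?W (?g \<otimes>\<^sub>m ?k)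
      = ?x \<otimes>\<^sub>m 1\<^sub>m (?Q * ?e) + ?g \<otimes>\<^sub>m (1\<^sub>m ?Q \<otimes>\<^sub>m ?y w + ?W \<otimes>\<^sub>m ?k)" for w
    by (simp add: S S2 kron_add_right mat_add_assoc dW)
  have o: "1\<^sub>m (qdim (Suc N) Js) \<otimes>\<^sub>m ?y w + W0 h ep kp km Js v (Suc N) \<otimes>\<^sub>m ?k
      = ?S (1\<^sub>m ?Q) (1\<^sub>m ?d \<otimes>\<^sub>m ?y w + ?x \<otimes>\<^sub>m ?k) + ?S ?W (?g \<otimes>\<^sub>m ?k)" for w
    unfolding W0_Suc qdim_Suc kron_one[symmetric]
    by (simp add: S S2 kron_add_left kron_assoc mat_add_assoc dW del: kron_one mult_Suc)
  let ?M = "?S (1\<^sub>m ?Q) (Rp (Suc N)) * ((1\<^sub>m ?d \<otimes>\<^sub>m dress Js J Rp Rm K N) * ?S (1\<^sub>m ?Q) (Rm (Suc N)))"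
  have "intertwines ?M
      (1\<^sub>m (qdim (Suc N) Js) \<otimes>\<^sub>m ?y u + W0 h ep kp km Js v (Suc N) \<otimes>\<^sub>m ?k)
      (1\<^sub>m (qdim (Suc N) Js) \<otimes>\<^sub>m ?y (inverse u) + W0 h ep kp km Js v (Suc N) \<otimes>\<^sub>m ?k)"
    unfolding o by (rule intertwines_comp[OF intertwines_comp[OF 1[unfolded m] 2] 3[unfolded m]])
  moreover have "dress Js J Rp Rm K (Suc N) = ?M"
  proof -
    have s: "?S (1\<^sub>m ?Q) A \<in> carrier_mat (?d * (?Q * ?e)) (?d * (?Q * ?e))" for A :: "complex mat"
      by (rule carrier_matI) (simp_all only: dim_sandwich mult.assoc index_one_mat)
    show ?thesis
      unfolding dress.simps
      by (rule assoc_mult_mat[OF s kron_carrier[OF one_carrier_mat dress_carrier[OF K(2)]] s])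
  qed
  ultimately show ?case by simp
qed

section \<open>Partial traces\<close>

lemma index_ptrace_last:
  assumes "A \<in> carrier_mat (Q * e) (Q * e)" "e > 0" "r < Q" "s < Q"
  shows "ptrace_last e A $$ (r, s) = (\<Sum>k<e. A $$ (r * e + k, s * e + k))"
  using assms by (simp add: ptrace_last_def)

lemma ptrace_last_carrier:
  assumes "A \<in> carrier_mat (Q * e) (Q * e)" "e > 0"
  shows "ptrace_last e A \<in> carrier_mat Q Q"
  using assms by (auto simp: ptrace_last_def intro!: carrier_matI)

lemma index_kron_one_mult:
  fixes A C :: "'a::comm_semiring_1 mat"
  assumes A: "A \<in> carrier_mat (Q * e) m" and C: "C \<in> carrier_mat e e" and "r < Q" "k < e" "j < m"
  shows "((1\<^sub>m Q \<otimes>\<^sub>m C) * A) $$ (r * e + k, j) = (\<Sum>l<e. C $$ (k, l) * A $$ (r * e + l, j))"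
proof -
  have "((1\<^sub>m Q \<otimes>\<^sub>m C) * A) $$ (r * e + k, j) = (\<Sum>s<Q * e. (1\<^sub>m Q \<otimes>\<^sub>m C) $$ (r * e + k, s) * A $$ (s, j))"
    by (rule index_mult_sum[OF kron_carrier[OF one_carrier_mat C] A]) (use assms in \<open>auto intro: kron_index_less\<close>)
  also have "\<dots> = (\<Sum>r'<Q. \<Sum>l<e. if r' = r then C $$ (k, l) * A $$ (r * e + l, j) else 0)"
    unfolding sum_lessThan_mult
    by (intro sum.cong refl) (use assms index_kron[of r "1\<^sub>m Q" k C] in auto)
  also have "\<dots> = (\<Sum>r'<Q. if r' = r then (\<Sum>l<e. C $$ (k, l) * A $$ (r * e + l, j)) else 0)"
    by (intro sum.cong refl) auto
  finally show ?thesis using assms by simp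
qed

lemma index_mult_kron_one:
  fixes A C :: "'a::comm_semiring_1 mat"
  assumes A: "A \<in> carrier_mat m (Q * e)" and C: "C \<in> carrier_mat e e" and "i < m" "s < Q" "k < e"
  shows "(A * (1\<^sub>m Q \<otimes>\<^sub>m C)) $$ (i, s * e + k) = (\<Sum>l<e. A $$ (i, s * e + l) * C $$ (l, k))"
proof -
  have "(A * (1\<^sub>m Q \<otimes>\<^sub>m C)) $$ (i, s * e + k) = (\<Sum>t<Q * e. A $$ (i, t) * (1\<^sub>m Q \<otimes>\<^sub>m C) $$ (t, s * e + k))"
    by (rule index_mult_sum[OF A kron_carrier[OF one_carrier_mat C]]) (use assms in \<open>auto intro: kron_index_less\<close>)
  also have "\<dots> = (\<Sum>s'<Q. \<Sum>l<e. if s' = s then A $$ (i, s * e + l) * C $$ (l, k) else 0)"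
    unfolding sum_lessThan_mult
    by (intro sum.cong refl) (use assms index_kron[of _ "1\<^sub>m Q" _ C s k] in auto)
  also have "\<dots> = (\<Sum>s'<Q. if s' = s then (\<Sum>l<e. A $$ (i, s * e + l) * C $$ (l, k)) else 0)"
    by (intro sum.cong refl) auto
  finally show ?thesis using assms by simp
qed

lemma ptrace_last_cyclic:
  fixes A C :: "'a::comm_semiring_1 mat"
  assumes A: "A \<in> carrier_mat (Q * e) (Q * e)" and C: "C \<in> carrier_mat e e" and e: "e > 0"
  shows "ptrace_last e ((1\<^sub>m Q \<otimes>\<^sub>m C) * A) = ptrace_last e (A * (1\<^sub>m Q \<otimes>\<^sub>m C))"
proof (rule eq_matI)
  have CA: "(1\<^sub>m Q \<otimes>\<^sub>m C) * A \<in> carrier_mat (Q * e) (Q * e)"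
    by (rule mult_carrier_mat[OF kron_carrier[OF one_carrier_mat C] A])
  have AC: "A * (1\<^sub>m Q \<otimes>\<^sub>m C) \<in> carrier_mat (Q * e) (Q * e)"
    by (rule mult_carrier_mat[OF A kron_carrier[OF one_carrier_mat C]])
  fix r s assume "r < dim_row (ptrace_last e (A * (1\<^sub>m Q \<otimes>\<^sub>m C)))" "s < dim_col (ptrace_last e (A * (1\<^sub>m Q \<otimes>\<^sub>m C)))"
  then have rs: "r < Q" "s < Q" using ptrace_last_carrier[OF AC e] by auto
  have "ptrace_last e ((1\<^sub>m Q \<otimes>\<^sub>m C) * A) $$ (r, s) = (\<Sum>k<e. \<Sum>l<e. C $$ (k, l) * A $$ (r * e + l, s * e + k))"
    unfolding index_ptrace_last[OF CA e rs]
    by (intro sum.cong refl index_kron_one_mult[OF A C]) (use rs in \<open>auto intro: kron_index_less\<close>)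
  also have "\<dots> = (\<Sum>l<e. \<Sum>k<e. C $$ (k, l) * A $$ (r * e + l, s * e + k))" by (rule sum.swap)
  also have "\<dots> = (\<Sum>l<e. \<Sum>k<e. A $$ (r * e + l, s * e + k) * C $$ (k, l))" by (simp add: mult.commute)
  also have "\<dots> = ptrace_last e (A * (1\<^sub>m Q \<otimes>\<^sub>m C)) $$ (r, s)"
    unfolding index_ptrace_last[OF AC e rs]
    by (intro sum.cong refl index_mult_kron_one[OF A C, symmetric]) (use rs in \<open>auto intro: kron_index_less\<close>)
  finally show "ptrace_last e ((1\<^sub>m Q \<otimes>\<^sub>m C) * A) $$ (r, s) = ptrace_last e (A * (1\<^sub>m Q \<otimes>\<^sub>m C)) $$ (r, s)" .
qed (use A C in \<open>auto simp: ptrace_last_def\<close>)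

lemma ptrace_last_mult_left:
  fixes A W :: "'a::comm_semiring_1 mat"
  assumes A: "A \<in> carrier_mat (Q * e) (Q * e)" and W: "W \<in> carrier_mat Q Q" and e: "e > 0"
  shows "ptrace_last e ((W \<otimes>\<^sub>m 1\<^sub>m e) * A) = W * ptrace_last e A"
proof (rule eq_matI)
  have We: "W \<otimes>\<^sub>m 1\<^sub>m e \<in> carrier_mat (Q * e) (Q * e)" by (rule kron_carrier[OF W one_carrier_mat])
  have WA: "(W \<otimes>\<^sub>m 1\<^sub>m e) * A \<in> carrier_mat (Q * e) (Q * e)" by (rule mult_carrier_mat[OF We A])
  note tA = ptrace_last_carrier[OF A e]
  fix r s assume "r < dim_row (W * ptrace_last e A)" "s < dim_col (W * ptrace_last e A)"
  then have rs: "r < Q" "s < Q" using tA W by auto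
  have "((W \<otimes>\<^sub>m 1\<^sub>m e) * A) $$ (r * e + k, s * e + k) = (\<Sum>r'<Q. W $$ (r, r') * A $$ (r' * e + k, s * e + k))" if k: "k < e" for k
  proof -
    have "((W \<otimes>\<^sub>m 1\<^sub>m e) * A) $$ (r * e + k, s * e + k)
        = (\<Sum>t<Q * e. (W \<otimes>\<^sub>m 1\<^sub>m e) $$ (r * e + k, t) * A $$ (t, s * e + k))"
      by (rule index_mult_sum[OF We A]) (use rs k in \<open>auto intro: kron_index_less\<close>)
    also have "\<dots> = (\<Sum>r'<Q. \<Sum>l<e. if l = k then W $$ (r, r') * A $$ (r' * e + k, s * e + k) else 0)"
      unfolding sum_lessThan_mult
      by (intro sum.cong refl) (use rs k W index_kron[of r W k "1\<^sub>m e"] in auto)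
    finally show ?thesis using k by simp
  qed
  then have "ptrace_last e ((W \<otimes>\<^sub>m 1\<^sub>m e) * A) $$ (r, s)
      = (\<Sum>k<e. \<Sum>r'<Q. W $$ (r, r') * A $$ (r' * e + k, s * e + k))"
    unfolding index_ptrace_last[OF WA e rs] by simp
  also have "\<dots> = (\<Sum>r'<Q. \<Sum>k<e. W $$ (r, r') * A $$ (r' * e + k, s * e + k))" by (rule sum.swap)
  also have "\<dots> = (\<Sum>r'<Q. W $$ (r, r') * ptrace_last e A $$ (r', s))"
    by (intro sum.cong refl) (use rs index_ptrace_last[OF A e] in \<open>simp add: sum_distrib_left\<close>)
  also have "\<dots> = (W * ptrace_last e A) $$ (r, s)" by (rule index_mult_sum[OF W tA rs, symmetric])
  finally show "ptrace_last e ((W \<otimes>\<^sub>m 1\<^sub>m e) * A) $$ (r, s) = (W * ptrace_last e A) $$ (r, s)" .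
qed (use A W e in \<open>auto simp: ptrace_last_def\<close>)

lemma ptrace_last_mult_right:
  fixes A W :: "'a::comm_semiring_1 mat"
  assumes A: "A \<in> carrier_mat (Q * e) (Q * e)" and W: "W \<in> carrier_mat Q Q" and e: "e > 0"
  shows "ptrace_last e (A * (W \<otimes>\<^sub>m 1\<^sub>m e)) = ptrace_last e A * W"
proof (rule eq_matI)
  have We: "W \<otimes>\<^sub>m 1\<^sub>m e \<in> carrier_mat (Q * e) (Q * e)" by (rule kron_carrier[OF W one_carrier_mat])
  have AW: "A * (W \<otimes>\<^sub>m 1\<^sub>m e) \<in> carrier_mat (Q * e) (Q * e)" by (rule mult_carrier_mat[OF A We])
  note tA = ptrace_last_carrier[OF A e]
  fix r s assume "r < dim_row (ptrace_last e A * W)" "s < dim_col (ptrace_last e A * W)"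
  then have rs: "r < Q" "s < Q" using tA W by auto
  have "(A * (W \<otimes>\<^sub>m 1\<^sub>m e)) $$ (r * e + k, s * e + k) = (\<Sum>s'<Q. A $$ (r * e + k, s' * e + k) * W $$ (s', s))" if k: "k < e" for k
  proof -
    have "(A * (W \<otimes>\<^sub>m 1\<^sub>m e)) $$ (r * e + k, s * e + k)
        = (\<Sum>t<Q * e. A $$ (r * e + k, t) * (W \<otimes>\<^sub>m 1\<^sub>m e) $$ (t, s * e + k))"
      by (rule index_mult_sum[OF A We]) (use rs k in \<open>auto intro: kron_index_less\<close>)
    also have "\<dots> = (\<Sum>s'<Q. \<Sum>l<e. if l = k then A $$ (r * e + k, s' * e + k) * W $$ (s', s) else 0)"
      unfolding sum_lessThan_mult
      by (intro sum.cong refl) (use rs k W index_kron[of _ W _ "1\<^sub>m e" s k] in auto)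
    finally show ?thesis using k by simp
  qed
  then have "ptrace_last e (A * (W \<otimes>\<^sub>m 1\<^sub>m e)) $$ (r, s)
      = (\<Sum>k<e. \<Sum>s'<Q. A $$ (r * e + k, s' * e + k) * W $$ (s', s))"
    unfolding index_ptrace_last[OF AW e rs] by simp
  also have "\<dots> = (\<Sum>s'<Q. \<Sum>k<e. A $$ (r * e + k, s' * e + k) * W $$ (s', s))" by (rule sum.swap)
  also have "\<dots> = (\<Sum>s'<Q. ptrace_last e A $$ (r, s') * W $$ (s', s))"
    by (intro sum.cong refl) (use rs index_ptrace_last[OF A e] in \<open>simp add: sum_distrib_right\<close>)
  also have "\<dots> = (ptrace_last e A * W) $$ (r, s)" by (rule index_mult_sum[OF tA W rs, symmetric])
  finally show "ptrace_last e (A * (W \<otimes>\<^sub>m 1\<^sub>m e)) $$ (r, s) = (ptrace_last e A * W) $$ (r, s)" .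
qed (use A W e in \<open>auto simp: ptrace_last_def\<close>)

lemma ptrace_last_diff:
  fixes A B :: "'a::comm_ring_1 mat"
  assumes "A \<in> carrier_mat (Q * e) (Q * e)" "B \<in> carrier_mat (Q * e) (Q * e)" "e > 0"
  shows "ptrace_last e (A - B) = ptrace_last e A - ptrace_last e B"
proof (rule eq_matI)
  fix r s assume "r < dim_row (ptrace_last e A - ptrace_last e B)" "s < dim_col (ptrace_last e A - ptrace_last e B)"
  then have rs: "r < Q" "s < Q" using assms by (auto simp: ptrace_last_def)
  then show "ptrace_last e (A - B) $$ (r, s) = (ptrace_last e A - ptrace_last e B) $$ (r, s)"
    using assms kron_index_less[OF rs(1), of _ e] kron_index_less[OF rs(2), of _ e]
    by (simp add: ptrace_last_def sum_subtractf)
qed (use assms in \<open>auto simp: ptrace_last_def\<close>)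

text \<open>
  If \<open>S\<close> intertwines \<open>1 \<otimes> x + W \<otimes> g\<close> and \<open>1 \<otimes> x' + W \<otimes> g\<close>, then the commutator of \<open>W\<close> with the
  partial trace of \<open>S\<close>, weighted with an operator \<open>D\<close> that commutes with \<open>g\<close>, is a weighted partial
  trace of \<open>S\<close> as well.  Here \<open>gi\<close> plays the role of \<open>g\<^sup>-\<^sup>1\<close>.
\<close>

lemma ptrace_last_commutator:
  fixes S W :: "'a::comm_ring_1 mat"
  assumes S: "S \<in> carrier_mat (Q * e) (Q * e)" and W: "W \<in> carrier_mat Q Q"
    and D: "D \<in> carrier_mat e e" and g: "g \<in> carrier_mat e e" and gi: "gi \<in> carrier_mat e e"
    and x: "x \<in> carrier_mat e e" and x': "x' \<in> carrier_mat e e" and e: "e > 0"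
    and eq: "S * (1\<^sub>m Q \<otimes>\<^sub>m x + W \<otimes>\<^sub>m g) = (1\<^sub>m Q \<otimes>\<^sub>m x' + W \<otimes>\<^sub>m g) * S"
    and D1: "g * (D * gi) = D" and D2: "(D * gi) * g = D"
  defines "t \<equiv> ptrace_last e ((1\<^sub>m Q \<otimes>\<^sub>m D) * S)"
  shows "t * W - W * t = ptrace_last e ((1\<^sub>m Q \<otimes>\<^sub>m (D * gi * x' - x * (D * gi))) * S)"
proof -
  let ?n = "Q * e" and ?I = "1\<^sub>m Q :: 'a mat"
  have k: "?I \<otimes>\<^sub>m C \<in> carrier_mat ?n ?n" if "C \<in> carrier_mat e e" for C by (rule kron_carrier[OF one_carrier_mat that])
  have Wg: "W \<otimes>\<^sub>m g \<in> carrier_mat ?n ?n" by (rule kron_carrier[OF W g])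
  have We: "W \<otimes>\<^sub>m 1\<^sub>m e \<in> carrier_mat ?n ?n" by (rule kron_carrier[OF W one_carrier_mat])
  define C where "C = D * gi"
  have C: "C \<in> carrier_mat e e" unfolding C_def by (rule mult_carrier_mat[OF D gi])
  have gC: "g * C = D" and Cg: "C * g = D" unfolding C_def by (rule D1, rule D2)
  have kk: "(?I \<otimes>\<^sub>m A) * (?I \<otimes>\<^sub>m B) = ?I \<otimes>\<^sub>m (A * B)" if "A \<in> carrier_mat e e" "B \<in> carrier_mat e e" for A B
    using that by (subst kron_mult) auto
  note m = mult_carrier_mat
  have CS: "(?I \<otimes>\<^sub>m C) * S \<in> carrier_mat ?n ?n" by (rule m[OF k[OF C] S])
  have sw: "W \<otimes>\<^sub>m g = (?I \<otimes>\<^sub>m g) * (W \<otimes>\<^sub>m 1\<^sub>m e)" "W \<otimes>\<^sub>m g = (W \<otimes>\<^sub>m 1\<^sub>m e) * (?I \<otimes>\<^sub>m g)"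
    using W g by (simp_all add: kron_mult)
  have cm: "(?I \<otimes>\<^sub>m C) * (W \<otimes>\<^sub>m 1\<^sub>m e) = (W \<otimes>\<^sub>m 1\<^sub>m e) * (?I \<otimes>\<^sub>m C)"
    using W C by (simp add: kron_mult)
  have a1: "ptrace_last e (((?I \<otimes>\<^sub>m C) * S) * (W \<otimes>\<^sub>m g)) = t * W"
  proof -
    have "((?I \<otimes>\<^sub>m C) * S) * (W \<otimes>\<^sub>m g) = (((?I \<otimes>\<^sub>m C) * S) * (?I \<otimes>\<^sub>m g)) * (W \<otimes>\<^sub>m 1\<^sub>m e)"
      unfolding sw(1) by (rule assoc_mult_mat[OF CS k[OF g] We, symmetric])
    then have "ptrace_last e (((?I \<otimes>\<^sub>m C) * S) * (W \<otimes>\<^sub>m g)) = ptrace_last e (((?I \<otimes>\<^sub>m C) * S) * (?I \<otimes>\<^sub>m g)) * W"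
      using ptrace_last_mult_right[OF m[OF CS k[OF g]] W e] by simp
    also have "ptrace_last e (((?I \<otimes>\<^sub>m C) * S) * (?I \<otimes>\<^sub>m g)) = ptrace_last e ((?I \<otimes>\<^sub>m g) * ((?I \<otimes>\<^sub>m C) * S))"
      by (rule ptrace_last_cyclic[OF CS g e, symmetric])
    also have "(?I \<otimes>\<^sub>m g) * ((?I \<otimes>\<^sub>m C) * S) = ((?I \<otimes>\<^sub>m g) * (?I \<otimes>\<^sub>m C)) * S"
      by (rule assoc_mult_mat[OF k[OF g] k[OF C] S, symmetric])
    also have "\<dots> = (?I \<otimes>\<^sub>m D) * S" unfolding kk[OF g C] gC ..
    finally show ?thesis by (simp only: t_def)
  qed
  have a2: "ptrace_last e ((?I \<otimes>\<^sub>m C) * ((W \<otimes>\<^sub>m g) * S)) = W * t"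
  proof -
    have "(?I \<otimes>\<^sub>m C) * ((W \<otimes>\<^sub>m g) * S) = ((?I \<otimes>\<^sub>m C) * (W \<otimes>\<^sub>m g)) * S"
      by (rule assoc_mult_mat[OF k[OF C] Wg S, symmetric])
    also have "(?I \<otimes>\<^sub>m C) * (W \<otimes>\<^sub>m g) = ((?I \<otimes>\<^sub>m C) * (W \<otimes>\<^sub>m 1\<^sub>m e)) * (?I \<otimes>\<^sub>m g)"
      unfolding sw(2) by (rule assoc_mult_mat[OF k[OF C] We k[OF g], symmetric])
    also have "\<dots> = (W \<otimes>\<^sub>m 1\<^sub>m e) * ((?I \<otimes>\<^sub>m C) * (?I \<otimes>\<^sub>m g))"
      unfolding cm by (rule assoc_mult_mat[OF We k[OF C] k[OF g]])
    also have "(?I \<otimes>\<^sub>m C) * (?I \<otimes>\<^sub>m g) = ?I \<otimes>\<^sub>m D" unfolding kk[OF C g] Cg ..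
    also have "(W \<otimes>\<^sub>m 1\<^sub>m e) * (?I \<otimes>\<^sub>m D) * S = (W \<otimes>\<^sub>m 1\<^sub>m e) * ((?I \<otimes>\<^sub>m D) * S)"
      by (rule assoc_mult_mat[OF We k[OF D] S])
    finally show ?thesis unfolding t_def using ptrace_last_mult_left[OF m[OF k[OF D] S] W e] by simp
  qed
  have b1: "ptrace_last e (((?I \<otimes>\<^sub>m C) * S) * (?I \<otimes>\<^sub>m x)) = ptrace_last e ((?I \<otimes>\<^sub>m (x * C)) * S)"
  proof -
    have "ptrace_last e (((?I \<otimes>\<^sub>m C) * S) * (?I \<otimes>\<^sub>m x)) = ptrace_last e ((?I \<otimes>\<^sub>m x) * ((?I \<otimes>\<^sub>m C) * S))"
      by (rule ptrace_last_cyclic[OF CS x e, symmetric])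
    also have "(?I \<otimes>\<^sub>m x) * ((?I \<otimes>\<^sub>m C) * S) = ((?I \<otimes>\<^sub>m x) * (?I \<otimes>\<^sub>m C)) * S"
      by (rule assoc_mult_mat[OF k[OF x] k[OF C] S, symmetric])
    finally show ?thesis unfolding kk[OF x C] .
  qed
  have b2: "(?I \<otimes>\<^sub>m C) * ((?I \<otimes>\<^sub>m x') * S) = (?I \<otimes>\<^sub>m (C * x')) * S"
    unfolding kk[OF C x', symmetric] by (rule assoc_mult_mat[OF k[OF C] k[OF x'] S, symmetric])
  define X where "X = ((?I \<otimes>\<^sub>m C) * S) * (?I \<otimes>\<^sub>m x)"
  define Y where "Y = ((?I \<otimes>\<^sub>m C) * S) * (W \<otimes>\<^sub>m g)"
  define X' where "X' = (?I \<otimes>\<^sub>m C) * ((?I \<otimes>\<^sub>m x') * S)"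
  define Y' where "Y' = (?I \<otimes>\<^sub>m C) * ((W \<otimes>\<^sub>m g) * S)"
  have car: "X \<in> carrier_mat ?n ?n" "Y \<in> carrier_mat ?n ?n" "X' \<in> carrier_mat ?n ?n" "Y' \<in> carrier_mat ?n ?n"
    unfolding X_def Y_def X'_def Y'_def
    by (rule m[OF CS k[OF x]] m[OF CS Wg] m[OF k[OF C] m[OF k[OF x'] S]] m[OF k[OF C] m[OF Wg S]])+
  have "X + Y = (?I \<otimes>\<^sub>m C) * (S * (?I \<otimes>\<^sub>m x + W \<otimes>\<^sub>m g))"
    unfolding X_def Y_def
    using mult_add_distrib_mat[OF CS k[OF x] Wg] assoc_mult_mat[OF k[OF C] S add_carrier_mat[OF Wg]] by metis
  also have "\<dots> = X' + Y'"
    unfolding X'_def Y'_def eq add_mult_distrib_mat[OF k[OF x'] Wg S]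
    by (rule mult_add_distrib_mat[OF k[OF C] m[OF k[OF x'] S] m[OF Wg S]])
  finally have XY: "X + Y = X' + Y'" .
  have "Y - Y' = X' - X"
  proof (rule eq_matI)
    fix i j assume "i < dim_row (X' - X)" "j < dim_col (X' - X)"
    then have ij: "i < ?n" "j < ?n" using car by auto
    have "(X + Y) $$ (i, j) = (X' + Y') $$ (i, j)" by (simp only: XY)
    then show "(Y - Y') $$ (i, j) = (X' - X) $$ (i, j)"
      using car ij by (simp add: algebra_simps)
  qed (use car in auto)
  then have "t * W - W * t = ptrace_last e X' - ptrace_last e X"
    using a1 a2 ptrace_last_diff[OF car(2,4) e] ptrace_last_diff[OF car(3,1) e]
    unfolding Y_def Y'_def by simp
  also have "\<dots> = ptrace_last e ((?I \<otimes>\<^sub>m (C * x')) * S) - ptrace_last e ((?I \<otimes>\<^sub>m (x * C)) * S)"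
    unfolding X'_def b2 X_def b1 ..
  also have "\<dots> = ptrace_last e ((?I \<otimes>\<^sub>m (C * x')) * S - (?I \<otimes>\<^sub>m (x * C)) * S)"
    by (rule ptrace_last_diff[OF m[OF k[OF m[OF C x']] S] m[OF k[OF m[OF x C]] S] e, symmetric])
  also have "(?I \<otimes>\<^sub>m (C * x')) * S - (?I \<otimes>\<^sub>m (x * C)) * S = (?I \<otimes>\<^sub>m (C * x') - ?I \<otimes>\<^sub>m (x * C)) * S"
    by (rule minus_mult_distrib_mat[OF k[OF m[OF C x']] k[OF m[OF x C]] S, symmetric])
  also have "?I \<otimes>\<^sub>m (C * x') - ?I \<otimes>\<^sub>m (x * C) = ?I \<otimes>\<^sub>m (C * x' - x * C)"
    by (rule eq_matI) (use C x x' in \<open>auto simp: index_kron' div_mod_less right_diff_distrib simp del: index_mult_mat(1)\<close>)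
  finally show ?thesis unfolding C_def .
qed

section \<open>Commutation with the transfer matrix\<close>

lemma R_mat_carrier: "R_mat h J1 J2 u \<in> carrier_mat (Suc J1 * Suc J2) (Suc J1 * Suc J2)"
  by (rule laurent_matD(1)[OF laurent_R_mat[where f = "\<lambda>_. u"]]) (rule laurent_const)+

text \<open>
  The weights which arise for the two generators cancel, provided that the entries of the diagonal
  matrix \<open>D\<close> satisfy the recursion of \<open>K_mat_zero_recursion\<close>.  The weight for the second
  generator is obtained by inverting \<open>h\<close> and \<open>u\<close>.
\<close>

lemma boundary_condition:
  fixes D :: "complex mat" and kp km :: complex
  assumes q: "not_root_of_unity h" and u: "u \<noteq> 0"
    and D: "D \<in> carrier_mat (Suc J) (Suc J)" "\<And>i j. i < Suc J \<Longrightarrow> j < Suc J \<Longrightarrow> i \<noteq> j \<Longrightarrow> D $$ (i, j) = 0"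
    and rec: "\<And>i. i < J \<Longrightarrow> a * h * inverse (h powi (int J - 2 * int i))
        * (D $$ (i, i) * U - D $$ (Suc i, Suc i) * inverse U)
      + b * h powi (int J - 2 * int i) * inverse h
        * (D $$ (i, i) * inverse U - D $$ (Suc i, Suc i) * U) = 0"
    and U: "U = inverse u * h powi (- 2)"
  defines "L \<equiv> \<lambda>h u. D * cartan (inverse h) J * current h kp km J (inverse u)
      - current h kp km J u * (D * cartan (inverse h) J)"
  shows "a \<cdot>\<^sub>m L h u + b \<cdot>\<^sub>m L (inverse h) (inverse u) = 0\<^sub>m (Suc J) (Suc J)"
proof (rule eq_matI)
  have h0: "h \<noteq> 0" by (rule not_root_of_unity_nonzero[OF q])
  have hi: "inverse h \<noteq> 0" using h0 by simp
  fix i j assume "i < dim_row (0\<^sub>m (Suc J) (Suc J) :: complex mat)" "j < dim_col (0\<^sub>m (Suc J) (Suc J) :: complex mat)"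
  then have ij: "i < Suc J" "j < Suc J" by auto
  have Lc: "L h u \<in> carrier_mat (Suc J) (Suc J)" for h u
    unfolding L_def by (rule carrier_matI) (use D in simp_all)
  have C: "D * cartan h J \<in> carrier_mat (Suc J) (Suc J)" for h by (rule mult_carrier_mat[OF D(1) carrier_spin(5)])
  have Cij: "(D * cartan h J) $$ (k, l) = D $$ (k, l) * cartan h J $$ (l, l)" if "k < Suc J" "l < Suc J" for h k l
    by (rule index_mult_diag_right[OF carrier_spin(5)]) (use that D(1) in \<open>auto simp: index_cartan\<close>)
  have Coff: "(D * cartan h J) $$ (k, l) = 0" if "k < Suc J" "l < Suc J" "k \<noteq> l" for h k l
    using Cij[OF that(1,2)] D(2)[OF that] by simp
  have L: "L h u $$ (i, j) = D $$ (i, i) * cartan (inverse h) J $$ (i, i) * current h kp km J (inverse u) $$ (i, j)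
      - current h kp km J u $$ (i, j) * (D $$ (j, j) * cartan (inverse h) J $$ (j, j))" for h u
  proof -
    have "(D * cartan (inverse h) J * current h kp km J (inverse u)) $$ (i, j)
        = (D * cartan (inverse h) J) $$ (i, i) * current h kp km J (inverse u) $$ (i, j)"
      by (rule index_mult_diag_left[OF C Coff]) (use ij in simp_all)
    moreover have "(current h kp km J u * (D * cartan (inverse h) J)) $$ (i, j)
        = current h kp km J u $$ (i, j) * (D * cartan (inverse h) J) $$ (j, j)"
      by (rule index_mult_diag_right[OF C Coff]) (use ij in simp_all)
    ultimately show ?thesis
      unfolding L_def using ij D(1) by (simp add: Cij del: index_mult_mat(1))
  qed
  have h2: "h powi (- 2) = inverse (h\<^sup>2)" by (simp add: power_int_minus)
  define e where "e = (\<lambda>i. a * h * inverse (h powi (int J - 2 * int i))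
        * (D $$ (i, i) * U - D $$ (Suc i, Suc i) * inverse U)
      + b * h powi (int J - 2 * int i) * inverse h
        * (D $$ (i, i) * inverse U - D $$ (Suc i, Suc i) * U))"
  have e0: "e i = 0" if "i < J" for i unfolding e_def by (rule rec[OF that])
  have "a * L h u $$ (i, j) + b * L (inverse h) (inverse u) $$ (i, j) = 0"
  proof -
    consider "j = Suc i" | "i = Suc j" | "j \<noteq> Suc i" "i \<noteq> Suc j" by blast
    then show ?thesis
    proof cases
      case 1
      have "a * L h u $$ (i, j) + b * L (inverse h) (inverse u) $$ (i, j) = kp * ladder h J i * e i"
        unfolding L unfolding e_def U h2 powi_weight(1)[OF h0] 1
        using ij 1 h0 u
        by (simp add: index_current_power[OF h0] index_current_power[OF hi] index_cartan_power[OF h0]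
            index_cartan_power[OF hi] spin_inverse)
          (simp add: power_inverse field_simps power2_eq_square)
      then show ?thesis using e0[of i] 1 ij by simp
    next
      case 2
      have "a * L h u $$ (i, j) + b * L (inverse h) (inverse u) $$ (i, j) = - (km * ladder h J j * e j)"
        unfolding L unfolding e_def U h2 powi_weight(1)[OF h0] 2
        using ij 2 h0 u
        by (simp add: index_current_power[OF h0] index_current_power[OF hi] index_cartan_power[OF h0]
            index_cartan_power[OF hi] spin_inverse)
          (simp add: power_inverse field_simps power2_eq_square)
      then show ?thesis using e0[of j] 2 ij by simp
    next
      case 3
      then show ?thesis unfolding L using ij by (simp add: index_current)
    qed
  qed
  then show "(a \<cdot>\<^sub>m L h u + b \<cdot>\<^sub>m L (inverse h) (inverse u)) $$ (i, j) = 0\<^sub>m (Suc J) (Suc J) $$ (i, j)"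
    using ij Lc[of h u] Lc[of "inverse h" "inverse u"] by simp
qed (use D in \<open>auto simp: L_def\<close>)

theorem proposition6p9:
  fixes q h u ep em kp km bep bem bkp bkm :: complex
    and N J :: nat and Js :: "nat \<Rightarrow> nat" and v :: "nat \<Rightarrow> complex"
  assumes "q \<noteq> 0" and "\<And>n::nat. n > 0 \<Longrightarrow> q ^ n \<noteq> 1" and "h\<^sup>2 = q"
    and "\<And>i. 1 \<le> i \<Longrightarrow> i \<le> N \<Longrightarrow> Js i \<ge> 1"
    and "\<And>i. 1 \<le> i \<Longrightarrow> i \<le> N \<Longrightarrow> v i \<noteq> 0"
    and "J \<ge> 1"
    and "kp \<noteq> 0" and "km \<noteq> 0"
    and "bkp = 0" and "bkm = 0"
    and "u \<noteq> 0"
  defines "t \<equiv> t_norm h ep em kp km bep bem bkp bkm N Js v J u"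
    and "W \<equiv> bep \<cdot>\<^sub>m W0 h ep kp km Js v N + bem \<cdot>\<^sub>m W1 h em kp km Js v N"
  shows "t * W - W * t = 0\<^sub>m (qdim N Js) (qdim N Js)"
proof -
  have q: "not_root_of_unity h"
    unfolding not_root_of_unity_def
  proof (intro conjI allI impI notI)
    show False if "h = 0" using that assms(1,3) by simp
    show False if "n > 0" "h ^ n = 1" for n
    proof -
      have "q ^ n = (h ^ n)\<^sup>2" unfolding assms(3)[symmetric] by (simp add: power_mult[symmetric] mult.commute)
      then show False using that assms(2)[OF that(1)] by simp
    qed
  qed
  have h0: "h \<noteq> 0" by (rule not_root_of_unity_nonzero[OF q])
  obtain n where J: "J = Suc n" using assms(6) by (cases J) auto
  let ?Q = "qdim N Js" and ?e = "Suc J"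
  define U where "U = inverse u * h powi (- 2)"
  have U0: "U \<noteq> 0" using assms(11) h0 by (simp add: U_def)
  define D where "D = K_plus_norm h bep bem bkp bkm J u"
  define K where "K = K_norm h ep em kp km J u"
  \<comment> \<open>\<open>D\<close> and \<open>K\<close> are the boundary matrices of the auxiliary space, \<open>S\<close> is the dressed \<open>K\<close>.\<close>
  define S where "S = dress Js J (\<lambda>i. R_norm h (Js i) J (u * v i)) (\<lambda>i. R_norm h (Js i) J (u * inverse (v i))) K N"
  obtain c where Dc: "D = transpose_mat (c \<cdot>\<^sub>m K_mat h bem bep 0 0 J U)"
    unfolding D_def K_plus_norm_def K_norm_def U_def assms(9,10) by simp
  obtain c' where Kc: "K = c' \<cdot>\<^sub>m K_mat h ep em kp km J u" unfolding K_def K_norm_def by blast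
  note Kmc = K_mat_carrier[of h _ _ _ _ J]
  have D: "D \<in> carrier_mat ?e ?e"
    unfolding Dc by (rule transpose_carrier_mat[THEN iffD2, OF smult_carrier_mat[OF K_mat_carrier]])
  have Dij: "D $$ (i, j) = c * K_mat h bem bep 0 0 J U $$ (j, i)" if "i < ?e" "j < ?e" for i j
    unfolding Dc using that Kmc[of bem bep 0 0 U] by simp
  have Doff: "D $$ (i, j) = 0" if "i < ?e" "j < ?e" "i \<noteq> j" for i j
    using Dij[OF that(1,2)] index_K_mat_zero[OF q, of j n i] that J by simp
  have Kcar: "K \<in> carrier_mat ?e ?e" unfolding Kc by (rule smult_carrier_mat[OF K_mat_carrier])
  have reflK: "reflect h ep kp km J u K" "reflect (inverse h) em kp km J (inverse u) K"
    unfolding Kc J reflect_def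
    by (rule intertwines_smult_left, rule reflect_K_mat[OF q assms(7,8,11), unfolded reflect_def])+
  have Rc: "R_norm h (Js i) J w \<in> carrier_mat (Suc (Js i) * Suc J) (Suc (Js i) * Suc J)" for i w
    unfolding R_norm_def by (rule smult_carrier_mat[OF R_mat_carrier])
  have ex: "exchange h (Js i) J w (R_norm h (Js i) J w)" "exchange (inverse h) (Js i) J (inverse w) (R_norm h (Js i) J w)"
    if i: "1 \<le> i" "i \<le> N" and w: "w \<noteq> 0" for i w
  proof -
    obtain m where m: "Js i = Suc m" using assms(4)[OF i] by (cases "Js i") auto
    have "J \<noteq> 0" using J by simp
    then show "exchange h (Js i) J w (R_norm h (Js i) J w)" "exchange (inverse h) (Js i) J (inverse w) (R_norm h (Js i) J w)"
      unfolding R_norm_def m by (intro exchange_smult exchange_R_mat[OF q _ w]; assumption)+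
  qed
  have uv: "u * v i \<noteq> 0" "u * inverse (v i) \<noteq> 0" if "1 \<le> i" "i \<le> N" for i
    using assms(5)[OF that] assms(11) by simp_all
  have Sc: "S \<in> carrier_mat (?Q * ?e) (?Q * ?e)" unfolding S_def by (rule dress_carrier[OF Kcar])
  \<comment> \<open>The reflection relations of the chain for the two generators.\<close>
  have S0: "intertwines S (1\<^sub>m ?Q \<otimes>\<^sub>m current h kp km J u + W0 h ep kp km Js v N \<otimes>\<^sub>m cartan h J)
    (1\<^sub>m ?Q \<otimes>\<^sub>m current h kp km J (inverse u) + W0 h ep kp km Js v N \<otimes>\<^sub>m cartan h J)"
    unfolding S_def
    by (rule intertwines_dress[OF reflK(1) Kcar assms(11) assms(5) ex(1) Rc ex(1) Rc]) (use uv in auto)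
  have S1: "intertwines S (1\<^sub>m ?Q \<otimes>\<^sub>m current (inverse h) kp km J (inverse u) + W1 h em kp km Js v N \<otimes>\<^sub>m cartan (inverse h) J)
    (1\<^sub>m ?Q \<otimes>\<^sub>m current (inverse h) kp km J (inverse (inverse u)) + W1 h em kp km Js v N \<otimes>\<^sub>m cartan (inverse h) J)"
    unfolding S_def W1_eq
  proof (rule intertwines_dress[OF reflK(2) Kcar _ _ _ Rc _ Rc])
    fix i assume i: "1 \<le> i" "i \<le> N"
    show "exchange (inverse h) (Js i) J (inverse u * inverse (v i)) (R_norm h (Js i) J (u * v i))"
      using ex(2)[OF i uv(1)[OF i]] by simp
    show "exchange (inverse h) (Js i) J (inverse u * inverse (inverse (v i))) (R_norm h (Js i) J (u * inverse (v i)))"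
      using ex(2)[OF i uv(2)[OF i]] by simp
  qed (use assms(5,11) in auto)
  have tS: "t = ptrace_last ?e ((1\<^sub>m ?Q \<otimes>\<^sub>m D) * S)"
  proof -
    let ?P = "mat_prod (?Q * (J + 1)) (map (\<lambda>i. R_site h N Js J (u * v i) i) (rev [1..<N + 1]))"
      and ?R = "mat_prod (?Q * (J + 1)) (map (\<lambda>i. R_site h N Js J (u * inverse (v i)) i) [1..<N + 1])"
      and ?K = "1\<^sub>m ?Q \<otimes>\<^sub>m K" and ?D = "1\<^sub>m ?Q \<otimes>\<^sub>m D"
    have P: "?P \<in> carrier_mat (?Q * ?e) (?Q * ?e)" and R: "?R \<in> carrier_mat (?Q * ?e) (?Q * ?e)"
      unfolding Suc_eq_plus1[symmetric] by (rule mat_prod_carrier, erule sites_carrier)+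
    have Dk: "?D \<in> carrier_mat (?Q * ?e) (?Q * ?e)" and Kk: "?K \<in> carrier_mat (?Q * ?e) (?Q * ?e)"
      by (rule kron_carrier[OF one_carrier_mat D] kron_carrier[OF one_carrier_mat Kcar])+
    have "?D * ?P * ?K * ?R = ?D * (?P * ?K * ?R)"
      unfolding assoc_mult_mat[OF Dk P Kk] by (rule assoc_mult_mat[OF Dk mult_carrier_mat[OF P Kk] R])
    also have "?P * ?K * ?R = S"
      unfolding S_def using dress_eq[OF Kcar, of N Js h "\<lambda>i. u * v i" "\<lambda>i. u * inverse (v i)"] by simp
    finally show ?thesis unfolding t_def t_norm_def D_def[symmetric] K_def[symmetric] by simp
  qed
  define L where "L = (\<lambda>h u. D * cartan (inverse h) J * current h kp km J (inverse u)
      - current h kp km J u * (D * cartan (inverse h) J))"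
  \<comment> \<open>\<open>D\<close> commutes with the group-like element, as both are diagonal.\<close>
  have gD: "cartan h J * (D * cartan (inverse h) J) = D" "(D * cartan (inverse h) J) * cartan h J = D" if "h \<noteq> 0" for h
  proof -
    have C: "D * cartan (inverse h) J \<in> carrier_mat ?e ?e" by (rule mult_carrier_mat[OF D carrier_spin(5)])
    have inv: "cartan (inverse h) J $$ (k, k) * cartan h J $$ (k, k) = 1" if "k < ?e" for k
      using that \<open>h \<noteq> 0\<close> by (simp add: index_cartan power_int_inverse)
    have Cij: "(D * cartan (inverse h) J) $$ (k, l) = D $$ (k, l) * cartan (inverse h) J $$ (l, l)" if "k < ?e" "l < ?e" for k l
      by (rule index_mult_diag_right[OF carrier_spin(5)]) (use that D in \<open>auto simp: index_cartan\<close>)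
    show "cartan h J * (D * cartan (inverse h) J) = D"
    proof (rule eq_matI)
      fix k l assume "k < dim_row D" "l < dim_col D"
      then have kl: "k < ?e" "l < ?e" using D by auto
      have "(cartan h J * (D * cartan (inverse h) J)) $$ (k, l) = cartan h J $$ (k, k) * (D $$ (k, l) * cartan (inverse h) J $$ (l, l))"
        unfolding Cij[OF kl, symmetric]
        by (rule index_mult_diag_left[OF carrier_spin(5)]) (use kl C in \<open>auto simp: index_cartan\<close>)
      then show "(cartan h J * (D * cartan (inverse h) J)) $$ (k, l) = D $$ (k, l)"
        using inv[OF kl(2)] Doff[OF kl] by (cases "k = l") (simp_all add: mult_ac del: index_mult_mat(1))
    qed (use D in auto)
    show "(D * cartan (inverse h) J) * cartan h J = D"
    proof (rule eq_matI)
      fix k l assume "k < dim_row D" "l < dim_col D"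
      then have kl: "k < ?e" "l < ?e" using D by auto
      have "((D * cartan (inverse h) J) * cartan h J) $$ (k, l) = (D $$ (k, l) * cartan (inverse h) J $$ (l, l)) * cartan h J $$ (l, l)"
        unfolding Cij[OF kl, symmetric]
        by (rule index_mult_diag_right[OF carrier_spin(5)]) (use kl C in \<open>auto simp: index_cartan\<close>)
      also have "\<dots> = D $$ (k, l)" unfolding mult.assoc inv[OF kl(2)] by simp
      finally show "((D * cartan (inverse h) J) * cartan h J) $$ (k, l) = D $$ (k, l)" .
    qed (use D in auto)
  qed
  have W1c: "W1 h em kp km Js v N \<in> carrier_mat ?Q ?Q" unfolding W1_eq by (rule W0_carrier)
  have e: "?e > 0" by simp
  have hi: "inverse h \<noteq> 0" using h0 by simp
  have c0: "t * W0 h ep kp km Js v N - W0 h ep kp km Js v N * t = ptrace_last ?e ((1\<^sub>m ?Q \<otimes>\<^sub>m L h u) * S)"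
    unfolding tS L_def
    by (rule ptrace_last_commutator[OF Sc W0_carrier D carrier_spin(5) carrier_spin(5) carrier_spin(6) carrier_spin(6) e
          intertwinesD(1)[OF S0] gD[OF h0]])
  have c1: "t * W1 h em kp km Js v N - W1 h em kp km Js v N * t
      = ptrace_last ?e ((1\<^sub>m ?Q \<otimes>\<^sub>m L (inverse h) (inverse u)) * S)"
    unfolding tS L_def
    by (rule ptrace_last_commutator[OF Sc W1c D carrier_spin(5) carrier_spin(5) carrier_spin(6) carrier_spin(6) e
          intertwinesD(1)[OF S1] gD[OF hi]])
  have L0: "bep \<cdot>\<^sub>m L h u + bem \<cdot>\<^sub>m L (inverse h) (inverse u) = 0\<^sub>m ?e ?e"
    unfolding L_def
  proof (rule boundary_condition[OF q assms(11) D Doff _ U_def])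
    fix i assume i: "i < J"
    have "D $$ (i, i) = c * K_mat h bem bep 0 0 J U $$ (i, i)"
      "D $$ (Suc i, Suc i) = c * K_mat h bem bep 0 0 J U $$ (Suc i, Suc i)"
      using Dij i by simp_all
    then have "bep * h * inverse (h powi (int J - 2 * int i)) * (D $$ (i, i) * U - D $$ (Suc i, Suc i) * inverse U)
      + bem * h powi (int J - 2 * int i) * inverse h * (D $$ (i, i) * inverse U - D $$ (Suc i, Suc i) * U)
      = c * (bep * h * inverse (h powi (int J - 2 * int i)) * (K_mat h bem bep 0 0 J U $$ (i, i) * U
          - K_mat h bem bep 0 0 J U $$ (Suc i, Suc i) * inverse U)
        + bem * h powi (int J - 2 * int i) * inverse h * (K_mat h bem bep 0 0 J U $$ (i, i) * inverse U
          - K_mat h bem bep 0 0 J U $$ (Suc i, Suc i) * U))"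
      by (simp add: algebra_simps)
    also have "\<dots> = 0" unfolding K_mat_zero_recursion[OF q U0 i] by simp
    finally show "bep * h * inverse (h powi (int J - 2 * int i)) * (D $$ (i, i) * U - D $$ (Suc i, Suc i) * inverse U)
      + bem * h powi (int J - 2 * int i) * inverse h * (D $$ (i, i) * inverse U - D $$ (Suc i, Suc i) * U) = 0" .
  qed
  have tc: "t \<in> carrier_mat ?Q ?Q"
    unfolding tS by (rule ptrace_last_carrier[OF mult_carrier_mat[OF kron_carrier[OF one_carrier_mat D] Sc] e])
  note W0c = W0_carrier[of h ep kp km Js v N]
  have "t * W - W * t = bep \<cdot>\<^sub>m (t * W0 h ep kp km Js v N - W0 h ep kp km Js v N * t)
      + bem \<cdot>\<^sub>m (t * W1 h em kp km Js v N - W1 h em kp km Js v N * t)"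
  proof -
    have "t * W = bep \<cdot>\<^sub>m (t * W0 h ep kp km Js v N) + bem \<cdot>\<^sub>m (t * W1 h em kp km Js v N)"
      unfolding W_def mult_add_distrib_mat[OF tc smult_carrier_mat[OF W0c] smult_carrier_mat[OF W1c]]
        mult_smult_distrib[OF tc W0c] mult_smult_distrib[OF tc W1c] ..
    moreover have "W * t = bep \<cdot>\<^sub>m (W0 h ep kp km Js v N * t) + bem \<cdot>\<^sub>m (W1 h em kp km Js v N * t)"
      unfolding W_def add_mult_distrib_mat[OF smult_carrier_mat[OF W0c] smult_carrier_mat[OF W1c] tc]
        mult_smult_assoc_mat[OF W0c tc] mult_smult_assoc_mat[OF W1c tc] ..
    moreover have "bep \<cdot>\<^sub>m A + bem \<cdot>\<^sub>m B - (bep \<cdot>\<^sub>m A' + bem \<cdot>\<^sub>m B') = bep \<cdot>\<^sub>m (A - A') + bem \<cdot>\<^sub>m (B - B')"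
      if "A \<in> carrier_mat ?Q ?Q" "B \<in> carrier_mat ?Q ?Q" "A' \<in> carrier_mat ?Q ?Q" "B' \<in> carrier_mat ?Q ?Q" for A B A' B'
      by (rule eq_matI) (use that in \<open>simp_all add: algebra_simps\<close>)
    note this[OF mult_carrier_mat[OF tc W0c] mult_carrier_mat[OF tc W1c] mult_carrier_mat[OF W0c tc] mult_carrier_mat[OF W1c tc]]
    ultimately show ?thesis by simp
  qed
  also have "\<dots> = 0\<^sub>m ?Q ?Q"
  proof (rule eq_matI)
    let ?A = "(1\<^sub>m ?Q \<otimes>\<^sub>m L h u) * S" and ?B = "(1\<^sub>m ?Q \<otimes>\<^sub>m L (inverse h) (inverse u)) * S"
    have Lc: "L h u \<in> carrier_mat ?e ?e" for h u
      unfolding L_def by (rule carrier_matI) (use D in simp_all)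
    have A: "?A \<in> carrier_mat (?Q * ?e) (?Q * ?e)" and B: "?B \<in> carrier_mat (?Q * ?e) (?Q * ?e)"
      by (rule mult_carrier_mat[OF kron_carrier[OF one_carrier_mat Lc] Sc])+
    fix r s assume "r < dim_row (0\<^sub>m ?Q ?Q :: complex mat)" "s < dim_col (0\<^sub>m ?Q ?Q :: complex mat)"
    then have rs: "r < ?Q" "s < ?Q" by auto
    have "bep * ?A $$ (r * ?e + k, s * ?e + k) + bem * ?B $$ (r * ?e + k, s * ?e + k) = 0" if k: "k < ?e" for k
    proof -
      have s': "s * ?e + k < ?Q * ?e" using rs k by (intro kron_index_less)
      have "bep * ?A $$ (r * ?e + k, s * ?e + k) + bem * ?B $$ (r * ?e + k, s * ?e + k)
          = (\<Sum>l<?e. (bep * L h u $$ (k, l) + bem * L (inverse h) (inverse u) $$ (k, l)) * S $$ (r * ?e + l, s * ?e + k))"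
        unfolding index_kron_one_mult[OF Sc Lc rs(1) k s'] sum_distrib_left sum.distrib[symmetric]
        by (intro sum.cong refl) (simp only: distrib_right mult.assoc)
      also have "\<dots> = 0"
      proof (intro sum.neutral ballI)
        fix l assume "l \<in> {..<?e}"
        then have l: "l < ?e" by simp
        have "(bep \<cdot>\<^sub>m L h u + bem \<cdot>\<^sub>m L (inverse h) (inverse u)) $$ (k, l) = 0" unfolding L0 using k l by simp
        then show "(bep * L h u $$ (k, l) + bem * L (inverse h) (inverse u) $$ (k, l)) * S $$ (r * ?e + l, s * ?e + k) = 0"
          using k l Lc[of h u] Lc[of "inverse h" "inverse u"] by simp
      qed
      finally show ?thesis .
    qed
    then have "bep * ptrace_last ?e ?A $$ (r, s) + bem * ptrace_last ?e ?B $$ (r, s) = 0"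
      unfolding index_ptrace_last[OF A e rs] index_ptrace_last[OF B e rs] sum_distrib_left sum.distrib[symmetric]
      by (intro sum.neutral ballI) simp
    then show "(bep \<cdot>\<^sub>m (t * W0 h ep kp km Js v N - W0 h ep kp km Js v N * t)
        + bem \<cdot>\<^sub>m (t * W1 h em kp km Js v N - W1 h em kp km Js v N * t)) $$ (r, s) = 0\<^sub>m ?Q ?Q $$ (r, s)"
      unfolding c0 c1 using rs ptrace_last_carrier[OF A e] ptrace_last_carrier[OF B e] by simp
  qed (use tc W1c in auto)
  finally show ?thesis .
qed

end
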